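(* Suppose $H(x)=\sum_{i=1}^dH_i(x_i)$ and $g(x,\xi)=(g_1(x_1,\xi),\dots,g_d(x_d,\xi))$ on $\mathbb R^d\times\Xi$, and that for every $1\le i\le d$ the pair $(H_i,g_i)$ satisfies the One-Dimensional Assumptions of the context with parameters $m_i\ge2$, $\beta_i\in[1,2]$ (all coordinates sharing the same driving chain). Let $m_{\max}:=\max_im_i$. Then (for a suitable choice of the constants $\kappa_i,\kappa_{0,i}>0$ in the coordinate weights $V_{\alpha,i}$) there exist $\alpha_0\in(0,1)$ and $c_0\in(0,1)$ such that, for every $\alpha\in(0,\alpha_0]$, the augmented chain $Z_n=(X_n,\xi_n)$ admits a unique invariant law $\pi_\alpha^{\rm sep}\in\mathcal P_1(\mathbb R^d\times\Xi,d_{{\rm sep},\alpha})$. Moreover, if $P_\alpha^{\rm sep}$ denotes its transition kernel, then $$W_{{\rm sep},\alpha}\bigl(\mu(P_\alpha^{\rm sep})^n,\nu(P_\alpha^{\rm sep})^n\bigr)\le(1-c_0\alpha^{m_{\max}-1})^n\,W_{{\rm sep},\alpha}(\mu,\nu),\qquad n\ge0,$$ for all probability laws $\mu,\nu$ on $\mathbb R^d\times\Xi$ for which the right-hand side is finite.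
   Context: Setup. $\|\cdot\|$ is the Euclidean norm. Data: $d,d_\Xi\ge1$; a nonempty closed convex set $\Xi\subseteq\mathbb R^{d_\Xi}$; a measurable space $\mathcal U$; i.i.d. $\mathcal U$-valued $U_1,U_2,\dots$; a Borel measurable $\Phi:\Xi\times\mathcal U\to\Xi$; functions $H_i:\mathbb R\to\mathbb R$ with $h_i:=H_i'$; Borel measurable $g_i:\mathbb R\times\Xi\to\mathbb R$, $1\le i\le d$. For $\alpha\in(0,1)$ the SGD recursion is $\xi_{n+1}=\Phi(\xi_n,U_{n+1})$, $X_{n+1,i}=X_{n,i}-\alpha\{h_i(X_{n,i})+g_i(X_{n,i},\xi_{n+1})\}$, and $Z_n=(X_n,\xi_n)$ is a Markov chain on $\mathbb R^d\times\Xi$ ($Z_0$ independent of the innovations). One-Dimensional Assumptions for $(H_i,g_i)$ with parameters $(m_i,\beta_i)$ (all constants may depend on $i$; convention $|t|^0=1$). (a) $H_i\in C^2(\mathbb R)$ is convex, $0\in\arg\min H_i$. (b) There are $R_i,c_{{\rm in},i},C_{{\rm in},i}>0$ with $H_i''(t)\ge c_{{\rm in},i}|t|^{m_i-2}$ and $|h_i(t)|\le C_{{\rm in},i}|t|^{m_i-1}$ for $0<|t|\le R_i$ (extended to $t=0$ by continuity if $m_i=2$). (c) If $\beta_i=2$: $H_i''(t)\ge c_{{\rm out},i}>0$ for $|t|\ge R_i$. If $1\le\beta_i<2$: $t\,h_i(t)\ge c_{{\rm out},i}|t|^{\beta_i}$ and $|h_i(t)|\le C_{{\rm out},i}|t|^{\beta_i-1}$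 for $|t|\ge R_i$, with $c_{{\rm out},i},C_{{\rm out},i}>0$. (d) There is a measurable $L_\Phi:\mathcal U\to[0,1]$ with $\|\Phi(\xi,u)-\Phi(\eta,u)\|\le L_\Phi(u)\|\xi-\eta\|$ for all $\xi,\eta,u$ and $\mathbb E L_\Phi(U_1)<1$. (e) There is $L_i>0$ with $|g_i(t,\Phi(\xi,u))-g_i(t,\Phi(\eta,u))|\le L_i\|\xi-\eta\|$ for all $t,\xi,\eta,u$. (f) There is $\xi_\star^{(i)}\in\Xi$ with $\mathbb E\|\Phi(\xi_\star^{(i)},U_1)-\xi_\star^{(i)}\|<\infty$; if $\beta_i=2$ also $\mathbb E|g_i(0,\Phi(\xi_\star^{(i)},U_1))|<\infty$. (g) (only if $\beta_i<2$) With $\bar g_i(t,\xi):=\mathbb E[g_i(t,\Phi(\xi,U_1))]$, there is $c_{{\rm diss},i}>0$ with $t\{h_i(t)+\bar g_i(t,\xi)\}\ge c_{{\rm diss},i}|t|^{\beta_i}$ for $|t|\ge R_i$, $\xi\in\Xi$. (h) (only if $\beta_i<2$) There is $\lambda_{0,i}>0$ with $\sup_{t\in\mathbb R,\xi\in\Xi}\mathbb E\exp\bigl(\lambda_{0,i}|g_i(t,\Phi(\xi,U_1))|/(1+|t|^{\beta_i-1})\bigr)<\infty$. (i) (only if $m_i>2$) There are $\varepsilon_i,p_i>0$ with $\inf_{\xi}\mathbb P(|g_i(0,\Phi(\xi,U_1))|\ge\varepsilon_i)\ge p_i$. (j) With $\mathsf G_i(t,\xi):=h_i(t)+g_i(t,\xi)$,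 $t\mapsto\mathsf G_i(t,\xi)$ is $C^1$ for every $\xi$, and there are $L_{\mathsf G,i}\ge1$, $\theta_i\in[0,1)$ with $(t-s)(\mathsf G_i(t,\xi)-\mathsf G_i(s,\xi))\ge L_{\mathsf G,i}^{-1}|\mathsf G_i(t,\xi)-\mathsf G_i(s,\xi)|^2$ and $(t-s)(\bar g_i(t,\xi)-\bar g_i(s,\xi))\ge-\theta_i(t-s)(h_i(t)-h_i(s))$ for all $s,t\in\mathbb R$, $\xi\in\Xi$. Weights and metrics. $V_{\alpha,i}(t,\xi):=\mathcal T_i(t)+\delta_{\alpha,i}\,\omega_i(t)$, where $\mathcal T_i\equiv1$ if $\beta_i=2$ and $\mathcal T_i(t)=\exp\{\kappa_i(|t|^{2-\beta_i}-(3R_i/4)^{2-\beta_i})_+\}$ if $\beta_i<2$; $\omega_i\equiv0,\ \delta_{\alpha,i}=0$ if $m_i=2$; $\omega_i(t)=(1-(2|t|/R_i)^{m_i-2})_+$, $\delta_{\alpha,i}=\kappa_{0,i}\alpha$ if $2<m_i\le3$; $\omega_i(t)=(1-2|t|/R_i)_+$, $\delta_{\alpha,i}=\kappa_{0,i}\alpha^{m_i-2}$ if $m_i>3$. The constants $\kappa_i,\kappa_{0,i}>0$ are independent of $\alpha$ (chosen sufficiently small). On $\mathbb R\times\Xi$ let $d_{i,\alpha}(z,z'):=\inf_\gamma\int_0^1V_{\alpha,i}(\gamma(s))|\dot\gamma(s)|_\alpha\,ds$ over absolutely continuous curves in $\mathbb R\times\Xi$ from $z$ to $z'$, with $|(t,\xi)|_\alpha:=|t|+\alpha^{-1}\|\xi\|$.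 Set $d_{{\rm sep},\alpha}((x,\xi),(y,\eta)):=\sum_{i=1}^dd_{i,\alpha}((x_i,\xi),(y_i,\eta))$; $W_{{\rm sep},\alpha}$ is the Wasserstein-1 distance with cost $d_{{\rm sep},\alpha}$; $\mathcal P_1(E,d)$ is the set of probability laws $\mu$ with $\int d(z,z_0)\,\mu(dz)<\infty$ for some $z_0$. *)

theory Defs
  imports "HOL-Probability.Probability"
begin

type_synonym ('d, 'k) state = "(real ^ 'd) \<times> (real ^ 'k)"

section \<open>The driving chain and the SGD recursion\<close>

text \<open>
  The SGD iterates live in \<open>real ^ 'd\<close> (coordinates indexed by \<open>'d\<close>), and \<open>\<Xi>\<close> is a subset of
  \<open>real ^ 'k\<close>. \<open>M\<close> is the underlying probability space, \<open>S\<close> the measurable space of the innovations,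
  and the i.i.d. innovations are \<open>U 1, U 2, \<dots>\<close> (the value \<open>U 0\<close> is never used).
\<close>

locale sgd_noise = prob_space M
  for M :: "'w measure" and S :: "'u measure" and U :: "nat \<Rightarrow> 'w \<Rightarrow> 'u"
    and \<Xi> :: "(real ^ 'k) set" and \<Phi> :: "real ^ 'k \<Rightarrow> 'u \<Rightarrow> real ^ 'k" +
  assumes Xi_nonempty: "\<Xi> \<noteq> {}"
    and Xi_closed: "closed \<Xi>"
    and Xi_convex: "convex \<Xi>"
    and U_indep: "indep_vars (\<lambda>_. S) U {1..}"
    and U_ident: "\<And>n. n \<ge> 1 \<Longrightarrow> distr M S (U n) = distr M S (U 1)"
    and Phi_measurable:
      "(\<lambda>(\<xi>, u). \<Phi> \<xi> u) \<in> restrict_space borel \<Xi> \<Otimes>\<^sub>M S \<rightarrow>\<^sub>M restrict_space borel \<Xi>"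

definition state_space :: "(real ^ 'k) set \<Rightarrow> ('d::finite, 'k) state measure" where
  "state_space \<Xi> = borel \<Otimes>\<^sub>M restrict_space borel \<Xi>"

definition sgd_step ::
  "('d::finite \<Rightarrow> real \<Rightarrow> real) \<Rightarrow> ('d \<Rightarrow> real \<Rightarrow> real ^ 'k \<Rightarrow> real) \<Rightarrow> (real ^ 'k \<Rightarrow> 'u \<Rightarrow> real ^ 'k)
    \<Rightarrow> real \<Rightarrow> ('d, 'k) state \<Rightarrow> 'u \<Rightarrow> ('d, 'k) state" where
  "sgd_step H g \<Phi> \<alpha> = (\<lambda>(x, \<xi>) u.
     ((\<chi> i. x $ i - \<alpha> * (deriv (H i) (x $ i) + g i (x $ i) (\<Phi> \<xi> u))), \<Phi> \<xi> u))"

primrec sgd_chain ::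
  "('d::finite \<Rightarrow> real \<Rightarrow> real) \<Rightarrow> ('d \<Rightarrow> real \<Rightarrow> real ^ 'k \<Rightarrow> real) \<Rightarrow> (real ^ 'k \<Rightarrow> 'u \<Rightarrow> real ^ 'k)
    \<Rightarrow> (nat \<Rightarrow> 'w \<Rightarrow> 'u) \<Rightarrow> real \<Rightarrow> ('d, 'k) state \<Rightarrow> nat \<Rightarrow> 'w \<Rightarrow> ('d, 'k) state" where
  "sgd_chain H g \<Phi> U \<alpha> z 0 \<omega> = z"
| "sgd_chain H g \<Phi> U \<alpha> z (Suc n) \<omega> = sgd_step H g \<Phi> \<alpha> (sgd_chain H g \<Phi> U \<alpha> z n \<omega>) (U (Suc n) \<omega>)"

text \<open>The transition kernel: the law of \<open>Z\<^sub>1\<close> when the chain starts at \<open>Z\<^sub>0 = z\<close>.\<close>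

definition sgd_kernel ::
  "'w measure \<Rightarrow> (nat \<Rightarrow> 'w \<Rightarrow> 'u) \<Rightarrow> (real ^ 'k) set \<Rightarrow> (real ^ 'k \<Rightarrow> 'u \<Rightarrow> real ^ 'k)
    \<Rightarrow> ('d::finite \<Rightarrow> real \<Rightarrow> real) \<Rightarrow> ('d \<Rightarrow> real \<Rightarrow> real ^ 'k \<Rightarrow> real)
    \<Rightarrow> real \<Rightarrow> ('d, 'k) state \<Rightarrow> ('d, 'k) state measure" where
  "sgd_kernel M U \<Xi> \<Phi> H g \<alpha> z = distr M (state_space \<Xi>) (sgd_chain H g \<Phi> U \<alpha> z 1)"

definition kernel_power :: "('z \<Rightarrow> 'z measure) \<Rightarrow> nat \<Rightarrow> 'z measure \<Rightarrow> 'z measure" where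
  "kernel_power K n \<mu> = ((\<lambda>\<rho>. \<rho> \<bind> K) ^^ n) \<mu>"

definition invariant_law :: "('z \<Rightarrow> 'z measure) \<Rightarrow> 'z measure \<Rightarrow> bool" where
  "invariant_law K \<pi> \<longleftrightarrow> \<pi> \<bind> K = \<pi>"

section \<open>The one-dimensional assumptions\<close>

text \<open>The convention \<open>\<bar>t\<bar>\<^sup>0 = 1\<close> has to be built in, since \<open>0 powr 0 = 0\<close>.\<close>

definition abs_pow :: "real \<Rightarrow> real \<Rightarrow> real" where
  "abs_pow t a = (if a = 0 then 1 else \<bar>t\<bar> powr a)"

definition mean_field ::
  "'w measure \<Rightarrow> (nat \<Rightarrow> 'w \<Rightarrow> 'u) \<Rightarrow> (real ^ 'k \<Rightarrow> 'u \<Rightarrow> real ^ 'k) \<Rightarrow> (real \<Rightarrow> real ^ 'k \<Rightarrow> real)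
    \<Rightarrow> real \<Rightarrow> real ^ 'k \<Rightarrow> real" where
  "mean_field M U \<Phi> g t \<xi> = (\<integral>\<omega>. g t (\<Phi> \<xi> (U 1 \<omega>)) \<partial>M)"

text \<open>
  The radius \<open>R\<close> is a parameter because it also enters the weights; the other constants are
  existentially quantified.
\<close>

locale one_dim_assumptions = sgd_noise M S U \<Xi> \<Phi>
  for M :: "'w measure" and S :: "'u measure" and U :: "nat \<Rightarrow> 'w \<Rightarrow> 'u"
    and \<Xi> :: "(real ^ 'k) set" and \<Phi> :: "real ^ 'k \<Rightarrow> 'u \<Rightarrow> real ^ 'k"
    and H :: "real \<Rightarrow> real" and g :: "real \<Rightarrow> real ^ 'k \<Rightarrow> real"
    and m \<beta> R :: real +
  assumes g_measurable:
      "(\<lambda>(t, \<xi>). g t \<xi>) \<in> borel \<Otimes>\<^sub>M restrict_space borel \<Xi> \<rightarrow>\<^sub>M borel"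
    and R_pos: "R > 0"
    and asm_a_C2: "H C1_differentiable_on UNIV" "deriv H C1_differentiable_on UNIV"
    and asm_a_convex: "convex_on UNIV H"
    and asm_a_min: "\<And>t. H 0 \<le> H t"
    and asm_b: "\<exists>c_in>0. \<exists>C_in>0. \<forall>t. \<bar>t\<bar> \<le> R \<and> (t \<noteq> 0 \<or> m = 2) \<longrightarrow>
        deriv (deriv H) t \<ge> c_in * abs_pow t (m - 2) \<and> \<bar>deriv H t\<bar> \<le> C_in * abs_pow t (m - 1)"
    and asm_c_quadratic: "\<beta> = 2 \<Longrightarrow> \<exists>c_out>0. \<forall>t. \<bar>t\<bar> \<ge> R \<longrightarrow> deriv (deriv H) t \<ge> c_out"
    and asm_c_subquadratic: "1 \<le> \<beta> \<Longrightarrow> \<beta> < 2 \<Longrightarrow> \<exists>c_out>0. \<exists>C_out>0. \<forall>t. \<bar>t\<bar> \<ge> R \<longrightarrow>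
        t * deriv H t \<ge> c_out * abs_pow t \<beta> \<and> \<bar>deriv H t\<bar> \<le> C_out * abs_pow t (\<beta> - 1)"
    and asm_d: "\<exists>L\<in>borel_measurable S. (\<forall>u\<in>space S. L u \<in> {0..1}) \<and>
        (\<forall>\<xi>\<in>\<Xi>. \<forall>\<eta>\<in>\<Xi>. \<forall>u\<in>space S. norm (\<Phi> \<xi> u - \<Phi> \<eta> u) \<le> L u * norm (\<xi> - \<eta>)) \<and>
        (\<integral>\<omega>. L (U 1 \<omega>) \<partial>M) < 1"
    and asm_e: "\<exists>L>0. \<forall>t. \<forall>\<xi>\<in>\<Xi>. \<forall>\<eta>\<in>\<Xi>. \<forall>u\<in>space S.
        \<bar>g t (\<Phi> \<xi> u) - g t (\<Phi> \<eta> u)\<bar> \<le> L * norm (\<xi> - \<eta>)"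
    and asm_f: "\<exists>\<xi>\<in>\<Xi>. integrable M (\<lambda>\<omega>. norm (\<Phi> \<xi> (U 1 \<omega>) - \<xi>)) \<and>
        (\<beta> = 2 \<longrightarrow> integrable M (\<lambda>\<omega>. \<bar>g 0 (\<Phi> \<xi> (U 1 \<omega>))\<bar>))"
    and asm_g: "\<beta> < 2 \<Longrightarrow> \<exists>c_diss>0. \<forall>t. \<forall>\<xi>\<in>\<Xi>. \<bar>t\<bar> \<ge> R \<longrightarrow>
        t * (deriv H t + mean_field M U \<Phi> g t \<xi>) \<ge> c_diss * abs_pow t \<beta>"
    and asm_h: "\<beta> < 2 \<Longrightarrow> \<exists>rate>0. (SUP t. SUP \<xi>\<in>\<Xi>.
        \<integral>\<^sup>+\<omega>. ennreal (exp (rate * \<bar>g t (\<Phi> \<xi> (U 1 \<omega>))\<bar> / (1 + abs_pow t (\<beta> - 1)))) \<partial>M) < \<infinity>"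
    and asm_i: "m > 2 \<Longrightarrow> \<exists>\<epsilon>>0. \<exists>p>0.
        (INF \<xi>\<in>\<Xi>. prob {\<omega> \<in> space M. \<bar>g 0 (\<Phi> \<xi> (U 1 \<omega>))\<bar> \<ge> \<epsilon>}) \<ge> p"
    and asm_j_C1: "\<And>\<xi>. \<xi> \<in> \<Xi> \<Longrightarrow> (\<lambda>t. deriv H t + g t \<xi>) C1_differentiable_on UNIV"
    and asm_j_cocoercive: "\<exists>L\<ge>1. \<forall>s t. \<forall>\<xi>\<in>\<Xi>.
        (t - s) * ((deriv H t + g t \<xi>) - (deriv H s + g s \<xi>))
          \<ge> inverse L * \<bar>(deriv H t + g t \<xi>) - (deriv H s + g s \<xi>)\<bar>\<^sup>2"
    and asm_j_monotone: "\<exists>\<theta>\<in>{0..<1}. \<forall>s t. \<forall>\<xi>\<in>\<Xi>.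
        (t - s) * (mean_field M U \<Phi> g t \<xi> - mean_field M U \<Phi> g s \<xi>)
          \<ge> - \<theta> * (t - s) * (deriv H t - deriv H s)"

section \<open>Weights and weighted path metrics\<close>

definition tail_weight :: "real \<Rightarrow> real \<Rightarrow> real \<Rightarrow> real \<Rightarrow> real" where
  "tail_weight \<beta> R \<kappa> t =
     (if \<beta> = 2 then 1
      else exp (\<kappa> * max 0 (abs_pow t (2 - \<beta>) - abs_pow (3 * R / 4) (2 - \<beta>))))"

definition core_bump :: "real \<Rightarrow> real \<Rightarrow> real \<Rightarrow> real" where
  "core_bump m R t =
     (if m = 2 then 0
      else if m \<le> 3 then max 0 (1 - abs_pow (2 * \<bar>t\<bar> / R) (m - 2))
      else max 0 (1 - 2 * \<bar>t\<bar> / R))"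

definition core_scale :: "real \<Rightarrow> real \<Rightarrow> real \<Rightarrow> real" where
  "core_scale m \<kappa>0 \<alpha> = (if m = 2 then 0 else if m \<le> 3 then \<kappa>0 * \<alpha> else \<kappa>0 * \<alpha> powr (m - 2))"

text \<open>\<open>V\<close> depends on the state \<open>(t, \<xi>)\<close> only through \<open>t\<close>.\<close>

definition weight :: "real \<Rightarrow> real \<Rightarrow> real \<Rightarrow> real \<Rightarrow> real \<Rightarrow> real \<Rightarrow> real \<times> (real ^ 'k) \<Rightarrow> real" where
  "weight m \<beta> R \<kappa> \<kappa>0 \<alpha> = (\<lambda>(t, \<xi>). tail_weight \<beta> R \<kappa> t + core_scale m \<kappa>0 \<alpha> * core_bump m R t)"

definition scaled_norm :: "real \<Rightarrow> real \<times> (real ^ 'k) \<Rightarrow> real" where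
  "scaled_norm \<alpha> = (\<lambda>(t, \<xi>). \<bar>t\<bar> + inverse \<alpha> * norm \<xi>)"

text \<open>Absolute continuity of a curve on \<open>[a, b]\<close> (unrelated to the library's notion for measures).\<close>

definition abs_cont_curve :: "real \<Rightarrow> real \<Rightarrow> (real \<Rightarrow> 'a::real_normed_vector) \<Rightarrow> bool" where
  "abs_cont_curve a b \<gamma> \<longleftrightarrow>
     (\<forall>\<epsilon>>0. \<exists>\<delta>>0. \<forall>(n::nat) l r.
        (\<forall>k<n. a \<le> l k \<and> l k \<le> r k \<and> r k \<le> b) \<and>
        disjoint_family_on (\<lambda>k. {l k<..<r k}) {..<n} \<and>
        (\<Sum>k<n. r k - l k) < \<delta>
        \<longrightarrow> (\<Sum>k<n. norm (\<gamma> (r k) - \<gamma> (l k))) < \<epsilon>)"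

definition admissible_curves ::
  "(real ^ 'k) set \<Rightarrow> real \<times> (real ^ 'k) \<Rightarrow> real \<times> (real ^ 'k) \<Rightarrow> (real \<Rightarrow> real \<times> (real ^ 'k)) set" where
  "admissible_curves \<Xi> z z' =
     {\<gamma>. abs_cont_curve 0 1 \<gamma> \<and> \<gamma> ` {0..1} \<subseteq> UNIV \<times> \<Xi> \<and> \<gamma> 0 = z \<and> \<gamma> 1 = z'}"

text \<open>
  An absolutely continuous curve is differentiable almost everywhere on \<open>[0, 1]\<close>, so the value
  of \<open>vector_derivative\<close> at the exceptional points does not influence the integral.
\<close>

definition coord_metric ::
  "(real ^ 'k) set \<Rightarrow> real \<Rightarrow> real \<Rightarrow> real \<Rightarrow> real \<Rightarrow> real \<Rightarrow> real
    \<Rightarrow> real \<times> (real ^ 'k) \<Rightarrow> real \<times> (real ^ 'k) \<Rightarrow> ennreal" where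
  "coord_metric \<Xi> m \<beta> R \<kappa> \<kappa>0 \<alpha> z z' =
     (INF \<gamma>\<in>admissible_curves \<Xi> z z'.
        \<integral>\<^sup>+s\<in>{0..1}. ennreal (weight m \<beta> R \<kappa> \<kappa>0 \<alpha> (\<gamma> s)
            * scaled_norm \<alpha> (vector_derivative \<gamma> (at s within {0..1}))) \<partial>lebesgue)"

definition sep_metric ::
  "(real ^ 'k) set \<Rightarrow> ('d::finite \<Rightarrow> real) \<Rightarrow> ('d \<Rightarrow> real) \<Rightarrow> ('d \<Rightarrow> real) \<Rightarrow> ('d \<Rightarrow> real) \<Rightarrow> ('d \<Rightarrow> real)
    \<Rightarrow> real \<Rightarrow> ('d, 'k) state \<Rightarrow> ('d, 'k) state \<Rightarrow> ennreal" where
  "sep_metric \<Xi> m \<beta> R \<kappa> \<kappa>0 \<alpha> = (\<lambda>(x, \<xi>) (y, \<eta>).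
     \<Sum>i\<in>UNIV. coord_metric \<Xi> (m i) (\<beta> i) (R i) (\<kappa> i) (\<kappa>0 i) \<alpha> (x $ i, \<xi>) (y $ i, \<eta>))"

section \<open>Wasserstein distance\<close>

definition law_on :: "'z measure \<Rightarrow> 'z measure \<Rightarrow> bool" where
  "law_on E \<mu> \<longleftrightarrow> prob_space \<mu> \<and> sets \<mu> = sets E"

definition couplings :: "'z measure \<Rightarrow> 'z measure \<Rightarrow> 'z measure \<Rightarrow> ('z \<times> 'z) measure set" where
  "couplings E \<mu> \<nu> = {\<gamma>. law_on (E \<Otimes>\<^sub>M E) \<gamma> \<and> distr \<gamma> E fst = \<mu> \<and> distr \<gamma> E snd = \<nu>}"

definition wasserstein1 ::
  "'z measure \<Rightarrow> ('z \<Rightarrow> 'z \<Rightarrow> ennreal) \<Rightarrow> 'z measure \<Rightarrow> 'z measure \<Rightarrow> ennreal" where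
  "wasserstein1 E c \<mu> \<nu> = (INF \<gamma>\<in>couplings E \<mu> \<nu>. \<integral>\<^sup>+p. c (fst p) (snd p) \<partial>\<gamma>)"

definition finite_first_moment_laws ::
  "'z measure \<Rightarrow> ('z \<Rightarrow> 'z \<Rightarrow> ennreal) \<Rightarrow> 'z measure set" where
  "finite_first_moment_laws E c = {\<mu>. law_on E \<mu> \<and> (\<exists>z0\<in>space E. (\<integral>\<^sup>+z. c z z0 \<partial>\<mu>) < \<infinity>)}"

end

theory Submission
  imports Defs
begin

text \<open>
  With \<open>F\<close> an antiderivative of the weight \<open>V\<close>, the path metric of one coordinate is
  \<open>inf\<^sub>r (\<bar>F t - F r\<bar> + \<bar>F s - F r\<bar> + V r * norm (\<xi> - \<eta>) / \<alpha>)\<close>: an optimal path moves the coordinate to a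
  height \<open>r\<close> where travelling in \<open>\<Xi>\<close> is cheap, and then moves on. One step of the recursion therefore
  contracts the metric in mean as soon as it contracts horizontal and vertical segments in mean.
  Horizontally the factor is the mean of \<open>(1 - \<alpha> G') V(t - \<alpha> G) / V t\<close>. Away from the minimiser the curvature
  or, when \<open>\<beta> < 2\<close>, the drift acting on the exponential tail weight gives \<open>1 - c \<alpha>\<close>. Near a degenerate minimiser
  (\<open>m > 2\<close>) the noise pushes the iterate off the peak of the bump in \<open>V\<close>, which yields
  \<open>1 - c \<alpha>\<^bsup>m - 1\<^esup>\<close>. Vertically the contraction of \<open>\<Phi>\<close> wins, since vertical lengths are divided by \<open>\<alpha>\<close>.
  The coordinates share the innovations, so the bounds add up. A map contracting in mean contracts the
  Wasserstein distance, and its backward iterates converge almost surely to a point with invariant law.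
\<close>

section \<open>Absolutely continuous curves\<close>

text \<open>Of the two inequalities behind the formula for the path metric, the upper one is a
  three-piece curve. The lower one concerns an arbitrary absolutely continuous curve measured with
  \<open>vector_derivative\<close>, so it takes differentiability almost everywhere and the bound of
  an increment by the integral of the derivative; this section derives both from Vitali coverings
  and gauges. The constants are fixed in the order kappa, kappa0, alpha. The tail weight grows in
  mean by a factor 1 + O(kappa alpha), so kappa has to be small against the curvature at moderate
  |t|. For beta < 2 the drift far out gains only a multiple of kappa alpha, and the bump, which
  costs at most kappa0 alpha, has to be small against that. In the core with m > 2 the bump 1 -
  (2|t|/R)^q, q = min(m-2, 1), has height kappa0 alpha^(m-1-q): a noise step of size alpha off the
  peak gains the order alpha^(m-1), while for |t| above a multiple of alpha the bump costs at most
  the order alpha |t|^(m-2) of the curvature gain.\<close>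

inductive var_chain :: "(real \<Rightarrow> real) \<Rightarrow> real \<Rightarrow> real \<Rightarrow> real \<Rightarrow> bool" for f where
  base: "var_chain f a a 0"
| step: "var_chain f a c v \<Longrightarrow> c \<le> b \<Longrightarrow> var_chain f a b (v + \<bar>f b - f c\<bar>)"

lemma var_chain_le: "var_chain f a b v \<Longrightarrow> a \<le> b"
  by (induction rule: var_chain.induct) auto

lemma var_chain_trans: "var_chain f b c w \<Longrightarrow> var_chain f a b v \<Longrightarrow> var_chain f a c (v + w)"
proof (induction rule: var_chain.induct)
  case (step b' c' v' d)
  then show ?case
    using var_chain.step[of f a c' "v + v'" d] by (simp add: add.assoc)
qed auto

lemma var_chain_single: "a \<le> b \<Longrightarrow> var_chain f a b \<bar>f b - f a\<bar>"
  using var_chain.step[OF var_chain.base, of a b f] by simp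

text \<open>The values of \<open>var_chain\<close> are the variation sums of \<open>f\<close> over
  finite partitions of [a, b]. Tilting \<open>f\<close> by s x alters each summand by at most |s|
  times the step, so bounded variation survives; the tilt later centres two slope levels around
  0.\<close>

lemma var_chain_minus_linear:
  "var_chain (\<lambda>x. f x - s * x) a b v \<Longrightarrow> \<exists>w. var_chain f a b w \<and> v \<le> w + \<bar>s\<bar> * (b - a)"
proof (induction rule: var_chain.induct)
  case (base a)
  then show ?case by (auto intro: var_chain.base)
next
  case (step a c v b)
  then obtain w where w: "var_chain f a c w" "v \<le> w + \<bar>s\<bar> * (c - a)" by auto
  have "\<bar>f b - s * b - (f c - s * c)\<bar> \<le> \<bar>f b - f c\<bar> + \<bar>s * (b - c)\<bar>"
    by (simp add: algebra_simps)
  also have "\<bar>s * (b - c)\<bar> = \<bar>s\<bar> * (b - c)" using step(2) by (simp add: abs_mult)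
  finally have "v + \<bar>f b - s * b - (f c - s * c)\<bar> \<le> w + \<bar>f b - f c\<bar> + \<bar>s\<bar> * (b - a)"
    using w(2) by (simp add: algebra_simps)
  then show ?case using var_chain.step[OF w(1) step(2)] by blast
qed

text \<open>A partition is refined cell by cell: gains of \<open>c\<close> times the measure of
  \<open>E\<close> inside each cell add up, by subadditivity of the measure, to \<open>c\<close>
  times the measure of \<open>E\<close> in [a, b].\<close>

lemma var_chain_refine:
  assumes sub: "\<And>x y. a \<le> x \<Longrightarrow> x \<le> y \<Longrightarrow> y \<le> b \<Longrightarrow>
      \<exists>w. var_chain f x y w \<and> \<bar>f y - f x\<bar> + c * measure lebesgue (E \<inter> {x..y}) \<le> w"
    and E: "E \<in> sets lebesgue" and c: "0 \<le> c" and ch: "var_chain f a b v"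
  shows "\<exists>w. var_chain f a b w \<and> v + c * measure lebesgue (E \<inter> {a..b}) \<le> w"
proof -
  have lm: "E \<inter> {x..y} \<in> lmeasurable" for x y :: real
  proof (rule fmeasurableI2)
    show "{x..y} \<in> lmeasurable" "E \<inter> {x..y} \<subseteq> {x..y}" by auto
    show "E \<inter> {x..y} \<in> sets lebesgue" using E by auto
  qed
  show ?thesis using ch sub
  proof (induction rule: var_chain.induct)
    case (base a)
    have "measure lebesgue (E \<inter> {a..a}) = 0"
      by (intro negligible_imp_measure0 negligible_subset[OF negligible_sing[of a]]) auto
    then show ?case by (auto intro: var_chain.base)
  next
    case (step a d v b)
    have ad: "a \<le> d" using step.hyps(1) by (rule var_chain_le)
    have "\<exists>w. var_chain f a d w \<and> v + c * measure lebesgue (E \<inter> {a..d}) \<le> w"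
    proof (rule step.IH)
      fix x y assume "a \<le> x" "x \<le> y" "y \<le> d"
      then show "\<exists>w. var_chain f x y w \<and> \<bar>f y - f x\<bar> + c * measure lebesgue (E \<inter> {x..y}) \<le> w"
        using step.hyps(2) by (intro step.prems) auto
    qed
    then obtain w where w: "var_chain f a d w" "v + c * measure lebesgue (E \<inter> {a..d}) \<le> w" by auto
    obtain u where u: "var_chain f d b u" "\<bar>f b - f d\<bar> + c * measure lebesgue (E \<inter> {d..b}) \<le> u"
      using step.prems[OF ad step.hyps(2)] by auto
    have sub: "E \<inter> {a..b} \<subseteq> E \<inter> {a..d} \<union> E \<inter> {d..b}" by auto
    have "measure lebesgue (E \<inter> {a..b}) \<le> measure lebesgue (E \<inter> {a..d} \<union> E \<inter> {d..b})"
      by (rule measure_mono_fmeasurable[OF sub]) (use lm in \<open>auto simp: fmeasurableD\<close>)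
    also have "\<dots> \<le> measure lebesgue (E \<inter> {a..d}) + measure lebesgue (E \<inter> {d..b})"
      by (rule measure_Un_le) (use E in auto)
    finally have "c * measure lebesgue (E \<inter> {a..b})
        \<le> c * measure lebesgue (E \<inter> {a..d}) + c * measure lebesgue (E \<inter> {d..b})"
      using c by (metis distrib_left mult_left_mono)
    then show ?case using var_chain_trans[OF u(1) w(1)] w(2) u(2)
      by (intro exI[of _ "w + u"]) auto
  qed
qed

text \<open>The intervals of \<open>C\<close> and the gaps between them form a partition of [a, b].
  The increments over the gaps sum to f b - f a minus the increments over \<open>C\<close>, so their
  absolute values sum to at least the last term on the left. The induction removes the interval with
  the largest left endpoint.\<close>

lemma var_chain_disjoint_intervals:
  assumes "finite C" "a \<le> b"
    and "\<And>l r. (l, r) \<in> C \<Longrightarrow> a \<le> l \<and> l < r \<and> r \<le> b"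
    and "pairwise (\<lambda>p q. disjnt {fst p..snd p} {fst q..snd q}) C"
  shows "\<exists>v. var_chain f a b v \<and>
    (\<Sum>(l, r)\<in>C. \<bar>f r - f l\<bar>) + \<bar>f b - f a - (\<Sum>(l, r)\<in>C. f r - f l)\<bar> \<le> v"
  using assms
proof (induction "card C" arbitrary: C b)
  case 0
  then show ?case by (auto intro!: var_chain_single)
next
  case (Suc n)
  then have ne: "C \<noteq> {}" "finite C" by auto
  then have "Max (fst ` C) \<in> fst ` C" by (intro Max_in) auto
  then obtain l r where lr: "(l, r) \<in> C" and "Max (fst ` C) = l" by auto
  then have lmax: "\<And>p. p \<in> C \<Longrightarrow> fst p \<le> l" using ne(2) Max_ge[of "fst ` C"] by auto
  define D where "D = C - {(l, r)}"
  have C: "C = insert (l, r) D" "(l, r) \<notin> D" "finite D" using lr ne by (auto simp: D_def)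
  have alrb: "a \<le> l" "l < r" "r \<le> b" using Suc.prems(3)[OF lr] by auto
  have D: "a \<le> l' \<and> l' < r' \<and> r' \<le> l" if "(l', r') \<in> D" for l' r'
  proof -
    have p: "(l', r') \<in> C" "(l', r') \<noteq> (l, r)" using that by (auto simp: D_def)
    have q: "a \<le> l'" "l' < r'" using Suc.prems(3)[OF p(1)] by auto
    have "disjnt {l'..r'} {l..r}"
      using pairwiseD[OF Suc.prems(4) p(1) lr p(2)] by simp
    then have "l \<notin> {l'..r'}" using alrb by (auto simp: disjnt_def)
    then show ?thesis using q lmax[OF p(1)] by auto
  qed
  have "\<exists>v. var_chain f a l v \<and>
    (\<Sum>(l, r)\<in>D. \<bar>f r - f l\<bar>) + \<bar>f l - f a - (\<Sum>(l, r)\<in>D. f r - f l)\<bar> \<le> v"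
  proof (rule Suc.hyps(1))
    show "n = card D" using Suc.hyps(2) C by simp
    show "pairwise (\<lambda>p q. disjnt {fst p..snd p} {fst q..snd q}) D"
      using Suc.prems(4) by (rule pairwise_subset) (auto simp: D_def)
  qed (use C alrb D in auto)
  then obtain v where v: "var_chain f a l v"
    "(\<Sum>(l, r)\<in>D. \<bar>f r - f l\<bar>) + \<bar>f l - f a - (\<Sum>(l, r)\<in>D. f r - f l)\<bar> \<le> v" by auto
  have "var_chain f a b (v + \<bar>f r - f l\<bar> + \<bar>f b - f r\<bar>)"
    using v(1) alrb by (intro var_chain.step) auto
  moreover have "(\<Sum>(l, r)\<in>C. \<bar>f r - f l\<bar>) = \<bar>f r - f l\<bar> + (\<Sum>(l, r)\<in>D. \<bar>f r - f l\<bar>)"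
    "(\<Sum>(l, r)\<in>C. f r - f l) = (f r - f l) + (\<Sum>(l, r)\<in>D. f r - f l)"
    using C by (auto simp: C(1))
  ultimately show ?case using v(2)
    by (intro exI[of _ "v + \<bar>f r - f l\<bar> + \<bar>f b - f r\<bar>"]) auto
qed

text \<open>Vitali's theorem yields countably many disjoint intervals that cover \<open>E\<close> up
  to a null set. Their union lies in a bounded interval, so finitely many of them miss less than
  half the measure of \<open>E\<close>; this is the factor 2.\<close>

lemma vitali_finite_intervals:
  fixes E :: "real set"
  assumes E: "E \<in> sets lebesgue" "E \<subseteq> {a<..<b}"
    and cover: "\<And>x d. x \<in> E \<Longrightarrow> 0 < d \<Longrightarrow> \<exists>l r. l \<le> x \<and> x \<le> r \<and> l < r \<and> r - l < d \<and> P l r"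
  obtains C where "finite C" "\<And>l r. (l, r) \<in> C \<Longrightarrow> a < l \<and> l < r \<and> r < b \<and> P l r"
    "pairwise (\<lambda>p q. disjnt {fst p..snd p} {fst q..snd q}) C"
    "measure lebesgue E \<le> 2 * (\<Sum>(l, r)\<in>C. r - l)"
proof (cases "measure lebesgue E = 0")
  case True
  then show ?thesis by (intro that[of "{}"]) auto
next
  case False
  then have pos: "0 < measure lebesgue E" by (simp add: zero_less_measure_iff)
  define K where "K = {p. a < fst p \<and> fst p < snd p \<and> snd p < b \<and> P (fst p) (snd p)}"
  define ce where "ce p = (fst p + snd p) / 2" for p :: "real \<times> real"
  define ra where "ra p = (snd p - fst p) / 2" for p :: "real \<times> real"
  have cb: "cball (ce p) (ra p) = {fst p..snd p}" for p
    by (auto simp: ce_def ra_def cball_eq_atLeastAtMost field_simps)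
  have "\<exists>p. p \<in> K \<and> x \<in> cball (ce p) (ra p) \<and> ra p < d" if xE: "x \<in> E" and d: "0 < d" for x d
  proof -
    \<comment> \<open>Keeping the interval shorter than the distances from \<open>x\<close> to the
      endpoints places it inside (a, b).\<close>
    define e where "e = min d (min (x - a) (b - x))"
    have "0 < e" using xE d E(2) by (auto simp: e_def)
    then obtain l r where lr: "l \<le> x" "x \<le> r" "l < r" "r - l < e" "P l r"
      using cover[OF xE, of e] by auto
    then have "(l, r) \<in> K" by (auto simp: K_def e_def)
    moreover have "ra (l, r) < d" using lr by (auto simp: ra_def e_def)
    ultimately show ?thesis unfolding cb using lr by (intro exI[of _ "(l, r)"]) auto
  qed
  then obtain C where C: "countable C" "C \<subseteq> K"
     "pairwise (\<lambda>i j. disjnt (cball (ce i) (ra i)) (cball (ce j) (ra j))) C"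
     "negligible (E - (\<Union>i\<in>C. cball (ce i) (ra i)))"
    using Vitali_covering_theorem_cballs[of K ra E ce] by (auto simp: K_def ra_def)
  define I where "I p = {fst p..snd p}" for p :: "real \<times> real"
  have I: "cball (ce p) (ra p) = I p" for p by (simp add: cb I_def)
  have Clm: "d \<in> lmeasurable" if "d \<in> I ` C" for d using that by (auto simp: I_def)
  have B: "measure lebesgue (\<Union>D) \<le> measure lebesgue {a..b}" if "D \<subseteq> I ` C" "finite D" for D
  proof (rule measure_mono_fmeasurable)
    show "\<Union>D \<subseteq> {a..b}" using that C(2) by (fastforce simp: I_def K_def)
    show "\<Union>D \<in> sets lebesgue" using that by (intro sets.finite_Union) (auto simp: I_def)
  qed auto
  obtain D where D: "D \<subseteq> I ` C" "finite D"
    "measure lebesgue (\<Union>(I ` C)) - measure lebesgue E / 2 < measure lebesgue (\<Union>D)"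
    using measure_countable_Union_approachable[of "I ` C" "measure lebesgue E / 2" "measure lebesgue {a..b}"]
      C(1) pos Clm B by auto
  obtain C' where C': "C' \<subseteq> C" "finite C'" "D = I ` C'" using D(1,2) by (meson finite_subset_image)
  have Ulm: "\<Union>(I ` C) \<in> lmeasurable"
  proof (rule fmeasurableI2[of "{a..b}"])
    show "\<Union>(I ` C) \<subseteq> {a..b}" using C(2) by (fastforce simp: I_def K_def)
    show "\<Union>(I ` C) \<in> sets lebesgue" using C(1) by (intro sets.countable_Union) (auto simp: I_def)
  qed auto
  have neg: "E - \<Union>(I ` C) \<in> null_sets lebesgue" using C(4) by (simp add: I negligible_iff_null_sets)
  have "measure lebesgue E \<le> measure lebesgue (\<Union>(I ` C) \<union> (E - \<Union>(I ` C)))"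
  proof (rule measure_mono_fmeasurable)
    show "\<Union>(I ` C) \<union> (E - \<Union>(I ` C)) \<in> lmeasurable"
      by (rule fmeasurable.Un[OF Ulm fmeasurableI_null_sets[OF neg]])
  qed (use E in auto)
  also have "\<dots> = measure lebesgue (\<Union>(I ` C))"
    by (rule measure_Un_null_set[OF fmeasurableD[OF Ulm] neg])
  finally have "measure lebesgue E \<le> 2 * measure lebesgue (\<Union>D)" using D(3) by linarith
  also have "measure lebesgue (\<Union>D) \<le> (\<Sum>p\<in>C'. measure lebesgue (I p))"
    unfolding C'(3) by (rule measure_UNION_le) (use C' in \<open>auto simp: I_def\<close>)
  also have "\<dots> = (\<Sum>(l, r)\<in>C'. r - l)"
    using C' C(2) by (intro sum.cong) (auto simp: I_def K_def)
  finally show ?thesis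
  proof (intro that[of C'])
    show "pairwise (\<lambda>p q. disjnt {fst p..snd p} {fst q..snd q}) C'"
      using C(3) C'(1) unfolding cb by (rule pairwise_subset)
  qed (use C' C(2) in \<open>auto simp: K_def\<close>)
qed

text \<open>On any [x, y] the covering selects disjoint intervals where \<open>f\<close> moves
  against the sign of f y - f x. They add variation themselves, and the rest of [x, y] has to make
  up for them, so the cell gains \<open>c\<close> times the measure of \<open>E\<close> inside it.
  Every partition can thus be refined with the same total gain, although the variation sums are
  bounded: \<open>E\<close> must be null.\<close>

lemma null_if_oscillating_slopes:
  fixes f :: "real \<Rightarrow> real"
  assumes E: "E \<in> sets lebesgue" "E \<subseteq> {a<..<b}" and c: "0 < c"
    and neg: "\<And>x d. x \<in> E \<Longrightarrow> 0 < d \<Longrightarrow>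
      \<exists>l r. l \<le> x \<and> x \<le> r \<and> l < r \<and> r - l < d \<and> f r - f l \<le> - c * (r - l)"
    and pos: "\<And>x d. x \<in> E \<Longrightarrow> 0 < d \<Longrightarrow>
      \<exists>l r. l \<le> x \<and> x \<le> r \<and> l < r \<and> r - l < d \<and> f r - f l \<ge> c * (r - l)"
    and bv: "\<And>v. var_chain f a b v \<Longrightarrow> v \<le> B"
  shows "measure lebesgue E = 0"
proof (rule ccontr)
  assume "measure lebesgue E \<noteq> 0"
  then have mE: "0 < measure lebesgue E" by (simp add: zero_less_measure_iff)
  have gain: "\<exists>w. var_chain f x y w \<and> \<bar>f y - f x\<bar> + c * measure lebesgue (E \<inter> {x..y}) \<le> w"
    if xy: "x \<le> y" and s: "s = 1 \<or> s = -1" "s * (f y - f x) \<ge> 0" for x y s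
  proof -
    have E': "E \<inter> {x<..<y} \<in> sets lebesgue" "E \<inter> {x<..<y} \<subseteq> {x<..<y}" using E by auto
    have "\<exists>l r. l \<le> z \<and> z \<le> r \<and> l < r \<and> r - l < d \<and> s * (f r - f l) \<le> - c * (r - l)"
      if z: "z \<in> E \<inter> {x<..<y}" "0 < d" for z d
    proof (cases "s = 1")
      case True
      then show ?thesis using neg[of z d] z by simp
    next
      case False
      then have "s = -1" using s(1) by simp
      moreover obtain l r where "l \<le> z" "z \<le> r" "l < r" "r - l < d" "f r - f l \<ge> c * (r - l)"
        using pos[of z d] z by blast
      ultimately show ?thesis by (intro exI[of _ l] exI[of _ r]) auto
    qed
    from vitali_finite_intervals[OF E' this] obtain C where C: "finite C"
      "\<And>l r. (l, r) \<in> C \<Longrightarrow> x < l \<and> l < r \<and> r < y \<and> s * (f r - f l) \<le> - c * (r - l)"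
      "pairwise (\<lambda>p q. disjnt {fst p..snd p} {fst q..snd q}) C"
      "measure lebesgue (E \<inter> {x<..<y}) \<le> 2 * (\<Sum>(l, r)\<in>C. r - l)" by blast
    obtain v where v: "var_chain f x y v"
      "(\<Sum>(l, r)\<in>C. \<bar>f r - f l\<bar>) + \<bar>f y - f x - (\<Sum>(l, r)\<in>C. f r - f l)\<bar> \<le> v"
      using var_chain_disjoint_intervals[OF C(1) xy _ C(3), of f] C(2) by (metis less_imp_le)
    define L where "L = (\<Sum>(l, r)\<in>C. r - l)"
    have "s * (f r - f l) \<le> - c * (r - l)" if "(l, r) \<in> C" for l r using C(2)[OF that] by simp
    then have sum: "s * (\<Sum>(l, r)\<in>C. f r - f l) \<le> - c * L"
      unfolding L_def sum_distrib_left by (intro sum_mono) (auto simp: split_def)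
    have "c * L \<le> (\<Sum>(l, r)\<in>C. \<bar>f r - f l\<bar>)"
    proof -
      have "c * (r - l) \<le> \<bar>f r - f l\<bar>" if "(l, r) \<in> C" for l r using C(2)[OF that] s(1) by auto
      then show ?thesis unfolding L_def sum_distrib_left by (intro sum_mono) (auto simp: split_def)
    qed
    \<comment> \<open>The increments over \<open>C\<close> sum to a number of the sign opposite to f
      y - f x and of size at least c L, so the remainder exceeds |f y - f x| by c L. Together with
      the c L of the intervals themselves this matches the factor 2 of the covering.\<close>
    moreover have "\<bar>f y - f x\<bar> + c * L \<le> \<bar>f y - f x - (\<Sum>(l, r)\<in>C. f r - f l)\<bar>"
      using s sum by auto
    moreover have "measure lebesgue (E \<inter> {x..y}) \<le> measure lebesgue (E \<inter> {x<..<y})"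
    proof -
      have "E \<inter> {x..y} = (E \<inter> {x<..<y}) \<union> (E \<inter> {x, y})" using xy by auto
      moreover have "negligible (E \<inter> {x, y})"
        by (rule negligible_subset[of "{x, y}"]) (auto intro: negligible_finite)
      then have "E \<inter> {x, y} \<in> null_sets lebesgue" by (simp add: negligible_iff_null_sets)
      ultimately show ?thesis using measure_Un_null_set[OF E'(1)] by simp
    qed
    then have "c * measure lebesgue (E \<inter> {x..y}) \<le> c * (2 * L)"
      using C(4) c unfolding L_def by (intro mult_left_mono) auto
    ultimately show ?thesis using v by (intro exI[of _ v]) auto
  qed
  obtain x0 where "x0 \<in> E" using mE by (cases "E = {}") auto
  then have ab: "a \<le> b" using E by force
  define Vs where "Vs = {v. var_chain f a b v}"
  have bdd: "bdd_above Vs" using bv by (auto simp: Vs_def bdd_above_def)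
  have "Vs \<noteq> {}" using var_chain_single[OF ab] by (auto simp: Vs_def)
  \<comment> \<open>A partition sum this close to the supremum would be refined beyond it.\<close>
  moreover have "Sup Vs - c * measure lebesgue E < Sup Vs" using c mE by simp
  ultimately obtain v where v: "var_chain f a b v" "Sup Vs - c * measure lebesgue E < v"
    by (metis (mono_tags) Vs_def bdd less_cSup_iff mem_Collect_eq)
  have "\<exists>w. var_chain f x y w \<and> \<bar>f y - f x\<bar> + c * measure lebesgue (E \<inter> {x..y}) \<le> w"
    if "x \<le> y" for x y
    using gain[OF that, of 1] gain[OF that, of "-1"] by (cases "f x \<le> f y") auto
  then obtain w where w: "var_chain f a b w" "v + c * measure lebesgue (E \<inter> {a..b}) \<le> w"
    using var_chain_refine[OF _ E(1) _ v(1), of c] c by auto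
  have "E \<inter> {a..b} = E" using E(2) by auto
  moreover have "w \<le> Sup Vs" using w(1) bdd by (auto simp: Vs_def intro: cSup_upper)
  ultimately show False using w v by auto
qed

lemma null_if_unbounded_slopes:
  fixes f :: "real \<Rightarrow> real"
  assumes E: "E \<in> sets lebesgue" "E \<subseteq> {a<..<b}"
    and steep: "\<And>x d N. x \<in> E \<Longrightarrow> 0 < d \<Longrightarrow>
      \<exists>l r. l \<le> x \<and> x \<le> r \<and> l < r \<and> r - l < d \<and> N * (r - l) \<le> \<bar>f r - f l\<bar>"
    and bv: "\<And>v. var_chain f a b v \<Longrightarrow> v \<le> B"
  shows "measure lebesgue E = 0"
proof (rule ccontr)
  assume "measure lebesgue E \<noteq> 0"
  then have mE: "0 < measure lebesgue E" by (simp add: zero_less_measure_iff)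
  obtain x0 where "x0 \<in> E" using mE by (cases "E = {}") auto
  then have ab: "a \<le> b" using E by force
  \<comment> \<open>Disjoint intervals of slope at least \<open>N\<close> and of total length at
    least half the measure of \<open>E\<close> then contribute |B| + 1, more than the variation
    bound.\<close>
  define N where "N = 2 * (\<bar>B\<bar> + 1) / measure lebesgue E"
  have N: "0 < N" using mE by (simp add: N_def)
  from vitali_finite_intervals[OF E steep] obtain C where C: "finite C"
      "\<And>l r. (l, r) \<in> C \<Longrightarrow> a < l \<and> l < r \<and> r < b \<and> N * (r - l) \<le> \<bar>f r - f l\<bar>"
      "pairwise (\<lambda>p q. disjnt {fst p..snd p} {fst q..snd q}) C"
      "measure lebesgue E \<le> 2 * (\<Sum>(l, r)\<in>C. r - l)" by blast
  obtain v where v: "var_chain f a b v"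
      "(\<Sum>(l, r)\<in>C. \<bar>f r - f l\<bar>) + \<bar>f b - f a - (\<Sum>(l, r)\<in>C. f r - f l)\<bar> \<le> v"
    using var_chain_disjoint_intervals[OF C(1) ab _ C(3), of f] C(2) by (metis less_imp_le)
  have "N * (r - l) \<le> \<bar>f r - f l\<bar>" if "(l, r) \<in> C" for l r using C(2)[OF that] by simp
  then have "N * (\<Sum>(l, r)\<in>C. r - l) \<le> (\<Sum>(l, r)\<in>C. \<bar>f r - f l\<bar>)"
    unfolding sum_distrib_left by (intro sum_mono) (auto simp: split_def)
  moreover have "N * measure lebesgue E \<le> N * (2 * (\<Sum>(l, r)\<in>C. r - l))"
    using C(4) N by (intro mult_left_mono) auto
  moreover have "N * measure lebesgue E = 2 * (\<bar>B\<bar> + 1)" using mE by (simp add: N_def)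
  ultimately show False using v bv[OF v(1)] by auto
qed

text \<open>A finite derivative exists at x unless the difference quotients are unbounded there
  (\<open>steep\<close>) or their lower and upper limits are separated by rationals p < q. Both
  exceptional sets are null by the two preceding lemmas, and the pairs are countable. Continuity of
  \<open>f\<close> makes the quotients continuous in x, so that these sets are Borel.\<close>

lemma bounded_variation_differentiable_ae:
  fixes f :: "real \<Rightarrow> real"
  assumes cont: "continuous_on UNIV f"
    and bv: "\<And>v. var_chain f a b v \<Longrightarrow> v \<le> B"
  shows "negligible {x \<in> {a<..<b}. \<not> f differentiable (at x)}"
proof -
  define slope where "slope x h = (f (x + h) - f x) / h" for x h
  define small where "small n = {h::real. h \<noteq> 0 \<and> \<bar>h\<bar> < 1 / Suc n}" for n
  \<comment> \<open>\<open>low p\<close> and \<open>up p\<close> collect the points with quotients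
    below \<open>p\<close>, or above \<open>p\<close>, at arbitrarily small steps \<open>h\<close>;
    they are countable intersections of open sets.\<close>
  define low where "low p = (\<Inter>n. \<Union>h\<in>small n. {x. slope x h < p})" for p
  define up where "up p = (\<Inter>n. \<Union>h\<in>small n. {x. p < slope x h})" for p
  have small: "\<exists>n. \<forall>h\<in>small n. \<bar>h\<bar> < d" if "0 < d" for d
  proof -
    obtain n where "1 / Suc n < d" using \<open>0 < d\<close> nat_approx_posE by blast
    then show ?thesis by (intro exI[of _ n]) (auto simp: small_def)
  qed
  have cs: "continuous_on UNIV (\<lambda>x. slope x h)" if "h \<noteq> 0" for h
    unfolding slope_def using that by (intro continuous_intros continuous_on_subset[OF cont]) (auto intro!: continuous_on_compose2[OF cont] continuous_intros)
  have low_m: "low p \<in> sets borel" for p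
  proof -
    have "open (\<Union>h\<in>small n. {x. slope x h < p})" for n
      by (intro open_UN ballI open_Collect_less cs) (auto simp: small_def)
    then show ?thesis unfolding low_def by (intro sets.countable_INT'') auto
  qed
  have up_m: "up p \<in> sets borel" for p
  proof -
    have "open (\<Union>h\<in>small n. {x. p < slope x h})" for n
      by (intro open_UN ballI open_Collect_less cs) (auto simp: small_def)
    then show ?thesis unfolding up_def by (intro sets.countable_INT'') auto
  qed
  have seg: "\<exists>l r. l \<le> x \<and> x \<le> r \<and> l < r \<and> r - l = \<bar>h\<bar> \<and> f r - f l = slope x h * (r - l)"
    if "h \<noteq> 0" for x h
    using that by (intro exI[of _ "min x (x + h)"] exI[of _ "max x (x + h)"])
      (auto simp: slope_def min_def max_def field_simps)
  have lowI: "\<exists>l r. l \<le> x \<and> x \<le> r \<and> l < r \<and> r - l < d \<and> f r - f l \<le> p * (r - l)"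
    if x: "x \<in> low p" and d: "0 < d" for x d p
  proof -
    obtain n where n: "\<forall>h\<in>small n. \<bar>h\<bar> < d" using small[OF d] by auto
    obtain h where h: "h \<in> small n" "slope x h < p" using x by (auto simp: low_def)
    have "h \<noteq> 0" using h by (auto simp: small_def)
    from seg[OF this, of x] obtain l r where lr: "l \<le> x" "x \<le> r" "l < r" "r - l = \<bar>h\<bar>" "f r - f l = slope x h * (r - l)"
      by blast
    moreover have "slope x h * (r - l) \<le> p * (r - l)" using lr h by (intro mult_right_mono) auto
    ultimately show ?thesis using n h by (intro exI[of _ l] exI[of _ r]) auto
  qed
  have upI: "\<exists>l r. l \<le> x \<and> x \<le> r \<and> l < r \<and> r - l < d \<and> f r - f l \<ge> p * (r - l)"
    if x: "x \<in> up p" and d: "0 < d" for x d p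
  proof -
    obtain n where n: "\<forall>h\<in>small n. \<bar>h\<bar> < d" using small[OF d] by auto
    obtain h where h: "h \<in> small n" "slope x h > p" using x by (auto simp: up_def)
    have "h \<noteq> 0" using h by (auto simp: small_def)
    from seg[OF this, of x] obtain l r where lr: "l \<le> x" "x \<le> r" "l < r" "r - l = \<bar>h\<bar>" "f r - f l = slope x h * (r - l)"
      by blast
    moreover have "slope x h * (r - l) \<ge> p * (r - l)" using lr h by (intro mult_right_mono) auto
    ultimately show ?thesis using n h by (intro exI[of _ l] exI[of _ r]) auto
  qed
  have negl: "negligible A" if "measure lebesgue A = 0" "A \<in> sets borel" "A \<subseteq> {a<..<b}" for A
  proof -
    have "A \<in> lmeasurable" by (rule fmeasurableI2[of "{a<..<b}"]) (use that in auto)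
    then show ?thesis using that(1) by (simp add: negligible_iff_measure)
  qed
  have osc: "negligible ({a<..<b} \<inter> (low p \<inter> up q))" if pq: "p < q" for p q
  proof (rule negl)
    \<comment> \<open>Subtracting the slope midway turns the levels \<open>p\<close> and
      \<open>q\<close> into -c and c.\<close>
    define s where "s = (p + q) / 2"
    define c where "c = (q - p) / 2"
    show "measure lebesgue ({a<..<b} \<inter> (low p \<inter> up q)) = 0"
    proof (rule null_if_oscillating_slopes[where f = "\<lambda>x. f x - s * x" and c = c and B = "B + \<bar>s\<bar> * (b - a)"])
      show "{a<..<b} \<inter> (low p \<inter> up q) \<in> sets lebesgue" using low_m up_m by auto
      show "0 < c" using pq by (simp add: c_def)
      fix x d :: real assume x: "x \<in> {a<..<b} \<inter> (low p \<inter> up q)" and d: "0 < d"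
      obtain l r where lr: "l \<le> x" "x \<le> r" "l < r" "r - l < d" "f r - f l \<le> p * (r - l)"
        using lowI[of x p d] x d by auto
      have "f r - s * r - (f l - s * l) \<le> - c * (r - l)"
        using lr(5) by (simp add: s_def c_def field_simps)
      then show "\<exists>l r. l \<le> x \<and> x \<le> r \<and> l < r \<and> r - l < d \<and> f r - s * r - (f l - s * l) \<le> - c * (r - l)"
        using lr by blast
      obtain l r where lr: "l \<le> x" "x \<le> r" "l < r" "r - l < d" "f r - f l \<ge> q * (r - l)"
        using upI[of x q d] x d by auto
      have "f r - s * r - (f l - s * l) \<ge> c * (r - l)"
        using lr(5) by (simp add: s_def c_def field_simps)
      then show "\<exists>l r. l \<le> x \<and> x \<le> r \<and> l < r \<and> r - l < d \<and> f r - s * r - (f l - s * l) \<ge> c * (r - l)"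
        using lr by blast
    next
      fix v assume "var_chain (\<lambda>x. f x - s * x) a b v"
      then show "v \<le> B + \<bar>s\<bar> * (b - a)" using var_chain_minus_linear bv by fastforce
    qed auto
  qed (use low_m up_m in auto)
  define steep where "steep = (\<Inter>k::nat. low (- real k)) \<union> (\<Inter>k::nat. up (real k))"
  have stp: "negligible ({a<..<b} \<inter> steep)"
  proof (rule negl)
    have sm: "steep \<in> sets borel" using low_m up_m unfolding steep_def
      by (intro sets.Un sets.countable_INT'') auto
    then show "{a<..<b} \<inter> steep \<in> sets borel" by auto
    show "measure lebesgue ({a<..<b} \<inter> steep) = 0"
    proof (rule null_if_unbounded_slopes[where f = f and B = B])
      show "{a<..<b} \<inter> steep \<in> sets lebesgue" using sm by auto
      fix x d N :: real assume x: "x \<in> {a<..<b} \<inter> steep" and d: "0 < d"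
      obtain k :: nat where k: "N \<le> real k" using real_arch_simple by blast
      from x consider "x \<in> low (- real k)" | "x \<in> up (real k)" unfolding steep_def by auto
      then show "\<exists>l r. l \<le> x \<and> x \<le> r \<and> l < r \<and> r - l < d \<and> N * (r - l) \<le> \<bar>f r - f l\<bar>"
      proof cases
        case 1
        obtain l r where lr: "l \<le> x" "x \<le> r" "l < r" "r - l < d" "f r - f l \<le> - real k * (r - l)"
          using lowI[OF 1 d] by blast
        moreover have "N * (r - l) \<le> real k * (r - l)" using k lr by (intro mult_right_mono) auto
        ultimately have "N * (r - l) \<le> \<bar>f r - f l\<bar>" by linarith
        with lr show ?thesis by blast
      next
        case 2
        obtain l r where lr: "l \<le> x" "x \<le> r" "l < r" "r - l < d" "f r - f l \<ge> real k * (r - l)"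
          using upI[OF 2 d] by blast
        moreover have "N * (r - l) \<le> real k * (r - l)" using k lr by (intro mult_right_mono) auto
        ultimately have "N * (r - l) \<le> \<bar>f r - f l\<bar>" by linarith
        with lr show ?thesis by blast
      qed
    qed (use bv in auto)
  qed auto
  define PQ where "PQ = {(p, q). p \<in> \<rat> \<and> q \<in> \<rat> \<and> p < (q::real)}"
  have "countable PQ"
    by (rule countable_subset[of _ "\<rat> \<times> \<rat>"]) (auto simp: PQ_def countable_rat)
  then have N: "negligible ({a<..<b} \<inter> steep \<union> (\<Union>(p, q)\<in>PQ. {a<..<b} \<inter> (low p \<inter> up q)))"
    by (intro negligible_Un stp negligible_countable_Union) (auto simp: PQ_def intro: osc)
  have "f differentiable (at x)" if x: "x \<in> {a<..<b}" and ns: "x \<notin> steep"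
    and no: "\<And>p q. (p, q) \<in> PQ \<Longrightarrow> x \<notin> low p \<inter> up q" for x
  proof -
    have nlow: "\<forall>\<^sub>F h in at 0. p \<le> slope x h" if xp: "x \<notin> low p" for p
    proof -
      obtain n where "\<forall>h\<in>small n. p \<le> slope x h" using xp by (auto simp: low_def not_less)
      then show ?thesis unfolding eventually_at
        by (intro exI[of _ "1 / Suc n"]) (auto simp: small_def dist_real_def)
    qed
    have nup: "\<forall>\<^sub>F h in at 0. slope x h \<le> p" if xp: "x \<notin> up p" for p
    proof -
      obtain n where "\<forall>h\<in>small n. slope x h \<le> p" using xp by (auto simp: up_def not_less)
      then show ?thesis unfolding eventually_at
        by (intro exI[of _ "1 / Suc n"]) (auto simp: small_def dist_real_def)
    qed
    \<comment> \<open>The eventual lower bounds of the quotients; their supremum \<open>L\<close> is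
      the lower limit and turns out to be the derivative.\<close>
    define P where "P = {p. \<forall>\<^sub>F h in at 0. p \<le> slope x h}"
    obtain k1 k2 where k: "\<forall>\<^sub>F h in at 0. - real k1 \<le> slope x h" "\<forall>\<^sub>F h in at 0. slope x h \<le> real k2"
      using ns nlow nup unfolding steep_def by blast
    have ne: "P \<noteq> {}" using k(1) by (auto simp: P_def)
    have "p \<le> real k2" if "p \<in> P" for p
    proof -
      have "\<forall>\<^sub>F h in at (0::real). p \<le> slope x h \<and> slope x h \<le> real k2"
        using that k(2) unfolding P_def by (intro eventually_conj) auto
      then obtain h where "p \<le> slope x h \<and> slope x h \<le> real k2"
        using eventually_happens'[OF trivial_limit_at] by blast
      then show ?thesis by simp
    qed
    then have bdd: "bdd_above P" by (auto simp: bdd_above_def)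
    define L where "L = Sup P"
    have "(slope x \<longlongrightarrow> L) (at 0)"
    proof (rule tendstoI)
      fix e :: real assume e: "0 < e"
      obtain p where p: "p \<in> P" "L - e < p" using less_cSup_iff[OF ne bdd, of "L - e"] e by (auto simp: L_def)
      obtain r s where rs: "r \<in> \<rat>" "s \<in> \<rat>" "L < r" "r < s" "s < L + e"
        using Rats_dense_in_real[of L "L + e"] Rats_dense_in_real e
        by (metis less_add_same_cancel1)
      \<comment> \<open>As r > L is no eventual lower bound, quotients below \<open>r\<close> recur.
        The pair (r, s) then excludes \<open>up s\<close>, so the quotients are eventually at most s
        < L + e.\<close>
      have "x \<in> low r"
      proof (rule ccontr)
        assume "x \<notin> low r"
        then have "r \<in> P" using nlow by (simp add: P_def)
        then have "r \<le> L" unfolding L_def using bdd by (rule cSup_upper)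
        then show False using rs by simp
      qed
      then have "\<forall>\<^sub>F h in at 0. slope x h \<le> s" using no[of r s] rs nup by (auto simp: PQ_def)
      moreover have "\<forall>\<^sub>F h in at 0. p \<le> slope x h" using p by (simp add: P_def)
      ultimately show "\<forall>\<^sub>F h in at 0. dist (slope x h) L < e"
        by eventually_elim (use p rs in \<open>auto simp: dist_real_def\<close>)
    qed
    then have "(f has_field_derivative L) (at x)"
      unfolding DERIV_def slope_def .
    then show ?thesis by (auto simp: real_differentiable_def)
  qed
  then have "{x \<in> {a<..<b}. \<not> f differentiable (at x)}
      \<subseteq> {a<..<b} \<inter> steep \<union> (\<Union>(p, q)\<in>PQ. {a<..<b} \<inter> (low p \<inter> up q))"
    by blast
  then show ?thesis by (rule negligible_subset[OF N])
qed

section \<open>Absolutely continuous functions: differentiability and increments\<close>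

lemma abs_cont_curve_subinterval:
  assumes "abs_cont_curve a b \<gamma>" "a \<le> c" "d \<le> b"
  shows "abs_cont_curve c d \<gamma>"
  unfolding abs_cont_curve_def
proof (intro allI impI)
  fix e :: real assume "0 < e"
  with assms(1) obtain \<delta> where \<delta>: "0 < \<delta>" "\<And>n l r. (\<forall>k<(n::nat). a \<le> l k \<and> l k \<le> r k \<and> r k \<le> b) \<and>
        disjoint_family_on (\<lambda>k. {l k<..<r k}) {..<n} \<and> (\<Sum>k<n. r k - l k) < \<delta>
        \<Longrightarrow> (\<Sum>k<n. norm (\<gamma> (r k) - \<gamma> (l k))) < e"
    unfolding abs_cont_curve_def by meson
  show "\<exists>\<delta>>0. \<forall>n l r. (\<forall>k<(n::nat). c \<le> l k \<and> l k \<le> r k \<and> r k \<le> d) \<and>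
        disjoint_family_on (\<lambda>k. {l k<..<r k}) {..<n} \<and> (\<Sum>k<n. r k - l k) < \<delta>
        \<longrightarrow> (\<Sum>k<n. norm (\<gamma> (r k) - \<gamma> (l k))) < e"
    using \<delta>(1) assms(2,3) by (intro exI[of _ \<delta>] conjI allI impI \<delta>(2)) (auto intro: order_trans)
qed

text \<open>Derives the absolute continuity of the components of a curve, of its projections and of
  \<open>F\<close> along it from that of the curve.\<close>

lemma abs_cont_curve_lipschitz_image:
  assumes "abs_cont_curve a b \<gamma>"
    and "\<And>s t. s \<in> {a..b} \<Longrightarrow> t \<in> {a..b} \<Longrightarrow> norm (\<phi> s - \<phi> t) \<le> C * norm (\<gamma> s - \<gamma> t)"
  shows "abs_cont_curve a b \<phi>"
  unfolding abs_cont_curve_def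
proof (intro allI impI)
  fix e :: real assume e: "0 < e"
  define e' where "e' = e / (\<bar>C\<bar> + 1)"
  have e': "0 < e'" using e by (simp add: e'_def add_nonneg_pos)
  then obtain \<delta> where \<delta>: "0 < \<delta>" "\<And>n l r. (\<forall>k<(n::nat). a \<le> l k \<and> l k \<le> r k \<and> r k \<le> b) \<and>
        disjoint_family_on (\<lambda>k. {l k<..<r k}) {..<n} \<and> (\<Sum>k<n. r k - l k) < \<delta>
        \<Longrightarrow> (\<Sum>k<n. norm (\<gamma> (r k) - \<gamma> (l k))) < e'"
    using assms(1) unfolding abs_cont_curve_def by meson
  have "(\<Sum>k<n. norm (\<phi> (r k) - \<phi> (l k))) < e"
    if *: "(\<forall>k<(n::nat). a \<le> l k \<and> l k \<le> r k \<and> r k \<le> b) \<and>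
        disjoint_family_on (\<lambda>k. {l k<..<r k}) {..<n} \<and> (\<Sum>k<n. r k - l k) < \<delta>" for n l r
  proof -
    have "(\<Sum>k<n. norm (\<phi> (r k) - \<phi> (l k))) \<le> (\<Sum>k<n. C * norm (\<gamma> (r k) - \<gamma> (l k)))"
      using * by (intro sum_mono assms(2)) (auto intro: order_trans)
    also have "\<dots> \<le> (\<bar>C\<bar> + 1) * (\<Sum>k<n. norm (\<gamma> (r k) - \<gamma> (l k)))"
      unfolding sum_distrib_left[symmetric] by (intro mult_right_mono sum_nonneg) auto
    also have "\<dots> < (\<bar>C\<bar> + 1) * e'"
      using \<delta>(2)[OF *] by (intro mult_strict_left_mono) auto
    also have "\<dots> = e" by (simp add: e'_def)
    finally show ?thesis .
  qed
  then show "\<exists>\<delta>>0. \<forall>n l r. (\<forall>k<(n::nat). a \<le> l k \<and> l k \<le> r k \<and> r k \<le> b) \<and>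
        disjoint_family_on (\<lambda>k. {l k<..<r k}) {..<n} \<and> (\<Sum>k<n. r k - l k) < \<delta>
        \<longrightarrow> (\<Sum>k<n. norm (\<phi> (r k) - \<phi> (l k))) < e"
    using \<delta>(1) by blast
qed

lemma lipschitz_abs_cont_curve:
  assumes "\<And>s t. s \<in> {a..b} \<Longrightarrow> t \<in> {a..b} \<Longrightarrow> norm (\<phi> s - \<phi> t) \<le> C * \<bar>s - t\<bar>"
  shows "abs_cont_curve a b \<phi>"
proof (rule abs_cont_curve_lipschitz_image)
  show "abs_cont_curve a b (\<lambda>x::real. x)"
    unfolding abs_cont_curve_def by (intro allI impI exI conjI, assumption) auto
qed (use assms in auto)

lemma abs_cont_curve_continuous_on:
  assumes ac: "abs_cont_curve a b \<gamma>"
  shows "continuous_on {a..b} \<gamma>"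
  unfolding continuous_on_iff
proof (intro ballI allI impI)
  fix x e :: real assume x: "x \<in> {a..b}" and "0 < e"
  with ac obtain \<delta> where \<delta>: "0 < \<delta>" "\<And>n l r. (\<forall>k<(n::nat). a \<le> l k \<and> l k \<le> r k \<and> r k \<le> b) \<and>
        disjoint_family_on (\<lambda>k. {l k<..<r k}) {..<n} \<and> (\<Sum>k<n. r k - l k) < \<delta>
        \<Longrightarrow> (\<Sum>k<n. norm (\<gamma> (r k) - \<gamma> (l k))) < e"
    unfolding abs_cont_curve_def by meson
  have "dist (\<gamma> y) (\<gamma> x) < e" if "y \<in> {a..b}" "dist y x < \<delta>" for y
  proof -
    have "(\<Sum>k<(1::nat). norm (\<gamma> (max x y) - \<gamma> (min x y))) < e"
      using x that by (intro \<delta>(2)) (auto simp: disjoint_family_on_def dist_real_def)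
    then show ?thesis
      by (auto simp: dist_norm min_def max_def norm_minus_commute split: if_splits)
  qed
  then show "\<exists>d>0. \<forall>x'\<in>{a..b}. dist x' x < d \<longrightarrow> dist (\<gamma> x') (\<gamma> x) < e"
    using \<delta>(1) by blast
qed

text \<open>Makes a partition available to \<open>abs_cont_curve\<close>, which speaks of indexed
  families of disjoint intervals.\<close>

lemma var_chain_indexed:
  "var_chain f a b v \<Longrightarrow> \<exists>(n::nat) l r. (\<forall>k<n. a \<le> l k \<and> l k \<le> r k \<and> r k \<le> b) \<and>
    disjoint_family_on (\<lambda>k. {l k<..<r k}) {..<n} \<and> (\<Sum>k<n. r k - l k) = b - a \<and>
    (\<Sum>k<n. \<bar>f (r k) - f (l k)\<bar>) = v"
proof (induction rule: var_chain.induct)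
  case (base a)
  show ?case by (intro exI[of _ 0]) (auto simp: disjoint_family_on_def)
next
  case (step a c v b)
  then obtain n :: nat and l r where *: "\<forall>k<n. a \<le> l k \<and> l k \<le> r k \<and> r k \<le> c"
    "disjoint_family_on (\<lambda>k. {l k<..<r k}) {..<n}" "(\<Sum>k<n. r k - l k) = c - a"
    "(\<Sum>k<n. \<bar>f (r k) - f (l k)\<bar>) = v" by blast
  have ac: "a \<le> c" using step.hyps(1) by (rule var_chain_le)
  have "{(l(n := c)) i<..<(r(n := b)) i} \<inter> {(l(n := c)) j<..<(r(n := b)) j} = {}"
    if "i < Suc n" "j < Suc n" "i \<noteq> j" for i j
  proof -
    have "r k \<le> c" if "k < n" for k using *(1) that by auto
    moreover have "{l i<..<r i} \<inter> {l j<..<r j} = {}" if "i < n" "j < n"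
      using *(2) that \<open>i \<noteq> j\<close> by (auto simp: disjoint_family_on_def)
    ultimately show ?thesis using that
      by (cases "i = n"; cases "j = n") (fastforce simp: less_Suc_eq)+
  qed
  then have "disjoint_family_on (\<lambda>k. {(l(n := c)) k<..<(r(n := b)) k}) {..<Suc n}"
    unfolding disjoint_family_on_def by blast
  then show ?case
    using * ac step.hyps
    by (intro exI[of _ "Suc n"] exI[of _ "l(n := c)"] exI[of _ "r(n := b)"])
      (auto simp: less_Suc_eq intro: order_trans)
qed

text \<open>A variation bound on short intervals is enough, because differentiability is
  local.\<close>

lemma abs_cont_curve_var_chain:
  fixes f :: "real \<Rightarrow> real"
  assumes "abs_cont_curve a b f" "0 < e"
  obtains \<delta> where "0 < \<delta>"
    "\<And>c d v. a \<le> c \<Longrightarrow> d \<le> b \<Longrightarrow> d - c < \<delta> \<Longrightarrow> var_chain f c d v \<Longrightarrow> v \<le> e"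
proof -
  obtain \<delta> where \<delta>: "0 < \<delta>" "\<And>n l r. (\<forall>k<(n::nat). a \<le> l k \<and> l k \<le> r k \<and> r k \<le> b) \<and>
        disjoint_family_on (\<lambda>k. {l k<..<r k}) {..<n} \<and> (\<Sum>k<n. r k - l k) < \<delta>
        \<Longrightarrow> (\<Sum>k<n. norm (f (r k) - f (l k))) < e"
    using assms unfolding abs_cont_curve_def by meson
  show thesis
  proof (rule that[OF \<delta>(1)])
    fix c d v assume cd: "a \<le> c" "d \<le> b" "d - c < \<delta>" "var_chain f c d v"
    obtain n :: nat and l r where *: "\<forall>k<n. c \<le> l k \<and> l k \<le> r k \<and> r k \<le> d"
      "disjoint_family_on (\<lambda>k. {l k<..<r k}) {..<n}" "(\<Sum>k<n. r k - l k) = d - c"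
      "(\<Sum>k<n. \<bar>f (r k) - f (l k)\<bar>) = v" using var_chain_indexed[OF cd(4)] by blast
    have "(\<Sum>k<n. norm (f (r k) - f (l k))) < e"
      using * cd by (intro \<delta>(2)) (auto intro: order_trans)
    then show "v \<le> e" using *(4) by simp
  qed
qed

text \<open>A gauge proof. At a tag outside \<open>N\<close> differentiability controls the
  increment of the cell up to \<open>e\<close> times its length. Cells tagged in \<open>N\<close>
  are confined to an open set of measure below \<delta>, where absolute continuity bounds the sum of
  all their increments by \<open>e\<close>.\<close>

lemma abs_cont_increment_le:
  fixes f g :: "real \<Rightarrow> real"
  assumes ab: "a \<le> b" and ac: "abs_cont_curve a b f"
    and N: "negligible N"
    and der: "\<And>x. x \<in> {a..b} - N \<Longrightarrow> (f has_field_derivative D x) (at x)"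
    and Dg: "\<And>x. x \<in> {a..b} - N \<Longrightarrow> \<bar>D x\<bar> \<le> g x"
    and g0: "\<And>x. 0 \<le> g x" and int: "(g has_integral I) {a..b}"
  shows "\<bar>f b - f a\<bar> \<le> I"
proof (rule field_le_epsilon)
  fix e0 :: real assume e0: "0 < e0"
  \<comment> \<open>The errors are \<open>e\<close> from the tags in \<open>N\<close>,
    \<open>e\<close> from the Riemann sum of \<open>g\<close> and e (b - a) from
    differentiability.\<close>
  define e where "e = e0 / (2 + (b - a))"
  have e: "0 < e" using e0 ab by (simp add: e_def)
  obtain \<delta> where \<delta>: "0 < \<delta>" "\<And>n l r. (\<forall>k<(n::nat). a \<le> l k \<and> l k \<le> r k \<and> r k \<le> b) \<and>
        disjoint_family_on (\<lambda>k. {l k<..<r k}) {..<n} \<and> (\<Sum>k<n. r k - l k) < \<delta>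
        \<Longrightarrow> (\<Sum>k<n. norm (f (r k) - f (l k))) < e"
    using ac e unfolding abs_cont_curve_def by meson
  have Nl: "N \<in> lmeasurable" "measure lebesgue N = 0" using N by (auto simp: negligible_iff_measure)
  obtain Op where Op: "open Op" "N \<subseteq> Op" "Op - N \<in> lmeasurable" "emeasure lebesgue (Op - N) < ennreal \<delta>"
    using sets_lebesgue_outer_open[of N \<delta>] \<delta>(1) fmeasurableD[OF Nl(1)] by blast
  have OpN: "Op = (Op - N) \<union> N" using Op(2) by auto
  have Opl: "Op \<in> lmeasurable" by (subst OpN) (rule fmeasurable.Un[OF Op(3) Nl(1)])
  \<comment> \<open>Outer regularity bounds the measure of Op - N only; as \<open>N\<close> is null,
    this bounds all of \<open>Op\<close>.\<close>
  have "measure lebesgue Op \<le> measure lebesgue (Op - N) + measure lebesgue N"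
    by (subst OpN) (intro measure_Un_le fmeasurableD Op Nl)
  also have "\<dots> < \<delta>" using Op(3,4) \<delta>(1) Nl(2) by (simp add: emeasure_eq_measure2 ennreal_less_iff)
  finally have Opm: "measure lebesgue Op < \<delta>" .
  obtain \<gamma>1 where \<gamma>1: "gauge \<gamma>1" "\<And>\<D>. \<D> tagged_division_of {a..b} \<Longrightarrow> \<gamma>1 fine \<D> \<Longrightarrow>
      norm ((\<Sum>(x,K)\<in>\<D>. measure lborel K *\<^sub>R g x) - I) < e"
    using int e unfolding has_integral_real by meson
  have "\<exists>s>0. \<forall>y. \<bar>y - x\<bar> < s \<longrightarrow> \<bar>f y - f x - D x * (y - x)\<bar> \<le> e * \<bar>y - x\<bar>"
    if x: "x \<in> {a..b} - N" for x
  proof -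
    have "(f has_derivative (\<lambda>h. D x * h)) (at x)" using der[OF x] by (simp add: has_field_derivative_def)
    then show ?thesis using e unfolding has_derivative_at_alt
      by (auto simp: abs_mult)
  qed
  then obtain s where s: "\<And>x. x \<in> {a..b} - N \<Longrightarrow> 0 < s x"
    "\<And>x y. x \<in> {a..b} - N \<Longrightarrow> \<bar>y - x\<bar> < s x \<Longrightarrow> \<bar>f y - f x - D x * (y - x)\<bar> \<le> e * \<bar>y - x\<bar>"
    by metis
  define \<gamma>2 where "\<gamma>2 x = (if x \<in> N then Op else if x \<in> {a..b} then ball x (s x) else ball x 1)" for x
  have "gauge \<gamma>2" unfolding gauge_def \<gamma>2_def using Op s(1) by auto
  then have "gauge (\<lambda>x. \<gamma>1 x \<inter> \<gamma>2 x)" using \<gamma>1(1) by (rule gauge_Int[rotated])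
  then obtain p where p: "p tagged_division_of {a..b}" "(\<lambda>x. \<gamma>1 x \<inter> \<gamma>2 x) fine p"
    using fine_division_exists_real by blast
  have fin: "finite p" using p(1) by auto
  have K: "\<exists>l r. K = {l..r} \<and> a \<le> l \<and> l \<le> x \<and> x \<le> r \<and> r \<le> b" if "(x, K) \<in> p" for x K
  proof -
    have "x \<in> K" "K \<subseteq> {a..b}" "\<exists>l r. K = cbox l r" using tagged_division_ofD(2,3,4)[OF p(1) that] by auto
    then show ?thesis by auto
  qed
  have fine1: "\<gamma>1 fine p" and fine2: "\<gamma>2 fine p" using p(2) by (auto simp: fine_def)
  define pN where "pN = {q \<in> p. fst q \<in> N}"
  have out: "(\<Sum>(x,K)\<in>p - pN. \<bar>f (Sup K) - f (Inf K)\<bar>) \<le> (\<Sum>(x,K)\<in>p. measure lborel K *\<^sub>R g x + e * measure lborel K)"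
  proof -
    have "\<bar>f (Sup K) - f (Inf K)\<bar> \<le> measure lborel K *\<^sub>R g x + e * measure lborel K" if xK: "(x, K) \<in> p - pN" for x K
    proof -
      obtain l r where lr: "K = {l..r}" "a \<le> l" "l \<le> x" "x \<le> r" "r \<le> b" using K xK by blast
      have x: "x \<in> {a..b} - N" using xK lr by (auto simp: pN_def)
      have "K \<subseteq> \<gamma>2 x" using fine2 xK by (auto simp: fine_def)
      then have "K \<subseteq> ball x (s x)" using x by (simp add: \<gamma>2_def)
      moreover have "l \<in> K" "r \<in> K" using lr by auto
      ultimately have "l \<in> ball x (s x)" "r \<in> ball x (s x)" by blast+
      then have *: "\<bar>f l - f x - D x * (l - x)\<bar> \<le> e * \<bar>l - x\<bar>" "\<bar>f r - f x - D x * (r - x)\<bar> \<le> e * \<bar>r - x\<bar>"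
        using s(2)[OF x] by (auto simp: dist_real_def abs_minus_commute)
      \<comment> \<open>The tag lies between \<open>l\<close> and \<open>r\<close>, so the two
        one-sided errors add up to exactly e (r - l).\<close>
      have "\<bar>(f r - f l) - D x * (r - l)\<bar> \<le> e * (r - l)"
      proof -
        have "e * \<bar>l - x\<bar> + e * \<bar>r - x\<bar> = e * (r - l)" using lr by (simp add: algebra_simps)
        moreover have "D x * (r - l) = D x * (r - x) - D x * (l - x)" by (simp add: algebra_simps)
        ultimately show ?thesis using * by linarith
      qed
      moreover have "\<bar>D x * (r - l)\<bar> \<le> g x * (r - l)" using Dg[OF x] lr by (auto simp: abs_mult intro!: mult_right_mono)
      ultimately show ?thesis using lr by (simp add: algebra_simps)
    qed
    then have "(\<Sum>(x,K)\<in>p - pN. \<bar>f (Sup K) - f (Inf K)\<bar>) \<le> (\<Sum>(x,K)\<in>p - pN. measure lborel K *\<^sub>R g x + e * measure lborel K)"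
      by (intro sum_mono) auto
    also have "\<dots> \<le> (\<Sum>(x,K)\<in>p. measure lborel K *\<^sub>R g x + e * measure lborel K)"
      using fin e g0 by (intro sum_mono2) (auto intro!: add_nonneg_nonneg)
    finally show ?thesis .
  qed
  have inn: "(\<Sum>(x,K)\<in>pN. \<bar>f (Sup K) - f (Inf K)\<bar>) < e"
  proof -
    have finN: "finite pN" using fin by (auto simp: pN_def)
    \<comment> \<open>The cells tagged in \<open>N\<close> are enumerated because absolute
      continuity is stated for indexed intervals.\<close>
    then obtain h where h: "bij_betw h {..<card pN} pN"
      using ex_bij_betw_nat_finite[OF finN] by (auto simp: atLeast0LessThan)
    define l where "l k = Inf (snd (h k))" for k
    define r where "r k = Sup (snd (h k))" for k
    have hk: "snd (h k) = {l k..r k} \<and> a \<le> l k \<and> l k \<le> r k \<and> r k \<le> b \<and> snd (h k) \<subseteq> Op"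
      if "k < card pN" for k
    proof -
      have hp: "h k \<in> pN" using bij_betwE[OF h] that by auto
      obtain x K' where xK: "h k = (x, K')" by (cases "h k")
      have xKp: "(x, K') \<in> p" using hp xK by (simp add: pN_def)
      obtain l' r' where lr: "K' = {l'..r'}" "a \<le> l'" "l' \<le> x" "x \<le> r'" "r' \<le> b"
        using K[OF xKp] by blast
      have "K' \<subseteq> \<gamma>2 x" using fine2 xKp by (auto simp: fine_def)
      moreover have "x \<in> N" using hp xK by (auto simp: pN_def)
      ultimately show ?thesis using lr xK by (simp add: l_def r_def \<gamma>2_def)
    qed
    have disj: "disjoint_family_on (\<lambda>k. {l k<..<r k}) {..<card pN}"
      unfolding disjoint_family_on_def
    proof (intro ballI impI)
      fix i j assume ij: "i \<in> {..<card pN}" "j \<in> {..<card pN}" "i \<noteq> j"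
      have ne: "h i \<noteq> h j" using h ij by (auto simp: bij_betw_def inj_on_def)
      have mem: "h i \<in> p" "h j \<in> p" using bij_betwE[OF h] ij by (auto simp: pN_def)
      have "interior (snd (h i)) \<inter> interior (snd (h j)) = {}"
        using tagged_division_ofD(5)[OF p(1), of "fst (h i)" "snd (h i)" "fst (h j)" "snd (h j)"] ne mem
        by (auto simp: prod_eq_iff)
      then show "{l i<..<r i} \<inter> {l j<..<r j} = {}" using hk[of i] hk[of j] ij by simp
    qed
    have "(\<Sum>k<card pN. r k - l k) = (\<Sum>k<card pN. measure lebesgue {l k<..<r k})"
      using hk by (intro sum.cong) auto
    also have "\<dots> = measure lebesgue (\<Union>k<card pN. {l k<..<r k})"
      using disj hk by (intro measure_finite_Union[symmetric]) auto
    also have "\<dots> \<le> measure lebesgue Op"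
    proof (rule measure_mono_fmeasurable)
      show "(\<Union>k<card pN. {l k<..<r k}) \<subseteq> Op" using hk by fastforce
    qed (use Opl in auto)
    finally have "(\<Sum>k<card pN. r k - l k) < \<delta>" using Opm by simp
    then have "(\<Sum>k<card pN. norm (f (r k) - f (l k))) < e" using disj hk by (intro \<delta>(2)) auto
    also have "(\<Sum>k<card pN. norm (f (r k) - f (l k))) = (\<Sum>(x,K)\<in>pN. \<bar>f (Sup K) - f (Inf K)\<bar>)"
      using sum.reindex_bij_betw[OF h, of "\<lambda>(x,K). \<bar>f (Sup K) - f (Inf K)\<bar>"]
      by (simp add: split_def l_def r_def)
    finally show ?thesis .
  qed
  have "f b - f a = (\<Sum>(x,K)\<in>p. f (Sup K) - f (Inf K))"
    using additive_tagged_division_1[OF ab p(1), of f] by simp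
  then have "\<bar>f b - f a\<bar> \<le> (\<Sum>(x,K)\<in>p. \<bar>f (Sup K) - f (Inf K)\<bar>)"
    by (auto simp: split_def intro: sum_abs)
  also have "\<dots> = (\<Sum>(x,K)\<in>pN. \<bar>f (Sup K) - f (Inf K)\<bar>) + (\<Sum>(x,K)\<in>p - pN. \<bar>f (Sup K) - f (Inf K)\<bar>)"
    using fin sum.subset_diff[of pN p "\<lambda>(x,K). \<bar>f (Sup K) - f (Inf K)\<bar>"] by (auto simp: pN_def)
  also have "\<dots> \<le> e + (\<Sum>(x,K)\<in>p. measure lborel K *\<^sub>R g x + e * measure lborel K)" using out inn by linarith
  also have "(\<Sum>(x,K)\<in>p. measure lborel K *\<^sub>R g x + e * measure lborel K)
      = (\<Sum>(x,K)\<in>p. measure lborel K *\<^sub>R g x) + e * (\<Sum>(x,K)\<in>p. measure lborel K)"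
    by (simp add: split_def sum.distrib sum_distrib_left)
  also have "(\<Sum>(x,K)\<in>p. measure lborel K) = b - a"
    using additive_content_tagged_division[of p a b] p(1) ab by simp
  also have "(\<Sum>(x,K)\<in>p. measure lborel K *\<^sub>R g x) \<le> I + e" using \<gamma>1(2)[OF p(1) fine1] by (simp add: abs_less_iff)
  finally have "\<bar>f b - f a\<bar> \<le> I + e * (2 + (b - a))" by (simp add: algebra_simps)
  also have "e * (2 + (b - a)) = e0" using ab by (simp add: e_def)
  finally show "\<bar>f b - f a\<bar> \<le> I + e0" by simp
qed

text \<open>The lemma on bounded variation applies on each interval with rational endpoints that is
  shorter than \<delta>, and countably many of these cover (a, b).\<close>

lemma abs_cont_differentiable_ae:
  fixes f :: "real \<Rightarrow> real"
  assumes ac: "abs_cont_curve a b f"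
  shows "negligible {x \<in> {a<..<b}. \<not> f differentiable (at x)}"
proof (cases "a < b")
  case True
  obtain \<delta> where \<delta>: "0 < \<delta>"
    "\<And>c d v. a \<le> c \<Longrightarrow> d \<le> b \<Longrightarrow> d - c < \<delta> \<Longrightarrow> var_chain f c d v \<Longrightarrow> v \<le> 1"
    using abs_cont_curve_var_chain[OF ac zero_less_one] by blast
  \<comment> \<open>Composing with the clamp to [a, b] extends \<open>f\<close> continuously to the
    line.\<close>
  define cl where "cl x = max a (min b x)" for x
  define f' where "f' = f \<circ> cl"
  have "continuous_on UNIV cl" unfolding cl_def by (intro continuous_intros)
  moreover have "cl ` UNIV \<subseteq> {a..b}" using True by (auto simp: cl_def)
  ultimately have cont: "continuous_on UNIV f'"
    unfolding f'_def using abs_cont_curve_continuous_on[OF ac]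
    by (meson continuous_on_compose continuous_on_subset)
  have f': "f' x = f x" if "x \<in> {a..b}" for x using that by (auto simp: f'_def cl_def)
  define PQ where "PQ = {(p, q). p \<in> \<rat> \<and> q \<in> \<rat> \<and> a < p \<and> p < q \<and> q < b \<and> q - p < \<delta>}"
  have "countable PQ"
    by (rule countable_subset[of _ "\<rat> \<times> \<rat>"]) (auto simp: PQ_def countable_rat)
  moreover have "negligible {x \<in> {p<..<q}. \<not> f differentiable (at x)}" if "(p, q) \<in> PQ" for p q
  proof -
    have pq: "a < p" "p < q" "q < b" "q - p < \<delta>" using that by (auto simp: PQ_def)
    have "v \<le> 1" if "var_chain f' p q v" for v
    proof -
      have "a < c \<Longrightarrow> d < b \<Longrightarrow> var_chain f' c d w \<Longrightarrow> var_chain f c d w" for c d w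
      proof (rotate_tac 2, induction rule: var_chain.induct)
        case (base a) show ?case by (rule var_chain.base)
      next
        case (step x c v y)
        have "x \<le> c" using step.hyps(1) by (rule var_chain_le)
        then have "f' y = f y" "f' c = f c" using step by (auto intro!: f')
        then show ?case using step by (auto intro!: var_chain.step)
      qed
      then have "var_chain f p q v" using pq that by blast
      then show ?thesis using \<delta>(2)[of p q v] pq by auto
    qed
    then have "negligible {x \<in> {p<..<q}. \<not> f' differentiable (at x)}"
      by (rule bounded_variation_differentiable_ae[OF cont])
    moreover have "f differentiable (at x)" if xpq: "x \<in> {p<..<q}" "f' differentiable (at x)" for x
    proof -
      obtain D where "(f' has_derivative D) (at x)" using xpq(2) by (auto simp: differentiable_def)
      then have "(f has_derivative D) (at x)"
        by (rule has_derivative_transform_within_open[of _ _ _ _ "{p<..<q}"]) (use xpq pq f' in auto)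
      then show ?thesis by (auto simp: differentiable_def)
    qed
    then have "{x \<in> {p<..<q}. \<not> f differentiable (at x)} \<subseteq> {x \<in> {p<..<q}. \<not> f' differentiable (at x)}" by blast
    ultimately show ?thesis by (rule negligible_subset)
  qed
  ultimately have "negligible (\<Union>(p, q)\<in>PQ. {x \<in> {p<..<q}. \<not> f differentiable (at x)})"
    by (intro negligible_countable_Union) auto
  moreover have "\<exists>p q. (p, q) \<in> PQ \<and> p < x \<and> x < q" if x: "x \<in> {a<..<b}" for x
  proof -
    obtain p where p: "p \<in> \<rat>" "max a (x - \<delta> / 2) < p" "p < x"
      using Rats_dense_in_real[of "max a (x - \<delta> / 2)" x] x \<delta>(1) by auto
    obtain q where q: "q \<in> \<rat>" "x < q" "q < min b (x + \<delta> / 2)"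
      using Rats_dense_in_real[of x "min b (x + \<delta> / 2)"] x \<delta>(1) by auto
    show ?thesis using p q by (intro exI[of _ p] exI[of _ q]) (auto simp: PQ_def)
  qed
  then have "{x \<in> {a<..<b}. \<not> f differentiable (at x)}
      \<subseteq> (\<Union>(p, q)\<in>PQ. {x \<in> {p<..<q}. \<not> f differentiable (at x)})" by fastforce
  ultimately show ?thesis by (rule negligible_subset)
qed (auto simp: not_less)

text \<open>The derivative is taken as a limit of difference quotients along 1 / (n + 1), which is a
  Borel function on the whole line; on the null set where \<open>f\<close> has no derivative its
  value is arbitrary. If the integral of |D| is infinite the bound on increments is trivial.\<close>

lemma abs_cont_derivative:
  fixes f :: "real \<Rightarrow> real"
  assumes ac: "abs_cont_curve a b f" and ab: "a < b"
  obtains D N where "D \<in> borel_measurable borel" "negligible N"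
    "\<And>x. x \<in> {a..b} - N \<Longrightarrow> x \<in> {a<..<b} \<and> (f has_field_derivative D x) (at x)"
    "\<And>c d. a \<le> c \<Longrightarrow> c \<le> d \<Longrightarrow> d \<le> b \<Longrightarrow>
      ennreal \<bar>f d - f c\<bar> \<le> (\<integral>\<^sup>+x\<in>{c..d}. ennreal \<bar>D x\<bar> \<partial>lborel)"
proof -
  define cl where "cl x = max a (min b x)" for x
  define f' where "f' = f \<circ> cl"
  have "continuous_on UNIV cl" unfolding cl_def by (intro continuous_intros)
  moreover have "cl ` UNIV \<subseteq> {a..b}" using ab by (auto simp: cl_def)
  ultimately have "continuous_on UNIV f'"
    unfolding f'_def using abs_cont_curve_continuous_on[OF ac]
    by (meson continuous_on_compose continuous_on_subset)
  then have f'_m[measurable]: "f' \<in> borel_measurable borel" by (rule borel_measurable_continuous_onI)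
  have f': "f' x = f x" if "x \<in> {a..b}" for x using that by (auto simp: f'_def cl_def)
  define D where "D x = lim (\<lambda>n. (f' (x + 1 / Suc n) - f' x) / (1 / Suc n))" for x
  have D_m[measurable]: "D \<in> borel_measurable borel" unfolding D_def by measurable
  \<comment> \<open>The endpoints are added so that outside \<open>N\<close> the derivative is
    two-sided.\<close>
  define N where "N = {x \<in> {a<..<b}. \<not> f differentiable (at x)} \<union> {a, b}"
  have N: "negligible N" unfolding N_def
    by (intro negligible_Un abs_cont_differentiable_ae ac negligible_finite) auto
  have der: "(f has_field_derivative D x) (at x)" if x: "x \<in> {a..b} - N" for x
  proof -
    have xab: "x \<in> {a<..<b}" using x by (auto simp: N_def)
    then obtain L where L: "(f has_field_derivative L) (at x)"
      using x by (auto simp: N_def real_differentiable_def)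
    then have "(f' has_field_derivative L) (at x)"
      by (rule has_field_derivative_transform_within_open[of _ _ _ "{a<..<b}"]) (use xab f' in auto)
    then have "((\<lambda>h. (f' (x + h) - f' x) / h) \<longlongrightarrow> L) (at 0)" by (simp add: DERIV_def)
    moreover have "filterlim (\<lambda>n. 1 / Suc n) (at (0::real)) sequentially"
      unfolding filterlim_at using LIMSEQ_inverse_real_of_nat by (auto simp: inverse_eq_divide)
    ultimately have "(\<lambda>n. (f' (x + 1 / Suc n) - f' x) / (1 / Suc n)) \<longlonglongrightarrow> L"
      by (rule filterlim_compose)
    then have "D x = L" unfolding D_def by (rule limI)
    then show ?thesis using L by simp
  qed
  show thesis
  proof (rule that[OF D_m N])
    fix x assume "x \<in> {a..b} - N"
    then show "x \<in> {a<..<b} \<and> (f has_field_derivative D x) (at x)" using der by (auto simp: N_def)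
  next
    fix c d assume cd: "a \<le> c" "c \<le> d" "d \<le> b"
    show "ennreal \<bar>f d - f c\<bar> \<le> (\<integral>\<^sup>+x\<in>{c..d}. ennreal \<bar>D x\<bar> \<partial>lborel)"
    proof (cases "(\<integral>\<^sup>+x\<in>{c..d}. ennreal \<bar>D x\<bar> \<partial>lborel) = \<infinity>")
      case False
      have eq: "(\<integral>\<^sup>+x\<in>{c..d}. ennreal \<bar>D x\<bar> \<partial>lborel) = (\<integral>\<^sup>+x. ennreal (\<bar>D x\<bar> * indicator {c..d} x) \<partial>lborel)"
        by (intro nn_integral_cong) (auto simp: indicator_def)
      then obtain I where I: "(\<integral>\<^sup>+x. ennreal (\<bar>D x\<bar> * indicator {c..d} x) \<partial>lborel) = ennreal I" "0 \<le> I"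
        using False by (cases "(\<integral>\<^sup>+x. ennreal (\<bar>D x\<bar> * indicator {c..d} x) \<partial>lborel)" rule: ennreal_cases) auto
      have "((\<lambda>x. \<bar>D x\<bar> * indicator {c..d} x) has_integral I) UNIV"
        by (rule nn_integral_has_integral[OF _ _ I]) auto
      then have "((\<lambda>x. if x \<in> {c..d} then \<bar>D x\<bar> else 0) has_integral I) UNIV"
        by (rule has_integral_eq[rotated]) (auto simp: indicator_def)
      then have "((\<lambda>x. \<bar>D x\<bar>) has_integral I) {c..d}" by (simp only: has_integral_restrict_UNIV)
      then have "\<bar>f d - f c\<bar> \<le> I"
        by (rule abs_cont_increment_le[OF cd(2) abs_cont_curve_subinterval[OF ac cd(1,3)] N, rotated 3])
          (use der cd in auto)
      then show ?thesis unfolding eq I(1) by (rule ennreal_leI)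
    qed simp
  qed
qed

section \<open>The path metric of a weight on a line\<close>

lemma continuous_antiderivative:
  fixes f :: "real \<Rightarrow> real"
  assumes "continuous_on UNIV f"
  obtains F where "\<And>x. (F has_real_derivative f x) (at x)"
proof
  fix x :: real
  \<comment> \<open>The interval from \<open>a\<close> to \<open>b\<close> has both the base point 0
    and \<open>x\<close> in its interior.\<close>
  define a where "a = - \<bar>x\<bar> - 1"
  define b where "b = \<bar>x\<bar> + 1"
  have "((\<lambda>u. LBINT y=ereal 0..ereal u. f y) has_vector_derivative f x) (at x within {a..b})"
    using assms by (intro interval_integral_FTC2) (auto simp: a_def b_def intro: continuous_on_subset)
  moreover have "at x within {a..b} = at x"
    by (intro at_within_interior) (auto simp: a_def b_def interior_atLeastAtMost_real)
  ultimately show "((\<lambda>u. LBINT y=ereal 0..ereal u. f y) has_real_derivative f x) (at x)"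
    by (simp add: has_real_derivative_iff_has_vector_derivative)
qed

text \<open>|F t - F s| is the length of a horizontal segment, and \<alpha> is the unit in which the
  phase is measured. The bound V \<ge> 1 makes the metric dominate |t - s| + norm (\<xi> - \<eta>) /
  \<alpha>.\<close>

locale weighted_line =
  fixes V F :: "real \<Rightarrow> real" and \<alpha> :: real
  assumes contV: "continuous_on UNIV V" and V_ge1: "1 \<le> V t"
    and derF: "(F has_real_derivative V t) (at t)" and \<alpha>: "0 < \<alpha>"
begin

definition cost :: "real \<Rightarrow> real \<times> 'b::euclidean_space \<Rightarrow> real \<times> 'b \<Rightarrow> real" where
  "cost r z z' = \<bar>F (fst z) - F r\<bar> + \<bar>F (fst z') - F r\<bar> + V r * (norm (snd z - snd z') / \<alpha>)"

definition wdist :: "real \<times> 'b::euclidean_space \<Rightarrow> real \<times> 'b \<Rightarrow> real" where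
  "wdist z z' = (INF r. cost r z z')"

lemma V_pos: "0 < V t"
  using V_ge1[of t] by simp

lemma F_diff_ge: "s \<le> t \<Longrightarrow> t - s \<le> F t - F s"
proof (cases "s < t")
  case True
  obtain u where "F t - F s = (t - s) * V u" using MVT2[OF True, of F V] derF by blast
  then show ?thesis using True V_ge1[of u] by simp
qed auto

lemma F_abs_diff_ge: "\<bar>t - s\<bar> \<le> \<bar>F t - F s\<bar>"
  using F_diff_ge[of s t] F_diff_ge[of t s] by (cases "s \<le> t") auto

lemma F_mono: "s \<le> t \<Longrightarrow> F s \<le> F t"
  using F_diff_ge[of s t] by simp

lemma F_abs_diff_le:
  assumes "\<And>u. min s t \<le> u \<Longrightarrow> u \<le> max s t \<Longrightarrow> V u \<le> C"
  shows "\<bar>F t - F s\<bar> \<le> C * \<bar>t - s\<bar>"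
proof -
  have *: "\<bar>F b - F a\<bar> \<le> C * \<bar>b - a\<bar>" if ab: "a < b" "\<And>u. a \<le> u \<Longrightarrow> u \<le> b \<Longrightarrow> V u \<le> C" for a b
  proof -
    obtain u where u: "a < u" "u < b" "F b - F a = (b - a) * V u" using MVT2[OF ab(1), of F V] derF by blast
    then show ?thesis using ab V_pos[of u] by (auto simp: abs_mult)
  qed
  show ?thesis using *[of s t] *[of t s] assms
    by (cases s t rule: linorder_cases) (auto simp: abs_minus_commute)
qed

lemma contF: "continuous_on A F"
  using derF by (meson DERIV_isCont continuous_at_imp_continuous_on)

lemma cost_nonneg: "0 \<le> cost r z z'"
  unfolding cost_def using V_pos[of r] \<alpha> by simp

lemma bdd_cost: "bdd_below (range (\<lambda>r. cost r z z'))"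
  unfolding bdd_below_def using cost_nonneg by blast

lemma wdist_le_cost: "wdist z z' \<le> cost r z z'"
  unfolding wdist_def by (rule cINF_lower[OF bdd_cost]) auto

lemma wdist_nonneg: "0 \<le> wdist z z'"
  unfolding wdist_def by (rule cINF_greatest) (auto intro: cost_nonneg)

lemma wdist_approx:
  assumes "0 < e" obtains r where "cost r z z' < wdist z z' + e"
  using cINF_less_iff[OF _ bdd_cost, of z z' "wdist z z' + e"] assms unfolding wdist_def by auto

lemma wdist_sym: "wdist z z' = wdist z' z"
  unfolding wdist_def cost_def by (simp add: norm_minus_commute add.commute)

text \<open>Both vertical moves can be made at the cheaper of two near-optimal heights
  \<open>r\<close> and \<open>q\<close>. The horizontal route to that height can run through the
  height of z', so it is covered by the four horizontal terms on the right.\<close>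

lemma wdist_triangle: "wdist z z'' \<le> wdist z z' + wdist z' z''"
proof (rule field_le_epsilon)
  fix e :: real assume "0 < e"
  then have e: "0 < e / 2" by simp
  obtain r where r: "cost r z z' < wdist z z' + e / 2" using wdist_approx[OF e] .
  obtain q where q: "cost q z' z'' < wdist z' z'' + e / 2" using wdist_approx[OF e] .
  define p where "p = (if V r \<le> V q then r else q)"
  have p: "V p \<le> V r" "V p \<le> V q" by (auto simp: p_def)
  have "V p * (norm (snd z - snd z'') / \<alpha>) \<le> V p * (norm (snd z - snd z') / \<alpha> + norm (snd z' - snd z'') / \<alpha>)"
    using V_pos[of p] \<alpha> norm_triangle_ineq[of "snd z - snd z'" "snd z' - snd z''"]
    by (intro mult_left_mono) (auto simp: divide_simps)
  also have "\<dots> \<le> V r * (norm (snd z - snd z') / \<alpha>) + V q * (norm (snd z' - snd z'') / \<alpha>)"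
    unfolding distrib_left using p \<alpha> by (intro add_mono mult_right_mono) auto
  finally have 1: "V p * (norm (snd z - snd z'') / \<alpha>) \<le> \<dots>" .
  have 2: "\<bar>F (fst z) - F p\<bar> + \<bar>F (fst z'') - F p\<bar> \<le>
    \<bar>F (fst z) - F r\<bar> + \<bar>F (fst z') - F r\<bar> + (\<bar>F (fst z') - F q\<bar> + \<bar>F (fst z'') - F q\<bar>)"
    unfolding p_def by auto
  have "wdist z z'' \<le> cost p z z''" by (rule wdist_le_cost)
  also have "\<dots> \<le> cost r z z' + cost q z' z''" unfolding cost_def using 1 2 by linarith
  finally show "wdist z z'' \<le> wdist z z' + wdist z' z'' + e" using r q by linarith
qed

lemma wdist_ge: "\<bar>t - s\<bar> + norm (x - y) / \<alpha> \<le> wdist (t, x) (s, y)"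
  unfolding wdist_def
proof (rule cINF_greatest)
  fix r
  have "norm (x - y) / \<alpha> \<le> V r * (norm (x - y) / \<alpha>)"
    using V_ge1[of r] \<alpha> by (metis divide_nonneg_pos mult_right_mono mult_1 norm_ge_zero)
  then show "\<bar>t - s\<bar> + norm (x - y) / \<alpha> \<le> cost r (t, x) (s, y)"
    using F_abs_diff_ge[of t r] F_abs_diff_ge[of s r] unfolding cost_def by auto
qed auto

lemma wdist_le: "wdist (t, x) (s, y) \<le> \<bar>F t - F s\<bar> + V t * (norm (x - y) / \<alpha>)"
  using wdist_le_cost[of "(t, x)" "(s, y)" t] unfolding cost_def by (simp add: abs_minus_commute)

lemma wdist_self [simp]: "wdist z z = 0"
  using wdist_le[of "fst z" "snd z" "fst z" "snd z"] wdist_nonneg[of z z] by simp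

lemma wdist_tendsto_0:
  assumes "(t \<longlongrightarrow> s) Fl" "(x \<longlongrightarrow> y) Fl"
  shows "((\<lambda>n. wdist (s, y) (t n, x n)) \<longlongrightarrow> 0) Fl"
proof (rule tendsto_sandwich[of "\<lambda>_. 0"])
  have "isCont F s" using derF by (rule DERIV_isCont)
  then have "((\<lambda>n. F (t n)) \<longlongrightarrow> F s) Fl" using assms(1) by (rule isCont_tendsto_compose)
  then have "((\<lambda>n. \<bar>F s - F (t n)\<bar> + V s * (norm (y - x n) / \<alpha>)) \<longlongrightarrow> \<bar>F s - F s\<bar> + V s * (norm (y - y) / \<alpha>)) Fl"
    using assms \<alpha> by (intro tendsto_intros) auto
  then show "((\<lambda>n. \<bar>F s - F (t n)\<bar> + V s * (norm (y - x n) / \<alpha>)) \<longlongrightarrow> 0) Fl" by simp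
qed (intro always_eventually allI wdist_nonneg wdist_le tendsto_const)+

text \<open>An infimum of continuous functions is upper semicontinuous: the strict sublevel sets are
  unions of open sets.\<close>

lemma wdist_measurable: "(\<lambda>p :: (real \<times> 'b::euclidean_space) \<times> (real \<times> 'b). wdist (fst p) (snd p)) \<in> borel_measurable borel"
proof (rule borel_measurableI_less)
  fix y
  have *: "{p :: (real \<times> 'b) \<times> (real \<times> 'b). wdist (fst p) (snd p) < y} = (\<Union>r. {p :: (real \<times> 'b) \<times> (real \<times> 'b). cost r (fst p) (snd p) < y})"
    unfolding wdist_def by (subst cINF_less_iff[OF _ bdd_cost]) auto
  have o: "open {p :: (real \<times> 'b) \<times> (real \<times> 'b). cost r (fst p) (snd p) < y}" for r
    unfolding cost_def using \<alpha>
    by (intro open_Collect_less continuous_intros continuous_on_compose2[OF contF[of UNIV]]) auto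
  have "open {p :: (real \<times> 'b) \<times> (real \<times> 'b). wdist (fst p) (snd p) < y}" unfolding * by (intro open_UN ballI o)
  then show "{p \<in> space (borel :: ((real \<times> 'b) \<times> (real \<times> 'b)) measure). wdist (fst p) (snd p) < y} \<in> sets borel" by (simp add: borel_open)
qed

text \<open>The height \<open>r\<close> to be used in \<open>cost\<close> is read off the curve: it
  is the height on the curve at which \<open>V\<close> is least. The first component passes through
  \<open>r\<close>, hence covers both horizontal terms, and the phase travels everywhere at weight
  at least \<open>V r\<close>.\<close>

lemma wdist_le_curve_length:
  fixes \<gamma> :: "real \<Rightarrow> real \<times> 'b::euclidean_space"
  assumes ac: "abs_cont_curve 0 1 \<gamma>"
  shows "ennreal (wdist (\<gamma> 0) (\<gamma> 1)) \<le> (\<integral>\<^sup>+s\<in>{0..1}. ennreal (V (fst (\<gamma> s)) *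
    (\<bar>fst (vector_derivative \<gamma> (at s within {0..1}))\<bar>
      + inverse \<alpha> * norm (snd (vector_derivative \<gamma> (at s within {0..1}))))) \<partial>lborel)"
proof -
  define \<tau> where "\<tau> s = fst (\<gamma> s)" for s
  define \<zeta> where "\<zeta> s = snd (\<gamma> s)" for s
  have "continuous_on {0..1} \<gamma>" using ac by (rule abs_cont_curve_continuous_on)
  then have cont\<tau>: "continuous_on {0..1} \<tau>" unfolding \<tau>_def by (intro continuous_intros)
  have comp: "compact (\<tau> ` {0..1})" using cont\<tau> by (intro compact_continuous_image) auto
  have cV: "continuous_on A V" for A using contV by (rule continuous_on_subset) auto
  obtain s0 where s0: "s0 \<in> {0..1}" "\<And>s. s \<in> {0..1} \<Longrightarrow> V (\<tau> s0) \<le> V (\<tau> s)"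
    using continuous_attains_inf[OF comp _ cV] by auto
  define r where "r = \<tau> s0"
  obtain A where A: "\<And>s. s \<in> {0..1} \<Longrightarrow> \<bar>\<tau> s\<bar> \<le> A"
    using compact_imp_bounded[OF comp] unfolding bounded_iff by (metis imageI real_norm_def)
  \<comment> \<open>On a bounded range of heights \<open>V\<close> is bounded, hence
    \<open>F\<close> is Lipschitz and its composition with the curve absolutely continuous.\<close>
  have "compact {-A..A}" by auto
  then have "bounded (V ` {-A..A})" by (intro compact_imp_bounded compact_continuous_image cV)
  then obtain C where C: "\<And>u. u \<in> {-A..A} \<Longrightarrow> V u \<le> C"
    unfolding bounded_iff by (metis abs_le_D1 imageI real_norm_def)
  have ac\<tau>: "abs_cont_curve 0 1 \<tau>"
  proof (rule abs_cont_curve_lipschitz_image[OF ac, of _ 1])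
    fix s t show "norm (\<tau> s - \<tau> t) \<le> 1 * norm (\<gamma> s - \<gamma> t)"
      unfolding \<tau>_def by (metis fst_diff norm_fst_le prod.collapse mult_1)
  qed
  have ac\<zeta>: "abs_cont_curve 0 1 (\<lambda>s. e \<bullet> \<zeta> s)" for e
  proof (rule abs_cont_curve_lipschitz_image[OF ac, of _ "norm e"])
    fix s t
    have "norm (e \<bullet> \<zeta> s - e \<bullet> \<zeta> t) \<le> norm e * norm (\<zeta> s - \<zeta> t)"
      by (simp add: inner_diff_right[symmetric] Cauchy_Schwarz_ineq2)
    also have "\<dots> \<le> norm e * norm (\<gamma> s - \<gamma> t)"
      unfolding \<zeta>_def by (intro mult_left_mono) (metis snd_diff norm_snd_le prod.collapse, simp)
    finally show "norm (e \<bullet> \<zeta> s - e \<bullet> \<zeta> t) \<le> norm e * norm (\<gamma> s - \<gamma> t)" .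
  qed
  have ac\<phi>: "abs_cont_curve 0 1 (\<lambda>s. F (\<tau> s))"
  proof (rule abs_cont_curve_lipschitz_image[OF ac\<tau>, of _ C])
    fix s t :: real assume "s \<in> {0..1}" "t \<in> {0..1}"
    then have "\<bar>\<tau> s\<bar> \<le> A" "\<bar>\<tau> t\<bar> \<le> A" using A by auto
    then show "norm (F (\<tau> s) - F (\<tau> t)) \<le> C * norm (\<tau> s - \<tau> t)"
      unfolding real_norm_def by (intro F_abs_diff_le C) auto
  qed
  \<comment> \<open>The unit vector along the net displacement of the phase, or 0 if there is none;
    projecting on it makes the vector-valued path scalar.\<close>
  define e where "e = sgn (\<zeta> 1 - \<zeta> 0)"
  have e: "norm e \<le> 1" "e \<bullet> (\<zeta> 1 - \<zeta> 0) = norm (\<zeta> 1 - \<zeta> 0)"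
  proof -
    show "norm e \<le> 1" by (simp add: e_def norm_sgn)
    show "e \<bullet> (\<zeta> 1 - \<zeta> 0) = norm (\<zeta> 1 - \<zeta> 0)"
      unfolding e_def sgn_div_norm by (cases "\<zeta> 1 = \<zeta> 0") (simp_all add: dot_square_norm power2_eq_square)
  qed
  obtain D1 N1 where 1: "D1 \<in> borel_measurable borel" "negligible N1"
    "\<And>x. x \<in> {0..1} - N1 \<Longrightarrow> x \<in> {0<..<1} \<and> ((\<lambda>s. F (\<tau> s)) has_field_derivative D1 x) (at x)"
    "\<And>c d. 0 \<le> c \<Longrightarrow> c \<le> d \<Longrightarrow> d \<le> 1 \<Longrightarrow>
      ennreal \<bar>F (\<tau> d) - F (\<tau> c)\<bar> \<le> (\<integral>\<^sup>+x\<in>{c..d}. ennreal \<bar>D1 x\<bar> \<partial>lborel)"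
    using abs_cont_derivative[OF ac\<phi> zero_less_one] by blast
  obtain D2 N2 where 2: "D2 \<in> borel_measurable borel" "negligible N2"
    "\<And>x. x \<in> {0..1} - N2 \<Longrightarrow> x \<in> {0<..<1} \<and> ((\<lambda>s. e \<bullet> \<zeta> s) has_field_derivative D2 x) (at x)"
    "\<And>c d. 0 \<le> c \<Longrightarrow> c \<le> d \<Longrightarrow> d \<le> 1 \<Longrightarrow>
      ennreal \<bar>e \<bullet> \<zeta> d - e \<bullet> \<zeta> c\<bar> \<le> (\<integral>\<^sup>+x\<in>{c..d}. ennreal \<bar>D2 x\<bar> \<partial>lborel)"
    using abs_cont_derivative[OF ac\<zeta> zero_less_one, of e] by blast
  \<comment> \<open>Off \<open>N\<close> the height and every coordinate of the phase are
    differentiable, so that \<open>vector_derivative\<close> is the true derivative of the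
    curve.\<close>
  define N where "N = N1 \<union> N2 \<union> {x \<in> {0<..<1}. \<not> \<tau> differentiable (at x)}
    \<union> (\<Union>j\<in>Basis. {x \<in> {0<..<1}. \<not> (\<lambda>s. j \<bullet> \<zeta> s) differentiable (at x)})"
  have N: "negligible N" unfolding N_def
    by (intro negligible_Un 1(2) 2(2) negligible_Union abs_cont_differentiable_ae[OF ac\<tau>])
      (use abs_cont_differentiable_ae[OF ac\<zeta>] in auto)
  note [measurable] = 1(1) 2(1)
  let ?v = "\<lambda>s. vector_derivative \<gamma> (at s within {0..1})"
  \<comment> \<open>The chain rule turns \<open>D1\<close> into \<open>V\<close> times the
    horizontal speed; Cauchy-Schwarz and the minimality of \<open>V r\<close> treat the
    phase.\<close>
  have pt: "\<bar>D1 s\<bar> + V r / \<alpha> * \<bar>D2 s\<bar> \<le> V (\<tau> s) * (\<bar>fst (?v s)\<bar> + inverse \<alpha> * norm (snd (?v s)))"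
    if s: "s \<in> {0..1} - N" for s
  proof -
    have s01: "s \<in> {0<..<1}" using 1(3) s by (auto simp: N_def)
    obtain a where a: "(\<tau> has_field_derivative a) (at s)" using s s01 by (auto simp: N_def real_differentiable_def)
    have "\<exists>b. ((\<lambda>s. j \<bullet> \<zeta> s) has_field_derivative b) (at s)" if "j \<in> Basis" for j
      using s s01 that by (auto simp: N_def real_differentiable_def)
    then obtain b where b: "\<And>j. j \<in> Basis \<Longrightarrow> ((\<lambda>s. j \<bullet> \<zeta> s) has_field_derivative b j) (at s)" by metis
    have "((\<lambda>s. \<Sum>j\<in>Basis. (j \<bullet> \<zeta> s) *\<^sub>R j) has_vector_derivative (\<Sum>j\<in>Basis. b j *\<^sub>R j)) (at s)"
      using b by (intro has_vector_derivative_sum) (auto intro!: derivative_eq_intros)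
    then have dz: "(\<zeta> has_vector_derivative (\<Sum>j\<in>Basis. b j *\<^sub>R j)) (at s)"
      by (simp add: inner_commute[of _ "\<zeta> _"] euclidean_representation)
    define w where "w = (\<Sum>j\<in>Basis. b j *\<^sub>R j)"
    have "((\<lambda>s. (\<tau> s, \<zeta> s)) has_vector_derivative (a, w)) (at s)"
      using a dz unfolding w_def[symmetric] has_real_derivative_iff_has_vector_derivative
      by (rule has_vector_derivative_Pair)
    then have "(\<gamma> has_vector_derivative (a, w)) (at s)" by (simp add: \<tau>_def \<zeta>_def)
    then have v: "?v s = (a, w)" using s01 by (intro vector_derivative_at_within_ivl) auto
    have "((\<lambda>s. F (\<tau> s)) has_field_derivative V (\<tau> s) * a) (at s)" by (rule DERIV_chain2[OF derF a])
    then have D1: "D1 s = V (\<tau> s) * a" using 1(3)[of s] s DERIV_unique by (auto simp: N_def)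
    have "((\<lambda>s. e \<bullet> \<zeta> s) has_vector_derivative e \<bullet> w) (at s)"
      using dz unfolding w_def[symmetric]
      by (rule bounded_linear.has_vector_derivative[OF bounded_linear_inner_right])
    then have D2: "D2 s = e \<bullet> w" using 2(3)[of s] s DERIV_unique
      unfolding has_real_derivative_iff_has_vector_derivative[symmetric] by (auto simp: N_def)
    have "\<bar>D2 s\<bar> \<le> norm w" unfolding D2 using Cauchy_Schwarz_ineq2[of e w] e(1)
      by (meson mult_left_le_one_le norm_ge_zero order_trans)
    then have "V r / \<alpha> * \<bar>D2 s\<bar> \<le> V (\<tau> s) / \<alpha> * norm w"
      using s0(2)[of s] s01 V_pos[of r] \<alpha> unfolding r_def by (intro mult_mono divide_right_mono) (auto intro: less_imp_le[OF V_pos])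
    then show ?thesis unfolding v D1 using V_pos[of "\<tau> s"] by (simp add: abs_mult algebra_simps divide_inverse)
  qed
  \<comment> \<open>Splitting at \<open>s0\<close>, where the height is \<open>r\<close>, yields
    both horizontal terms.\<close>
  have F1: "ennreal \<bar>F (\<tau> 0) - F r\<bar> + ennreal \<bar>F (\<tau> 1) - F r\<bar> \<le> (\<integral>\<^sup>+s\<in>{0..1}. ennreal \<bar>D1 s\<bar> \<partial>lborel)"
  proof -
    have "ennreal \<bar>F (\<tau> 0) - F r\<bar> + ennreal \<bar>F (\<tau> 1) - F r\<bar>
      \<le> (\<integral>\<^sup>+s\<in>{0..s0}. ennreal \<bar>D1 s\<bar> \<partial>lborel) + (\<integral>\<^sup>+s\<in>{s0..1}. ennreal \<bar>D1 s\<bar> \<partial>lborel)"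
      using 1(4)[of 0 s0] 1(4)[of s0 1] s0(1) unfolding r_def by (intro add_mono) (auto simp: abs_minus_commute)
    also have "\<dots> = (\<integral>\<^sup>+s. ennreal \<bar>D1 s\<bar> * indicator {0..s0} s + ennreal \<bar>D1 s\<bar> * indicator {s0..1} s \<partial>lborel)"
      by (intro nn_integral_add[symmetric]) auto
    also have "\<dots> \<le> (\<integral>\<^sup>+s\<in>{0..1}. ennreal \<bar>D1 s\<bar> \<partial>lborel)"
    proof (rule nn_integral_mono_AE)
      have "AE s in lborel. s \<noteq> s0" by (rule AE_lborel_singleton)
      then show "AE s in lborel. ennreal \<bar>D1 s\<bar> * indicator {0..s0} s + ennreal \<bar>D1 s\<bar> * indicator {s0..1} s
          \<le> ennreal \<bar>D1 s\<bar> * indicator {0..1} s"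
        by eventually_elim (use s0(1) in \<open>auto simp: indicator_def\<close>)
    qed
    finally show ?thesis .
  qed
  have F2: "ennreal (V r * (norm (\<zeta> 0 - \<zeta> 1) / \<alpha>)) \<le> (\<integral>\<^sup>+s\<in>{0..1}. ennreal (V r / \<alpha> * \<bar>D2 s\<bar>) \<partial>lborel)"
  proof -
    have "V r * (norm (\<zeta> 0 - \<zeta> 1) / \<alpha>) = V r / \<alpha> * \<bar>e \<bullet> \<zeta> 1 - e \<bullet> \<zeta> 0\<bar>"
      using e(2) by (simp add: inner_diff_right norm_minus_commute)
    then have "ennreal (V r * (norm (\<zeta> 0 - \<zeta> 1) / \<alpha>)) = ennreal (V r / \<alpha>) * ennreal \<bar>e \<bullet> \<zeta> 1 - e \<bullet> \<zeta> 0\<bar>"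
      using V_pos[of r] \<alpha> by (simp only:) (rule ennreal_mult, auto)
    also have "\<dots> \<le> ennreal (V r / \<alpha>) * (\<integral>\<^sup>+s\<in>{0..1}. ennreal \<bar>D2 s\<bar> \<partial>lborel)"
      using 2(4)[of 0 1] by (intro mult_left_mono) auto
    also have "\<dots> = (\<integral>\<^sup>+s\<in>{0..1}. ennreal (V r / \<alpha> * \<bar>D2 s\<bar>) \<partial>lborel)"
    proof -
      have "ennreal (V r / \<alpha> * \<bar>D2 s\<bar>) = ennreal (V r / \<alpha>) * ennreal \<bar>D2 s\<bar>" for s
        using V_pos[of r] \<alpha> by (intro ennreal_mult) auto
      then show ?thesis by (simp only: mult.assoc) (rule nn_integral_cmult[symmetric], simp)
    qed
    finally show ?thesis .
  qed
  have "ennreal (wdist (\<gamma> 0) (\<gamma> 1)) \<le> ennreal (cost r (\<gamma> 0) (\<gamma> 1))"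
    by (rule ennreal_leI[OF wdist_le_cost])
  also have "\<dots> = (ennreal \<bar>F (\<tau> 0) - F r\<bar> + ennreal \<bar>F (\<tau> 1) - F r\<bar>) + ennreal (V r * (norm (\<zeta> 0 - \<zeta> 1) / \<alpha>))"
    using V_pos[of r] \<alpha> unfolding cost_def \<tau>_def \<zeta>_def by (simp add: ennreal_plus)
  also have "\<dots> \<le> (\<integral>\<^sup>+s\<in>{0..1}. ennreal \<bar>D1 s\<bar> \<partial>lborel) + (\<integral>\<^sup>+s\<in>{0..1}. ennreal (V r / \<alpha> * \<bar>D2 s\<bar>) \<partial>lborel)"
    by (intro add_mono F1 F2)
  also have "\<dots> = (\<integral>\<^sup>+s. ennreal \<bar>D1 s\<bar> * indicator {0..1} s + ennreal (V r / \<alpha> * \<bar>D2 s\<bar>) * indicator {0..1} s \<partial>lborel)"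
    by (intro nn_integral_add[symmetric]) auto
  \<comment> \<open>The exceptional set is only known to be Lebesgue null, hence the passage to the
    completed measure.\<close>
  also have "\<dots> = (\<integral>\<^sup>+s. ennreal \<bar>D1 s\<bar> * indicator {0..1} s + ennreal (V r / \<alpha> * \<bar>D2 s\<bar>) * indicator {0..1} s \<partial>lebesgue)"
    by (simp add: nn_integral_completion)
  also have "\<dots> \<le> (\<integral>\<^sup>+s\<in>{0..1}. ennreal (V (\<tau> s) * (\<bar>fst (?v s)\<bar> + inverse \<alpha> * norm (snd (?v s)))) \<partial>lebesgue)"
  proof (rule nn_integral_mono_AE)
    have "AE s in lebesgue. s \<notin> N" using N by (auto simp: negligible_iff_null_sets intro: AE_not_in)
    then show "AE s in lebesgue. ennreal \<bar>D1 s\<bar> * indicator {0..1} s + ennreal (V r / \<alpha> * \<bar>D2 s\<bar>) * indicator {0..1} s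
      \<le> ennreal (V (\<tau> s) * (\<bar>fst (?v s)\<bar> + inverse \<alpha> * norm (snd (?v s)))) * indicator {0..1} s"
    proof eventually_elim
      case (elim s)
      have "0 \<le> V r / \<alpha> * \<bar>D2 s\<bar>" using V_pos[of r] \<alpha> by simp
      then show ?case using pt[of s] elim
        by (auto simp: indicator_def ennreal_plus[symmetric] simp del: ennreal_plus intro!: ennreal_leI)
    qed
  qed
  finally show ?thesis by (simp add: \<tau>_def nn_integral_completion)
qed

text \<open>The factor sgn c orients the antiderivative, so that the derivative is nonnegative on a
  descending segment as well.\<close>

lemma nn_integral_affine_segment:
  assumes "p \<le> q"
  shows "(\<integral>\<^sup>+u\<in>{p..q}. ennreal (V (a + c * (u - p)) * \<bar>c\<bar>) \<partial>lborel) = ennreal \<bar>F (a + c * (q - p)) - F a\<bar>"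
proof -
  have [measurable]: "V \<in> borel_measurable borel" using contV by (rule borel_measurable_continuous_onI)
  have "(\<integral>\<^sup>+u\<in>{p..q}. ennreal (V (a + c * (u - p)) * \<bar>c\<bar>) \<partial>lborel)
      = ennreal (sgn c * F (a + c * (q - p)) - sgn c * F (a + c * (p - p)))"
  proof (rule nn_integral_FTC_Icc)
    fix u
    have "((\<lambda>u. sgn c * F (a + c * (u - p))) has_real_derivative sgn c * (V (a + c * (u - p)) * c)) (at u)"
      by (intro DERIV_cmult DERIV_chain2[OF derF]) (auto intro!: derivative_eq_intros)
    moreover have "sgn c * (V (a + c * (u - p)) * c) = V (a + c * (u - p)) * \<bar>c\<bar>"
      by (simp add: sgn_if abs_if)
    ultimately show "((\<lambda>u. sgn c * F (a + c * (u - p))) has_real_derivative V (a + c * (u - p)) * \<bar>c\<bar>) (at u)"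
      by simp
    show "0 \<le> V (a + c * (u - p)) * \<bar>c\<bar>" using V_pos[of "a + c * (u - p)"] by simp
  qed (use assms in auto)
  also have "sgn c * F (a + c * (q - p)) - sgn c * F (a + c * (p - p)) = \<bar>F (a + c * (q - p)) - F a\<bar>"
  proof (cases c "0::real" rule: linorder_cases)
    case less
    then have "F (a + c * (q - p)) \<le> F a" using assms by (intro F_mono) (auto simp: mult_nonpos_nonneg)
    then show ?thesis using less by simp
  next
    case greater
    then have "F a \<le> F (a + c * (q - p))" using assms by (intro F_mono) auto
    then show ?thesis using greater by simp
  qed auto
  finally show ?thesis .
qed

lemma curve_with_cost:
  fixes x y :: "'b::euclidean_space"
  assumes X: "convex X" "x \<in> X" "y \<in> X"
  obtains \<gamma> where "abs_cont_curve 0 1 \<gamma>" "\<gamma> ` {0..1} \<subseteq> UNIV \<times> X" "\<gamma> 0 = (t, x)" "\<gamma> 1 = (s, y)"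
    "(\<integral>\<^sup>+u\<in>{0..1}. ennreal (V (fst (\<gamma> u)) *
      (\<bar>fst (vector_derivative \<gamma> (at u within {0..1}))\<bar>
        + inverse \<alpha> * norm (snd (vector_derivative \<gamma> (at u within {0..1}))))) \<partial>lborel)
      \<le> ennreal (cost r (t, x) (s, y))"
proof -
  \<comment> \<open>\<open>c k\<close> rises linearly from 0 to 1 on [k/3, (k+1)/3] and is constant
    elsewhere: the curve moves first to height \<open>r\<close>, then in the phase, then to height
    \<open>s\<close>.\<close>
  define c where "c k u = max 0 (min 1 (3 * u - k))" for k u :: real
  define \<gamma> where "\<gamma> u = (t + c 0 u * (r - t) + c 2 u * (s - r), x + c 1 u *\<^sub>R (y - x))" for u
  have c_lip: "\<bar>c k u - c k v\<bar> \<le> 3 * \<bar>u - v\<bar>" for k u v unfolding c_def by (simp add: max_def min_def abs_if)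
  have c01: "0 \<le> c k u" "c k u \<le> 1" for k u unfolding c_def by auto
  have ac: "abs_cont_curve 0 1 \<gamma>"
  proof (rule lipschitz_abs_cont_curve)
    fix u v
    have "norm (\<gamma> u - \<gamma> v) \<le> norm ((c 0 u - c 0 v) * (r - t) + (c 2 u - c 2 v) * (s - r)) + norm ((c 1 u - c 1 v) *\<^sub>R (y - x))"
      unfolding \<gamma>_def by (rule order_trans[OF _ norm_Pair_le]) (simp add: algebra_simps)
    also have "\<dots> \<le> \<bar>c 0 u - c 0 v\<bar> * \<bar>r - t\<bar> + \<bar>c 2 u - c 2 v\<bar> * \<bar>s - r\<bar> + \<bar>c 1 u - c 1 v\<bar> * norm (y - x)"
      by (simp add: abs_mult[symmetric])
    also have "\<dots> \<le> (3 * \<bar>u - v\<bar>) * \<bar>r - t\<bar> + (3 * \<bar>u - v\<bar>) * \<bar>s - r\<bar> + (3 * \<bar>u - v\<bar>) * norm (y - x)"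
      by (intro add_mono mult_right_mono c_lip) auto
    finally show "norm (\<gamma> u - \<gamma> v) \<le> (3 * (\<bar>r - t\<bar> + \<bar>s - r\<bar> + norm (y - x))) * \<bar>u - v\<bar>"
      by (simp add: algebra_simps)
  qed
  have img: "\<gamma> ` {0..1} \<subseteq> UNIV \<times> X"
  proof -
    have "x + c 1 u *\<^sub>R (y - x) \<in> X" for u
      using convexD_alt[OF X c01[of 1 u]] by (simp add: algebra_simps)
    then show ?thesis by (auto simp: \<gamma>_def)
  qed
  define f1 where "f1 u = V (t + (3 * (r - t)) * (u - 0)) * \<bar>3 * (r - t)\<bar>" for u
  define f2 where "f2 = V r * (inverse \<alpha> * norm (3 *\<^sub>R (y - x)))"
  define f3 where "f3 u = V (r + (3 * (s - r)) * (u - 2/3)) * \<bar>3 * (s - r)\<bar>" for u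
  let ?v = "\<lambda>u. vector_derivative \<gamma> (at u within {0..1})"
  let ?q = "\<lambda>u. V (fst (\<gamma> u)) * (\<bar>fst (?v u)\<bar> + inverse \<alpha> * norm (snd (?v u)))"
  have vd: "?v u = d" if "u \<in> {p<..<q}" "0 \<le> p" "q \<le> 1" "\<And>w. w \<in> {p<..<q} \<Longrightarrow> (h w = \<gamma> w)"
    "(h has_vector_derivative d) (at u)" for u p q h d
  proof (rule vector_derivative_at_within_ivl)
    show "(\<gamma> has_vector_derivative d) (at u)"
      by (rule has_vector_derivative_transform_within_open[of h d u "{p<..<q}" \<gamma>]) (use that in auto)
  qed (use that in auto)
  have p1: "?q u = f1 u" if u: "u \<in> {0<..<1/3}" for u
  proof -
    have "((\<lambda>u. (t + 3 * u * (r - t), x)) has_vector_derivative (3 * (r - t), 0)) (at u)"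
      by (auto intro!: derivative_eq_intros)
    then have "?v u = (3 * (r - t), 0)"
      by (intro vd[OF u]) (auto simp: \<gamma>_def c_def)
    then show ?thesis using u by (simp add: f1_def \<gamma>_def c_def algebra_simps)
  qed
  have p2: "?q u = f2" if u: "u \<in> {1/3<..<2/3}" for u
  proof -
    have "((\<lambda>u. (r, x + (3 * u - 1) *\<^sub>R (y - x))) has_vector_derivative (0, 3 *\<^sub>R (y - x))) (at u)"
      by (auto intro!: derivative_eq_intros)
    then have "?v u = (0, 3 *\<^sub>R (y - x))"
      by (intro vd[OF u]) (auto simp: \<gamma>_def c_def)
    then show ?thesis using u by (simp add: f2_def \<gamma>_def c_def)
  qed
  have p3: "?q u = f3 u" if u: "u \<in> {2/3<..<1}" for u
  proof -
    have "((\<lambda>u. (r + (3 * u - 2) * (s - r), y)) has_vector_derivative (3 * (s - r), 0)) (at u)"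
      by (auto intro!: derivative_eq_intros)
    then have "?v u = (3 * (s - r), 0)"
      by (intro vd[OF u]) (auto simp: \<gamma>_def c_def)
    then show ?thesis using u by (simp add: f3_def \<gamma>_def c_def algebra_simps)
  qed
  have [measurable]: "V \<in> borel_measurable borel" using contV by (rule borel_measurable_continuous_onI)
  have [measurable]: "f1 \<in> borel_measurable borel" "f3 \<in> borel_measurable borel"
    unfolding f1_def f3_def by measurable
  have "(\<integral>\<^sup>+u\<in>{0..1}. ennreal (?q u) \<partial>lborel) \<le>
    (\<integral>\<^sup>+u. ennreal (f1 u) * indicator {0..1/3} u + (ennreal f2 * indicator {1/3..2/3} u + ennreal (f3 u) * indicator {2/3..1} u) \<partial>lborel)"
  proof (rule nn_integral_mono_AE)
    \<comment> \<open>At the breakpoints the curve may have no derivative; the integrands are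
      compared off this finite set.\<close>
    have "AE u in lborel. u \<notin> {0, 1/3, 2/3, 1::real}"
      by (intro AE_not_in finite_imp_null_set_lborel) auto
    then show "AE u in lborel. ennreal (?q u) * indicator {0..1} u \<le>
      ennreal (f1 u) * indicator {0..1/3} u + (ennreal f2 * indicator {1/3..2/3} u + ennreal (f3 u) * indicator {2/3..1} u)"
    proof eventually_elim
      case (elim u)
      consider "u \<notin> {0..1}" | "u \<in> {0<..<1/3}" | "u \<in> {1/3<..<2/3}" | "u \<in> {2/3<..<1}" using elim by fastforce
      then show ?case using p1[of u] p2[of u] p3[of u] by cases (auto simp: indicator_def)
    qed
  qed
  also have "\<dots> = (\<integral>\<^sup>+u\<in>{0..1/3}. ennreal (f1 u) \<partial>lborel) + ((\<integral>\<^sup>+u\<in>{1/3..2/3::real}. ennreal f2 \<partial>lborel)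
      + (\<integral>\<^sup>+u\<in>{2/3..1}. ennreal (f3 u) \<partial>lborel))"
    by (subst nn_integral_add, simp, simp, subst nn_integral_add) auto
  also have "(\<integral>\<^sup>+u\<in>{0..1/3}. ennreal (f1 u) \<partial>lborel) = ennreal \<bar>F t - F r\<bar>"
  proof -
    have e: "t + 3 * (r - t) * (1/3 - 0) = r" "(0::real) \<le> 1/3" by (auto simp: field_simps)
    show ?thesis unfolding f1_def nn_integral_affine_segment[OF e(2)] e(1) by (simp only: abs_minus_commute)
  qed
  also have "(\<integral>\<^sup>+u\<in>{2/3..1}. ennreal (f3 u) \<partial>lborel) = ennreal \<bar>F s - F r\<bar>"
  proof -
    have e: "r + 3 * (s - r) * (1 - 2/3) = s" "2/3 \<le> (1::real)" by (auto simp: field_simps)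
    show ?thesis unfolding f3_def nn_integral_affine_segment[OF e(2)] e(1) ..
  qed
  also have "(\<integral>\<^sup>+u\<in>{1/3..2/3::real}. ennreal f2 \<partial>lborel) = ennreal (V r * (norm (x - y) / \<alpha>))"
  proof -
    have "(\<integral>\<^sup>+u\<in>{1/3..2/3::real}. ennreal f2 \<partial>lborel) = ennreal f2 * ennreal (1/3)"
      by (subst nn_integral_cmult_indicator) auto
    also have "\<dots> = ennreal (f2 * (1/3))"
      using V_pos[of r] \<alpha> by (intro ennreal_mult[symmetric]) (auto simp: f2_def)
    also have "f2 * (1/3) = V r * (norm (x - y) / \<alpha>)"
    proof -
      have "norm (3 *\<^sub>R (y - x)) = 3 * norm (x - y)"
        by (simp only: norm_scaleR norm_minus_commute[of y x])
      then show ?thesis unfolding f2_def by (simp only:) (simp add: field_simps)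
    qed
    finally show ?thesis .
  qed
  also have "ennreal \<bar>F t - F r\<bar> + (ennreal (V r * (norm (x - y) / \<alpha>)) + ennreal \<bar>F s - F r\<bar>) = ennreal (cost r (t, x) (s, y))"
  proof -
    have c: "cost r (t, x) (s, y) = \<bar>F t - F r\<bar> + (V r * (norm (x - y) / \<alpha>) + \<bar>F s - F r\<bar>)"
      by (simp add: cost_def)
    show ?thesis unfolding c using V_pos[of r] \<alpha> by (subst ennreal_plus; simp)+
  qed
  finally have le: "(\<integral>\<^sup>+u\<in>{0..1}. ennreal (?q u) \<partial>lborel) \<le> ennreal (cost r (t, x) (s, y))" .
  show thesis by (rule that[OF ac img _ _ le]) (simp_all add: \<gamma>_def c_def)
qed

end

lemma coord_metric_eq_wdist:
  fixes \<Xi> :: "(real ^ 'k) set" and x y :: "real ^ 'k"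
  assumes "weighted_line V F \<alpha>"
    and w: "\<And>t \<xi>. weight m \<beta> R \<kappa> \<kappa>0 \<alpha> (t, \<xi> :: real ^ 'k) = V t"
    and X: "convex \<Xi>" "x \<in> \<Xi>" "y \<in> \<Xi>"
  shows "coord_metric \<Xi> m \<beta> R \<kappa> \<kappa>0 \<alpha> (t, x) (s, y) = ennreal (weighted_line.wdist V F \<alpha> (t, x) (s, y))"
proof -
  interpret weighted_line V F \<alpha> by fact
  have w': "weight m \<beta> R \<kappa> \<kappa>0 \<alpha> z = V (fst z)" for z :: "real \<times> (real ^ 'k)"
    using w[of "fst z" "snd z"] by simp
  let ?L = "\<lambda>\<gamma> :: real \<Rightarrow> real \<times> (real ^ 'k). \<integral>\<^sup>+u\<in>{0..1}. ennreal (V (fst (\<gamma> u)) *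
      (\<bar>fst (vector_derivative \<gamma> (at u within {0..1}))\<bar>
        + inverse \<alpha> * norm (snd (vector_derivative \<gamma> (at u within {0..1}))))) \<partial>lborel"
  have eq: "coord_metric \<Xi> m \<beta> R \<kappa> \<kappa>0 \<alpha> (t, x) (s, y) = (INF \<gamma>\<in>admissible_curves \<Xi> (t, x) (s, y). ?L \<gamma>)"
    unfolding coord_metric_def w' scaled_norm_def by (simp add: split_def nn_integral_completion)
  show ?thesis unfolding eq
  proof (rule antisym)
    show "ennreal (wdist (t, x) (s, y)) \<le> (INF \<gamma>\<in>admissible_curves \<Xi> (t, x) (s, y). ?L \<gamma>)"
    proof (rule INF_greatest)
      fix \<gamma> assume "\<gamma> \<in> admissible_curves \<Xi> (t, x) (s, y)"
      then show "ennreal (wdist (t, x) (s, y)) \<le> ?L \<gamma>"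
        using wdist_le_curve_length[of \<gamma>] by (auto simp: admissible_curves_def)
    qed
    show "(INF \<gamma>\<in>admissible_curves \<Xi> (t, x) (s, y). ?L \<gamma>) \<le> ennreal (wdist (t, x) (s, y))"
    proof (rule ennreal_le_epsilon)
      fix e :: real assume e: "0 < e"
      obtain r where r: "cost r (t, x) (s, y) < wdist (t, x) (s, y) + e" using wdist_approx[OF e] .
      obtain \<gamma> where \<gamma>: "abs_cont_curve 0 1 \<gamma>" "\<gamma> ` {0..1} \<subseteq> UNIV \<times> \<Xi>" "\<gamma> 0 = (t, x)" "\<gamma> 1 = (s, y)"
        "?L \<gamma> \<le> ennreal (cost r (t, x) (s, y))" using curve_with_cost[OF X, of t s r] by blast
      have "(INF \<gamma>\<in>admissible_curves \<Xi> (t, x) (s, y). ?L \<gamma>) \<le> ?L \<gamma>"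
        by (rule INF_lower) (use \<gamma> in \<open>simp add: admissible_curves_def\<close>)
      also have "\<dots> \<le> ennreal (cost r (t, x) (s, y))" by (rule \<gamma>(5))
      also have "\<dots> \<le> ennreal (wdist (t, x) (s, y) + e)" using r by (intro ennreal_leI) simp
      also have "\<dots> = ennreal (wdist (t, x) (s, y)) + ennreal e" by (rule ennreal_plus[OF wdist_nonneg less_imp_le[OF e]])
      finally show "(INF \<gamma>\<in>admissible_curves \<Xi> (t, x) (s, y). ?L \<gamma>) \<le> ennreal (wdist (t, x) (s, y)) + ennreal e" .
    qed
  qed
qed

section \<open>Random maps contracting in mean\<close>

text \<open>\<open>D\<close> is a real-valued metric on the whole type and \<open>c\<close> the
  extended cost that agrees with it on \<open>X\<close>. By \<open>dist_le_D\<close>, summable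
  increments in \<open>D\<close> make a sequence Cauchy in the topology; by
  \<open>D_tendsto\<close>, bounds in \<open>D\<close> pass to its limit.\<close>

locale mean_contraction = prob_space Q
  for Q :: "'u measure" +
  fixes X :: "'z::{second_countable_topology, complete_space} set"
    and E :: "'z measure" and S :: "'z \<Rightarrow> 'u \<Rightarrow> 'z" and D :: "'z \<Rightarrow> 'z \<Rightarrow> real"
    and c :: "'z \<Rightarrow> 'z \<Rightarrow> ennreal" and \<rho> C :: real and z0 :: 'z and K :: "'z \<Rightarrow> 'z measure"
  assumes X_closed: "closed X" and z0: "z0 \<in> X"
    and sets_E: "sets E = sets (restrict_space borel X)"
    and S_measurable: "case_prod S \<in> E \<Otimes>\<^sub>M Q \<rightarrow>\<^sub>M E"
    and S_continuous: "\<And>u. u \<in> space Q \<Longrightarrow> continuous_on X (\<lambda>z. S z u)"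
    and D_nonneg: "\<And>z z'. 0 \<le> D z z'"
    and D_sym: "\<And>z z'. D z z' = D z' z"
    and D_triangle: "\<And>z z' z''. D z z'' \<le> D z z' + D z' z''"
    and D_measurable: "(\<lambda>p. D (fst p) (snd p)) \<in> borel_measurable borel"
    and dist_le_D: "\<And>z z'. dist z z' \<le> C * D z z'"
    and D_tendsto: "\<And>f z. f \<longlonglongrightarrow> z \<Longrightarrow> (\<lambda>n. D z (f n)) \<longlonglongrightarrow> 0"
    and \<rho>: "0 < \<rho>" "\<rho> < 1" and C: "0 \<le> C"
    and contract: "\<And>z z'. z \<in> X \<Longrightarrow> z' \<in> X \<Longrightarrow>
      (\<integral>\<^sup>+u. ennreal (D (S z u) (S z' u)) \<partial>Q) \<le> ennreal \<rho> * ennreal (D z z')"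
    and moment: "(\<integral>\<^sup>+u. ennreal (D z0 (S z0 u)) \<partial>Q) < \<infinity>"
    and c_eq: "\<And>z z'. z \<in> X \<Longrightarrow> z' \<in> X \<Longrightarrow> c z z' = ennreal (D z z')"
    and K_eq: "\<And>z. z \<in> X \<Longrightarrow> K z = distr Q E (S z)"
begin

lemma space_E: "space E = X"
  using sets_eq_imp_space_eq[OF sets_E] by (simp add: space_restrict_space)

lemma id_measurable: "(\<lambda>z. z) \<in> E \<rightarrow>\<^sub>M borel"
  unfolding measurable_cong_sets[OF sets_E refl] by (rule measurable_restrict_space1) simp

lemma measurable_E_I:
  assumes "f \<in> M \<rightarrow>\<^sub>M borel" "\<And>x. x \<in> space M \<Longrightarrow> f x \<in> X"
  shows "f \<in> M \<rightarrow>\<^sub>M E"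
  unfolding measurable_cong_sets[OF refl sets_E]
  by (rule measurable_restrict_space2) (use assms in auto)

lemma D_measurable2: "f \<in> M \<rightarrow>\<^sub>M E \<Longrightarrow> g \<in> M \<rightarrow>\<^sub>M E \<Longrightarrow> (\<lambda>x. D (f x) (g x)) \<in> borel_measurable M"
proof -
  assume "f \<in> M \<rightarrow>\<^sub>M E" "g \<in> M \<rightarrow>\<^sub>M E"
  then have "f \<in> M \<rightarrow>\<^sub>M borel" "g \<in> M \<rightarrow>\<^sub>M borel" using id_measurable by (auto intro: measurable_compose)
  then have "(\<lambda>x. (f x, g x)) \<in> M \<rightarrow>\<^sub>M borel" by (rule borel_measurable_Pair)
  from measurable_compose[OF this D_measurable] show ?thesis by simp
qed

lemma S_measurable2: "f \<in> M \<rightarrow>\<^sub>M E \<Longrightarrow> g \<in> M \<rightarrow>\<^sub>M Q \<Longrightarrow> (\<lambda>x. S (f x) (g x)) \<in> M \<rightarrow>\<^sub>M E"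
  using measurable_compose[OF measurable_Pair S_measurable, of f M g] by simp

declare D_measurable2 [measurable (raw)] S_measurable2 [measurable (raw)]

lemma K_measurable: "K \<in> E \<rightarrow>\<^sub>M subprob_algebra E"
proof -
  have "(\<lambda>z. distr Q E (S z)) \<in> E \<rightarrow>\<^sub>M subprob_algebra E"
    by (rule measurable_distr2[OF S_measurable measurable_const])
      (simp add: space_subprob_algebra prob_space_imp_subprob_space[OF prob_space_axioms])
  then show ?thesis using K_eq by (subst measurable_cong[of E K]) (auto simp: space_E)
qed

text \<open>A kernel step is realised by applying the random map with an independent innovation;
  couplings and limits can then be handled as maps on product spaces.\<close>

lemma bind_K_eq:
  assumes M: "prob_space M" and h[measurable]: "h \<in> M \<rightarrow>\<^sub>M E"
  shows "distr M E h \<bind> K = distr (M \<Otimes>\<^sub>M Q) E (\<lambda>(p, u). S (h p) u)"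
proof (rule measure_eqI)
  interpret M: prob_space M by fact
  have ne: "space (distr M E h) \<noteq> {}" using z0 by (auto simp: space_E)
  have Km: "K \<in> distr M E h \<rightarrow>\<^sub>M subprob_algebra E" using K_measurable by simp
  have hX: "h p \<in> X" if "p \<in> space M" for p using measurable_space[OF h that] by (simp add: space_E)
  have sets: "sets (distr M E h \<bind> K) = sets E"
    by (rule sets_bind[OF _ ne]) (simp add: space_E K_eq)
  then show "sets (distr M E h \<bind> K) = sets (distr (M \<Otimes>\<^sub>M Q) E (\<lambda>(p, u). S (h p) u))" by simp
  fix A assume "A \<in> sets (distr M E h \<bind> K)"
  then have A[measurable]: "A \<in> sets E" using sets by simp
  have "emeasure (distr M E h \<bind> K) A = (\<integral>\<^sup>+z. emeasure (K z) A \<partial>distr M E h)"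
    by (rule emeasure_bind[OF ne Km A])
  also have "\<dots> = (\<integral>\<^sup>+p. emeasure (K (h p)) A \<partial>M)"
    using measurable_emeasure_kernel[OF K_measurable A] by (intro nn_integral_distr) auto
  also have "\<dots> = (\<integral>\<^sup>+p. emeasure Q (Pair p -` ((\<lambda>(p, u). S (h p) u) -` A \<inter> space (M \<Otimes>\<^sub>M Q))) \<partial>M)"
  proof (rule nn_integral_cong)
    fix p assume p: "p \<in> space M"
    have [measurable]: "S (h p) \<in> Q \<rightarrow>\<^sub>M E" using S_measurable2[of "\<lambda>_. h p" Q "\<lambda>u. u"] hX[OF p] by (simp add: space_E)
    have "emeasure (K (h p)) A = emeasure Q (S (h p) -` A \<inter> space Q)"
      using hX[OF p] by (simp add: K_eq emeasure_distr)
    also have "S (h p) -` A \<inter> space Q = Pair p -` ((\<lambda>(p, u). S (h p) u) -` A \<inter> space (M \<Otimes>\<^sub>M Q))"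
      using p by (auto simp: space_pair_measure)
    finally show "emeasure (K (h p)) A
        = emeasure Q (Pair p -` ((\<lambda>(p, u). S (h p) u) -` A \<inter> space (M \<Otimes>\<^sub>M Q)))" .
  qed
  also have "\<dots> = emeasure (M \<Otimes>\<^sub>M Q) ((\<lambda>(p, u). S (h p) u) -` A \<inter> space (M \<Otimes>\<^sub>M Q))"
    by (rule emeasure_pair_measure_alt[symmetric]) measurable
  also have "\<dots> = emeasure (distr (M \<Otimes>\<^sub>M Q) E (\<lambda>(p, u). S (h p) u)) A"
    by (rule emeasure_distr[symmetric]) measurable
  finally show "emeasure (distr M E h \<bind> K) A = emeasure (distr (M \<Otimes>\<^sub>M Q) E (\<lambda>(p, u). S (h p) u)) A" .
qed

section \<open>Couplings and the contraction of the Wasserstein distance\<close>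

lemma coupling_cost: "\<gamma> \<in> couplings E \<mu> \<nu> \<Longrightarrow>
  (\<integral>\<^sup>+p. c (fst p) (snd p) \<partial>\<gamma>) = (\<integral>\<^sup>+p. ennreal (D (fst p) (snd p)) \<partial>\<gamma>)"
proof (rule nn_integral_cong)
  fix p assume "\<gamma> \<in> couplings E \<mu> \<nu>" "p \<in> space \<gamma>"
  then have "p \<in> space (E \<Otimes>\<^sub>M E)" unfolding couplings_def law_on_def using sets_eq_imp_space_eq by blast
  then show "c (fst p) (snd p) = ennreal (D (fst p) (snd p))"
    by (auto simp: space_pair_measure space_E c_eq)
qed

text \<open>The synchronous coupling: both components are moved by the same innovation, to which the
  contraction in mean applies after Fubini.\<close>

lemma coupling_step:
  assumes \<gamma>: "\<gamma> \<in> couplings E \<mu> \<nu>"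
  obtains \<gamma>' where "\<gamma>' \<in> couplings E (\<mu> \<bind> K) (\<nu> \<bind> K)"
    "(\<integral>\<^sup>+p. ennreal (D (fst p) (snd p)) \<partial>\<gamma>') \<le> ennreal \<rho> * (\<integral>\<^sup>+p. ennreal (D (fst p) (snd p)) \<partial>\<gamma>)"
proof
  interpret \<gamma>: prob_space \<gamma> using \<gamma> by (simp add: couplings_def law_on_def)
  interpret P: pair_prob_space \<gamma> Q ..
  have [measurable_cong]: "sets \<gamma> = sets (E \<Otimes>\<^sub>M E)" using \<gamma> by (simp add: couplings_def law_on_def)
  have sp: "fst p \<in> X \<and> snd p \<in> X" if "p \<in> space \<gamma>" for p
    using that sets_eq_imp_space_eq[of \<gamma> "E \<Otimes>\<^sub>M E"] \<gamma> by (auto simp: couplings_def law_on_def space_pair_measure space_E)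
  let ?T = "\<lambda>(p, u). (S (fst p) u, S (snd p) u)"
  define \<gamma>' where "\<gamma>' = distr (\<gamma> \<Otimes>\<^sub>M Q) (E \<Otimes>\<^sub>M E) ?T"
  have T[measurable]: "?T \<in> \<gamma> \<Otimes>\<^sub>M Q \<rightarrow>\<^sub>M E \<Otimes>\<^sub>M E" by measurable
  have "distr \<gamma>' E fst = distr (\<gamma> \<Otimes>\<^sub>M Q) E (\<lambda>(p, u). S (fst p) u)"
    unfolding \<gamma>'_def by (subst distr_distr) (auto simp: comp_def split_def)
  also have "\<dots> = distr \<gamma> E fst \<bind> K" by (rule bind_K_eq[symmetric]) (unfold_locales, measurable)
  finally have 1: "distr \<gamma>' E fst = \<mu> \<bind> K" using \<gamma> by (simp add: couplings_def)
  have "distr \<gamma>' E snd = distr (\<gamma> \<Otimes>\<^sub>M Q) E (\<lambda>(p, u). S (snd p) u)"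
    unfolding \<gamma>'_def by (subst distr_distr) (auto simp: comp_def split_def)
  also have "\<dots> = distr \<gamma> E snd \<bind> K" by (rule bind_K_eq[symmetric]) (unfold_locales, measurable)
  finally have 2: "distr \<gamma>' E snd = \<nu> \<bind> K" using \<gamma> by (simp add: couplings_def)
  show "\<gamma>' \<in> couplings E (\<mu> \<bind> K) (\<nu> \<bind> K)"
    using 1 2 P.prob_space_distr[OF T] by (simp add: couplings_def law_on_def \<gamma>'_def)
  have "(\<integral>\<^sup>+p. ennreal (D (fst p) (snd p)) \<partial>\<gamma>') = (\<integral>\<^sup>+q. ennreal (D (fst (?T q)) (snd (?T q))) \<partial>(\<gamma> \<Otimes>\<^sub>M Q))"
    unfolding \<gamma>'_def by (rule nn_integral_distr) measurable
  also have "\<dots> = (\<integral>\<^sup>+p. \<integral>\<^sup>+u. ennreal (D (S (fst p) u) (S (snd p) u)) \<partial>Q \<partial>\<gamma>)"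
    by (subst nn_integral_fst[symmetric]) (auto simp: split_def)
  also have "\<dots> \<le> (\<integral>\<^sup>+p. ennreal \<rho> * ennreal (D (fst p) (snd p)) \<partial>\<gamma>)"
    using sp by (intro nn_integral_mono contract) auto
  also have "\<dots> = ennreal \<rho> * (\<integral>\<^sup>+p. ennreal (D (fst p) (snd p)) \<partial>\<gamma>)"
    by (rule nn_integral_cmult) measurable
  finally show "(\<integral>\<^sup>+p. ennreal (D (fst p) (snd p)) \<partial>\<gamma>') \<le> \<dots>" .
qed

lemma wasserstein1_step:
  assumes fin: "wasserstein1 E c \<mu> \<nu> < \<infinity>"
  shows "wasserstein1 E c (\<mu> \<bind> K) (\<nu> \<bind> K) \<le> ennreal \<rho> * wasserstein1 E c \<mu> \<nu>"
proof (rule ennreal_le_epsilon)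
  fix e :: real assume e: "0 < e"
  \<comment> \<open>Finiteness is what makes the inequality strict; a near-optimal coupling replaces
    an optimal one.\<close>
  have "wasserstein1 E c \<mu> \<nu> < wasserstein1 E c \<mu> \<nu> + ennreal e"
    using fin e by (simp add: ennreal_add_left_cancel_less[of _ 0, simplified])
  then obtain \<gamma> where \<gamma>: "\<gamma> \<in> couplings E \<mu> \<nu>"
    "(\<integral>\<^sup>+p. c (fst p) (snd p) \<partial>\<gamma>) < wasserstein1 E c \<mu> \<nu> + ennreal e"
    unfolding wasserstein1_def by (auto simp: INF_less_iff)
  obtain \<gamma>' where \<gamma>': "\<gamma>' \<in> couplings E (\<mu> \<bind> K) (\<nu> \<bind> K)"
    "(\<integral>\<^sup>+p. ennreal (D (fst p) (snd p)) \<partial>\<gamma>') \<le> ennreal \<rho> * (\<integral>\<^sup>+p. ennreal (D (fst p) (snd p)) \<partial>\<gamma>)"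
    using coupling_step[OF \<gamma>(1)] .
  have "wasserstein1 E c (\<mu> \<bind> K) (\<nu> \<bind> K) \<le> (\<integral>\<^sup>+p. c (fst p) (snd p) \<partial>\<gamma>')"
    unfolding wasserstein1_def by (rule INF_lower[OF \<gamma>'(1)])
  also have "\<dots> \<le> ennreal \<rho> * (\<integral>\<^sup>+p. c (fst p) (snd p) \<partial>\<gamma>)"
    using \<gamma>'(2) by (simp add: coupling_cost[OF \<gamma>(1)] coupling_cost[OF \<gamma>'(1)])
  also have "\<dots> \<le> ennreal \<rho> * (wasserstein1 E c \<mu> \<nu> + ennreal e)"
    using \<gamma>(2) by (intro mult_left_mono) auto
  also have "\<dots> = ennreal \<rho> * wasserstein1 E c \<mu> \<nu> + ennreal (\<rho> * e)"
    using \<rho> e by (simp add: distrib_left ennreal_mult)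
  also have "ennreal (\<rho> * e) \<le> ennreal e" using \<rho> e by (intro ennreal_leI) (simp add: mult_left_le_one_le)
  finally show "wasserstein1 E c (\<mu> \<bind> K) (\<nu> \<bind> K) \<le> ennreal \<rho> * wasserstein1 E c \<mu> \<nu> + ennreal e"
    by (simp add: add_left_mono)
qed

lemma wasserstein1_kernel_power:
  assumes fin: "wasserstein1 E c \<mu> \<nu> < \<infinity>"
  shows "wasserstein1 E c (kernel_power K n \<mu>) (kernel_power K n \<nu>) \<le> ennreal (\<rho> ^ n) * wasserstein1 E c \<mu> \<nu>"
proof (induction n)
  case 0
  then show ?case by (simp add: kernel_power_def)
next
  case (Suc n)
  have "ennreal (\<rho> ^ n) * wasserstein1 E c \<mu> \<nu> < \<infinity>" using fin by (simp add: ennreal_mult_less_top)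
  then have "wasserstein1 E c (kernel_power K n \<mu>) (kernel_power K n \<nu>) < \<infinity>" using Suc by simp
  from wasserstein1_step[OF this]
  have "wasserstein1 E c (kernel_power K (Suc n) \<mu>) (kernel_power K (Suc n) \<nu>)
      \<le> ennreal \<rho> * wasserstein1 E c (kernel_power K n \<mu>) (kernel_power K n \<nu>)"
    by (simp add: kernel_power_def)
  also have "\<dots> \<le> ennreal \<rho> * (ennreal (\<rho> ^ n) * wasserstein1 E c \<mu> \<nu>)" by (intro mult_left_mono Suc) simp
  also have "\<dots> = ennreal (\<rho> ^ Suc n) * wasserstein1 E c \<mu> \<nu>"
    using \<rho> by (simp add: ennreal_mult mult.assoc)
  finally show ?case .
qed

text \<open>The easy half of Kantorovich duality: along couplings of arbitrarily small cost the mean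
  of a function that is Lipschitz for \<open>D\<close> changes arbitrarily little.\<close>

lemma wasserstein1_zero_le:
  fixes f :: "'z \<Rightarrow> real"
  assumes W: "wasserstein1 E c \<mu> \<nu> = 0" and f[measurable]: "f \<in> borel_measurable borel"
    and f0: "\<And>z. 0 \<le> f z" and lip: "\<And>z z'. f z \<le> f z' + L * D z z'" and L: "0 \<le> L"
  shows "(\<integral>\<^sup>+z. ennreal (f z) \<partial>\<mu>) \<le> (\<integral>\<^sup>+z. ennreal (f z) \<partial>\<nu>)"
proof (rule ennreal_le_epsilon)
  fix e :: real assume e: "0 < e"
  define e' where "e' = e / (L + 1)"
  have e': "0 < e'" using e L by (simp add: e'_def)
  then have "wasserstein1 E c \<mu> \<nu> < ennreal e'" using W by simp
  then obtain \<gamma> where \<gamma>: "\<gamma> \<in> couplings E \<mu> \<nu>" "(\<integral>\<^sup>+p. c (fst p) (snd p) \<partial>\<gamma>) < ennreal e'"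
    unfolding wasserstein1_def by (auto simp: INF_less_iff)
  have [measurable_cong]: "sets \<gamma> = sets (E \<Otimes>\<^sub>M E)" using \<gamma> by (simp add: couplings_def law_on_def)
  have fE[measurable]: "f \<in> borel_measurable E" using measurable_compose[OF id_measurable f] by simp
  have \<mu>: "\<mu> = distr \<gamma> E fst" "\<nu> = distr \<gamma> E snd" using \<gamma> by (auto simp: couplings_def)
  have "(\<integral>\<^sup>+z. ennreal (f z) \<partial>\<mu>) = (\<integral>\<^sup>+p. ennreal (f (fst p)) \<partial>\<gamma>)"
    unfolding \<mu>(1) by (rule nn_integral_distr) measurable
  also have "\<dots> \<le> (\<integral>\<^sup>+p. ennreal (f (snd p)) + ennreal L * ennreal (D (fst p) (snd p)) \<partial>\<gamma>)"
  proof (rule nn_integral_mono)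
    fix p
    have "ennreal (f (fst p)) \<le> ennreal (f (snd p) + L * D (fst p) (snd p))" by (rule ennreal_leI[OF lip])
    also have "\<dots> = ennreal (f (snd p)) + ennreal L * ennreal (D (fst p) (snd p))"
      using f0 L D_nonneg by (simp add: ennreal_mult)
    finally show "ennreal (f (fst p)) \<le> \<dots>" .
  qed
  also have "\<dots> = (\<integral>\<^sup>+p. ennreal (f (snd p)) \<partial>\<gamma>) + ennreal L * (\<integral>\<^sup>+p. ennreal (D (fst p) (snd p)) \<partial>\<gamma>)"
    by (subst nn_integral_add) (measurable, subst nn_integral_cmult, measurable)
  also have "(\<integral>\<^sup>+p. ennreal (f (snd p)) \<partial>\<gamma>) = (\<integral>\<^sup>+z. ennreal (f z) \<partial>\<nu>)"
    unfolding \<mu>(2) by (rule nn_integral_distr[symmetric]) measurable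
  also have "ennreal L * (\<integral>\<^sup>+p. ennreal (D (fst p) (snd p)) \<partial>\<gamma>) \<le> ennreal L * ennreal e'"
    using \<gamma>(2) unfolding coupling_cost[OF \<gamma>(1)] by (intro mult_left_mono) auto
  also have "ennreal L * ennreal e' = ennreal (L * e')" using L e' by (simp add: ennreal_mult)
  also have "\<dots> \<le> ennreal e" using L e by (intro ennreal_leI) (simp add: e'_def divide_simps)
  finally show "(\<integral>\<^sup>+z. ennreal (f z) \<partial>\<mu>) \<le> (\<integral>\<^sup>+z. ennreal (f z) \<partial>\<nu>) + ennreal e"
    by (simp add: add_left_mono)
qed

lemma wasserstein1_sym_zero:
  assumes W: "wasserstein1 E c \<mu> \<nu> = 0"
  shows "wasserstein1 E c \<nu> \<mu> = 0"
proof -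
  have "wasserstein1 E c \<nu> \<mu> \<le> wasserstein1 E c \<mu> \<nu>"
    unfolding wasserstein1_def[of E c \<mu> \<nu>]
  proof (rule INF_greatest)
    fix \<gamma> assume \<gamma>: "\<gamma> \<in> couplings E \<mu> \<nu>"
    interpret \<gamma>: prob_space \<gamma> using \<gamma> by (simp add: couplings_def law_on_def)
    have [measurable_cong]: "sets \<gamma> = sets (E \<Otimes>\<^sub>M E)" using \<gamma> by (simp add: couplings_def law_on_def)
    let ?s = "\<lambda>p. (snd p, fst p)"
    have s[measurable]: "?s \<in> \<gamma> \<rightarrow>\<^sub>M E \<Otimes>\<^sub>M E" by measurable
    define \<gamma>' where "\<gamma>' = distr \<gamma> (E \<Otimes>\<^sub>M E) ?s"
    have \<gamma>': "\<gamma>' \<in> couplings E \<nu> \<mu>"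
      using \<gamma> \<gamma>.prob_space_distr[OF s] unfolding couplings_def law_on_def \<gamma>'_def
      by (auto simp: distr_distr comp_def)
    have "wasserstein1 E c \<nu> \<mu> \<le> (\<integral>\<^sup>+p. c (fst p) (snd p) \<partial>\<gamma>')"
      unfolding wasserstein1_def by (rule INF_lower[OF \<gamma>'])
    also have "\<dots> = (\<integral>\<^sup>+p. ennreal (D (snd p) (fst p)) \<partial>\<gamma>)"
      unfolding coupling_cost[OF \<gamma>'] unfolding \<gamma>'_def by (subst nn_integral_distr) auto
    also have "\<dots> = (\<integral>\<^sup>+p. c (fst p) (snd p) \<partial>\<gamma>)"
      unfolding coupling_cost[OF \<gamma>] by (simp add: D_sym)
    finally show "wasserstein1 E c \<nu> \<mu> \<le> (\<integral>\<^sup>+p. c (fst p) (snd p) \<partial>\<gamma>)" .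
  qed
  then show ?thesis using W by simp
qed

text \<open>The truncated multiples of the distance to the complement of an open set
  \<open>G\<close> are Lipschitz and increase to the indicator of \<open>G\<close>. The laws
  therefore agree on open sets, a generator closed under intersection, and as the closed set
  \<open>X\<close> is Borel this decides all sets of \<open>E\<close>.\<close>

lemma wasserstein1_zero_eq:
  assumes W: "wasserstein1 E c \<mu> \<nu> = 0" and \<mu>: "law_on E \<mu>" and \<nu>: "law_on E \<nu>"
  shows "\<mu> = \<nu>"
proof -
  interpret \<mu>: prob_space \<mu> using \<mu> by (simp add: law_on_def)
  interpret \<nu>: prob_space \<nu> using \<nu> by (simp add: law_on_def)
  have [measurable_cong]: "sets \<mu> = sets E" "sets \<nu> = sets E" using \<mu> \<nu> by (auto simp: law_on_def)
  have idm[measurable]: "(\<lambda>z. z) \<in> \<mu> \<rightarrow>\<^sub>M borel" "(\<lambda>z. z) \<in> \<nu> \<rightarrow>\<^sub>M borel" using id_measurable by auto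
  have int_eq: "(\<integral>\<^sup>+z. ennreal (f z) \<partial>\<mu>) = (\<integral>\<^sup>+z. ennreal (f z) \<partial>\<nu>)"
    if "f \<in> borel_measurable borel" "\<And>z. 0 \<le> f z" "\<And>z z'. f z \<le> f z' + L * D z z'" "0 \<le> L" for f :: "'z \<Rightarrow> real" and L
    by (intro antisym wasserstein1_zero_le[OF W that] wasserstein1_zero_le[OF wasserstein1_sym_zero[OF W] that])
  define \<mu>' where "\<mu>' = distr \<mu> borel (\<lambda>z. z)"
  define \<nu>' where "\<nu>' = distr \<nu> borel (\<lambda>z. z)"
  have op: "emeasure \<mu>' G = emeasure \<nu>' G" if G: "open G" for G
  \<comment> \<open>\<open>infdist\<close> to the empty set is 0 by convention, so the whole space
    is treated apart.\<close>
  proof (cases "- G = {}")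
    case True
    then have "G = UNIV" by auto
    then show ?thesis
      unfolding \<mu>'_def \<nu>'_def by (simp add: emeasure_distr \<mu>.emeasure_space_1 \<nu>.emeasure_space_1)
  next
    case False
    define f where "f n z = min 1 (real n * infdist z (- G))" for n z
    have fm[measurable]: "f n \<in> borel_measurable borel" for n
      unfolding f_def by (intro borel_measurable_continuous_onI continuous_intros)
    have f0: "0 \<le> f n z" for n z by (simp add: f_def infdist_nonneg)
    have flip: "f n z \<le> f n z' + (real n * C) * D z z'" for n z z'
    proof -
      have "infdist z (- G) \<le> infdist z' (- G) + dist z z'" by (rule infdist_triangle)
      also have "dist z z' \<le> C * D z z'" by (rule dist_le_D)
      finally have "real n * infdist z (- G) \<le> real n * (infdist z' (- G) + C * D z z')"
        by (intro mult_left_mono) auto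
      moreover have "0 \<le> real n * C * D z z'" using C D_nonneg by simp
      ultimately show ?thesis unfolding f_def by (auto simp: algebra_simps min_def)
    qed
    have inc: "incseq (\<lambda>n z. ennreal (f n z))"
      unfolding f_def incseq_def le_fun_def
      by (auto intro!: ennreal_leI min.mono mult_right_mono infdist_nonneg)
    have sup: "(SUP n. ennreal (f n z)) = indicator G z" for z
    proof (cases "z \<in> G")
      case True
      have "infdist z (- G) \<noteq> 0"
        using True False in_closed_iff_infdist_zero[of "- G" z] G by (auto simp: closed_def)
      then have pos: "0 < infdist z (- G)" using infdist_nonneg[of z "- G"] by simp
      obtain n :: nat where "1 / infdist z (- G) \<le> real n" using real_arch_simple by blast
      then have "f n z = 1" using pos by (simp add: f_def field_simps min_def)
      then have "1 \<le> (SUP n. ennreal (f n z))" by (intro SUP_upper2[of n]) auto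
      moreover have "(SUP n. ennreal (f n z)) \<le> 1" by (intro SUP_least) (auto simp: f_def)
      ultimately have "(SUP n. ennreal (f n z)) = 1" by (rule antisym[rotated])
      then show ?thesis using True by simp
    next
      case False
      then have "f n z = 0" for n by (simp add: f_def)
      then show ?thesis using False by (simp only: ennreal_0 indicator_simps) simp
    qed
    have *: "emeasure (distr M borel (\<lambda>z. z)) G = (SUP n. \<integral>\<^sup>+z. ennreal (f n z) \<partial>M)"
      if M[measurable]: "(\<lambda>z. z) \<in> M \<rightarrow>\<^sub>M borel" for M
    proof -
      have [measurable]: "f n \<in> borel_measurable M" for n using measurable_compose[OF M fm] by simp
      have "emeasure (distr M borel (\<lambda>z. z)) G = (\<integral>\<^sup>+z. indicator G z \<partial>distr M borel (\<lambda>z. z))"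
        using G by simp
      also have "\<dots> = (\<integral>\<^sup>+z. indicator G z \<partial>M)" using G by (intro nn_integral_distr) auto
      also have "\<dots> = (\<integral>\<^sup>+z. (SUP n. ennreal (f n z)) \<partial>M)" by (simp add: sup)
      also have "\<dots> = (SUP n. \<integral>\<^sup>+z. ennreal (f n z) \<partial>M)"
        using inc by (intro nn_integral_monotone_convergence_SUP) auto
      finally show ?thesis .
    qed
    show ?thesis unfolding \<mu>'_def \<nu>'_def *[OF idm(1)] *[OF idm(2)]
      using C by (intro SUP_cong refl int_eq[OF fm f0 flip]) auto
  qed
  have eq': "\<mu>' = \<nu>'"
  proof (rule measure_eqI_generator_eq[of "{G. open G}" UNIV _ _ "\<lambda>_. UNIV"])
    show "Int_stable {G :: 'z set. open G}" by (auto simp: Int_stable_def)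
    show "emeasure \<mu>' UNIV \<noteq> \<infinity>"
      unfolding \<mu>'_def by (simp add: emeasure_distr \<mu>.emeasure_space_1)
    show "emeasure \<mu>' G = emeasure \<nu>' G" if "G \<in> {G. open G}" for G using that op by simp
    show "sets \<mu>' = sigma_sets UNIV {G. open G}" "sets \<nu>' = sigma_sets UNIV {G. open G}"
      unfolding \<mu>'_def \<nu>'_def by (auto simp: borel_def)
  qed auto
  show ?thesis
  proof (rule measure_eqI)
    show "sets \<mu> = sets \<nu>" using \<mu> \<nu> by (simp add: law_on_def)
    fix A assume "A \<in> sets \<mu>"
    then have A: "A \<in> sets E" using \<mu> by (simp add: law_on_def)
    then have "A \<subseteq> X" using sets.sets_into_space space_E by blast
    moreover have "A \<in> sets borel" using A X_closed by (auto simp: sets_E sets_restrict_space)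
    moreover have "space \<mu> = X" "space \<nu> = X" using \<mu> \<nu> space_E sets_eq_imp_space_eq by (auto simp: law_on_def)
    ultimately have "emeasure \<mu> A = emeasure \<mu>' A" "emeasure \<nu> A = emeasure \<nu>' A"
      unfolding \<mu>'_def \<nu>'_def by (auto simp: emeasure_distr Int_absorb2)
    then show "emeasure \<mu> A = emeasure \<nu> A" using eq' by simp
  qed
qed

text \<open>The product coupling has finite cost: the distance of two points is bounded by a route
  over the two base points.\<close>

lemma wasserstein1_finite:
  assumes "\<mu> \<in> finite_first_moment_laws E c" "\<nu> \<in> finite_first_moment_laws E c"
  shows "wasserstein1 E c \<mu> \<nu> < \<infinity>"
proof -
  from assms obtain a b where \<mu>: "law_on E \<mu>" "a \<in> space E" "(\<integral>\<^sup>+z. c z a \<partial>\<mu>) < \<infinity>"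
    and \<nu>: "law_on E \<nu>" "b \<in> space E" "(\<integral>\<^sup>+z. c z b \<partial>\<nu>) < \<infinity>"
    unfolding finite_first_moment_laws_def by blast
  interpret \<mu>: prob_space \<mu> using \<mu> by (simp add: law_on_def)
  interpret \<nu>: prob_space \<nu> using \<nu> by (simp add: law_on_def)
  interpret P: pair_prob_space \<mu> \<nu> ..
  have s[measurable_cong]: "sets \<mu> = sets E" "sets \<nu> = sets E" using \<mu> \<nu> by (auto simp: law_on_def)
  have sp: "space \<mu> = X" "space \<nu> = X" using s[THEN sets_eq_imp_space_eq] by (auto simp: space_E)
  have c\<mu>: "(\<integral>\<^sup>+z. c z a \<partial>\<mu>) = (\<integral>\<^sup>+z. ennreal (D z a) \<partial>\<mu>)" "(\<integral>\<^sup>+z. c z b \<partial>\<nu>) = (\<integral>\<^sup>+z. ennreal (D z b) \<partial>\<nu>)"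
    using \<mu>(2) \<nu>(2) by (auto intro!: nn_integral_cong c_eq simp: sp space_E)
  have coup: "\<mu> \<Otimes>\<^sub>M \<nu> \<in> couplings E \<mu> \<nu>"
  proof -
    have "distr (\<mu> \<Otimes>\<^sub>M \<nu>) E fst = distr (\<mu> \<Otimes>\<^sub>M \<nu>) \<mu> fst" using s by (intro distr_cong) auto
    moreover have "distr (\<mu> \<Otimes>\<^sub>M \<nu>) \<mu> fst = \<mu>" by (rule \<nu>.distr_pair_fst)
    moreover have "distr (\<mu> \<Otimes>\<^sub>M \<nu>) E snd = \<nu>"
    proof -
      have "distr (\<mu> \<Otimes>\<^sub>M \<nu>) E snd = distr (distr (\<nu> \<Otimes>\<^sub>M \<mu>) (\<mu> \<Otimes>\<^sub>M \<nu>) (\<lambda>(x, y). (y, x))) E snd"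
        by (subst P.distr_pair_swap) simp
      also have "\<dots> = distr (\<nu> \<Otimes>\<^sub>M \<mu>) \<nu> fst"
        by (subst distr_distr) (auto intro!: distr_cong simp: s(2) comp_def split_def)
      also have "\<dots> = \<nu>" by (rule \<mu>.distr_pair_fst)
      finally show ?thesis .
    qed
    ultimately show ?thesis unfolding couplings_def law_on_def
      using P.prob_space_axioms sets_pair_measure_cong[OF s] by simp
  qed
  have aE: "(\<lambda>z. a) \<in> M \<rightarrow>\<^sub>M E" "(\<lambda>z. b) \<in> M \<rightarrow>\<^sub>M E" for M :: "'x measure" using \<mu>(2) \<nu>(2) by auto
  note [measurable] = aE
  have "wasserstein1 E c \<mu> \<nu> \<le> (\<integral>\<^sup>+p. ennreal (D (fst p) (snd p)) \<partial>(\<mu> \<Otimes>\<^sub>M \<nu>))"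
    unfolding wasserstein1_def using coup coupling_cost[OF coup] by (intro INF_lower2) auto
  also have "\<dots> \<le> (\<integral>\<^sup>+p. (ennreal (D (fst p) a) + ennreal (D a b)) + ennreal (D (snd p) b) \<partial>(\<mu> \<Otimes>\<^sub>M \<nu>))"
  proof (rule nn_integral_mono)
    fix p :: "'z \<times> 'z"
    have "D (fst p) (snd p) \<le> (D (fst p) a + D a b) + D (snd p) b"
      using D_triangle[of "fst p" "snd p" a] D_triangle[of a "snd p" b] D_sym[of b "snd p"] by linarith
    then show "ennreal (D (fst p) (snd p)) \<le> (ennreal (D (fst p) a) + ennreal (D a b)) + ennreal (D (snd p) b)"
      using D_nonneg by (simp add: ennreal_plus[symmetric] ennreal_leI del: ennreal_plus)
  qed
  also have "\<dots> = (\<integral>\<^sup>+z. ennreal (D z a) \<partial>\<mu>) + ennreal (D a b) + (\<integral>\<^sup>+z. ennreal (D z b) \<partial>\<nu>)"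
  proof -
    have "(\<integral>\<^sup>+p. ennreal (D (fst p) a) \<partial>(\<mu> \<Otimes>\<^sub>M \<nu>)) = (\<integral>\<^sup>+z. ennreal (D z a) \<partial>\<mu>)"
      by (subst \<nu>.nn_integral_fst[symmetric]) (auto simp: \<nu>.emeasure_space_1)
    moreover have "(\<integral>\<^sup>+p. ennreal (D (snd p) b) \<partial>(\<mu> \<Otimes>\<^sub>M \<nu>)) = (\<integral>\<^sup>+z. ennreal (D z b) \<partial>\<nu>)"
      by (subst \<nu>.nn_integral_fst[symmetric]) (auto simp: \<mu>.emeasure_space_1)
    ultimately show ?thesis
      by (subst nn_integral_add, measurable, subst nn_integral_add) (auto simp: P.emeasure_space_1)
  qed
  also have "\<dots> < \<infinity>" using \<mu>(3) \<nu>(3) unfolding c\<mu> by (simp add: less_top[symmetric])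
  finally show ?thesis .
qed

text \<open>The distance of the two laws is finite and, by invariance, at most \<rho> times itself,
  hence 0.\<close>

lemma invariant_law_unique:
  assumes "\<mu> \<in> finite_first_moment_laws E c" "\<nu> \<in> finite_first_moment_laws E c"
    and "invariant_law K \<mu>" "invariant_law K \<nu>"
  shows "\<mu> = \<nu>"
proof (rule wasserstein1_zero_eq)
  have fin: "wasserstein1 E c \<mu> \<nu> < \<infinity>" using assms by (intro wasserstein1_finite)
  then obtain w where w: "wasserstein1 E c \<mu> \<nu> = ennreal w" "0 \<le> w"
    by (cases "wasserstein1 E c \<mu> \<nu>" rule: ennreal_cases) auto
  have "wasserstein1 E c \<mu> \<nu> \<le> ennreal \<rho> * wasserstein1 E c \<mu> \<nu>"
    using wasserstein1_step[OF fin] assms(3,4) by (simp add: invariant_law_def)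
  then have "w \<le> \<rho> * w" using w \<rho> by (simp add: ennreal_mult[symmetric])
  then have "(1 - \<rho>) * w \<le> 0" by (simp add: algebra_simps)
  then have "w = 0" using w(2) \<rho> by (simp add: mult_le_0_iff)
  then show "wasserstein1 E c \<mu> \<nu> = 0" using w by simp
qed (use assms in \<open>auto simp: finite_first_moment_laws_def\<close>)

text \<open>Random maps composed in reverse order: \<open>shd\<close> acts last, and a new
  innovation enters next to the start \<open>z0\<close>. For each n the law is that of the forward
  chain, but consecutive terms differ only in the innermost map, which is what makes the sequence
  converge almost surely.\<close>

primrec backward :: "nat \<Rightarrow> 'u stream \<Rightarrow> 'z" where
  "backward 0 \<omega> = z0"
| "backward (Suc n) \<omega> = S (backward n (stl \<omega>)) (shd \<omega>)"

lemma backward_measurable [measurable]: "backward n \<in> stream_space Q \<rightarrow>\<^sub>M E"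
proof (induction n)
  case 0
  then show ?case using z0 by (simp add: space_E)
next
  case (Suc n)
  have "(\<lambda>\<omega>. backward n (stl \<omega>)) \<in> stream_space Q \<rightarrow>\<^sub>M E"
    by (rule measurable_compose[OF measurable_stl Suc])
  then show ?case unfolding backward.simps by (rule S_measurable2) measurable
qed

lemma backward_in_X: "\<omega> \<in> space (stream_space Q) \<Longrightarrow> backward n \<omega> \<in> X"
  using measurable_space[OF backward_measurable] by (simp add: space_E)

text \<open>Peeling off the outermost map contracts the mean distance by \<rho>, since
  \<open>shd\<close> is independent of the tail; after n such steps the first displacement from
  \<open>z0\<close> remains.\<close>

lemma backward_increment:
  "(\<integral>\<^sup>+\<omega>. ennreal (D (backward n \<omega>) (backward (Suc n) \<omega>)) \<partial>stream_space Q)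
    \<le> ennreal (\<rho> ^ n) * (\<integral>\<^sup>+u. ennreal (D z0 (S z0 u)) \<partial>Q)"
proof (induction n)
  case 0
  interpret SS: prob_space "stream_space Q" by (rule prob_space_stream_space)
  have [measurable]: "(\<lambda>_. z0) \<in> M \<rightarrow>\<^sub>M E" for M :: "'x measure" using z0 by (simp add: space_E)
  have "(\<integral>\<^sup>+\<omega>. ennreal (D (backward 0 \<omega>) (backward (Suc 0) \<omega>)) \<partial>stream_space Q)
      = (\<integral>\<^sup>+u. \<integral>\<^sup>+\<omega>. ennreal (D z0 (S z0 u)) \<partial>stream_space Q \<partial>Q)"
    by (subst nn_integral_stream_space) auto
  also have "\<dots> = (\<integral>\<^sup>+u. ennreal (D z0 (S z0 u)) \<partial>Q)" by (simp add: SS.emeasure_space_1)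
  finally show ?case by simp
next
  case (Suc n)
  interpret SS: prob_space "stream_space Q" by (rule prob_space_stream_space)
  interpret P: pair_sigma_finite Q "stream_space Q" ..
  have "(\<integral>\<^sup>+\<omega>. ennreal (D (backward (Suc n) \<omega>) (backward (Suc (Suc n)) \<omega>)) \<partial>stream_space Q)
      = (\<integral>\<^sup>+u. \<integral>\<^sup>+\<omega>. ennreal (D (S (backward n \<omega>) u) (S (backward (Suc n) \<omega>) u)) \<partial>stream_space Q \<partial>Q)"
    by (subst nn_integral_stream_space) (auto intro!: D_measurable2 backward_measurable simp del: backward.simps(2), simp)
  also have "\<dots> = (\<integral>\<^sup>+\<omega>. \<integral>\<^sup>+u. ennreal (D (S (backward n \<omega>) u) (S (backward (Suc n) \<omega>) u)) \<partial>Q \<partial>stream_space Q)"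
    by (rule P.Fubini'[symmetric]) measurable
  also have "\<dots> \<le> (\<integral>\<^sup>+\<omega>. ennreal \<rho> * ennreal (D (backward n \<omega>) (backward (Suc n) \<omega>)) \<partial>stream_space Q)"
    by (intro nn_integral_mono contract backward_in_X)
  also have "\<dots> = ennreal \<rho> * (\<integral>\<^sup>+\<omega>. ennreal (D (backward n \<omega>) (backward (Suc n) \<omega>)) \<partial>stream_space Q)"
    by (rule nn_integral_cmult) measurable
  also have "\<dots> \<le> ennreal \<rho> * (ennreal (\<rho> ^ n) * (\<integral>\<^sup>+u. ennreal (D z0 (S z0 u)) \<partial>Q))"
    by (intro mult_left_mono Suc) simp
  also have "\<dots> = ennreal (\<rho> ^ Suc n) * (\<integral>\<^sup>+u. ennreal (D z0 (S z0 u)) \<partial>Q)"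
    using \<rho> by (simp add: ennreal_mult mult.assoc)
  finally show ?case .
qed

lemma backward_sum_finite:
  "(\<integral>\<^sup>+\<omega>. (\<Sum>n. ennreal (D (backward n \<omega>) (backward (Suc n) \<omega>))) \<partial>stream_space Q) < \<infinity>"
proof -
  have "(\<integral>\<^sup>+\<omega>. (\<Sum>n. ennreal (D (backward n \<omega>) (backward (Suc n) \<omega>))) \<partial>stream_space Q)
     = (\<Sum>n. (\<integral>\<^sup>+\<omega>. ennreal (D (backward n \<omega>) (backward (Suc n) \<omega>)) \<partial>stream_space Q))"
    by (rule nn_integral_suminf) measurable
  also have "\<dots> \<le> (\<Sum>n. ennreal (\<rho> ^ n) * (\<integral>\<^sup>+u. ennreal (D z0 (S z0 u)) \<partial>Q))"
    by (intro suminf_le backward_increment) auto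
  also have "\<dots> = (\<Sum>n. ennreal (\<rho> ^ n)) * (\<integral>\<^sup>+u. ennreal (D z0 (S z0 u)) \<partial>Q)"
    by (rule ennreal_suminf_multc)
  also have "(\<Sum>n. ennreal (\<rho> ^ n)) = ennreal (\<Sum>n. \<rho> ^ n)"
    using \<rho> by (intro suminf_ennreal2 summable_geometric) auto
  also have "ennreal (\<Sum>n. \<rho> ^ n) * (\<integral>\<^sup>+u. ennreal (D z0 (S z0 u)) \<partial>Q) < \<infinity>"
    using moment by (simp add: ennreal_mult_less_top)
  finally show ?thesis .
qed

text \<open>A finite mean makes the sum of the increments finite almost surely, and
  \<open>dist_le_D\<close> transfers the summability to the topology.\<close>

lemma backward_Cauchy: "AE \<omega> in stream_space Q. Cauchy (\<lambda>n. backward n \<omega>)"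
proof -
  have "AE \<omega> in stream_space Q. (\<Sum>n. ennreal (D (backward n \<omega>) (backward (Suc n) \<omega>))) \<noteq> \<infinity>"
    by (rule nn_integral_noteq_infinite) (use backward_sum_finite in auto)
  then show ?thesis
  proof eventually_elim
    case (elim \<omega>)
    have sm: "summable (\<lambda>n. D (backward n \<omega>) (backward (Suc n) \<omega>))"
      using elim by (intro summable_suminf_not_top D_nonneg) auto
    have "summable (\<lambda>n. dist (backward n \<omega>) (backward (Suc n) \<omega>))"
    proof (rule summable_comparison_test')
      show "summable (\<lambda>n. C * D (backward n \<omega>) (backward (Suc n) \<omega>))" using sm by (rule summable_mult)
      show "norm (dist (backward n \<omega>) (backward (Suc n) \<omega>)) \<le> C * D (backward n \<omega>) (backward (Suc n) \<omega>)" for n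
        using dist_le_D by simp
    qed
    then have sc: "Cauchy (\<lambda>n. \<Sum>k<n. dist (backward k \<omega>) (backward (Suc k) \<omega>))"
      using summable_LIMSEQ LIMSEQ_imp_Cauchy by blast
    have tele: "dist (backward m \<omega>) (backward n \<omega>) \<le> (\<Sum>k<n. dist (backward k \<omega>) (backward (Suc k) \<omega>)) -
        (\<Sum>k<m. dist (backward k \<omega>) (backward (Suc k) \<omega>))" if "m \<le> n" for m n
      using that
    proof (induction n rule: dec_induct)
      case (step n)
      have "dist (backward m \<omega>) (backward (Suc n) \<omega>) \<le> dist (backward m \<omega>) (backward n \<omega>) + dist (backward n \<omega>) (backward (Suc n) \<omega>)"
        by (rule dist_triangle)
      then show ?case using step.IH by simp
    qed simp
    show ?case
    proof (rule metric_CauchyI)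
      fix e :: real assume "0 < e"
      then obtain N where N: "\<And>m n. m \<ge> N \<Longrightarrow> n \<ge> N \<Longrightarrow> dist (\<Sum>k<m. dist (backward k \<omega>) (backward (Suc k) \<omega>))
          (\<Sum>k<n. dist (backward k \<omega>) (backward (Suc k) \<omega>)) < e"
        using sc metric_CauchyD by blast
      have "dist (backward m \<omega>) (backward n \<omega>) < e" if "m \<ge> N" "n \<ge> N" for m n
      proof (cases "m \<le> n")
        case True
        then show ?thesis using tele[OF True] N[OF that] by (simp add: dist_real_def)
      next
        case False
        then have "n \<le> m" by simp
        from tele[OF this] show ?thesis using N[OF that] by (simp add: dist_real_def dist_commute)
      qed
      then show "\<exists>M. \<forall>m\<ge>M. \<forall>n\<ge>M. dist (backward m \<omega>) (backward n \<omega>) < e" by blast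
    qed
  qed
qed

text \<open>Where the iterates are not Cauchy the constant sequence \<open>z0\<close> is taken
  instead, so that the limit lies in \<open>X\<close> everywhere and is measurable.\<close>

definition limit_point :: "'u stream \<Rightarrow> 'z" where
  "limit_point \<omega> = lim (\<lambda>n. if Cauchy (\<lambda>n. backward n \<omega>) then backward n \<omega> else z0)"

lemma limit_point_tendsto: "Cauchy (\<lambda>n. backward n \<omega>) \<Longrightarrow> (\<lambda>n. backward n \<omega>) \<longlonglongrightarrow> limit_point \<omega>"
proof -
  assume c: "Cauchy (\<lambda>n. backward n \<omega>)"
  then have "limit_point \<omega> = lim (\<lambda>n. backward n \<omega>)" by (simp add: limit_point_def)
  then show "(\<lambda>n. backward n \<omega>) \<longlonglongrightarrow> limit_point \<omega>"
    using Cauchy_convergent[OF c] by (simp only: convergent_LIMSEQ_iff)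
qed

lemma limit_point_in_X: "\<omega> \<in> space (stream_space Q) \<Longrightarrow> limit_point \<omega> \<in> X"
proof (cases "Cauchy (\<lambda>n. backward n \<omega>)")
  case True
  assume "\<omega> \<in> space (stream_space Q)"
  then show ?thesis
    by (intro closed_sequentially[OF X_closed _ limit_point_tendsto[OF True]] allI backward_in_X)
next
  case False
  then show ?thesis using z0 by (simp add: limit_point_def)
qed

lemma limit_point_measurable [measurable]: "limit_point \<in> stream_space Q \<rightarrow>\<^sub>M E"
proof (rule measurable_E_I[OF _ limit_point_in_X])
  have b[measurable]: "backward n \<in> borel_measurable (stream_space Q)" for n
    using measurable_compose[OF backward_measurable id_measurable] by simp
  have [measurable]: "Measurable.pred (stream_space Q) (\<lambda>\<omega>. Cauchy (\<lambda>n. backward n \<omega>))"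
    unfolding pred_def by (rule sets_Collect_Cauchy) (rule b)
  show "limit_point \<in> borel_measurable (stream_space Q)"
  proof (rule borel_measurable_LIMSEQ_metric)
    show "(\<lambda>\<omega>. if Cauchy (\<lambda>n. backward n \<omega>) then backward n \<omega> else z0) \<in> borel_measurable (stream_space Q)" for n
      by measurable
    show "(\<lambda>n. if Cauchy (\<lambda>n. backward n \<omega>) then backward n \<omega> else z0) \<longlonglongrightarrow> limit_point \<omega>" for \<omega>
      using limit_point_tendsto[of \<omega>] by (cases "Cauchy (\<lambda>n. backward n \<omega>)") (auto simp: limit_point_def)
  qed
qed

text \<open>Continuity of each random map lets the recursion of the iterates pass to the limit. This
  fixed-point equation is what makes the law of the limit invariant.\<close>

lemma limit_point_shift: "AE u in Q. AE \<omega> in stream_space Q. limit_point (u ## \<omega>) = S (limit_point \<omega>) u"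
proof -
  interpret SS: prob_space "stream_space Q" by (rule prob_space_stream_space)
  have b[measurable]: "backward n \<in> borel_measurable (stream_space Q)" for n
    using measurable_compose[OF backward_measurable id_measurable] by simp
  have "Measurable.pred (stream_space Q) (\<lambda>\<omega>. Cauchy (\<lambda>n. backward n \<omega>))"
    unfolding pred_def by (rule sets_Collect_Cauchy) (rule b)
  from AE_stream_space[OF this]
  have "AE u in Q. AE \<omega> in stream_space Q. Cauchy (\<lambda>n. backward n (u ## \<omega>))"
    using backward_Cauchy by simp
  moreover have "AE u in Q. u \<in> space Q" by simp
  ultimately show ?thesis
  proof eventually_elim
    case (elim u)
    note u = elim
    have "AE \<omega> in stream_space Q. \<omega> \<in> space (stream_space Q)" by simp
    with u(1) backward_Cauchy show ?case
    proof eventually_elim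
      case (elim \<omega>)
      have "(\<lambda>n. S (backward n \<omega>) u) \<longlonglongrightarrow> S (limit_point \<omega>) u"
        using continuous_on_tendsto_compose[OF S_continuous[OF u(2)] limit_point_tendsto[OF elim(2)]]
          limit_point_in_X[OF elim(3)] backward_in_X[OF elim(3)] by simp
      moreover have "(\<lambda>n. backward (Suc n) (u ## \<omega>)) \<longlonglongrightarrow> limit_point (u ## \<omega>)"
        using limit_point_tendsto[OF elim(1)] by (rule LIMSEQ_Suc)
      ultimately show ?case using LIMSEQ_unique by fastforce
    qed
  qed
qed

text \<open>The law of \<open>limit_point\<close> is taken. Its first moment is bounded by the sum
  of the increments, and it is invariant because prepending an independent innovation does not
  change the law of the stream.\<close>

lemma invariant_law_exists:
  "\<exists>\<pi>. \<pi> \<in> finite_first_moment_laws E c \<and> invariant_law K \<pi>"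
proof (intro exI conjI)
  interpret SS: prob_space "stream_space Q" by (rule prob_space_stream_space)
  interpret P: pair_sigma_finite Q "stream_space Q" ..
  define \<pi> where "\<pi> = distr (stream_space Q) E limit_point"
  have law: "law_on E \<pi>" unfolding law_on_def \<pi>_def using SS.prob_space_distr[OF limit_point_measurable] by simp
  have [measurable]: "(\<lambda>_. z0) \<in> M \<rightarrow>\<^sub>M E" for M :: "'x measure" using z0 by (simp add: space_E)
  have le: "AE \<omega> in stream_space Q. ennreal (D (limit_point \<omega>) z0) \<le> (\<Sum>n. ennreal (D (backward n \<omega>) (backward (Suc n) \<omega>)))"
    using backward_Cauchy
  proof eventually_elim
    case (elim \<omega>)
    show ?case
    proof (rule ennreal_le_epsilon)
      fix e :: real assume e: "0 < e"
      have "(\<lambda>n. D (limit_point \<omega>) (backward n \<omega>)) \<longlonglongrightarrow> 0" by (rule D_tendsto[OF limit_point_tendsto[OF elim]])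
      then have "\<forall>\<^sub>F n in sequentially. D (limit_point \<omega>) (backward n \<omega>) < e" using e by (simp add: order_tendstoD)
      then obtain n where n: "D (limit_point \<omega>) (backward n \<omega>) < e" by (auto simp: eventually_sequentially)
      have "D (backward k \<omega>) z0 \<le> (\<Sum>i<k. D (backward i \<omega>) (backward (Suc i) \<omega>))" for k
      proof (induction k)
        case 0
        have "D z0 z0 = 0" using D_tendsto[of "\<lambda>_. z0" z0] by (simp add: LIMSEQ_const_iff)
        then show ?case by simp
      next
        case (Suc k)
        have "D (backward (Suc k) \<omega>) z0 \<le> D (backward (Suc k) \<omega>) (backward k \<omega>) + D (backward k \<omega>) z0" by (rule D_triangle)
        also have "D (backward (Suc k) \<omega>) (backward k \<omega>) = D (backward k \<omega>) (backward (Suc k) \<omega>)" by (rule D_sym)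
        finally show ?case using Suc by (simp only: sum.lessThan_Suc)
      qed
      from this[of n] have "D (limit_point \<omega>) z0 \<le> (\<Sum>i<n. D (backward i \<omega>) (backward (Suc i) \<omega>)) + e"
        using D_triangle[of "limit_point \<omega>" z0 "backward n \<omega>"] n by linarith
      then have "ennreal (D (limit_point \<omega>) z0) \<le> ennreal ((\<Sum>i<n. D (backward i \<omega>) (backward (Suc i) \<omega>)) + e)"
        by (rule ennreal_leI)
      also have "\<dots> = (\<Sum>i<n. ennreal (D (backward i \<omega>) (backward (Suc i) \<omega>))) + ennreal e"
        using e D_nonneg by (simp only: ennreal_plus sum_nonneg less_imp_le sum_ennreal)
      also have "\<dots> \<le> (\<Sum>i. ennreal (D (backward i \<omega>) (backward (Suc i) \<omega>))) + ennreal e"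
        by (intro add_right_mono sum_le_suminf) auto
      finally show "ennreal (D (limit_point \<omega>) z0) \<le> \<dots>" .
    qed
  qed
  have "(\<integral>\<^sup>+z. c z z0 \<partial>\<pi>) = (\<integral>\<^sup>+z. ennreal (D z z0) \<partial>\<pi>)"
    using z0 by (intro nn_integral_cong) (simp add: \<pi>_def space_E c_eq)
  also have "\<dots> = (\<integral>\<^sup>+\<omega>. ennreal (D (limit_point \<omega>) z0) \<partial>stream_space Q)"
    unfolding \<pi>_def by (rule nn_integral_distr) measurable
  also have "\<dots> < \<infinity>"
    using nn_integral_mono_AE[OF le] backward_sum_finite by (rule le_less_trans)
  finally show "\<pi> \<in> finite_first_moment_laws E c"
    unfolding finite_first_moment_laws_def using law z0 by (auto simp: space_E)
  have "\<pi> \<bind> K = distr (stream_space Q \<Otimes>\<^sub>M Q) E (\<lambda>(p, u). S (limit_point p) u)"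
    unfolding \<pi>_def by (rule bind_K_eq[OF SS.prob_space_axioms limit_point_measurable])
  also have "\<dots> = \<pi>"
  proof (rule measure_eqI)
    fix A assume "A \<in> sets (distr (stream_space Q \<Otimes>\<^sub>M Q) E (\<lambda>(p, u). S (limit_point p) u))"
    then have A[measurable]: "A \<in> sets E" by simp
    let ?d = "distr (stream_space Q \<Otimes>\<^sub>M Q) E (\<lambda>(p, u). S (limit_point p) u)"
    have "emeasure ?d A = (\<integral>\<^sup>+z. indicator A z \<partial>?d)" by simp
    also have "\<dots> = (\<integral>\<^sup>+q. indicator A (case q of (p, u) \<Rightarrow> S (limit_point p) u) \<partial>(stream_space Q \<Otimes>\<^sub>M Q))"
      by (rule nn_integral_distr) measurable
    also have "\<dots> = (\<integral>\<^sup>+\<omega>. \<integral>\<^sup>+u. indicator A (S (limit_point \<omega>) u) \<partial>Q \<partial>stream_space Q)"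
      by (subst nn_integral_fst[symmetric]) auto
    \<comment> \<open>The order is exchanged so that \<open>u\<close> can become the head of the
      stream.\<close>
    also have "\<dots> = (\<integral>\<^sup>+u. \<integral>\<^sup>+\<omega>. indicator A (S (limit_point \<omega>) u) \<partial>stream_space Q \<partial>Q)"
      by (rule P.Fubini') measurable
    also have "\<dots> = (\<integral>\<^sup>+u. \<integral>\<^sup>+\<omega>. indicator A (limit_point (u ## \<omega>)) \<partial>stream_space Q \<partial>Q)"
    proof (rule nn_integral_cong_AE)
      show "AE u in Q. (\<integral>\<^sup>+\<omega>. indicator A (S (limit_point \<omega>) u) \<partial>stream_space Q)
          = (\<integral>\<^sup>+\<omega>. indicator A (limit_point (u ## \<omega>)) \<partial>stream_space Q)"
        using limit_point_shift
      proof eventually_elim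
        case (elim u)
        show ?case
          by (rule nn_integral_cong_AE) (use elim in eventually_elim, simp)
      qed
    qed
    also have "\<dots> = (\<integral>\<^sup>+\<omega>. indicator A (limit_point \<omega>) \<partial>stream_space Q)"
      by (rule nn_integral_stream_space[symmetric]) measurable
    also have "\<dots> = (\<integral>\<^sup>+z. indicator A z \<partial>\<pi>)"
      unfolding \<pi>_def by (rule nn_integral_distr[symmetric]) measurable
    also have "\<dots> = emeasure \<pi> A" by (simp add: \<pi>_def)
    finally show "emeasure ?d A = emeasure \<pi> A" .
  qed (simp add: \<pi>_def)
  finally show "invariant_law K \<pi>" by (simp add: invariant_law_def)
qed

end

section \<open>Tail weights and core bumps\<close>

text \<open>The tangent at 1 of a concave power, an instance of the weighted inequality between
  geometric and arithmetic means.\<close>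

lemma powr_le_affine:
  fixes x b :: real
  assumes "0 \<le> x" "0 < b" "b \<le> 1"
  shows "x powr b \<le> 1 + b * (x - 1)"
proof (cases "x = 0")
  case False
  then have "x powr b * 1 powr (1 - b) \<le> b * x + (1 - b) * 1"
    using assms by (intro Youngs_inequality_0) auto
  then show ?thesis by (simp add: algebra_simps)
qed (use assms in auto)

text \<open>For y \<le> 1 the tangent bound suffices. Beyond the sign change the base is y - 1, and
  y - 1 \<le> y^2 pays for the reflected linear term.\<close>

lemma abs_one_minus_powr_le_quadratic:
  fixes y b :: real
  assumes b: "0 < b" "b \<le> 1"
  shows "\<bar>1 - y\<bar> powr b \<le> 1 - b * y + 2 * y\<^sup>2"
proof (cases "y \<le> 1")
  case True
  then have "\<bar>1 - y\<bar> powr b \<le> 1 + b * ((1 - y) - 1)" using powr_le_affine[of "1 - y" b] b by simp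
  moreover have "b * ((1 - y) - 1) = - (b * y)" by (simp add: algebra_simps)
  moreover have "0 \<le> 2 * y\<^sup>2" by simp
  ultimately show ?thesis by linarith
next
  case False
  then have "\<bar>1 - y\<bar> powr b \<le> 1 + b * ((y - 1) - 1)" using powr_le_affine[of "y - 1" b] b by simp
  also have "\<dots> = 1 - b * y + 2 * (b * (y - 1))" by (simp add: algebra_simps)
  also have "b * (y - 1) \<le> 1 * (y - 1)" using False b by (intro mult_right_mono) auto
  also have "1 * (y - 1) \<le> y\<^sup>2" using False zero_le_power2[of "y - 1"] by (simp add: power2_diff)
  finally show ?thesis by simp
qed

lemma abs_one_minus_powr_le_abs:
  fixes y b :: real
  assumes b: "0 < b" "b \<le> 1"
  shows "\<bar>1 - y\<bar> powr b \<le> 1 + \<bar>y\<bar>"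
proof -
  have "\<bar>1 - y\<bar> powr b \<le> 1 + b * (\<bar>1 - y\<bar> - 1)" using powr_le_affine[of "\<bar>1 - y\<bar>" b] b by simp
  also have "b * (\<bar>1 - y\<bar> - 1) \<le> b * \<bar>y\<bar>" using b by (intro mult_left_mono) auto
  also have "b * \<bar>y\<bar> \<le> 1 * \<bar>y\<bar>" using b by (intro mult_right_mono) auto
  finally show ?thesis by simp
qed

lemma exp_minus_one_le: "exp x - 1 \<le> x * exp (x::real)"
proof -
  have "1 + (- x) \<le> exp (- x)" by (rule exp_ge_add_one_self)
  then have "(1 + (- x)) * exp x \<le> exp (- x) * exp x" by (intro mult_right_mono) auto
  then show ?thesis by (simp add: algebra_simps exp_minus)
qed

text \<open>The remainder exp x - 1 - x is at most x (exp x - 1), and this product is at most x^2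
  exp |x| for either sign of x.\<close>

lemma exp_le_second_order: "exp x \<le> 1 + x + x\<^sup>2 * exp \<bar>x::real\<bar>"
proof -
  have "exp x - 1 - x \<le> x * (exp x - 1)" using exp_minus_one_le[of x] by (simp add: algebra_simps)
  also have "\<dots> \<le> x\<^sup>2 * exp \<bar>x\<bar>"
  proof (cases "0 \<le> x")
    case True
    then have "x * (exp x - 1) \<le> x * (x * exp x)" by (intro mult_left_mono exp_minus_one_le)
    then show ?thesis using True by (simp add: power2_eq_square mult.assoc)
  next
    case False
    have "x * (exp x - 1) \<le> x * x"
    proof (rule mult_left_mono_neg)
      show "x \<le> exp x - 1" using exp_ge_add_one_self[of x] by linarith
    qed (use False in auto)
    also have "x * x \<le> x * x * exp \<bar>x\<bar>" using mult_left_mono[of 1 "exp \<bar>x\<bar>" "x * x"] by simp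
    finally show ?thesis by (simp only: power2_eq_square)
  qed
  finally show ?thesis by simp
qed

lemma power_le_fact_exp:
  fixes x :: real
  assumes "0 \<le> x"
  shows "x ^ n \<le> fact n * exp x"
proof -
  have "(\<Sum>k\<in>{n}. x ^ k /\<^sub>R fact k) \<le> (\<Sum>k. x ^ k /\<^sub>R fact k)"
    using assms by (intro sum_le_suminf sums_summable[OF exp_converges]) auto
  also have "\<dots> = exp x" using sums_unique[OF exp_converges] by (rule sym)
  finally have le: "x ^ n /\<^sub>R fact n \<le> exp x" by simp
  have "x ^ n = fact n * (x ^ n /\<^sub>R fact n)" by simp
  also have "\<dots> \<le> fact n * exp x" by (rule mult_left_mono[OF le]) simp
  finally show ?thesis .
qed

text \<open>With b = 2 - \<beta> and r = 3R/4 this is the exponent of the tail weight divided by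
  \<kappa>.\<close>

definition psi :: "real \<Rightarrow> real \<Rightarrow> real \<Rightarrow> real" where
  "psi b r t = max 0 (\<bar>t\<bar> powr b - r powr b)"

lemma psi_nonneg: "0 \<le> psi b r t"
  by (simp add: psi_def)

lemma psi_eq_0: "0 < b \<Longrightarrow> \<bar>t\<bar> \<le> r \<Longrightarrow> psi b r t = 0"
  unfolding psi_def by (simp add: powr_mono2)

text \<open>By concavity the power grows at most with its slope at max |s| r. The decay of this
  slope in |s| offsets the growth |t|^(\<beta>-1) that is allowed to the noise.\<close>

lemma psi_lipschitz:
  assumes b: "0 < b" "b \<le> 1" and r: "0 < r"
  shows "psi b r t - psi b r s \<le> \<bar>t - s\<bar> * max \<bar>s\<bar> r powr (b - 1)"
proof -
  define a where "a = max \<bar>s\<bar> r"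
  define a' where "a' = max \<bar>t\<bar> r"
  have a: "0 < a" "0 < a'" using r by (auto simp: a_def a'_def)
  have eq: "psi b r u = max \<bar>u\<bar> r powr b - r powr b" for u
  proof (cases "\<bar>u\<bar> \<le> r")
    case True
    then show ?thesis using psi_eq_0[of b u r] b by (simp add: max_absorb2)
  next
    case False
    then have "r powr b \<le> \<bar>u\<bar> powr b" using b r by (intro powr_mono2) auto
    then show ?thesis using False by (simp add: psi_def max_absorb1)
  qed
  have "a' powr b = a powr b * (a' / a) powr b" using a by (simp add: powr_divide)
  also have "\<dots> \<le> a powr b * (1 + b * (a' / a - 1))" using a b by (intro mult_left_mono powr_le_affine) auto
  also have "\<dots> = a powr b + b * (a' - a) * (a powr b / a)" using a by (simp add: field_simps)
  also have "a powr b / a = a powr (b - 1)" using a by (simp add: powr_diff)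
  also have "b * (a' - a) * a powr (b - 1) \<le> \<bar>t - s\<bar> * a powr (b - 1)"
  proof (rule mult_right_mono)
    have "b * (a' - a) \<le> b * \<bar>t - s\<bar>" using b by (intro mult_left_mono) (auto simp: a_def a'_def)
    also have "\<dots> \<le> 1 * \<bar>t - s\<bar>" using b by (intro mult_right_mono) auto
    finally show "b * (a' - a) \<le> \<bar>t - s\<bar>" by simp
  qed auto
  finally show ?thesis unfolding eq a_def a'_def by simp
qed

text \<open>To first order a move by -g changes |s|^b by -b w, and the correction is quadratic in
  the relative step y = g / s. The truncation of \<open>psi\<close> below r = 3R/4 interferes only
  with moves from |s| \<ge> R to |s - g| < r; these force y > 1/4, and then the quadratic term
  dominates the linear one.\<close>

lemma psi_drift:
  assumes b: "0 < b" "b \<le> 1" and R: "0 < R" and s: "R \<le> \<bar>s\<bar>" and r: "r = 3 * R / 4"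
    and w: "w = sgn s * \<bar>s\<bar> powr (b - 1) * g"
  shows "psi b r (s - g) - psi b r s \<le> \<bar>w\<bar>"
    and "psi b r (s - g) - psi b r s \<le> - b * w + 4 * R powr (- b) * w\<^sup>2"
proof -
  define y where "y = g / s"
  define P where "P = \<bar>s\<bar> powr b"
  have s0: "s \<noteq> 0" "0 < \<bar>s\<bar>" using s R by auto
  have P: "0 < P" using s0 by (simp add: P_def)
  have sg: "\<bar>s - g\<bar> = \<bar>s\<bar> * \<bar>1 - y\<bar>" using s0 by (simp add: y_def abs_mult[symmetric] field_simps)
  have Py: "P * y = w"
    using s0 by (simp add: P_def y_def w powr_diff sgn_if abs_if field_simps)
  have rP: "r powr b \<le> P" unfolding P_def using b R s r by (intro powr_mono2) auto
  \<comment> \<open>At s the truncation is inactive, so the change is the larger of the truncated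
    and the untruncated one.\<close>
  have diff: "psi b r (s - g) - psi b r s = max (r powr b - P) (P * \<bar>1 - y\<bar> powr b - P)"
    unfolding psi_def sg using rP by (simp add: P_def powr_mult max_def)
  have q1: "P * \<bar>1 - y\<bar> powr b - P \<le> \<bar>w\<bar>"
  proof -
    have "P * \<bar>1 - y\<bar> powr b \<le> P * (1 + \<bar>y\<bar>)" using P b by (intro mult_left_mono abs_one_minus_powr_le_abs) auto
    also have "\<dots> = P + \<bar>P * y\<bar>" using P by (simp add: algebra_simps abs_mult)
    finally show ?thesis unfolding Py by simp
  qed
  show "psi b r (s - g) - psi b r s \<le> \<bar>w\<bar>" unfolding diff using q1 rP by simp
  have "R powr b \<le> P" unfolding P_def using b R s by (intro powr_mono2) auto
  then have "1 \<le> R powr (- b) * P" using R by (simp add: powr_minus field_simps)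
  then have "(1 * P) * y\<^sup>2 \<le> (R powr (- b) * P * P) * y\<^sup>2"
    using P by (intro mult_right_mono) auto
  then have w2: "P * y\<^sup>2 \<le> R powr (- b) * w\<^sup>2" unfolding Py[symmetric] by (simp add: power2_eq_square mult_ac)
  have q2: "P * \<bar>1 - y\<bar> powr b - P \<le> - b * w + 4 * R powr (- b) * w\<^sup>2"
  proof -
    have "P * \<bar>1 - y\<bar> powr b \<le> P * (1 - b * y + 2 * y\<^sup>2)" using P b by (intro mult_left_mono abs_one_minus_powr_le_quadratic) auto
    also have "\<dots> = P - b * w + 2 * (P * y\<^sup>2)" unfolding Py[symmetric] by (simp add: algebra_simps)
    finally have "P * \<bar>1 - y\<bar> powr b - P \<le> - b * w + 2 * (P * y\<^sup>2)" by simp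
    moreover have "2 * (P * y\<^sup>2) \<le> 4 * (P * y\<^sup>2)" using P by simp
    ultimately show ?thesis using w2 by linarith
  qed
  have q3: "r powr b - P \<le> - b * w + 4 * R powr (- b) * w\<^sup>2" if lt: "P * \<bar>1 - y\<bar> powr b < r powr b"
  proof -
    have *: "(\<bar>s\<bar> * \<bar>1 - y\<bar>) powr b < r powr b" using lt by (simp add: P_def powr_mult)
    have "\<bar>s\<bar> * \<bar>1 - y\<bar> < r"
    proof (rule ccontr)
      assume "\<not> \<bar>s\<bar> * \<bar>1 - y\<bar> < r"
      then have "r powr b \<le> (\<bar>s\<bar> * \<bar>1 - y\<bar>) powr b" using b r R by (intro powr_mono2) auto
      then show False using * by simp
    qed
    also have "r \<le> \<bar>s\<bar> * (3 / 4)" using r s by simp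
    finally have "\<bar>1 - y\<bar> < 3 / 4" using s0 by simp
    then have y: "1 / 4 < y" by (simp add: abs_if split: if_splits)
    have "b * y \<le> 1 * y" using b y by (intro mult_right_mono) auto
    also have "1 * y \<le> 4 * y * y" using y by (intro mult_right_mono) auto
    finally have "0 \<le> - b * y + 4 * y\<^sup>2" by (simp add: power2_eq_square mult_ac)
    then have "0 \<le> P * (- b * y + 4 * y\<^sup>2)" using P by simp
    also have "\<dots> = - b * w + 4 * (P * y\<^sup>2)" unfolding Py[symmetric] by (simp add: algebra_simps)
    finally show ?thesis using w2 rP by linarith
  qed
  show "psi b r (s - g) - psi b r s \<le> - b * w + 4 * R powr (- b) * w\<^sup>2"
    unfolding diff using q2 q3 by (cases "P * \<bar>1 - y\<bar> powr b < r powr b") auto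
qed

text \<open>This exponent q merges the cases m \<le> 3 and m > 3: the bump is the positive part of 1
  - (2|t|/R)^q and its height is \<kappa>0 \<alpha>^(m-1-q), so that a displacement of order
  \<alpha> from the peak lowers the weight by the order \<alpha>^(m-1).\<close>

definition bump_exponent :: "real \<Rightarrow> real" where
  "bump_exponent m = min (m - 2) 1"

lemma bump_exponent:
  assumes "2 < m"
  shows "0 < bump_exponent m" "bump_exponent m \<le> 1" "bump_exponent m \<le> m - 2"
  using assms by (auto simp: bump_exponent_def)

lemma core_bump_eq: "2 < m \<Longrightarrow> 0 < R \<Longrightarrow> core_bump m R t = max 0 (1 - (2 * \<bar>t\<bar> / R) powr bump_exponent m)"
  unfolding core_bump_def abs_pow_def bump_exponent_def by (auto simp: min_def)

lemma core_scale_eq: "2 < m \<Longrightarrow> 0 < \<alpha> \<Longrightarrow> core_scale m \<kappa>0 \<alpha> = \<kappa>0 * \<alpha> powr (m - 1 - bump_exponent m)"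
  unfolding core_scale_def bump_exponent_def by (auto simp: min_def)

lemma core_bump_bounds: "0 < R \<Longrightarrow> 0 \<le> core_bump m R t \<and> core_bump m R t \<le> 1"
  unfolding core_bump_def abs_pow_def by auto

lemma core_bump_outside:
  assumes "2 \<le> m" "0 < R" "R / 2 \<le> \<bar>t\<bar>"
  shows "core_bump m R t = 0"
proof (cases "m = 2")
  case False
  have "1 \<le> (2 * \<bar>t\<bar> / R) powr bump_exponent m"
    using assms False bump_exponent[of m] by (intro ge_one_powr_ge_zero) (auto simp: field_simps)
  then show ?thesis using core_bump_eq[of m R t] assms False by simp
qed (simp add: core_bump_def)

lemma core_scale_bounds:
  assumes "2 \<le> m" "0 < \<kappa>0" "0 < \<alpha>" "\<alpha> \<le> 1"
  shows "0 \<le> core_scale m \<kappa>0 \<alpha>" "core_scale m \<kappa>0 \<alpha> \<le> \<kappa>0 * \<alpha>"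
proof -
  have "core_scale m \<kappa>0 \<alpha> \<le> \<kappa>0 * \<alpha>" if "m > 2"
  proof -
    have "\<alpha> powr (m - 1 - bump_exponent m) \<le> \<alpha> powr 1"
      using assms bump_exponent[OF that] by (intro powr_mono') auto
    then show ?thesis using assms that by (simp add: core_scale_eq)
  qed
  then show "core_scale m \<kappa>0 \<alpha> \<le> \<kappa>0 * \<alpha>" using assms by (cases "m = 2") (auto simp: core_scale_def)
  show "0 \<le> core_scale m \<kappa>0 \<alpha>" using assms by (auto simp: core_scale_def)
qed

lemma continuous_core_bump: "2 \<le> m \<Longrightarrow> 0 < R \<Longrightarrow> continuous_on UNIV (core_bump m R)"
proof (cases "m = 2")
  case False
  assume "2 \<le> m" "0 < R"
  then have "core_bump m R = (\<lambda>t. max 0 (1 - (2 * \<bar>t\<bar> / R) powr bump_exponent m))"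
    using False by (intro ext core_bump_eq) auto
  moreover have "continuous_on UNIV (\<lambda>t. max 0 (1 - (2 * \<bar>t\<bar> / R) powr bump_exponent m))"
    using bump_exponent[of m] False \<open>2 \<le> m\<close> \<open>0 < R\<close>
    by (intro continuous_intros continuous_on_powr') auto
  ultimately show ?thesis by simp
qed (simp add: core_bump_def[abs_def])

text \<open>Curvature gains cb \<alpha> |\<tau>|^(m-2). A step towards the peak costs at most
  \<delta> (2|\<tau>|/R)^q, the deficit of the scaled bump at \<tau>. As \<delta> = \<kappa>0
  \<alpha>^(m-1-q) and \<alpha> \<le> |\<tau>| / \<eta>, the cost is at most a multiple of \<kappa>0
  \<alpha> |\<tau>|^(m-2), and the bound on \<kappa>0 makes it at most half of the gain.\<close>

lemma (in prob_space) core_contraction_far: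
  assumes m: "2 < m" and R: "0 < R" and \<kappa>0: "0 < \<kappa>0" and \<alpha>: "0 < \<alpha>" "\<alpha> \<le> 1" and \<eta>: "0 < \<eta>"
    and \<kappa>0': "\<kappa>0 * (2 / R) powr bump_exponent m * \<eta> powr - (m - 2 - bump_exponent m) \<le> cb / 2" and cb: "0 < cb"
    and \<tau>: "\<eta> * \<alpha> \<le> \<bar>\<tau>\<bar>" "\<bar>\<tau>\<bar> \<le> R / 2"
    and [measurable]: "X \<in> borel_measurable M" "D \<in> borel_measurable M"
    and D: "\<And>u. u \<in> space M \<Longrightarrow> 0 \<le> D u" "\<And>u. u \<in> space M \<Longrightarrow> \<alpha> * D u \<le> 1"
    and ED: "cb * \<bar>\<tau>\<bar> powr (m - 2) \<le> (\<integral>u. D u \<partial>M)"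
  shows "(\<integral>u. (1 - \<alpha> * D u) * (1 + core_scale m \<kappa>0 \<alpha> * core_bump m R (X u)) \<partial>M)
    \<le> 1 + core_scale m \<kappa>0 \<alpha> * core_bump m R \<tau> - cb / 2 * \<eta> powr (m - 2) * \<alpha> powr (m - 1)"
proof -
  define q where "q = bump_exponent m"
  define \<delta> where "\<delta> = core_scale m \<kappa>0 \<alpha>"
  have q: "0 < q" "q \<le> 1" "q \<le> m - 2" using bump_exponent[OF m] by (auto simp: q_def)
  have \<delta>: "0 \<le> \<delta>" "\<delta> = \<kappa>0 * \<alpha> powr (m - 1 - q)"
    using core_scale_bounds(1)[of m \<kappa>0 \<alpha>] core_scale_eq[OF m \<alpha>(1)] m \<kappa>0 \<alpha> by (auto simp: \<delta>_def q_def)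
  have \<tau>0: "0 < \<bar>\<tau>\<bar>" using \<tau> \<eta> \<alpha> by (metis less_le_trans mult_pos_pos)
  have Dm: "AE u in M. norm (D u) \<le> 1 / \<alpha>" using D \<alpha> by (intro AE_I2) (auto simp: field_simps)
  have iD: "integrable M D" by (rule integrable_const_bound[OF Dm]) simp
  have [measurable]: "core_bump m R \<in> borel_measurable borel"
    using m R by (intro borel_measurable_continuous_onI continuous_core_bump) auto
  have cb01: "0 \<le> core_bump m R t" "core_bump m R t \<le> 1" for t using core_bump_bounds[OF R] by auto
  have le: "(1 - \<alpha> * D u) * (1 + \<delta> * core_bump m R (X u)) \<le> 1 - \<alpha> * D u + \<delta>" if "u \<in> space M" for u
  proof -
    have "(1 - \<alpha> * D u) * (\<delta> * core_bump m R (X u)) \<le> 1 * (\<delta> * 1)"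
      using D[OF that] \<alpha> \<delta> cb01 by (intro mult_mono mult_left_mono) auto
    then show ?thesis by (simp add: algebra_simps)
  qed
  have "(\<integral>u. (1 - \<alpha> * D u) * (1 + \<delta> * core_bump m R (X u)) \<partial>M) \<le> (\<integral>u. 1 - \<alpha> * D u + \<delta> \<partial>M)"
  proof (rule integral_mono_AE)
    show "integrable M (\<lambda>u. (1 - \<alpha> * D u) * (1 + \<delta> * core_bump m R (X u)))"
    proof (rule integrable_const_bound[of _ "1 * (1 + \<delta> * 1)"])
      have "norm ((1 - \<alpha> * D u) * (1 + \<delta> * core_bump m R (X u))) \<le> 1 * (1 + \<delta> * 1)" if "u \<in> space M" for u
        unfolding norm_mult using D[OF that] \<alpha> \<delta>(1) cb01[of "X u"] mult_left_mono[OF cb01(2)[of "X u"] \<delta>(1)]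
        by (intro mult_mono) auto
      then show "AE u in M. norm ((1 - \<alpha> * D u) * (1 + \<delta> * core_bump m R (X u))) \<le> 1 * (1 + \<delta> * 1)" by auto
    qed simp
  qed (use iD le in auto)
  also have "\<dots> = 1 - \<alpha> * (\<integral>u. D u \<partial>M) + \<delta>" using iD by (simp add: prob_space)
  also have "\<dots> \<le> 1 - \<alpha> * (cb * \<bar>\<tau>\<bar> powr (m - 2)) + \<delta>" using ED \<alpha> by simp
  also have "1 - \<alpha> * (cb * \<bar>\<tau>\<bar> powr (m - 2)) + \<delta>
      \<le> 1 - \<alpha> * (cb * \<bar>\<tau>\<bar> powr (m - 2)) + (\<delta> * core_bump m R \<tau> + cb / 2 * (\<alpha> * \<bar>\<tau>\<bar> powr (m - 2)))"
  proof -
  \<comment> \<open>Within R / 2 the bump is not truncated: its value and the power add up to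
    1.\<close>
  have "\<delta> = \<delta> * core_bump m R \<tau> + \<delta> * (2 * \<bar>\<tau>\<bar> / R) powr q"
  proof -
    have "(2 * \<bar>\<tau>\<bar> / R) powr q \<le> 1 powr q" using \<tau> R q by (intro powr_mono2) (auto simp: field_simps)
    then have "core_bump m R \<tau> + (2 * \<bar>\<tau>\<bar> / R) powr q = 1" using m R by (simp add: core_bump_eq q_def)
    then show ?thesis unfolding distrib_left[symmetric] by simp
  qed
  moreover have "\<delta> * (2 * \<bar>\<tau>\<bar> / R) powr q \<le> cb / 2 * (\<alpha> * \<bar>\<tau>\<bar> powr (m - 2))"
  proof -
    have "\<alpha> powr (m - 1 - q) = \<alpha> * \<alpha> powr (m - 2 - q)"
      using \<alpha> powr_add[of \<alpha> 1 "m - 2 - q"] by (simp add: algebra_simps)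
    also have "\<alpha> powr (m - 2 - q) \<le> (\<bar>\<tau>\<bar> / \<eta>) powr (m - 2 - q)"
      using \<tau> \<alpha> \<eta> q by (intro powr_mono2) (auto simp: field_simps)
    also have "(\<bar>\<tau>\<bar> / \<eta>) powr (m - 2 - q) = \<eta> powr - (m - 2 - q) * \<bar>\<tau>\<bar> powr (m - 2 - q)"
    proof -
      have "(\<bar>\<tau>\<bar> / \<eta>) powr c = \<eta> powr - c * \<bar>\<tau>\<bar> powr c" for c
        using \<tau>0 \<eta> powr_divide[of "\<bar>\<tau>\<bar>" \<eta> c] by (simp add: powr_minus field_simps)
      then show ?thesis .
    qed
    finally have "\<alpha> powr (m - 1 - q) \<le> \<alpha> * (\<eta> powr - (m - 2 - q) * \<bar>\<tau>\<bar> powr (m - 2 - q))"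
      using \<alpha> by (simp add: mult_left_mono)
    then have "\<delta> \<le> \<kappa>0 * (\<alpha> * (\<eta> powr - (m - 2 - q) * \<bar>\<tau>\<bar> powr (m - 2 - q)))"
      unfolding \<delta>(2) using \<kappa>0 by (intro mult_left_mono) auto
    then have le: "\<delta> * (2 * \<bar>\<tau>\<bar> / R) powr q
        \<le> \<kappa>0 * (\<alpha> * (\<eta> powr - (m - 2 - q) * \<bar>\<tau>\<bar> powr (m - 2 - q))) * (2 * \<bar>\<tau>\<bar> / R) powr q"
      by (intro mult_right_mono) auto
    have pw: "(2 * \<bar>\<tau>\<bar> / R) powr q = (2 / R) powr q * \<bar>\<tau>\<bar> powr q"
      using \<tau>0 R powr_mult[of "2 / R" "\<bar>\<tau>\<bar>" q] by simp
    note le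
    also have "\<kappa>0 * (\<alpha> * (\<eta> powr - (m - 2 - q) * \<bar>\<tau>\<bar> powr (m - 2 - q))) * (2 * \<bar>\<tau>\<bar> / R) powr q
        = (\<kappa>0 * (2 / R) powr q * \<eta> powr - (m - 2 - q)) * (\<alpha> * (\<bar>\<tau>\<bar> powr (m - 2 - q) * \<bar>\<tau>\<bar> powr q))"
      unfolding pw by (simp only: mult_ac)
    also have "\<bar>\<tau>\<bar> powr (m - 2 - q) * \<bar>\<tau>\<bar> powr q = \<bar>\<tau>\<bar> powr (m - 2)"
      unfolding powr_add[symmetric] by simp
    also have "(\<kappa>0 * (2 / R) powr q * \<eta> powr - (m - 2 - q)) * (\<alpha> * \<bar>\<tau>\<bar> powr (m - 2)) \<le> cb / 2 * (\<alpha> * \<bar>\<tau>\<bar> powr (m - 2))"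
      using \<kappa>0' \<alpha> unfolding q_def by (intro mult_right_mono) auto
    finally show ?thesis .
  qed
  ultimately show ?thesis by linarith
  qed
  also have "1 - \<alpha> * (cb * \<bar>\<tau>\<bar> powr (m - 2)) + (\<delta> * core_bump m R \<tau> + cb / 2 * (\<alpha> * \<bar>\<tau>\<bar> powr (m - 2)))
     = 1 + \<delta> * core_bump m R \<tau> - cb / 2 * (\<alpha> * \<bar>\<tau>\<bar> powr (m - 2))" by (simp add: algebra_simps)
  also have "\<dots> \<le> 1 + \<delta> * core_bump m R \<tau> - cb / 2 * (\<alpha> * (\<eta> * \<alpha>) powr (m - 2))"
  proof -
    have "(\<eta> * \<alpha>) powr (m - 2) \<le> \<bar>\<tau>\<bar> powr (m - 2)" using \<tau> \<eta> \<alpha> m by (intro powr_mono2) auto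
    then have "cb / 2 * (\<alpha> * (\<eta> * \<alpha>) powr (m - 2)) \<le> cb / 2 * (\<alpha> * \<bar>\<tau>\<bar> powr (m - 2))"
      using cb \<alpha> by (intro mult_left_mono) auto
    then show ?thesis by simp
  qed
  also have "\<alpha> * (\<eta> * \<alpha>) powr (m - 2) = \<eta> powr (m - 2) * \<alpha> powr (m - 1)"
    using \<alpha> \<eta> powr_add[of \<alpha> 1 "m - 2"] by (simp add: powr_mult)
  finally show ?thesis unfolding \<delta>_def by (simp add: mult.assoc)
qed

text \<open>Near the minimiser the noise pushes the iterate a distance of order \<open>\<alpha>\<close> off the peak of the bump.\<close>

lemma (in prob_space) core_contraction_near:
  assumes m: "2 < m" and R: "0 < R" and \<kappa>0: "0 < \<kappa>0" and \<alpha>: "0 < \<alpha>" "\<alpha> \<le> 1" "\<alpha> * \<epsilon> \<le> 2 * R"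
    and p: "0 < p" "p \<le> 1" and \<epsilon>: "0 < \<epsilon>"
    and \<eta>: "0 < \<eta>" "\<eta> \<le> \<epsilon> / 4" "\<eta> \<le> \<epsilon> / 4 * (p / 2) powr (1 / bump_exponent m)"
    and \<tau>: "\<bar>\<tau>\<bar> \<le> \<eta> * \<alpha>"
    and [measurable]: "Y \<in> borel_measurable M" "D \<in> borel_measurable M"
    and D: "\<And>u. u \<in> space M \<Longrightarrow> 0 \<le> D u" "\<And>u. u \<in> space M \<Longrightarrow> \<alpha> * D u \<le> 1"
    and noise: "p \<le> prob {u \<in> space M. \<epsilon> / 2 \<le> \<bar>Y u\<bar>}"
  shows "(\<integral>u. (1 - \<alpha> * D u) * (1 + core_scale m \<kappa>0 \<alpha> * core_bump m R (\<tau> - \<alpha> * Y u)) \<partial>M)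
    \<le> 1 + core_scale m \<kappa>0 \<alpha> * core_bump m R \<tau>
        - \<kappa>0 * (p / 2) * (\<epsilon> / (2 * R)) powr bump_exponent m * \<alpha> powr (m - 1)"
proof -
  define q where "q = bump_exponent m"
  define \<delta> where "\<delta> = core_scale m \<kappa>0 \<alpha>"
  \<comment> \<open>The drop of the bump at distance \<alpha> \<epsilon> / 4 from its peak.\<close>
  define s where "s = (\<alpha> * \<epsilon> / (2 * R)) powr q"
  define A where "A = {u \<in> space M. \<epsilon> / 2 \<le> \<bar>Y u\<bar>}"
  have A[measurable]: "A \<in> sets M" unfolding A_def by measurable
  have q: "0 < q" "q \<le> 1" using bump_exponent[OF m] by (auto simp: q_def)
  have \<delta>: "0 \<le> \<delta>" "\<delta> = \<kappa>0 * \<alpha> powr (m - 1 - q)"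
    using core_scale_bounds(1)[of m \<kappa>0 \<alpha>] core_scale_eq[OF m \<alpha>(1)] m \<kappa>0 \<alpha> by (auto simp: \<delta>_def q_def)
  have "s \<le> 1 powr q" unfolding s_def using \<alpha> R \<epsilon> q by (intro powr_mono2) (auto simp: field_simps)
  then have s: "0 \<le> s" "s \<le> 1" by (auto simp: s_def)
  have bump: "core_bump m R t = max 0 (1 - (2 * \<bar>t\<bar> / R) powr q)" for t
    using core_bump_eq[OF m R] by (simp add: q_def)
  have [measurable]: "core_bump m R \<in> borel_measurable borel"
    using m R by (intro borel_measurable_continuous_onI continuous_core_bump) auto
  have cb01: "0 \<le> core_bump m R t" "core_bump m R t \<le> 1" for t using core_bump_bounds[OF R] by auto
  have drop: "core_bump m R (\<tau> - \<alpha> * Y u) \<le> 1 - s * indicator A u" if "u \<in> space M" for u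
  proof (cases "u \<in> A")
    case True
    then have "\<epsilon> / 2 \<le> \<bar>Y u\<bar>" by (simp add: A_def)
    then have "\<alpha> * (\<epsilon> / 2) \<le> \<alpha> * \<bar>Y u\<bar>" using \<alpha> by (intro mult_left_mono) auto
    then have "\<alpha> * \<epsilon> / 2 \<le> \<bar>\<alpha> * Y u\<bar>" using \<alpha> by (simp add: abs_mult)
    \<comment> \<open>The step is at least \<alpha> \<epsilon> / 2 and the start at most \<alpha>
      \<epsilon> / 4 from 0, so the iterate ends at distance at least \<alpha> \<epsilon> /
      4.\<close>
    moreover have "\<eta> * \<alpha> \<le> \<alpha> * \<epsilon> / 4"
      using mult_right_mono[OF \<eta>(2), of \<alpha>] \<alpha> by (simp add: mult_ac)
    ultimately have "\<alpha> * \<epsilon> / 4 \<le> \<bar>\<tau> - \<alpha> * Y u\<bar>" using \<tau> by linarith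
    then have "s \<le> (2 * \<bar>\<tau> - \<alpha> * Y u\<bar> / R) powr q"
      unfolding s_def using \<alpha> \<epsilon> R q by (intro powr_mono2) (auto simp: field_simps)
    then show ?thesis using True s unfolding bump by simp
  qed (use cb01 in auto)
  have iA: "integrable M (indicator A :: 'a \<Rightarrow> real)"
    by (rule integrable_real_indicator) (simp_all add: emeasure_eq_measure)
  have "(\<integral>u. (1 - \<alpha> * D u) * (1 + \<delta> * core_bump m R (\<tau> - \<alpha> * Y u)) \<partial>M) \<le> (\<integral>u. 1 + \<delta> * (1 - s * indicator A u) \<partial>M)"
  proof (rule integral_mono_AE)
    show "integrable M (\<lambda>u. (1 - \<alpha> * D u) * (1 + \<delta> * core_bump m R (\<tau> - \<alpha> * Y u)))"
    proof (rule integrable_const_bound[of _ "1 * (1 + \<delta> * 1)"])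
      have "norm ((1 - \<alpha> * D u) * (1 + \<delta> * core_bump m R (\<tau> - \<alpha> * Y u))) \<le> 1 * (1 + \<delta> * 1)" if "u \<in> space M" for u
        unfolding norm_mult using D[OF that] \<alpha> \<delta>(1) cb01[of "\<tau> - \<alpha> * Y u"] mult_left_mono[OF cb01(2)[of "\<tau> - \<alpha> * Y u"] \<delta>(1)]
        by (intro mult_mono) auto
      then show "AE u in M. norm ((1 - \<alpha> * D u) * (1 + \<delta> * core_bump m R (\<tau> - \<alpha> * Y u))) \<le> 1 * (1 + \<delta> * 1)" by auto
    qed simp
    have "(1 - \<alpha> * D u) * (1 + \<delta> * core_bump m R (\<tau> - \<alpha> * Y u)) \<le> 1 + \<delta> * (1 - s * indicator A u)" if "u \<in> space M" for u
    proof -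
      have "(1 - \<alpha> * D u) * (1 + \<delta> * core_bump m R (\<tau> - \<alpha> * Y u)) \<le> 1 * (1 + \<delta> * core_bump m R (\<tau> - \<alpha> * Y u))"
        using D[OF that] \<alpha> \<delta>(1) cb01 by (intro mult_right_mono add_nonneg_nonneg) auto
      also have "\<dots> \<le> 1 + \<delta> * (1 - s * indicator A u)" using mult_left_mono[OF drop[OF that] \<delta>(1)] by simp
      finally show ?thesis .
    qed
    then show "AE u in M. (1 - \<alpha> * D u) * (1 + \<delta> * core_bump m R (\<tau> - \<alpha> * Y u)) \<le> 1 + \<delta> * (1 - s * indicator A u)" by auto
  qed (use iA in auto)
  also have "\<dots> = 1 + \<delta> * (1 - s * prob A)" using iA by (simp add: prob_space)
  also have "\<dots> \<le> 1 + \<delta> * (1 - s * p)"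
    using noise s \<delta>(1) unfolding A_def by (intro add_left_mono mult_left_mono diff_left_mono) auto
  also have "\<dots> \<le> 1 + \<delta> * (core_bump m R \<tau> - p / 2 * s)"
  proof -
    \<comment> \<open>The factor (p/2)^(1/q) in the bound on \<eta> makes the deficit of the bump at
      \<tau> at most half of the mean drop s p produced by the noise.\<close>
    have "(2 * \<bar>\<tau>\<bar> / R) powr q \<le> (2 * (\<epsilon> / 4 * (p / 2) powr (1 / q) * \<alpha>) / R) powr q"
    proof -
      have f: "\<bar>\<tau>\<bar> \<le> \<epsilon> / 4 * (p / 2) powr (1 / q) * \<alpha>"
        using \<tau> mult_right_mono[OF \<eta>(3), of \<alpha>] \<alpha> unfolding q_def by linarith
      have "2 * \<bar>\<tau>\<bar> / R \<le> 2 * (\<epsilon> / 4 * (p / 2) powr (1 / q) * \<alpha>) / R"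
        by (intro divide_right_mono mult_left_mono f) (use R in auto)
      then show ?thesis using R q by (intro powr_mono2) auto
    qed
    also have "2 * (\<epsilon> / 4 * (p / 2) powr (1 / q) * \<alpha>) / R = (\<alpha> * \<epsilon> / (2 * R)) * (p / 2) powr (1 / q)"
      by (simp add: field_simps)
    also have "((\<alpha> * \<epsilon> / (2 * R)) * (p / 2) powr (1 / q)) powr q = s * (p / 2)"
    proof -
      have "((p / 2) powr (1 / q)) powr q = p / 2" using p q by (simp add: powr_powr)
      then show ?thesis unfolding s_def using \<alpha> \<epsilon> R p
        by (subst powr_mult) auto
    qed
    finally have "1 - s * (p / 2) \<le> core_bump m R \<tau>" unfolding bump by simp
    then have "1 - s * p \<le> core_bump m R \<tau> - p / 2 * s" by (simp add: algebra_simps)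
    then show ?thesis using \<delta>(1) by (simp add: mult_left_mono)
  qed
  also have "\<dots> = 1 + \<delta> * core_bump m R \<tau> - \<delta> * (p / 2 * s)" by (simp add: algebra_simps)
  also have "\<delta> * (p / 2 * s) = \<kappa>0 * (p / 2) * (\<epsilon> / (2 * R)) powr q * \<alpha> powr (m - 1)"
  proof -
    have "s = (\<epsilon> / (2 * R)) powr q * \<alpha> powr q"
      unfolding s_def using \<alpha> \<epsilon> R powr_mult[of "\<epsilon> / (2 * R)" \<alpha> q] by (simp add: mult.commute)
    moreover have "\<alpha> powr (m - 1 - q) * \<alpha> powr q = \<alpha> powr (m - 1)" unfolding powr_add[symmetric] by simp
    ultimately show ?thesis unfolding \<delta>(2) by (simp add: mult_ac)
  qed
  finally show ?thesis unfolding \<delta>_def q_def .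
qed

section \<open>Contraction in one coordinate\<close>

text \<open>The assumptions on one coordinate in the form used below, under the law \<open>Q\<close>
  of an innovation. \<open>G\<close> is the full drift at the updated phase and \<open>G'\<close>
  its derivative in t. The mean of \<open>G'\<close> is bounded below in the core and, for \<beta> =
  2, outside; for \<beta> < 2 dissipativity and exponential moments of \<open>G\<close> take over
  outside.\<close>

locale sgd_coordinate = prob_space Q
  for Q :: "'u measure" +
  fixes \<Xi> :: "'b::euclidean_space set" and \<Phi> :: "'b \<Rightarrow> 'u \<Rightarrow> 'b"
    and G G' :: "real \<Rightarrow> 'b \<Rightarrow> 'u \<Rightarrow> real" and L\<Phi> :: "'u \<Rightarrow> real"
    and m \<beta> R LG Lg cb cd rate Ce \<epsilon> p :: real
  assumes m: "2 \<le> m" and \<beta>: "1 \<le> \<beta>" "\<beta> \<le> 2" and R: "0 < R"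
    and par: "0 < LG" "0 < Lg" "0 < cb" "0 < cd" "0 < rate" "0 \<le> Ce" "0 < \<epsilon>" "0 < p"
    and G_measurable: "\<And>\<xi>. \<xi> \<in> \<Xi> \<Longrightarrow> (\<lambda>(t, u). G t \<xi> u) \<in> borel_measurable (borel \<Otimes>\<^sub>M Q)"
    and G'_measurable: "\<And>\<xi>. \<xi> \<in> \<Xi> \<Longrightarrow> (\<lambda>(t, u). G' t \<xi> u) \<in> borel_measurable (borel \<Otimes>\<^sub>M Q)"
    and G_deriv: "\<And>t \<xi> u. \<xi> \<in> \<Xi> \<Longrightarrow> u \<in> space Q \<Longrightarrow> ((\<lambda>t. G t \<xi> u) has_real_derivative G' t \<xi> u) (at t)"
    and G'_bounds: "\<And>t \<xi> u. \<xi> \<in> \<Xi> \<Longrightarrow> u \<in> space Q \<Longrightarrow> 0 \<le> G' t \<xi> u"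
      "\<And>t \<xi> u. \<xi> \<in> \<Xi> \<Longrightarrow> u \<in> space Q \<Longrightarrow> G' t \<xi> u \<le> LG"
    and G_lipschitz: "\<And>t \<xi> \<eta> u. \<xi> \<in> \<Xi> \<Longrightarrow> \<eta> \<in> \<Xi> \<Longrightarrow> u \<in> space Q \<Longrightarrow> \<bar>G t \<xi> u - G t \<eta> u\<bar> \<le> Lg * norm (\<xi> - \<eta>)"
    and mean_core: "\<And>t \<xi>. \<xi> \<in> \<Xi> \<Longrightarrow> \<bar>t\<bar> \<le> R \<Longrightarrow> t \<noteq> 0 \<or> m = 2 \<Longrightarrow> cb * abs_pow t (m - 2) \<le> (\<integral>u. G' t \<xi> u \<partial>Q)"
    and mean_out: "\<And>t \<xi>. \<beta> = 2 \<Longrightarrow> \<xi> \<in> \<Xi> \<Longrightarrow> R \<le> \<bar>t\<bar> \<Longrightarrow> cb \<le> (\<integral>u. G' t \<xi> u \<partial>Q)"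
    and dissipative: "\<And>t \<xi>. \<beta> < 2 \<Longrightarrow> \<xi> \<in> \<Xi> \<Longrightarrow> R \<le> \<bar>t\<bar> \<Longrightarrow> cd * \<bar>t\<bar> powr \<beta> \<le> t * (\<integral>u. G t \<xi> u \<partial>Q)"
    and exp_moment: "\<And>t \<xi>. \<beta> < 2 \<Longrightarrow> \<xi> \<in> \<Xi> \<Longrightarrow>
      (\<integral>\<^sup>+u. ennreal (exp (rate * (\<bar>G t \<xi> u\<bar> / (1 + abs_pow t (\<beta> - 1))))) \<partial>Q) \<le> ennreal Ce"
    and noise: "\<And>\<xi>. 2 < m \<Longrightarrow> \<xi> \<in> \<Xi> \<Longrightarrow> p \<le> prob {u \<in> space Q. \<epsilon> \<le> \<bar>G 0 \<xi> u\<bar>}"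
    and \<Phi>_measurable: "\<And>\<xi>. \<xi> \<in> \<Xi> \<Longrightarrow> \<Phi> \<xi> \<in> borel_measurable Q"
    and \<Phi>_in: "\<And>\<xi> u. \<xi> \<in> \<Xi> \<Longrightarrow> u \<in> space Q \<Longrightarrow> \<Phi> \<xi> u \<in> \<Xi>"
    and L\<Phi>_measurable: "L\<Phi> \<in> borel_measurable Q"
    and L\<Phi>_bounds: "\<And>u. u \<in> space Q \<Longrightarrow> 0 \<le> L\<Phi> u" "\<And>u. u \<in> space Q \<Longrightarrow> L\<Phi> u \<le> 1"
    and L\<Phi>_mean: "(\<integral>u. L\<Phi> u \<partial>Q) < 1"
    and \<Phi>_lipschitz: "\<And>\<xi> \<eta> u. \<xi> \<in> \<Xi> \<Longrightarrow> \<eta> \<in> \<Xi> \<Longrightarrow> u \<in> space Q \<Longrightarrow>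
      norm (\<Phi> \<xi> u - \<Phi> \<eta> u) \<le> L\<Phi> u * norm (\<xi> - \<eta>)"
    and \<Phi>_moment: "\<And>\<xi>. \<xi> \<in> \<Xi> \<Longrightarrow> integrable Q (\<lambda>u. norm (\<Phi> \<xi> u - \<xi>))"
    and G_moment: "\<And>\<xi>. \<beta> = 2 \<Longrightarrow> \<xi> \<in> \<Xi> \<Longrightarrow> integrable Q (\<lambda>u. \<bar>G 0 \<xi> u\<bar>)"
    and \<Xi>_convex: "convex \<Xi>"
begin

section \<open>Moments of the drift and growth of the tail weight\<close>

definition scale :: "real \<Rightarrow> real" where
  "scale t = 1 + abs_pow t (\<beta> - 1)"

text \<open>Bounds the mean of Y^n exp (rate Y / 2) for Y = |G| / scale: half of the exponential
  moment is spent on the power, through x^n \<le> n! exp x.\<close>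

definition moment_bound :: "nat \<Rightarrow> real" where
  "moment_bound n = fact n * (2 / rate) ^ n * Ce"

definition K :: real where
  "K = 1 + (3 * R / 4) powr (1 - \<beta>)"

lemma scale_ge_1: "1 \<le> scale t"
  by (simp add: scale_def abs_pow_def)

lemma scale_pos: "0 < scale t"
  using scale_ge_1[of t] by simp

lemma K_ge_1: "1 \<le> K"
  by (simp add: K_def)

lemma moment_bound_nonneg: "0 \<le> moment_bound n"
  using par by (simp add: moment_bound_def)

text \<open>The left side is the local Lipschitz constant of the tail exponent. A move of size
  \<alpha> |G| therefore changes \<kappa> times that exponent by at most \<kappa> K \<alpha> Y,
  where Y = |G| / scale has an exponential moment uniform in t.\<close>

lemma max_powr_le: "max \<bar>t\<bar> (3 * R / 4) powr (1 - \<beta>) \<le> K / scale t"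
proof -
  define a where "a = max \<bar>t\<bar> (3 * R / 4)"
  have a: "0 < a" "3 * R / 4 \<le> a" using R by (auto simp: a_def)
  have "abs_pow t (\<beta> - 1) \<le> a powr (\<beta> - 1)"
    using \<beta> a by (auto simp: abs_pow_def a_def intro!: powr_mono2)
  moreover have "1 \<le> a powr (\<beta> - 1) * (3 * R / 4) powr (1 - \<beta>)"
  proof -
    have "(3 * R / 4) powr (\<beta> - 1) \<le> a powr (\<beta> - 1)" using a R \<beta> by (intro powr_mono2) auto
    then have "(3 * R / 4) powr (\<beta> - 1) * (3 * R / 4) powr (1 - \<beta>) \<le> a powr (\<beta> - 1) * (3 * R / 4) powr (1 - \<beta>)"
      by (intro mult_right_mono) auto
    then show ?thesis using R unfolding powr_add[symmetric] by simp
  qed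
  ultimately have "scale t \<le> a powr (\<beta> - 1) * K" unfolding scale_def K_def distrib_left by linarith
  then have "a powr (1 - \<beta>) * scale t \<le> a powr (1 - \<beta>) * (a powr (\<beta> - 1) * K)" by (intro mult_left_mono) auto
  also have "\<dots> = (a powr (1 - \<beta>) * a powr (\<beta> - 1)) * K" by simp
  also have "a powr (1 - \<beta>) * a powr (\<beta> - 1) = 1" using a unfolding powr_add[symmetric] by simp
  finally show ?thesis using scale_pos[of t] unfolding a_def[symmetric] by (simp add: field_simps)
qed

lemma tail_weight_eq: "\<beta> < 2 \<Longrightarrow> tail_weight \<beta> R \<kappa> t = exp (\<kappa> * psi (2 - \<beta>) (3 * R / 4) t)"
  using R by (simp add: tail_weight_def psi_def abs_pow_def)

lemma tail_weight_2: "\<beta> = 2 \<Longrightarrow> tail_weight \<beta> R \<kappa> t = 1"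
  by (simp add: tail_weight_def)

lemma tail_weight_ge_1: "0 \<le> \<kappa> \<Longrightarrow> 1 \<le> tail_weight \<beta> R \<kappa> t"
  using tail_weight_2 tail_weight_eq psi_nonneg \<beta> by (cases "\<beta> = 2") auto

lemma tail_weight_inner: "\<bar>t\<bar> \<le> 3 * R / 4 \<Longrightarrow> tail_weight \<beta> R \<kappa> t = 1"
  using tail_weight_2 tail_weight_eq psi_eq_0[of "2 - \<beta>" t "3 * R / 4"] \<beta> by (cases "\<beta> = 2") auto

lemma continuous_tail_weight: "continuous_on UNIV (tail_weight \<beta> R \<kappa>)"
proof (cases "\<beta> = 2")
  case True
  then show ?thesis by (simp add: tail_weight_def[abs_def])
next
  case False
  then have eq: "tail_weight \<beta> R \<kappa> = (\<lambda>t. exp (\<kappa> * max 0 (\<bar>t\<bar> powr (2 - \<beta>) - (3 * R / 4) powr (2 - \<beta>))))"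
    using \<beta> tail_weight_eq by (auto simp: psi_def)
  show ?thesis unfolding eq using False \<beta> R
    by (intro continuous_intros continuous_on_powr') auto
qed

lemma tail_weight_measurable [measurable]: "tail_weight \<beta> R \<kappa> \<in> borel_measurable borel"
  by (rule borel_measurable_continuous_onI[OF continuous_tail_weight])

lemma G_measurable1 [measurable (raw)]: "\<xi> \<in> \<Xi> \<Longrightarrow> G t \<xi> \<in> borel_measurable Q"
proof -
  assume "\<xi> \<in> \<Xi>"
  from measurable_compose[OF measurable_Pair1' G_measurable[OF this], of t] show ?thesis by simp
qed

lemma G'_measurable1 [measurable (raw)]: "\<xi> \<in> \<Xi> \<Longrightarrow> G' t \<xi> \<in> borel_measurable Q"
proof -
  assume "\<xi> \<in> \<Xi>"
  from measurable_compose[OF measurable_Pair1' G'_measurable[OF this], of t] show ?thesis by simp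
qed

lemma tail_weight_ratio:
  assumes b: "\<beta> < 2" and \<kappa>: "0 \<le> \<kappa>"
  shows "tail_weight \<beta> R \<kappa> s \<le> tail_weight \<beta> R \<kappa> t * exp (\<kappa> * K * \<bar>s - t\<bar> / scale t)"
proof -
  have "psi (2 - \<beta>) (3 * R / 4) s - psi (2 - \<beta>) (3 * R / 4) t \<le> \<bar>s - t\<bar> * max \<bar>t\<bar> (3 * R / 4) powr ((2 - \<beta>) - 1)"
    using b \<beta> R by (intro psi_lipschitz) auto
  also have "\<dots> \<le> \<bar>s - t\<bar> * (K / scale t)" using max_powr_le[of t] by (intro mult_left_mono) (auto simp: algebra_simps)
  finally have "\<kappa> * (psi (2 - \<beta>) (3 * R / 4) s - psi (2 - \<beta>) (3 * R / 4) t) \<le> \<kappa> * (\<bar>s - t\<bar> * (K / scale t))"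
    using \<kappa> by (intro mult_left_mono)
  then have "\<kappa> * psi (2 - \<beta>) (3 * R / 4) s \<le> \<kappa> * psi (2 - \<beta>) (3 * R / 4) t + \<kappa> * K * \<bar>s - t\<bar> / scale t"
    by (simp add: algebra_simps)
  then show ?thesis unfolding tail_weight_eq[OF b] exp_add[symmetric] by simp
qed

lemma moments:
  fixes t :: real
  assumes b: "\<beta> < 2" and \<xi>: "\<xi> \<in> \<Xi>"
  defines "Y \<equiv> \<lambda>u. \<bar>G t \<xi> u\<bar> / scale t"
  shows "integrable Q (\<lambda>u. Y u ^ n * exp (rate / 2 * Y u))"
    and "(\<integral>u. Y u ^ n * exp (rate / 2 * Y u) \<partial>Q) \<le> moment_bound n"
proof -
  have [measurable]: "G t \<xi> \<in> borel_measurable Q" using \<xi> by measurable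
  have [measurable]: "Y \<in> borel_measurable Q" unfolding Y_def by measurable
  have Y0: "0 \<le> Y u" for u using scale_pos[of t] by (simp add: Y_def)
  have nn: "(\<integral>\<^sup>+u. ennreal (exp (rate * Y u)) \<partial>Q) \<le> ennreal Ce"
    using exp_moment[OF b \<xi>, of t] by (simp add: Y_def scale_def)
  have int: "integrable Q (\<lambda>u. exp (rate * Y u))"
    by (rule integrableI_bounded) (use le_less_trans[OF nn ennreal_less_top] in auto)
  have le_Ce: "(\<integral>u. exp (rate * Y u) \<partial>Q) \<le> Ce"
    using nn nn_integral_eq_integral[OF int] par by simp
  have pt: "Y u ^ n * exp (rate / 2 * Y u) \<le> fact n * (2 / rate) ^ n * exp (rate * Y u)" for u
  proof -
    have "(rate / 2 * Y u) ^ n \<le> fact n * exp (rate / 2 * Y u)" using par Y0 by (intro power_le_fact_exp) auto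
    then have "(2 / rate) ^ n * (rate / 2 * Y u) ^ n \<le> (2 / rate) ^ n * (fact n * exp (rate / 2 * Y u))"
      using par by (intro mult_left_mono) auto
    moreover have "(2 / rate) ^ n * (rate / 2 * Y u) ^ n = Y u ^ n"
      using par by (simp add: power_mult_distrib[symmetric])
    ultimately have "Y u ^ n * exp (rate / 2 * Y u) \<le> (2 / rate) ^ n * (fact n * exp (rate / 2 * Y u)) * exp (rate / 2 * Y u)"
      by (intro mult_right_mono) auto
    also have "\<dots> = fact n * (2 / rate) ^ n * (exp (rate / 2 * Y u) * exp (rate / 2 * Y u))" by simp
    also have "exp (rate / 2 * Y u) * exp (rate / 2 * Y u) = exp (rate * Y u)" by (simp add: exp_add[symmetric])
    finally show ?thesis .
  qed
  have int2: "integrable Q (\<lambda>u. fact n * (2 / rate) ^ n * exp (rate * Y u))" using int by simp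
  show int3: "integrable Q (\<lambda>u. Y u ^ n * exp (rate / 2 * Y u))"
    by (rule Bochner_Integration.integrable_bound[OF int2]) (use pt Y0 in \<open>auto intro!: AE_I2 order_trans[OF _ abs_ge_self]\<close>)
  have "(\<integral>u. Y u ^ n * exp (rate / 2 * Y u) \<partial>Q) \<le> (\<integral>u. fact n * (2 / rate) ^ n * exp (rate * Y u) \<partial>Q)"
    by (rule integral_mono[OF int3 int2 pt])
  also have "\<dots> = fact n * (2 / rate) ^ n * (\<integral>u. exp (rate * Y u) \<partial>Q)" by simp
  also have "\<dots> \<le> moment_bound n" unfolding moment_bound_def using par le_Ce by (intro mult_left_mono) auto
  finally show "(\<integral>u. Y u ^ n * exp (rate / 2 * Y u) \<partial>Q) \<le> moment_bound n" .
qed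

lemma integrable_G:
  assumes b: "\<beta> < 2" and \<xi>: "\<xi> \<in> \<Xi>"
  shows "integrable Q (G t \<xi>)"
proof (rule Bochner_Integration.integrable_bound)
  show "integrable Q (\<lambda>u. scale t * ((\<bar>G t \<xi> u\<bar> / scale t) ^ 1 * exp (rate / 2 * (\<bar>G t \<xi> u\<bar> / scale t))))"
    by (intro integrable_mult_right moments(1)[OF b \<xi>])
  show "G t \<xi> \<in> borel_measurable Q" using \<xi> by measurable
  have "\<bar>G t \<xi> u\<bar> * 1 \<le> \<bar>G t \<xi> u\<bar> * exp (rate / 2 * (\<bar>G t \<xi> u\<bar> / scale t))" for u
    using par scale_pos[of t] by (intro mult_left_mono) auto
  then show "AE u in Q. norm (G t \<xi> u) \<le> norm (scale t * ((\<bar>G t \<xi> u\<bar> / scale t) ^ 1 * exp (rate / 2 * (\<bar>G t \<xi> u\<bar> / scale t))))"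
    using scale_pos[of t] by (auto simp: abs_mult)
qed

text \<open>\<open>Z\<close> dominates the growth of the logarithm of the tail weight at all points
  within \<alpha> (|G| + Lg) of t. The extra \<alpha> Lg covers the points between the iterates of
  two phases at distance at most 1. The excess in mean is proportional to \<kappa>, so that a small
  \<kappa> keeps it below the curvature gain.\<close>

lemma weight_excess:
  "\<exists>C>0. \<exists>a>0. \<forall>\<kappa>\<in>{0<..1}. \<forall>\<alpha>\<in>{0<..a}. \<forall>t. \<forall>\<xi>\<in>\<Xi>. \<exists>Z. Z \<in> borel_measurable Q \<and>
    (\<forall>u\<in>space Q. 0 \<le> Z u \<and> (\<forall>s. \<bar>s - t\<bar> \<le> \<alpha> * (\<bar>G t \<xi> u\<bar> + Lg) \<longrightarrow>
        tail_weight \<beta> R \<kappa> s \<le> tail_weight \<beta> R \<kappa> t * exp (Z u))) \<and>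
    integrable Q (\<lambda>u. exp (Z u)) \<and> (\<integral>u. exp (Z u) \<partial>Q) \<le> 1 + \<kappa> * C * \<alpha>"
proof (cases "\<beta> = 2")
  case True
  then show ?thesis
    by (intro exI[of _ 1] conjI ballI allI exI[of _ "\<lambda>_. 0"]) (auto simp: tail_weight_def prob_space)
next
  case False
  then have b: "\<beta> < 2" using \<beta> by simp
  \<comment> \<open>From exp Z \<le> 1 + Z exp Z with Z at most linear in Y; the summand 1 makes
    \<open>C\<close> positive. The bound \<open>a\<close> on \<alpha> keeps the exponent within rate
    / 2 times Y + Lg.\<close>
  define C where "C = K * exp (rate * Lg / 2) * (moment_bound 1 + Lg * moment_bound 0) + 1"
  define a where "a = rate / (2 * K)"
  have C: "0 < C" "0 < a" unfolding C_def a_def using K_ge_1 moment_bound_nonneg par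
    by (auto intro!: add_nonneg_pos mult_nonneg_nonneg add_nonneg_nonneg)
  have "\<exists>Z. Z \<in> borel_measurable Q \<and>
    (\<forall>u\<in>space Q. 0 \<le> Z u \<and> (\<forall>s. \<bar>s - t\<bar> \<le> \<alpha> * (\<bar>G t \<xi> u\<bar> + Lg) \<longrightarrow>
        tail_weight \<beta> R \<kappa> s \<le> tail_weight \<beta> R \<kappa> t * exp (Z u))) \<and>
    integrable Q (\<lambda>u. exp (Z u)) \<and> (\<integral>u. exp (Z u) \<partial>Q) \<le> 1 + \<kappa> * C * \<alpha>"
    if \<kappa>: "0 < \<kappa>" "\<kappa> \<le> 1" and \<alpha>: "0 < \<alpha>" "\<alpha> \<le> a" and \<xi>: "\<xi> \<in> \<Xi>" for \<kappa> \<alpha> t \<xi>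
  proof -
    define Y where "Y u = \<bar>G t \<xi> u\<bar> / scale t" for u
    define Z where "Z u = \<kappa> * K * (\<alpha> * (\<bar>G t \<xi> u\<bar> + Lg)) / scale t" for u
    have [measurable]: "G t \<xi> \<in> borel_measurable Q" using \<xi> by measurable
    have Zm[measurable]: "Z \<in> borel_measurable Q" unfolding Z_def by measurable
    have Y0: "0 \<le> Y u" for u using scale_pos[of t] by (simp add: Y_def)
    have Z0: "0 \<le> Z u" for u using \<kappa> \<alpha> K_ge_1 par scale_pos[of t] unfolding Z_def
      by (intro divide_nonneg_nonneg mult_nonneg_nonneg add_nonneg_nonneg) auto
    have ratio: "tail_weight \<beta> R \<kappa> s \<le> tail_weight \<beta> R \<kappa> t * exp (Z u)"
      if "\<bar>s - t\<bar> \<le> \<alpha> * (\<bar>G t \<xi> u\<bar> + Lg)" for s u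
    proof -
      have "tail_weight \<beta> R \<kappa> s \<le> tail_weight \<beta> R \<kappa> t * exp (\<kappa> * K * \<bar>s - t\<bar> / scale t)"
        using \<kappa> by (intro tail_weight_ratio[OF b]) auto
      also have "\<dots> \<le> tail_weight \<beta> R \<kappa> t * exp (Z u)"
        unfolding Z_def using that \<kappa> K_ge_1 scale_pos[of t] tail_weight_ge_1[of \<kappa> t]
        by (auto intro!: mult_left_mono divide_right_mono)
      finally show ?thesis .
    qed
    have Ka: "K * \<alpha> \<le> rate / 2"
    proof -
      have "K * \<alpha> \<le> K * a" using \<alpha> K_ge_1 by (intro mult_left_mono) auto
      then show ?thesis using K_ge_1 by (simp add: a_def)
    qed
    have ZY: "Z u \<le> \<kappa> * (K * \<alpha>) * (Y u + Lg)" for u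
    proof -
      have "Lg / scale t \<le> Lg" using scale_ge_1[of t] par by (simp add: divide_le_eq mult_le_cancel_left1)
      then have "\<kappa> * (K * \<alpha>) * (Y u + Lg / scale t) \<le> \<kappa> * (K * \<alpha>) * (Y u + Lg)"
        using \<kappa> K_ge_1 \<alpha> by (intro mult_left_mono) auto
      moreover have "Z u = \<kappa> * (K * \<alpha>) * (Y u + Lg / scale t)"
        unfolding Z_def Y_def by (simp add: add_divide_distrib algebra_simps)
      ultimately show ?thesis by simp
    qed
    define E where "E u = 1 + \<kappa> * (K * \<alpha>) * exp (rate * Lg / 2) *
        (Y u ^ 1 * exp (rate / 2 * Y u) + Lg * (Y u ^ 0 * exp (rate / 2 * Y u)))" for u
    have eZ: "exp (Z u) \<le> E u" for u
    proof -
      have "Z u \<le> 1 * (rate / 2) * (Y u + Lg)"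
        by (rule order_trans[OF ZY]) (use \<kappa> Ka Y0[of u] par K_ge_1 \<alpha> in \<open>intro mult_right_mono mult_mono; simp\<close>)
      then have e: "exp (Z u) \<le> exp (rate * Lg / 2) * exp (rate / 2 * Y u)"
        unfolding exp_add[symmetric] by (simp add: algebra_simps)
      have "exp (Z u) \<le> 1 + Z u * exp (Z u)" using exp_minus_one_le[of "Z u"] by simp
      also have "Z u * exp (Z u) \<le> (\<kappa> * (K * \<alpha>) * (Y u + Lg)) * (exp (rate * Lg / 2) * exp (rate / 2 * Y u))"
        using e ZY[of u] Z0[of u] order_trans[OF Z0[of u] ZY[of u]] by (intro mult_mono) auto
      also have "1 + \<dots> = E u" unfolding E_def by (simp add: algebra_simps)
      finally show ?thesis by simp
    qed
    have mom: "integrable Q (\<lambda>u. Y u ^ n * exp (rate / 2 * Y u))"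
      "(\<integral>u. Y u ^ n * exp (rate / 2 * Y u) \<partial>Q) \<le> moment_bound n" for n
      using moments[OF b \<xi>, of t n] unfolding Y_def by auto
    have iE: "integrable Q E" unfolding E_def
      by (intro Bochner_Integration.integrable_add integrable_mult_right mom(1)) auto
    have iZ: "integrable Q (\<lambda>u. exp (Z u))"
      by (rule Bochner_Integration.integrable_bound[OF iE]) (use eZ in \<open>auto intro!: AE_I2 order_trans[OF _ abs_ge_self]\<close>)
    have "(\<integral>u. exp (Z u) \<partial>Q) \<le> (\<integral>u. E u \<partial>Q)" by (rule integral_mono[OF iZ iE eZ])
    also have "\<dots> = 1 + \<kappa> * (K * \<alpha>) * exp (rate * Lg / 2) *
        ((\<integral>u. Y u ^ 1 * exp (rate / 2 * Y u) \<partial>Q) + Lg * (\<integral>u. Y u ^ 0 * exp (rate / 2 * Y u) \<partial>Q))"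
      unfolding E_def using mom(1)[of 1] mom(1)[of 0]
      by (subst Bochner_Integration.integral_add; (subst integral_mult_right_zero)?; (subst Bochner_Integration.integral_add)?; simp add: prob_space)
    also have "\<dots> \<le> 1 + \<kappa> * (K * \<alpha>) * exp (rate * Lg / 2) * (moment_bound 1 + Lg * moment_bound 0)"
      using \<kappa> \<alpha> K_ge_1 par by (intro add_left_mono mult_left_mono add_mono mom(2)) auto
    also have "\<dots> = 1 + \<kappa> * (C - 1) * \<alpha>" unfolding C_def by (simp add: algebra_simps)
    also have "\<dots> \<le> 1 + \<kappa> * C * \<alpha>" using \<kappa> \<alpha> by (intro add_left_mono mult_right_mono mult_left_mono) auto
    finally have "(\<integral>u. exp (Z u) \<partial>Q) \<le> 1 + \<kappa> * C * \<alpha>" .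
    then show ?thesis using Zm Z0 ratio iZ by blast
  qed
  then show ?thesis using C by (intro exI[of _ C] exI[of _ a] conjI) auto
qed

text \<open>For |t| \<le> R / 2 the tail weight is 1, and it can exceed 1 only after a jump of at
  least R / 4, which forces \<alpha> (4 S / R) Y \<ge> 1. The n-th power of this quantity bounds the
  indicator of the event, so the excess is of any prescribed order in \<alpha>.\<close>

lemma weight_core_tail:
  "\<exists>C\<ge>0. \<exists>a>0. \<forall>\<kappa>\<in>{0<..1}. \<forall>\<alpha>\<in>{0<..a}. \<forall>t. \<forall>\<xi>\<in>\<Xi>. \<bar>t\<bar> \<le> R / 2 \<longrightarrow>
    integrable Q (\<lambda>u. tail_weight \<beta> R \<kappa> (t - \<alpha> * G t \<xi> u)) \<and>
    (\<integral>u. tail_weight \<beta> R \<kappa> (t - \<alpha> * G t \<xi> u) \<partial>Q) \<le> 1 + C * \<alpha> ^ n"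
proof (cases "\<beta> = 2")
  case True
  then have "tail_weight \<beta> R \<kappa> t = 1" for \<kappa> t by (rule tail_weight_2)
  then show ?thesis by - (rule exI[of _ 0], rule conjI, simp, rule exI[of _ 1], auto simp: prob_space)
next
  case False
  then have b: "\<beta> < 2" using \<beta> by simp
  define S where "S = 1 + R powr (\<beta> - 1)"
  define C where "C = (4 * S / R) ^ n * moment_bound n"
  define a where "a = rate / (2 * K)"
  have S: "0 < S" by (simp add: S_def add_pos_nonneg)
  have C: "0 \<le> C" "0 < a" unfolding C_def a_def using K_ge_1 moment_bound_nonneg par S R by auto
  have "integrable Q (\<lambda>u. tail_weight \<beta> R \<kappa> (t - \<alpha> * G t \<xi> u)) \<and>
    (\<integral>u. tail_weight \<beta> R \<kappa> (t - \<alpha> * G t \<xi> u) \<partial>Q) \<le> 1 + C * \<alpha> ^ n"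
    if \<kappa>: "0 < \<kappa>" "\<kappa> \<le> 1" and \<alpha>: "0 < \<alpha>" "\<alpha> \<le> a" and \<xi>: "\<xi> \<in> \<Xi>" and t: "\<bar>t\<bar> \<le> R / 2" for \<kappa> \<alpha> t \<xi>
  proof -
    define Y where "Y u = \<bar>G t \<xi> u\<bar> / scale t" for u
    have [measurable]: "G t \<xi> \<in> borel_measurable Q" using \<xi> by measurable
    have Y0: "0 \<le> Y u" for u using scale_pos[of t] by (simp add: Y_def)
    have Ka: "\<kappa> * (K * \<alpha>) \<le> 1 * (rate / 2)"
    proof (rule mult_mono)
      have "K * \<alpha> \<le> K * a" using \<alpha> K_ge_1 by (intro mult_left_mono) auto
      then show "K * \<alpha> \<le> rate / 2" using K_ge_1 by (simp add: a_def)
    qed (use \<kappa> K_ge_1 \<alpha> in auto)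
    have sc: "scale t \<le> S"
      using t R \<beta> by (auto simp: scale_def S_def abs_pow_def intro!: powr_mono2)
    define E where "E u = 1 + (\<alpha> * (4 * S / R)) ^ n * (Y u ^ n * exp (rate / 2 * Y u))" for u
    have le: "tail_weight \<beta> R \<kappa> (t - \<alpha> * G t \<xi> u) \<le> E u" for u
    proof (cases "\<bar>t - \<alpha> * G t \<xi> u\<bar> \<le> 3 * R / 4")
      case True
      then have "tail_weight \<beta> R \<kappa> (t - \<alpha> * G t \<xi> u) = 1" by (rule tail_weight_inner)
      moreover have "0 \<le> (\<alpha> * (4 * S / R)) ^ n * (Y u ^ n * exp (rate / 2 * Y u))"
        using \<alpha> S R Y0 by auto
      ultimately show ?thesis by (simp add: E_def)
    next
      case False
      then have "R / 4 \<le> \<bar>\<alpha> * G t \<xi> u\<bar>" using t by linarith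
      then have "R / 4 \<le> \<alpha> * \<bar>G t \<xi> u\<bar>" using \<alpha> by (simp add: abs_mult)
      also have "\<bar>G t \<xi> u\<bar> = Y u * scale t" using scale_pos[of t] by (simp add: Y_def)
      also have "\<alpha> * (Y u * scale t) \<le> \<alpha> * (Y u * S)" using sc Y0 \<alpha> by (intro mult_left_mono) auto
      finally have "1 \<le> \<alpha> * (4 * S / R) * Y u" using R by (simp add: field_simps)
      then have one: "1 \<le> (\<alpha> * (4 * S / R) * Y u) ^ n" by (rule one_le_power)
      have "tail_weight \<beta> R \<kappa> (t - \<alpha> * G t \<xi> u) \<le> tail_weight \<beta> R \<kappa> t * exp (\<kappa> * K * \<bar>(t - \<alpha> * G t \<xi> u) - t\<bar> / scale t)"
        using \<kappa> by (intro tail_weight_ratio[OF b]) auto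
      also have "tail_weight \<beta> R \<kappa> t = 1" using t R by (intro tail_weight_inner) auto
      also have "\<kappa> * K * \<bar>(t - \<alpha> * G t \<xi> u) - t\<bar> / scale t = \<kappa> * (K * \<alpha>) * Y u"
        using \<alpha> by (simp add: Y_def abs_mult)
      also have "1 * exp (\<kappa> * (K * \<alpha>) * Y u) \<le> exp (rate / 2 * Y u)"
        using mult_right_mono[OF Ka Y0[of u]] by simp
      also have "\<dots> \<le> (\<alpha> * (4 * S / R) * Y u) ^ n * exp (rate / 2 * Y u)"
        using mult_right_mono[OF one, of "exp (rate / 2 * Y u)"] by simp
      also have "\<dots> = E u - 1" unfolding E_def power_mult_distrib by simp
      finally show ?thesis by simp
    qed
    have mom: "integrable Q (\<lambda>u. Y u ^ n * exp (rate / 2 * Y u))"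
      "(\<integral>u. Y u ^ n * exp (rate / 2 * Y u) \<partial>Q) \<le> moment_bound n"
      using moments[OF b \<xi>, of t n] unfolding Y_def by auto
    have iE: "integrable Q E" unfolding E_def
      by (intro Bochner_Integration.integrable_add integrable_mult_right mom(1)) auto
    have ge1: "1 \<le> tail_weight \<beta> R \<kappa> s" for s using \<kappa> tail_weight_ge_1 by simp
    have iT: "integrable Q (\<lambda>u. tail_weight \<beta> R \<kappa> (t - \<alpha> * G t \<xi> u))"
    proof (rule Bochner_Integration.integrable_bound[OF iE])
      show "AE u in Q. norm (tail_weight \<beta> R \<kappa> (t - \<alpha> * G t \<xi> u)) \<le> norm (E u)"
        using le ge1 by (intro AE_I2) (auto intro: order_trans[OF _ abs_ge_self] simp: abs_of_nonneg[OF order_trans[OF zero_le_one ge1]])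
    qed measurable
    have "(\<integral>u. tail_weight \<beta> R \<kappa> (t - \<alpha> * G t \<xi> u) \<partial>Q) \<le> (\<integral>u. E u \<partial>Q)" by (rule integral_mono[OF iT iE le])
    also have "\<dots> = 1 + (\<alpha> * (4 * S / R)) ^ n * (\<integral>u. Y u ^ n * exp (rate / 2 * Y u) \<partial>Q)"
      unfolding E_def using mom(1) by (simp add: prob_space)
    also have "\<dots> \<le> 1 + (\<alpha> * (4 * S / R)) ^ n * moment_bound n"
      using \<alpha> S R by (intro add_left_mono mult_left_mono mom(2)) auto
    also have "\<dots> = 1 + C * \<alpha> ^ n" unfolding C_def power_mult_distrib by simp
    finally show ?thesis using iT by simp
  qed
  then show ?thesis using C by (intro exI[of _ C] exI[of _ a] conjI) auto
qed

text \<open>The exponential of the change of the exponent is expanded to second order. Dissipativity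
  bounds the mean of the linear part \<open>w\<close> below by cd \<alpha>, and its square, even
  times an exponential, has mean of order \<alpha>^2. Because \<kappa> \<le> 1, the factor
  \<kappa>^2 of the second-order term is at most \<kappa>, and gain and error share the factor
  \<kappa>.\<close>

lemma weight_drift:
  assumes b: "\<beta> < 2"
  shows "\<exists>C\<ge>0. \<exists>a>0. \<forall>\<kappa>\<in>{0<..1}. \<forall>\<alpha>\<in>{0<..a}. \<forall>t. \<forall>\<xi>\<in>\<Xi>. R \<le> \<bar>t\<bar> \<longrightarrow>
    integrable Q (\<lambda>u. tail_weight \<beta> R \<kappa> (t - \<alpha> * G t \<xi> u)) \<and>
    (\<integral>u. tail_weight \<beta> R \<kappa> (t - \<alpha> * G t \<xi> u) \<partial>Q)
      \<le> tail_weight \<beta> R \<kappa> t * (1 - \<kappa> * (2 - \<beta>) * cd * \<alpha> + \<kappa> * C * \<alpha>\<^sup>2)"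
proof -
  define b where "b = 2 - \<beta>"
  have b01: "0 < b" "b \<le> 1" using assms \<beta> by (auto simp: b_def)
  define B where "B = 4 * R powr (- b) + 1"
  define C where "C = K\<^sup>2 * B * moment_bound 2"
  define a where "a = rate / (2 * K)"
  have C: "0 \<le> C" "0 < a" "1 \<le> B" unfolding C_def a_def B_def using K_ge_1 moment_bound_nonneg par by auto
  have "integrable Q (\<lambda>u. tail_weight \<beta> R \<kappa> (t - \<alpha> * G t \<xi> u)) \<and>
    (\<integral>u. tail_weight \<beta> R \<kappa> (t - \<alpha> * G t \<xi> u) \<partial>Q)
      \<le> tail_weight \<beta> R \<kappa> t * (1 - \<kappa> * b * cd * \<alpha> + \<kappa> * C * \<alpha>\<^sup>2)"
    if \<kappa>: "0 < \<kappa>" "\<kappa> \<le> 1" and \<alpha>: "0 < \<alpha>" "\<alpha> \<le> a" and \<xi>: "\<xi> \<in> \<Xi>" and t: "R \<le> \<bar>t\<bar>" for \<kappa> \<alpha> t \<xi>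
  proof -
    define Y where "Y u = \<bar>G t \<xi> u\<bar> / scale t" for u
    define w where "w u = sgn t * \<bar>t\<bar> powr (b - 1) * (\<alpha> * G t \<xi> u)" for u
    define E where "E u = 1 - \<kappa> * b * w u + \<kappa> * B * K\<^sup>2 * \<alpha>\<^sup>2 * (Y u ^ 2 * exp (rate / 2 * Y u))" for u
    have [measurable]: "G t \<xi> \<in> borel_measurable Q" using \<xi> by measurable
    have t0: "t \<noteq> 0" using t R by auto
    have Y0: "0 \<le> Y u" for u using scale_pos[of t] by (simp add: Y_def)
    have Ka: "K * \<alpha> \<le> rate / 2"
    proof -
      have "K * \<alpha> \<le> K * a" using \<alpha> K_ge_1 by (intro mult_left_mono) auto
      then show ?thesis using K_ge_1 by (simp add: a_def)
    qed
    have wY: "\<bar>w u\<bar> \<le> \<alpha> * K * Y u" for u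
    proof -
      have mx: "max \<bar>t\<bar> (3 * R / 4) = \<bar>t\<bar>" using t R by auto
      have "\<bar>w u\<bar> = \<bar>t\<bar> powr (1 - \<beta>) * (\<alpha> * \<bar>G t \<xi> u\<bar>)"
        using t0 \<alpha> unfolding w_def b_def by (simp add: abs_mult abs_sgn_eq)
      also have "\<dots> \<le> (K / scale t) * (\<alpha> * \<bar>G t \<xi> u\<bar>)"
        using max_powr_le[of t] \<alpha> unfolding mx by (intro mult_right_mono) auto
      also have "\<dots> = \<alpha> * K * Y u" by (simp add: Y_def)
      finally show ?thesis .
    qed
    have le: "tail_weight \<beta> R \<kappa> (t - \<alpha> * G t \<xi> u) \<le> tail_weight \<beta> R \<kappa> t * E u" for u
    proof -
      define d where "d = psi b (3 * R / 4) (t - \<alpha> * G t \<xi> u) - psi b (3 * R / 4) t"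
      \<comment> \<open>The minimum keeps the sharp expansion and at the same time |D| \<le> |w|, so
        that the remainder is dominated by the exponential moment.\<close>
      define D where "D = min \<bar>w u\<bar> (- b * w u + 4 * R powr (- b) * (w u)\<^sup>2)"
      have "d \<le> D" unfolding d_def D_def
        using psi_drift[OF b01 R t refl, of "w u" "\<alpha> * G t \<xi> u"] by (simp add: w_def)
      have bw: "b * \<bar>w u\<bar> \<le> 1 * \<bar>w u\<bar>" using b01 by (intro mult_right_mono) auto
      have "- (b * \<bar>w u\<bar>) \<le> - b * w u" using b01 by (simp add: mult_left_mono)
      moreover have "0 \<le> 4 * R powr (- b) * (w u)\<^sup>2" by simp
      ultimately have "- \<bar>w u\<bar> \<le> - b * w u + 4 * R powr (- b) * (w u)\<^sup>2" using bw by linarith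
      then have D: "\<bar>D\<bar> \<le> \<bar>w u\<bar>" unfolding D_def by auto
      have kD: "\<bar>\<kappa> * D\<bar> \<le> \<bar>w u\<bar>"
        using mult_mono[of \<kappa> 1 "\<bar>D\<bar>" "\<bar>w u\<bar>"] \<kappa> D by (simp add: abs_mult)
      have w2: "(w u)\<^sup>2 \<le> (\<alpha> * K * Y u)\<^sup>2" using power_mono[OF wY[of u], of 2] by simp
      have "\<bar>w u\<bar> \<le> rate / 2 * Y u"
        using wY[of u] mult_right_mono[OF Ka Y0[of u]] by (simp add: mult.commute)
      then have ew: "exp \<bar>w u\<bar> \<le> exp (rate / 2 * Y u)" by simp
      have e1: "1 \<le> exp (rate / 2 * Y u)" using par Y0 by simp
      have a1: "exp (\<kappa> * d) \<le> exp (\<kappa> * D)" using \<open>d \<le> D\<close> \<kappa> by simp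
      have a2: "exp (\<kappa> * D) \<le> 1 + \<kappa> * D + (\<kappa> * D)\<^sup>2 * exp \<bar>\<kappa> * D\<bar>" by (rule exp_le_second_order)
      have a3: "\<kappa> * D \<le> \<kappa> * (- b * w u + 4 * R powr (- b) * (w u)\<^sup>2)"
        using \<kappa> by (intro mult_left_mono) (auto simp: D_def)
      have a4: "(\<kappa> * D)\<^sup>2 * exp \<bar>\<kappa> * D\<bar> \<le> (\<kappa> * (w u)\<^sup>2) * exp (rate / 2 * Y u)"
      proof (rule mult_mono)
        have "D\<^sup>2 \<le> (w u)\<^sup>2" using D by (simp add: abs_le_square_iff[symmetric])
        then have "\<kappa> * \<kappa> * D\<^sup>2 \<le> \<kappa> * 1 * (w u)\<^sup>2" using \<kappa> by (intro mult_mono) auto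
        then show "(\<kappa> * D)\<^sup>2 \<le> \<kappa> * (w u)\<^sup>2" by (simp add: power2_eq_square mult_ac)
        show "exp \<bar>\<kappa> * D\<bar> \<le> exp (rate / 2 * Y u)" using kD ew by (meson exp_le_cancel_iff order_trans)
      qed (use \<kappa> in auto)
      from a1 a2 a3 a4 have 1: "exp (\<kappa> * d) \<le> 1 + \<kappa> * (- b * w u + 4 * R powr (- b) * (w u)\<^sup>2) + (\<kappa> * (w u)\<^sup>2) * exp (rate / 2 * Y u)"
        by linarith
      have "4 * R powr (- b) * (w u)\<^sup>2 * 1 \<le> 4 * R powr (- b) * (w u)\<^sup>2 * exp (rate / 2 * Y u)"
        using e1 by (intro mult_left_mono) auto
      then have "\<kappa> * (4 * R powr (- b) * (w u)\<^sup>2) \<le> \<kappa> * (4 * R powr (- b) * (w u)\<^sup>2 * exp (rate / 2 * Y u))"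
        using \<kappa> by (intro mult_left_mono) auto
      with 1 have "exp (\<kappa> * d) \<le> 1 - \<kappa> * b * w u + \<kappa> * B * ((w u)\<^sup>2 * exp (rate / 2 * Y u))"
        unfolding B_def by (simp add: algebra_simps)
      also have "\<kappa> * B * ((w u)\<^sup>2 * exp (rate / 2 * Y u)) \<le> \<kappa> * B * ((\<alpha> * K * Y u)\<^sup>2 * exp (rate / 2 * Y u))"
        using w2 \<kappa> C by (intro mult_left_mono mult_right_mono) auto
      also have "1 - \<kappa> * b * w u + \<dots> = E u" unfolding E_def by (simp add: power_mult_distrib mult_ac)
      finally have "exp (\<kappa> * d) \<le> E u" by simp
      then have "tail_weight \<beta> R \<kappa> t * exp (\<kappa> * d) \<le> tail_weight \<beta> R \<kappa> t * E u"
        using tail_weight_ge_1[of \<kappa> t] \<kappa> by (intro mult_left_mono) auto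
      moreover have "tail_weight \<beta> R \<kappa> t * exp (\<kappa> * d) = tail_weight \<beta> R \<kappa> (t - \<alpha> * G t \<xi> u)"
        unfolding tail_weight_eq[OF assms] exp_add[symmetric] d_def b_def by (simp add: algebra_simps)
      ultimately show ?thesis by simp
    qed
    have mom: "integrable Q (\<lambda>u. Y u ^ 2 * exp (rate / 2 * Y u))"
      "(\<integral>u. Y u ^ 2 * exp (rate / 2 * Y u) \<partial>Q) \<le> moment_bound 2"
      using moments[OF assms \<xi>, of t 2] unfolding Y_def by auto
    have iG: "integrable Q (G t \<xi>)" by (rule integrable_G[OF assms \<xi>])
    have iw: "integrable Q w" unfolding w_def by (intro integrable_mult_right iG)
    have iE: "integrable Q E" unfolding E_def
      by (intro Bochner_Integration.integrable_add Bochner_Integration.integrable_diff integrable_mult_right mom(1) iw) auto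
    have ge1: "1 \<le> tail_weight \<beta> R \<kappa> s" for s using \<kappa> tail_weight_ge_1 by simp
    have iTE: "integrable Q (\<lambda>u. tail_weight \<beta> R \<kappa> t * E u)" using iE by simp
    have iT: "integrable Q (\<lambda>u. tail_weight \<beta> R \<kappa> (t - \<alpha> * G t \<xi> u))"
    proof (rule Bochner_Integration.integrable_bound[OF iTE])
      show "AE u in Q. norm (tail_weight \<beta> R \<kappa> (t - \<alpha> * G t \<xi> u)) \<le> norm (tail_weight \<beta> R \<kappa> t * E u)"
        using le ge1 by (intro AE_I2) (auto intro: order_trans[OF _ abs_ge_self] simp: abs_of_nonneg[OF order_trans[OF zero_le_one ge1]])
    qed measurable
    have Ew: "cd * \<alpha> \<le> (\<integral>u. w u \<partial>Q)"
    proof -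
      have "cd * \<bar>t\<bar> powr \<beta> \<le> t * (\<integral>u. G t \<xi> u \<partial>Q)" by (rule dissipative[OF assms \<xi> t])
      \<comment> \<open>Dissipativity is multiplied by \<alpha> |t|^(-\<beta>), which turns t into
        the coefficient sgn t |t|^(b-1) of \<open>w\<close>.\<close>
      then have i1: "\<bar>t\<bar> powr (- \<beta>) * \<alpha> * (cd * \<bar>t\<bar> powr \<beta>) \<le> \<bar>t\<bar> powr (- \<beta>) * \<alpha> * (t * (\<integral>u. G t \<xi> u \<partial>Q))"
        using \<alpha> by (intro mult_left_mono) auto
      have "\<bar>t\<bar> powr (- \<beta>) * \<bar>t\<bar> powr \<beta> = 1" using t0 unfolding powr_add[symmetric] by simp
      then have i2: "\<bar>t\<bar> powr (- \<beta>) * \<alpha> * (cd * \<bar>t\<bar> powr \<beta>) = cd * \<alpha>" by (simp add: mult_ac)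
      have *: "\<bar>t\<bar> powr (- \<beta>) * t = sgn t * \<bar>t\<bar> powr (b - 1)"
      proof -
        have "\<bar>t\<bar> powr (b - 1) = \<bar>t\<bar> powr (- \<beta>) * \<bar>t\<bar> powr 1" unfolding powr_add[symmetric] b_def by simp
        then show ?thesis using t0 by (simp add: sgn_if abs_if)
      qed
      have "\<bar>t\<bar> powr (- \<beta>) * \<alpha> * (t * (\<integral>u. G t \<xi> u \<partial>Q)) = (\<integral>u. w u \<partial>Q)"
      proof -
        have "(\<integral>u. w u \<partial>Q) = sgn t * \<bar>t\<bar> powr (b - 1) * (\<alpha> * (\<integral>u. G t \<xi> u \<partial>Q))" unfolding w_def by simp
        also have "\<dots> = (\<bar>t\<bar> powr (- \<beta>) * t) * (\<alpha> * (\<integral>u. G t \<xi> u \<partial>Q))" using * by simp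
        finally show ?thesis by (simp only: mult_ac)
      qed
      with i1 i2 show ?thesis by simp
    qed
    have "(\<integral>u. tail_weight \<beta> R \<kappa> (t - \<alpha> * G t \<xi> u) \<partial>Q) \<le> (\<integral>u. tail_weight \<beta> R \<kappa> t * E u \<partial>Q)"
      by (rule integral_mono[OF iT iTE le])
    also have "\<dots> = tail_weight \<beta> R \<kappa> t * (\<integral>u. E u \<partial>Q)" by simp
    also have "(\<integral>u. E u \<partial>Q) = 1 - \<kappa> * b * (\<integral>u. w u \<partial>Q) + \<kappa> * B * K\<^sup>2 * \<alpha>\<^sup>2 * (\<integral>u. Y u ^ 2 * exp (rate / 2 * Y u) \<partial>Q)"
      unfolding E_def using mom(1) iw by (simp add: prob_space)
    also have "tail_weight \<beta> R \<kappa> t * \<dots> \<le> tail_weight \<beta> R \<kappa> t * (1 - \<kappa> * b * cd * \<alpha> + \<kappa> * C * \<alpha>\<^sup>2)"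
    proof (rule mult_left_mono)
      have "\<kappa> * b * (cd * \<alpha>) \<le> \<kappa> * b * (\<integral>u. w u \<partial>Q)" using Ew \<kappa> b01 by (intro mult_left_mono) auto
      moreover have "\<kappa> * B * K\<^sup>2 * \<alpha>\<^sup>2 * (\<integral>u. Y u ^ 2 * exp (rate / 2 * Y u) \<partial>Q) \<le> \<kappa> * B * K\<^sup>2 * \<alpha>\<^sup>2 * moment_bound 2"
        using mom(2) \<kappa> C by (intro mult_left_mono) auto
      moreover have "\<kappa> * B * K\<^sup>2 * \<alpha>\<^sup>2 * moment_bound 2 = \<kappa> * C * \<alpha>\<^sup>2" unfolding C_def by (simp add: mult_ac)
      ultimately show "1 - \<kappa> * b * (\<integral>u. w u \<partial>Q) + \<kappa> * B * K\<^sup>2 * \<alpha>\<^sup>2 * (\<integral>u. Y u ^ 2 * exp (rate / 2 * Y u) \<partial>Q)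
          \<le> 1 - \<kappa> * b * cd * \<alpha> + \<kappa> * C * \<alpha>\<^sup>2"
        using mult.assoc[of "\<kappa> * b" cd \<alpha>] by linarith
    qed (use order_trans[OF zero_le_one ge1] in auto)
    finally show ?thesis using iT by simp
  qed
  then show ?thesis using C unfolding b_def by (intro exI[of _ C] exI[of _ a] conjI) auto
qed

section \<open>Horizontal segments: the one-step factor in the core, the middle and the outer
  region\<close>

definition weight1 :: "real \<Rightarrow> real \<Rightarrow> real \<Rightarrow> real \<Rightarrow> real" where
  "weight1 \<kappa> \<kappa>0 \<alpha> t = tail_weight \<beta> R \<kappa> t + core_scale m \<kappa>0 \<alpha> * core_bump m R t"

lemma continuous_weight1: "continuous_on UNIV (weight1 \<kappa> \<kappa>0 \<alpha>)"
  unfolding weight1_def by (intro continuous_intros continuous_tail_weight continuous_core_bump m R)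

lemma weight1_measurable [measurable]: "weight1 \<kappa> \<kappa>0 \<alpha> \<in> borel_measurable borel"
  by (rule borel_measurable_continuous_onI[OF continuous_weight1])

lemma weight1_bounds:
  assumes "0 < \<kappa>" "0 < \<kappa>0" "0 < \<alpha>" "\<alpha> \<le> 1"
  shows "1 \<le> weight1 \<kappa> \<kappa>0 \<alpha> t" "tail_weight \<beta> R \<kappa> t \<le> weight1 \<kappa> \<kappa>0 \<alpha> t"
    "weight1 \<kappa> \<kappa>0 \<alpha> t \<le> tail_weight \<beta> R \<kappa> t + \<kappa>0 * \<alpha>"
proof -
  have d: "0 \<le> core_scale m \<kappa>0 \<alpha>" "core_scale m \<kappa>0 \<alpha> \<le> \<kappa>0 * \<alpha>"
    using core_scale_bounds m assms by auto
  have c: "0 \<le> core_bump m R t" "core_bump m R t \<le> 1" using core_bump_bounds[OF R] by auto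
  have "core_scale m \<kappa>0 \<alpha> * core_bump m R t \<le> core_scale m \<kappa>0 \<alpha> * 1" using c d by (intro mult_left_mono)
  then show "weight1 \<kappa> \<kappa>0 \<alpha> t \<le> tail_weight \<beta> R \<kappa> t + \<kappa>0 * \<alpha>" using d unfolding weight1_def by linarith
  have "0 \<le> core_scale m \<kappa>0 \<alpha> * core_bump m R t" using c d by simp
  then show "tail_weight \<beta> R \<kappa> t \<le> weight1 \<kappa> \<kappa>0 \<alpha> t" "1 \<le> weight1 \<kappa> \<kappa>0 \<alpha> t"
    using tail_weight_ge_1[of \<kappa> t] assms unfolding weight1_def by auto
qed

lemma weight1_outside: "R / 2 \<le> \<bar>t\<bar> \<Longrightarrow> weight1 \<kappa> \<kappa>0 \<alpha> t = tail_weight \<beta> R \<kappa> t"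
  unfolding weight1_def using core_bump_outside[OF m R] by simp

lemma G_lipschitz_t:
  assumes "\<xi> \<in> \<Xi>" "u \<in> space Q"
  shows "\<bar>G t \<xi> u - G s \<xi> u\<bar> \<le> LG * \<bar>t - s\<bar>"
proof -
  have "norm (G t \<xi> u - G s \<xi> u) \<le> LG * norm (t - s)"
    by (rule field_differentiable_bound[of UNIV _ "\<lambda>t. G' t \<xi> u"])
      (use G_deriv[OF assms] G'_bounds[OF assms] in \<open>auto simp: has_field_derivative_at_within\<close>)
  then show ?thesis by simp
qed

lemma integrable_G': "\<xi> \<in> \<Xi> \<Longrightarrow> integrable Q (G' t \<xi>)"
  by (rule integrable_const_bound[of _ LG]) (use G'_bounds in \<open>auto intro!: AE_I2\<close>)

lemma step_factor:
  assumes "\<alpha> * LG \<le> 1" "0 < \<alpha>" "\<xi> \<in> \<Xi>" "u \<in> space Q"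
  shows "0 \<le> 1 - \<alpha> * G' t \<xi> u" "1 - \<alpha> * G' t \<xi> u \<le> 1"
proof -
  have "\<alpha> * G' t \<xi> u \<le> \<alpha> * LG" using assms G'_bounds by (intro mult_left_mono) auto
  then show "0 \<le> 1 - \<alpha> * G' t \<xi> u" using assms(1) by linarith
  show "1 - \<alpha> * G' t \<xi> u \<le> 1" using assms G'_bounds by simp
qed

lemma integrable_step_weight:
  assumes \<alpha>: "\<alpha> * LG \<le> 1" "0 < \<alpha>" "\<alpha> \<le> 1" and \<xi>: "\<xi> \<in> \<Xi>" and \<kappa>: "0 < \<kappa>" "0 < \<kappa>0"
    and T: "integrable Q (\<lambda>u. tail_weight \<beta> R \<kappa> (t - \<alpha> * G t \<xi> u))"
  shows "integrable Q (\<lambda>u. (1 - \<alpha> * G' t \<xi> u) * weight1 \<kappa> \<kappa>0 \<alpha> (t - \<alpha> * G t \<xi> u))"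
proof (rule Bochner_Integration.integrable_bound)
  show "integrable Q (\<lambda>u. tail_weight \<beta> R \<kappa> (t - \<alpha> * G t \<xi> u) + \<kappa>0 * \<alpha>)" using T by simp
  have [measurable]: "G t \<xi> \<in> borel_measurable Q" "G' t \<xi> \<in> borel_measurable Q" using \<xi> by measurable
  show "(\<lambda>u. (1 - \<alpha> * G' t \<xi> u) * weight1 \<kappa> \<kappa>0 \<alpha> (t - \<alpha> * G t \<xi> u)) \<in> borel_measurable Q" by measurable
  have "norm ((1 - \<alpha> * G' t \<xi> u) * weight1 \<kappa> \<kappa>0 \<alpha> (t - \<alpha> * G t \<xi> u)) \<le> norm (tail_weight \<beta> R \<kappa> (t - \<alpha> * G t \<xi> u) + \<kappa>0 * \<alpha>)"
    if u: "u \<in> space Q" for u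
  proof -
    note w = weight1_bounds[OF \<kappa> \<alpha>(2,3), of "t - \<alpha> * G t \<xi> u"]
    have "(1 - \<alpha> * G' t \<xi> u) * weight1 \<kappa> \<kappa>0 \<alpha> (t - \<alpha> * G t \<xi> u) \<le> 1 * weight1 \<kappa> \<kappa>0 \<alpha> (t - \<alpha> * G t \<xi> u)"
      using step_factor[OF \<alpha>(1,2) \<xi> u, of t] w by (intro mult_right_mono) auto
    moreover have "0 \<le> (1 - \<alpha> * G' t \<xi> u) * weight1 \<kappa> \<kappa>0 \<alpha> (t - \<alpha> * G t \<xi> u)"
      using step_factor[OF \<alpha>(1,2) \<xi> u, of t] w by (intro mult_nonneg_nonneg) auto
    ultimately show ?thesis unfolding real_norm_def using w by linarith
  qed
  then show "AE u in Q. norm ((1 - \<alpha> * G' t \<xi> u) * weight1 \<kappa> \<kappa>0 \<alpha> (t - \<alpha> * G t \<xi> u)) \<le> norm (tail_weight \<beta> R \<kappa> (t - \<alpha> * G t \<xi> u) + \<kappa>0 * \<alpha>)"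
    by auto
qed

text \<open>Here the mean of \<open>G'\<close> is at least c2. The bounds on \<kappa> and \<kappa>0
  let the tail weight and the bump lose c2 / 4 times \<alpha> each, which leaves a gain of c2 / 2
  times \<alpha>.\<close>

lemma contraction_middle:
  "\<exists>k>0. \<exists>k0>0. \<exists>c>0. \<exists>a>0. \<forall>\<kappa>\<in>{0<..k}. \<forall>\<kappa>0\<in>{0<..k0}. \<forall>\<alpha>\<in>{0<..a}. \<forall>t. \<forall>\<xi>\<in>\<Xi>.
    R / 2 \<le> \<bar>t\<bar> \<and> (\<bar>t\<bar> \<le> R \<or> \<beta> = 2) \<longrightarrow>
    (\<integral>u. (1 - \<alpha> * G' t \<xi> u) * weight1 \<kappa> \<kappa>0 \<alpha> (t - \<alpha> * G t \<xi> u) \<partial>Q) \<le> (1 - c * \<alpha>) * weight1 \<kappa> \<kappa>0 \<alpha> t"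
proof -
  obtain C a where C: "0 < C" "0 < a" and exc: "\<forall>\<kappa>\<in>{0<..1}. \<forall>\<alpha>\<in>{0<..a}. \<forall>t. \<forall>\<xi>\<in>\<Xi>. \<exists>Z. Z \<in> borel_measurable Q \<and>
    (\<forall>u\<in>space Q. 0 \<le> Z u \<and> (\<forall>s. \<bar>s - t\<bar> \<le> \<alpha> * (\<bar>G t \<xi> u\<bar> + Lg) \<longrightarrow>
        tail_weight \<beta> R \<kappa> s \<le> tail_weight \<beta> R \<kappa> t * exp (Z u))) \<and>
    integrable Q (\<lambda>u. exp (Z u)) \<and> (\<integral>u. exp (Z u) \<partial>Q) \<le> 1 + \<kappa> * C * \<alpha>"
    using weight_excess by blast
  \<comment> \<open>Up to \<open>R\<close> the core bound is used at its smallest value, at |t| = R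
    / 2; beyond \<open>R\<close> it is the curvature bound for \<beta> = 2.\<close>
  define c2 where "c2 = min cb (cb * (R / 2) powr (m - 2))"
  have c2: "0 < c2" using par R by (simp add: c2_def)
  have mean: "c2 \<le> (\<integral>u. G' t \<xi> u \<partial>Q)" if "R / 2 \<le> \<bar>t\<bar> \<and> (\<bar>t\<bar> \<le> R \<or> \<beta> = 2)" "\<xi> \<in> \<Xi>" for t \<xi>
  proof (cases "\<bar>t\<bar> \<le> R")
    case True
    have "(R / 2) powr (m - 2) \<le> abs_pow t (m - 2)" using that R m by (auto simp: abs_pow_def intro!: powr_mono2)
    then have "cb * (R / 2) powr (m - 2) \<le> cb * abs_pow t (m - 2)" using par by (intro mult_left_mono) auto
    also have "\<dots> \<le> (\<integral>u. G' t \<xi> u \<partial>Q)" using that R True by (intro mean_core) auto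
    finally show ?thesis by (simp add: c2_def)
  next
    case False
    then show ?thesis using mean_out[of \<xi> t] that by (simp add: c2_def)
  qed
  define k where "k = min 1 (c2 / (4 * C))"
  define k0 where "k0 = c2 / 4"
  define a' where "a' = min a (min 1 (1 / LG))"
  have pos: "0 < k" "0 < k0" "0 < c2 / 2" "0 < a'" using c2 C par by (auto simp: k_def k0_def a'_def)
  have "(\<integral>u. (1 - \<alpha> * G' t \<xi> u) * weight1 \<kappa> \<kappa>0 \<alpha> (t - \<alpha> * G t \<xi> u) \<partial>Q) \<le> (1 - c2 / 2 * \<alpha>) * weight1 \<kappa> \<kappa>0 \<alpha> t"
    if \<kappa>: "0 < \<kappa>" "\<kappa> \<le> k" "0 < \<kappa>0" "\<kappa>0 \<le> k0" and \<alpha>: "0 < \<alpha>" "\<alpha> \<le> a'" and \<xi>: "\<xi> \<in> \<Xi>"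
      and t: "R / 2 \<le> \<bar>t\<bar> \<and> (\<bar>t\<bar> \<le> R \<or> \<beta> = 2)" for \<kappa> \<kappa>0 \<alpha> t \<xi>
  proof -
    have \<alpha>': "\<alpha> \<le> a" "\<alpha> \<le> 1" "\<alpha> * LG \<le> 1" using \<alpha> par by (auto simp: a'_def field_simps)
    have \<kappa>': "\<kappa> \<le> 1" "\<kappa> * C \<le> c2 / 4" "\<kappa>0 \<le> c2 / 4" using \<kappa> C by (auto simp: k_def k0_def field_simps)
    obtain Z where Z: "Z \<in> borel_measurable Q" "\<And>u. u \<in> space Q \<Longrightarrow> 0 \<le> Z u"
      "\<And>u s. u \<in> space Q \<Longrightarrow> \<bar>s - t\<bar> \<le> \<alpha> * (\<bar>G t \<xi> u\<bar> + Lg) \<Longrightarrow> tail_weight \<beta> R \<kappa> s \<le> tail_weight \<beta> R \<kappa> t * exp (Z u)"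
      "integrable Q (\<lambda>u. exp (Z u))" "(\<integral>u. exp (Z u) \<partial>Q) \<le> 1 + \<kappa> * C * \<alpha>"
      using exc[rule_format, of \<kappa> \<alpha> \<xi> t] \<kappa> \<kappa>' \<alpha> \<alpha>' \<xi> by auto
    let ?T = "tail_weight \<beta> R \<kappa>"
    have T1: "1 \<le> ?T s" for s using \<kappa> by (intro tail_weight_ge_1) auto
    have Tle: "?T (t - \<alpha> * G t \<xi> u) \<le> ?T t * exp (Z u)" if "u \<in> space Q" for u
      using that \<alpha> par by (intro Z(3)) (auto simp: abs_mult intro!: mult_left_mono)
    have [measurable]: "G t \<xi> \<in> borel_measurable Q" using \<xi> by measurable
    have iTZ: "integrable Q (\<lambda>u. ?T t * exp (Z u))" using Z(4) by simp
    have iT: "integrable Q (\<lambda>u. ?T (t - \<alpha> * G t \<xi> u))"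
    proof (rule Bochner_Integration.integrable_bound[OF iTZ])
      show "AE u in Q. norm (?T (t - \<alpha> * G t \<xi> u)) \<le> norm (?T t * exp (Z u))"
        using Tle by (intro AE_I2) (auto intro: order_trans[OF _ abs_ge_self] simp: abs_of_nonneg[OF order_trans[OF zero_le_one T1]])
    qed measurable
    note iV = integrable_step_weight[OF \<alpha>'(3) \<alpha>(1) \<alpha>'(2) \<xi> \<kappa>(1,3) iT]
    have pt: "(1 - \<alpha> * G' t \<xi> u) * weight1 \<kappa> \<kappa>0 \<alpha> (t - \<alpha> * G t \<xi> u) \<le> ?T t * (exp (Z u) - \<alpha> * G' t \<xi> u) + \<kappa>0 * \<alpha>"
      if u: "u \<in> space Q" for u
    proof -
      note f = step_factor[OF \<alpha>'(3) \<alpha>(1) \<xi> u, of t]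
      have "(1 - \<alpha> * G' t \<xi> u) * weight1 \<kappa> \<kappa>0 \<alpha> (t - \<alpha> * G t \<xi> u) \<le> (1 - \<alpha> * G' t \<xi> u) * (?T t * exp (Z u) + \<kappa>0 * \<alpha>)"
        using f weight1_bounds(3)[OF \<kappa>(1,3) \<alpha>(1) \<alpha>'(2), of "t - \<alpha> * G t \<xi> u"] Tle[OF u]
        by (intro mult_left_mono) auto
      also have "\<dots> = ?T t * ((1 - \<alpha> * G' t \<xi> u) * exp (Z u)) + (1 - \<alpha> * G' t \<xi> u) * (\<kappa>0 * \<alpha>)" by (simp add: algebra_simps)
      also have "(1 - \<alpha> * G' t \<xi> u) * (\<kappa>0 * \<alpha>) \<le> 1 * (\<kappa>0 * \<alpha>)" using f \<kappa> \<alpha> by (intro mult_right_mono) auto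
      also have "?T t * ((1 - \<alpha> * G' t \<xi> u) * exp (Z u)) \<le> ?T t * (exp (Z u) - \<alpha> * G' t \<xi> u)"
      proof (rule mult_left_mono)
        \<comment> \<open>Both factors depend on the same innovation; exp Z \<ge> 1 bounds their
          product by a difference whose mean can be taken term by term.\<close>
        have "\<alpha> * G' t \<xi> u * 1 \<le> \<alpha> * G' t \<xi> u * exp (Z u)"
          using Z(2)[OF u] \<alpha> G'_bounds(1)[OF \<xi> u] by (intro mult_left_mono) auto
        then show "(1 - \<alpha> * G' t \<xi> u) * exp (Z u) \<le> exp (Z u) - \<alpha> * G' t \<xi> u" by (simp add: algebra_simps)
      qed (use order_trans[OF zero_le_one T1] in auto)
      finally show ?thesis by simp
    qed
    have "(\<integral>u. (1 - \<alpha> * G' t \<xi> u) * weight1 \<kappa> \<kappa>0 \<alpha> (t - \<alpha> * G t \<xi> u) \<partial>Q)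
        \<le> (\<integral>u. ?T t * (exp (Z u) - \<alpha> * G' t \<xi> u) + \<kappa>0 * \<alpha> \<partial>Q)"
      using pt iV Z(4) integrable_G'[OF \<xi>, of t] by (intro integral_mono_AE) auto
    also have "\<dots> = ?T t * ((\<integral>u. exp (Z u) \<partial>Q) - \<alpha> * (\<integral>u. G' t \<xi> u \<partial>Q)) + \<kappa>0 * \<alpha>"
      using Z(4) integrable_G'[OF \<xi>, of t] by (simp add: prob_space)
    also have "\<dots> \<le> ?T t * (1 + c2 / 4 * \<alpha> - \<alpha> * c2) + ?T t * (c2 / 4 * \<alpha>)"
    proof (rule add_mono)
      have "\<kappa> * C * \<alpha> \<le> c2 / 4 * \<alpha>" using \<kappa>' \<alpha> by (intro mult_right_mono) auto
      moreover have "\<alpha> * c2 \<le> \<alpha> * (\<integral>u. G' t \<xi> u \<partial>Q)" using mean[OF t \<xi>] \<alpha> by (intro mult_left_mono) auto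
      ultimately have "(\<integral>u. exp (Z u) \<partial>Q) - \<alpha> * (\<integral>u. G' t \<xi> u \<partial>Q) \<le> 1 + c2 / 4 * \<alpha> - \<alpha> * c2"
        using Z(5) by linarith
      then show "?T t * ((\<integral>u. exp (Z u) \<partial>Q) - \<alpha> * (\<integral>u. G' t \<xi> u \<partial>Q)) \<le> ?T t * (1 + c2 / 4 * \<alpha> - \<alpha> * c2)"
        by (rule mult_left_mono) (rule order_trans[OF zero_le_one T1])
      have "1 * (\<kappa>0 * \<alpha>) \<le> ?T t * (c2 / 4 * \<alpha>)"
        using T1[of t] \<kappa>' \<kappa> \<alpha> by (intro mult_mono mult_right_mono) auto
      then show "\<kappa>0 * \<alpha> \<le> ?T t * (c2 / 4 * \<alpha>)" by simp
    qed
    also have "\<dots> = (1 - c2 / 2 * \<alpha>) * ?T t" by (simp add: algebra_simps)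
    also have "?T t = weight1 \<kappa> \<kappa>0 \<alpha> t" using t by (simp add: weight1_outside)
    finally show ?thesis .
  qed
  then show ?thesis using pos
    by (intro exI[of _ k] exI[of _ k0] exI[of _ "c2 / 2"] exI[of _ a'] conjI) auto
qed

text \<open>Beyond \<open>R\<close> with \<beta> < 2 the curvature may vanish, and the drift of the
  tail weight alone gains e \<alpha>. The quadratic error and the bump take e / 4 times \<alpha>
  each; as \<open>e\<close> contains \<kappa>, the bound on \<kappa>0 depends on \<kappa>.\<close>

lemma contraction_outer:
  assumes b: "\<beta> < 2" and \<kappa>: "0 < \<kappa>" "\<kappa> \<le> 1"
  shows "\<exists>k0>0. \<exists>c>0. \<exists>a>0. \<forall>\<kappa>0\<in>{0<..k0}. \<forall>\<alpha>\<in>{0<..a}. \<forall>t. \<forall>\<xi>\<in>\<Xi>. R \<le> \<bar>t\<bar> \<longrightarrow>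
    (\<integral>u. (1 - \<alpha> * G' t \<xi> u) * weight1 \<kappa> \<kappa>0 \<alpha> (t - \<alpha> * G t \<xi> u) \<partial>Q) \<le> (1 - c * \<alpha>) * weight1 \<kappa> \<kappa>0 \<alpha> t"
proof -
  obtain C a where C: "0 \<le> C" "0 < a" and drift: "\<forall>\<kappa>\<in>{0<..1}. \<forall>\<alpha>\<in>{0<..a}. \<forall>t. \<forall>\<xi>\<in>\<Xi>. R \<le> \<bar>t\<bar> \<longrightarrow>
    integrable Q (\<lambda>u. tail_weight \<beta> R \<kappa> (t - \<alpha> * G t \<xi> u)) \<and>
    (\<integral>u. tail_weight \<beta> R \<kappa> (t - \<alpha> * G t \<xi> u) \<partial>Q)
      \<le> tail_weight \<beta> R \<kappa> t * (1 - \<kappa> * (2 - \<beta>) * cd * \<alpha> + \<kappa> * C * \<alpha>\<^sup>2)"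
    using weight_drift[OF b] by blast
  define e where "e = \<kappa> * (2 - \<beta>) * cd"
  have e: "0 < e" using \<kappa> b par by (simp add: e_def)
  define k0 where "k0 = e / 4"
  define a' where "a' = min a (min 1 (min (1 / LG) (e / (4 * (C + 1)))))"
  have pos: "0 < k0" "0 < e / 2" "0 < a'" using e C par by (auto simp: k0_def a'_def)
  have "(\<integral>u. (1 - \<alpha> * G' t \<xi> u) * weight1 \<kappa> \<kappa>0 \<alpha> (t - \<alpha> * G t \<xi> u) \<partial>Q) \<le> (1 - e / 2 * \<alpha>) * weight1 \<kappa> \<kappa>0 \<alpha> t"
    if \<kappa>0: "0 < \<kappa>0" "\<kappa>0 \<le> k0" and \<alpha>: "0 < \<alpha>" "\<alpha> \<le> a'" and \<xi>: "\<xi> \<in> \<Xi>" and t: "R \<le> \<bar>t\<bar>" for \<kappa>0 \<alpha> t \<xi>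
  proof -
    have \<alpha>': "\<alpha> \<le> a" "\<alpha> \<le> 1" "\<alpha> * LG \<le> 1" using \<alpha> par by (auto simp: a'_def field_simps)
    have "\<alpha> \<le> e / (4 * (C + 1))" using \<alpha> by (simp add: a'_def)
    then have "(C + 1) * \<alpha> \<le> e / 4" using C by (simp add: field_simps)
    then have Ca: "C * \<alpha> \<le> e / 4" using \<alpha> by (simp add: algebra_simps)
    let ?T = "tail_weight \<beta> R \<kappa>"
    have T1: "1 \<le> ?T s" for s using \<kappa> by (intro tail_weight_ge_1) auto
    have iT: "integrable Q (\<lambda>u. ?T (t - \<alpha> * G t \<xi> u))"
      and ET: "(\<integral>u. ?T (t - \<alpha> * G t \<xi> u) \<partial>Q) \<le> ?T t * (1 - e * \<alpha> + \<kappa> * C * \<alpha>\<^sup>2)"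
      using drift[rule_format, of \<kappa> \<alpha> \<xi> t] \<kappa> \<alpha> \<alpha>' \<xi> t unfolding e_def by auto
    note iV = integrable_step_weight[OF \<alpha>'(3) \<alpha>(1) \<alpha>'(2) \<xi> \<kappa>(1) \<kappa>0(1) iT]
    have pt: "(1 - \<alpha> * G' t \<xi> u) * weight1 \<kappa> \<kappa>0 \<alpha> (t - \<alpha> * G t \<xi> u) \<le> ?T (t - \<alpha> * G t \<xi> u) + \<kappa>0 * \<alpha>"
      if u: "u \<in> space Q" for u
    proof -
      note w = weight1_bounds[OF \<kappa>(1) \<kappa>0(1) \<alpha>(1) \<alpha>'(2), of "t - \<alpha> * G t \<xi> u"]
      have "(1 - \<alpha> * G' t \<xi> u) * weight1 \<kappa> \<kappa>0 \<alpha> (t - \<alpha> * G t \<xi> u) \<le> 1 * weight1 \<kappa> \<kappa>0 \<alpha> (t - \<alpha> * G t \<xi> u)"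
        using step_factor[OF \<alpha>'(3) \<alpha>(1) \<xi> u, of t] w by (intro mult_right_mono) auto
      then show ?thesis using w by linarith
    qed
    have "(\<integral>u. (1 - \<alpha> * G' t \<xi> u) * weight1 \<kappa> \<kappa>0 \<alpha> (t - \<alpha> * G t \<xi> u) \<partial>Q)
        \<le> (\<integral>u. ?T (t - \<alpha> * G t \<xi> u) + \<kappa>0 * \<alpha> \<partial>Q)"
      using pt iV iT by (intro integral_mono_AE) auto
    also have "\<dots> = (\<integral>u. ?T (t - \<alpha> * G t \<xi> u) \<partial>Q) + \<kappa>0 * \<alpha>" using iT by (simp add: prob_space)
    also have "\<dots> \<le> ?T t * (1 - e * \<alpha> + e / 4 * \<alpha>) + ?T t * (e / 4 * \<alpha>)"
    proof (rule add_mono)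
      have "\<kappa> * (C * \<alpha>) \<le> 1 * (e / 4)" using \<kappa> Ca C \<alpha> by (intro mult_mono) auto
      then have "\<kappa> * (C * \<alpha>) * \<alpha> \<le> 1 * (e / 4) * \<alpha>" using \<alpha> by (intro mult_right_mono) auto
      then have "\<kappa> * C * \<alpha>\<^sup>2 \<le> e / 4 * \<alpha>" by (simp add: power2_eq_square mult.assoc)
      then have "1 - e * \<alpha> + \<kappa> * C * \<alpha>\<^sup>2 \<le> 1 - e * \<alpha> + e / 4 * \<alpha>" by linarith
      then have "?T t * (1 - e * \<alpha> + \<kappa> * C * \<alpha>\<^sup>2) \<le> ?T t * (1 - e * \<alpha> + e / 4 * \<alpha>)"
        by (rule mult_left_mono) (rule order_trans[OF zero_le_one T1])
      with ET show "(\<integral>u. ?T (t - \<alpha> * G t \<xi> u) \<partial>Q) \<le> ?T t * (1 - e * \<alpha> + e / 4 * \<alpha>)" by linarith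
      have "1 * (\<kappa>0 * \<alpha>) \<le> ?T t * (e / 4 * \<alpha>)"
        using T1[of t] \<kappa>0 \<alpha> unfolding k0_def by (intro mult_mono mult_right_mono) auto
      then show "\<kappa>0 * \<alpha> \<le> ?T t * (e / 4 * \<alpha>)" by simp
    qed
    also have "\<dots> = (1 - e / 2 * \<alpha>) * ?T t" by (simp add: algebra_simps)
    also have "?T t = weight1 \<kappa> \<kappa>0 \<alpha> t" using t R by (intro weight1_outside[symmetric]) auto
    finally show ?thesis .
  qed
  then show ?thesis using pos
    by (intro exI[of _ k0] exI[of _ "e / 2"] exI[of _ a'] conjI) auto
qed

text \<open>\<open>from_flat\<close> reduces to a weight without tail part, at the price C
  \<alpha>^n, which is small against \<alpha>^(m-1). For m = 2 the curvature is bounded below and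
  there is no bump. For m > 2 the threshold |t| = \<eta> \<alpha> separates the two core
  estimates.\<close>

lemma contraction_core:
  "\<exists>k0>0. \<forall>\<kappa>0\<in>{0<..k0}. \<exists>c>0. \<exists>a>0. \<forall>\<kappa>\<in>{0<..1}. \<forall>\<alpha>\<in>{0<..a}. \<forall>t. \<forall>\<xi>\<in>\<Xi>. \<bar>t\<bar> \<le> R / 2 \<longrightarrow>
    (\<integral>u. (1 - \<alpha> * G' t \<xi> u) * weight1 \<kappa> \<kappa>0 \<alpha> (t - \<alpha> * G t \<xi> u) \<partial>Q) \<le> weight1 \<kappa> \<kappa>0 \<alpha> t - c * \<alpha> powr (m - 1)"
proof -
  \<comment> \<open>With n \<ge> m the tail error \<alpha>^n is at most \<alpha> times
    \<alpha>^(m-1).\<close>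
  define n where "n = nat \<lceil>m\<rceil>"
  have n: "m \<le> real n" unfolding n_def by linarith
  obtain C a where C: "0 \<le> C" "0 < a" and tail: "\<forall>\<kappa>\<in>{0<..1}. \<forall>\<alpha>\<in>{0<..a}. \<forall>t. \<forall>\<xi>\<in>\<Xi>. \<bar>t\<bar> \<le> R / 2 \<longrightarrow>
    integrable Q (\<lambda>u. tail_weight \<beta> R \<kappa> (t - \<alpha> * G t \<xi> u)) \<and>
    (\<integral>u. tail_weight \<beta> R \<kappa> (t - \<alpha> * G t \<xi> u) \<partial>Q) \<le> 1 + C * \<alpha> ^ n"
    using weight_core_tail[of n] by blast
  have from_flat: "\<exists>c>0. \<exists>a>0. \<forall>\<kappa>\<in>{0<..1}. \<forall>\<alpha>\<in>{0<..a}. \<forall>t. \<forall>\<xi>\<in>\<Xi>. \<bar>t\<bar> \<le> R / 2 \<longrightarrow>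
    (\<integral>u. (1 - \<alpha> * G' t \<xi> u) * weight1 \<kappa> \<kappa>0 \<alpha> (t - \<alpha> * G t \<xi> u) \<partial>Q) \<le> weight1 \<kappa> \<kappa>0 \<alpha> t - c * \<alpha> powr (m - 1)"
    if \<kappa>0: "0 < \<kappa>0" and c: "0 < c" "0 < a1" and flat: "\<And>\<alpha> t \<xi>. 0 < \<alpha> \<Longrightarrow> \<alpha> \<le> a1 \<Longrightarrow> \<alpha> \<le> 1 \<Longrightarrow> \<alpha> * LG \<le> 1 \<Longrightarrow> \<xi> \<in> \<Xi> \<Longrightarrow> \<bar>t\<bar> \<le> R / 2 \<Longrightarrow>
      (\<integral>u. (1 - \<alpha> * G' t \<xi> u) * (1 + core_scale m \<kappa>0 \<alpha> * core_bump m R (t - \<alpha> * G t \<xi> u)) \<partial>Q)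
        \<le> 1 + core_scale m \<kappa>0 \<alpha> * core_bump m R t - c * \<alpha> powr (m - 1)" for \<kappa>0 c a1
  proof -
    define a' where "a' = min (min a a1) (min 1 (min (1 / LG) (c / (2 * (C + 1)))))"
    have a': "0 < a'" using C c par by (auto simp: a'_def)
    have "(\<integral>u. (1 - \<alpha> * G' t \<xi> u) * weight1 \<kappa> \<kappa>0 \<alpha> (t - \<alpha> * G t \<xi> u) \<partial>Q) \<le> weight1 \<kappa> \<kappa>0 \<alpha> t - c / 2 * \<alpha> powr (m - 1)"
      if \<kappa>: "0 < \<kappa>" "\<kappa> \<le> 1" and \<alpha>: "0 < \<alpha>" "\<alpha> \<le> a'" and \<xi>: "\<xi> \<in> \<Xi>" and t: "\<bar>t\<bar> \<le> R / 2" for \<kappa> \<alpha> t \<xi>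
    proof -
      have \<alpha>': "\<alpha> \<le> a" "\<alpha> \<le> a1" "\<alpha> \<le> 1" "\<alpha> * LG \<le> 1" using \<alpha> par by (auto simp: a'_def field_simps)
      have "\<alpha> \<le> c / (2 * (C + 1))" using \<alpha> by (simp add: a'_def)
      then have "(C + 1) * \<alpha> \<le> c / 2" using C by (simp add: field_simps)
      then have Ca: "C * \<alpha> \<le> c / 2" using \<alpha> by (simp add: algebra_simps)
      let ?T = "tail_weight \<beta> R \<kappa>"
      let ?w = "\<lambda>s. core_scale m \<kappa>0 \<alpha> * core_bump m R s"
      have T1: "1 \<le> ?T s" for s using \<kappa> by (intro tail_weight_ge_1) auto
      have iT: "integrable Q (\<lambda>u. ?T (t - \<alpha> * G t \<xi> u))"
        and ET: "(\<integral>u. ?T (t - \<alpha> * G t \<xi> u) \<partial>Q) \<le> 1 + C * \<alpha> ^ n"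
        using tail[rule_format, of \<kappa> \<alpha> \<xi> t] \<kappa> \<alpha> \<alpha>' \<xi> t by auto
      note iV = integrable_step_weight[OF \<alpha>'(4) \<alpha>(1) \<alpha>'(3) \<xi> \<kappa>(1) \<kappa>0 iT]
      have [measurable]: "G t \<xi> \<in> borel_measurable Q" "G' t \<xi> \<in> borel_measurable Q" using \<xi> by measurable
      have iF: "integrable Q (\<lambda>u. (1 - \<alpha> * G' t \<xi> u) * (1 + ?w (t - \<alpha> * G t \<xi> u)))"
      proof (rule integrable_const_bound[of _ "1 * (1 + \<kappa>0 * \<alpha>)"])
        have [measurable]: "core_bump m R \<in> borel_measurable borel"
          by (rule borel_measurable_continuous_onI[OF continuous_core_bump[OF m R]])
        show "(\<lambda>u. (1 - \<alpha> * G' t \<xi> u) * (1 + ?w (t - \<alpha> * G t \<xi> u))) \<in> borel_measurable Q" by measurable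
        have "norm ((1 - \<alpha> * G' t \<xi> u) * (1 + ?w (t - \<alpha> * G t \<xi> u))) \<le> 1 * (1 + \<kappa>0 * \<alpha>)" if u: "u \<in> space Q" for u
        proof -
          have cs: "0 \<le> core_scale m \<kappa>0 \<alpha>" "core_scale m \<kappa>0 \<alpha> \<le> \<kappa>0 * \<alpha>"
            using core_scale_bounds[OF m \<kappa>0 \<alpha>(1) \<alpha>'(3)] by auto
          have "0 \<le> ?w s \<and> ?w s \<le> \<kappa>0 * \<alpha> * 1" for s
            using core_bump_bounds[OF R, of m s] cs mult_mono[of "core_scale m \<kappa>0 \<alpha>" "\<kappa>0 * \<alpha>" "core_bump m R s" 1] by auto
          then show ?thesis unfolding norm_mult using step_factor[OF \<alpha>'(4) \<alpha>(1) \<xi> u, of t]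
            by (intro mult_mono) auto
        qed
        then show "AE u in Q. norm ((1 - \<alpha> * G' t \<xi> u) * (1 + ?w (t - \<alpha> * G t \<xi> u))) \<le> 1 * (1 + \<kappa>0 * \<alpha>)" by auto
      qed
      have pt: "(1 - \<alpha> * G' t \<xi> u) * weight1 \<kappa> \<kappa>0 \<alpha> (t - \<alpha> * G t \<xi> u)
          \<le> (1 - \<alpha> * G' t \<xi> u) * (1 + ?w (t - \<alpha> * G t \<xi> u)) + (?T (t - \<alpha> * G t \<xi> u) - 1)"
        if u: "u \<in> space Q" for u
      proof -
        have "(1 - \<alpha> * G' t \<xi> u) * (?T (t - \<alpha> * G t \<xi> u) - 1) \<le> 1 * (?T (t - \<alpha> * G t \<xi> u) - 1)"
          using step_factor[OF \<alpha>'(4) \<alpha>(1) \<xi> u, of t] T1 by (intro mult_right_mono) auto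
        then show ?thesis unfolding weight1_def by (simp add: algebra_simps)
      qed
      have "(\<integral>u. (1 - \<alpha> * G' t \<xi> u) * weight1 \<kappa> \<kappa>0 \<alpha> (t - \<alpha> * G t \<xi> u) \<partial>Q)
        \<le> (\<integral>u. (1 - \<alpha> * G' t \<xi> u) * (1 + ?w (t - \<alpha> * G t \<xi> u)) + (?T (t - \<alpha> * G t \<xi> u) - 1) \<partial>Q)"
        using pt iV iF iT by (intro integral_mono_AE) auto
      also have "\<dots> = (\<integral>u. (1 - \<alpha> * G' t \<xi> u) * (1 + ?w (t - \<alpha> * G t \<xi> u)) \<partial>Q) + ((\<integral>u. ?T (t - \<alpha> * G t \<xi> u) \<partial>Q) - 1)"
        using iF iT by (simp add: prob_space)
      also have "\<dots> \<le> (1 + ?w t - c * \<alpha> powr (m - 1)) + C * \<alpha> ^ n"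
        using flat[OF \<alpha>(1) \<alpha>'(2,3,4) \<xi> t] ET by linarith
      also have "C * \<alpha> ^ n \<le> c / 2 * \<alpha> powr (m - 1)"
      proof -
        have "\<alpha> ^ n = \<alpha> powr (real n)" using \<alpha> by (simp add: powr_realpow)
        also have "\<dots> \<le> \<alpha> powr (1 + (m - 1))" using \<alpha> \<alpha>' n by (intro powr_mono') auto
        also have "\<dots> = \<alpha> * \<alpha> powr (m - 1)" unfolding powr_add using \<alpha> by simp
        finally have "C * \<alpha> ^ n \<le> C * (\<alpha> * \<alpha> powr (m - 1))" using C by (intro mult_left_mono) auto
        also have "\<dots> \<le> c / 2 * \<alpha> powr (m - 1)" using mult_right_mono[OF Ca, of "\<alpha> powr (m - 1)"] by (simp add: mult.assoc)
        finally show ?thesis .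
      qed
      also have "?T t = 1" using t R by (intro tail_weight_inner) auto
      then have "(1 + ?w t - c * \<alpha> powr (m - 1)) + c / 2 * \<alpha> powr (m - 1) = weight1 \<kappa> \<kappa>0 \<alpha> t - c / 2 * \<alpha> powr (m - 1)"
        by (simp add: weight1_def)
      finally show ?thesis by simp
    qed
    then show ?thesis using c a' by (intro exI[of _ "c / 2"] exI[of _ a'] conjI) auto
  qed
  show ?thesis
  proof (cases "m = 2")
    case True
    have flat2: "(\<integral>u. (1 - \<alpha> * G' t \<xi> u) * (1 + core_scale m \<kappa>0 \<alpha> * core_bump m R (t - \<alpha> * G t \<xi> u)) \<partial>Q)
        \<le> 1 + core_scale m \<kappa>0 \<alpha> * core_bump m R t - cb * \<alpha> powr (m - 1)"
      if "0 < \<alpha>" "\<xi> \<in> \<Xi>" "\<bar>t\<bar> \<le> R / 2" for \<kappa>0 \<alpha> t \<xi>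
    proof -
      have "cb \<le> (\<integral>u. G' t \<xi> u \<partial>Q)" using mean_core[of \<xi> t] that R True by (simp add: abs_pow_def)
      then have "\<alpha> * cb \<le> \<alpha> * (\<integral>u. G' t \<xi> u \<partial>Q)" using that by (intro mult_left_mono) auto
      then show ?thesis using True that integrable_G'[of \<xi> t] by (simp add: core_scale_def prob_space mult.commute)
    qed
    show ?thesis
    proof (rule exI[of _ 1], rule conjI, simp, rule ballI)
      fix \<kappa>0 :: real assume "\<kappa>0 \<in> {0<..1}"
      then have "0 < \<kappa>0" by simp
      then show "\<exists>c>0. \<exists>a>0. \<forall>\<kappa>\<in>{0<..1}. \<forall>\<alpha>\<in>{0<..a}. \<forall>t. \<forall>\<xi>\<in>\<Xi>. \<bar>t\<bar> \<le> R / 2 \<longrightarrow>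
        (\<integral>u. (1 - \<alpha> * G' t \<xi> u) * weight1 \<kappa> \<kappa>0 \<alpha> (t - \<alpha> * G t \<xi> u) \<partial>Q) \<le> weight1 \<kappa> \<kappa>0 \<alpha> t - c * \<alpha> powr (m - 1)"
        by (rule from_flat[OF _ par(3) zero_less_one flat2])
    qed
  next
    case False
    then have m2: "2 < m" using m by simp
    define p' where "p' = min p 1"
    have p': "0 < p'" "p' \<le> 1" "p' \<le> p" using par by (auto simp: p'_def)
    \<comment> \<open>The bound \<epsilon> / (2 LG) ensures that moving from 0 to t changes the
      drift by at most \<epsilon> / 2, so noise of size \<epsilon> at 0 is still at least \<epsilon>
      / 2 at t. The other two bounds are those of the near estimate.\<close>
    define \<eta> where "\<eta> = min (min (\<epsilon> / 4) (\<epsilon> / (2 * LG))) (\<epsilon> / 4 * (p' / 2) powr (1 / bump_exponent m))"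
    have \<eta>: "0 < \<eta>" "\<eta> \<le> \<epsilon> / 4" "\<eta> \<le> \<epsilon> / 4 * (p' / 2) powr (1 / bump_exponent m)" "\<eta> \<le> \<epsilon> / (2 * LG)"
      using par p' by (auto simp: \<eta>_def)
    then have \<eta>LG: "LG * \<eta> \<le> \<epsilon> / 2" using par by (simp add: field_simps)
    define A where "A = (2 / R) powr bump_exponent m * \<eta> powr - (m - 2 - bump_exponent m)"
    have A: "0 < A" using R \<eta> by (simp add: A_def)
    define k0 where "k0 = cb / 2 / A"
    have k0: "0 < k0" using par A by (simp add: k0_def)
    have "\<exists>c>0. \<exists>a>0. \<forall>\<kappa>\<in>{0<..1}. \<forall>\<alpha>\<in>{0<..a}. \<forall>t. \<forall>\<xi>\<in>\<Xi>. \<bar>t\<bar> \<le> R / 2 \<longrightarrow>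
      (\<integral>u. (1 - \<alpha> * G' t \<xi> u) * weight1 \<kappa> \<kappa>0 \<alpha> (t - \<alpha> * G t \<xi> u) \<partial>Q) \<le> weight1 \<kappa> \<kappa>0 \<alpha> t - c * \<alpha> powr (m - 1)"
      if \<kappa>0: "0 < \<kappa>0" "\<kappa>0 \<le> k0" for \<kappa>0
    proof -
      define c1 where "c1 = cb / 2 * \<eta> powr (m - 2)"
      define c2 where "c2 = \<kappa>0 * (p' / 2) * (\<epsilon> / (2 * R)) powr bump_exponent m"
      have c12: "0 < c1" "0 < c2" using par \<eta> \<kappa>0 p' R by (auto simp: c1_def c2_def)
      show ?thesis
      proof (rule from_flat[OF \<kappa>0(1), of "min c1 c2" "2 * R / \<epsilon>"])
        fix \<alpha> t \<xi> assume \<alpha>: "0 < \<alpha>" "\<alpha> \<le> 2 * R / \<epsilon>" "\<alpha> \<le> 1" "\<alpha> * LG \<le> 1" and \<xi>: "\<xi> \<in> \<Xi>" and t: "\<bar>t\<bar> \<le> R / 2"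
        have [measurable]: "G t \<xi> \<in> borel_measurable Q" "G' t \<xi> \<in> borel_measurable Q" "G 0 \<xi> \<in> borel_measurable Q" using \<xi> by measurable
        have D: "0 \<le> G' t \<xi> u" "\<alpha> * G' t \<xi> u \<le> 1" if "u \<in> space Q" for u
          using step_factor[OF \<alpha>(4,1) \<xi> that, of t] G'_bounds(1)[OF \<xi> that] by auto
        have "(\<integral>u. (1 - \<alpha> * G' t \<xi> u) * (1 + core_scale m \<kappa>0 \<alpha> * core_bump m R (t - \<alpha> * G t \<xi> u)) \<partial>Q)
          \<le> 1 + core_scale m \<kappa>0 \<alpha> * core_bump m R t - min c1 c2 * \<alpha> powr (m - 1)"
        proof (cases "\<eta> * \<alpha> \<le> \<bar>t\<bar>")
          case True
          have "0 < \<eta> * \<alpha>" using \<eta>(1) \<alpha>(1) by (rule mult_pos_pos)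
          then have t0: "t \<noteq> 0" using True by linarith
          have "\<kappa>0 * A \<le> k0 * A" using \<kappa>0 A by (intro mult_right_mono) auto
          then have kA: "\<kappa>0 * (2 / R) powr bump_exponent m * \<eta> powr - (m - 2 - bump_exponent m) \<le> cb / 2"
          proof -
            have "k0 * A = cb / 2" using A by (simp add: k0_def)
            with \<open>\<kappa>0 * A \<le> k0 * A\<close> have "\<kappa>0 * A \<le> cb / 2" by (simp only:)
            then show ?thesis unfolding A_def by (simp only: mult.assoc)
          qed
          have mc: "cb * \<bar>t\<bar> powr (m - 2) \<le> (\<integral>u. G' t \<xi> u \<partial>Q)"
            using mean_core[of \<xi> t] \<xi> t t0 R m2 by (simp add: abs_pow_def)
          have "(\<integral>u. (1 - \<alpha> * G' t \<xi> u) * (1 + core_scale m \<kappa>0 \<alpha> * core_bump m R (t - \<alpha> * G t \<xi> u)) \<partial>Q)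
            \<le> 1 + core_scale m \<kappa>0 \<alpha> * core_bump m R t - cb / 2 * \<eta> powr (m - 2) * \<alpha> powr (m - 1)"
            by (rule core_contraction_far[OF m2 R \<kappa>0(1) \<alpha>(1,3) \<eta>(1) kA _ True t _ _ D mc]) (use par in auto)
          moreover have "min c1 c2 * \<alpha> powr (m - 1) \<le> cb / 2 * \<eta> powr (m - 2) * \<alpha> powr (m - 1)"
            unfolding c1_def by (intro mult_right_mono) auto
          ultimately show ?thesis by linarith
        next
          case False
          then have tl: "\<bar>t\<bar> \<le> \<eta> * \<alpha>" by simp
          have "\<eta> * \<alpha> \<le> \<eta> * 1" using \<eta> \<alpha> by (intro mult_left_mono) auto
          then have "LG * \<bar>t\<bar> \<le> LG * \<eta>" using tl par by (intro mult_left_mono) auto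
          then have Lt: "LG * \<bar>t\<bar> \<le> \<epsilon> / 2" using \<eta>LG by simp
          have "\<epsilon> / 2 \<le> \<bar>G t \<xi> u\<bar>" if "u \<in> space Q" "\<epsilon> \<le> \<bar>G 0 \<xi> u\<bar>" for u
            using G_lipschitz_t[OF \<xi> that(1), of t 0] that(2) Lt by simp
          then have "prob {u \<in> space Q. \<epsilon> \<le> \<bar>G 0 \<xi> u\<bar>} \<le> prob {u \<in> space Q. \<epsilon> / 2 \<le> \<bar>G t \<xi> u\<bar>}"
            by (intro finite_measure_mono) auto
          then have noise': "p' \<le> prob {u \<in> space Q. \<epsilon> / 2 \<le> \<bar>G t \<xi> u\<bar>}"
            using noise[OF m2 \<xi>] p'(3) by linarith
          have \<alpha>\<epsilon>: "\<alpha> * \<epsilon> \<le> 2 * R" using \<alpha>(2) par by (simp add: field_simps)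
          have "(\<integral>u. (1 - \<alpha> * G' t \<xi> u) * (1 + core_scale m \<kappa>0 \<alpha> * core_bump m R (t - \<alpha> * G t \<xi> u)) \<partial>Q)
            \<le> 1 + core_scale m \<kappa>0 \<alpha> * core_bump m R t - \<kappa>0 * (p' / 2) * (\<epsilon> / (2 * R)) powr bump_exponent m * \<alpha> powr (m - 1)"
            by (rule core_contraction_near[OF m2 R \<kappa>0(1) \<alpha>(1,3) \<alpha>\<epsilon> p'(1,2) _ \<eta>(1,2,3) tl _ _ D noise']) (use par in auto)
          moreover have "min c1 c2 * \<alpha> powr (m - 1) \<le> \<kappa>0 * (p' / 2) * (\<epsilon> / (2 * R)) powr bump_exponent m * \<alpha> powr (m - 1)"
            unfolding c2_def by (intro mult_right_mono) auto
          ultimately show ?thesis by linarith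
        qed
        then show "(\<integral>u. (1 - \<alpha> * G' t \<xi> u) * (1 + core_scale m \<kappa>0 \<alpha> * core_bump m R (t - \<alpha> * G t \<xi> u)) \<partial>Q)
          \<le> 1 + core_scale m \<kappa>0 \<alpha> * core_bump m R t - min c1 c2 * \<alpha> powr (m - 1)" .
      qed (use c12 R par in auto)
    qed
    then show ?thesis using k0 by (intro exI[of _ k0] conjI) auto
  qed
qed

text \<open>\<kappa> comes from the middle region and is fixed before \<kappa>0, whose bound in the
  outer region depends on it; \<alpha> comes last. Gains of order \<alpha> are weakened to
  \<alpha>^(m-1), and the additive gain in the core becomes a factor because the weight there is at
  most 1 + \<kappa>0.\<close>

lemma line_contraction:
  "\<exists>\<kappa>>0. \<kappa> \<le> 1 \<and> (\<exists>\<kappa>0>0. \<exists>c>0. \<exists>a>0. \<forall>\<alpha>\<in>{0<..a}. \<forall>t. \<forall>\<xi>\<in>\<Xi>.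
    integrable Q (\<lambda>u. (1 - \<alpha> * G' t \<xi> u) * weight1 \<kappa> \<kappa>0 \<alpha> (t - \<alpha> * G t \<xi> u)) \<and>
    (\<integral>u. (1 - \<alpha> * G' t \<xi> u) * weight1 \<kappa> \<kappa>0 \<alpha> (t - \<alpha> * G t \<xi> u) \<partial>Q)
      \<le> (1 - c * \<alpha> powr (m - 1)) * weight1 \<kappa> \<kappa>0 \<alpha> t)"
proof -
  obtain k k1 c1 a1 where mid0: "0 < k" "0 < k1" "0 < c1" "0 < a1" and
    mid: "\<forall>\<kappa>\<in>{0<..k}. \<forall>\<kappa>0\<in>{0<..k1}. \<forall>\<alpha>\<in>{0<..a1}. \<forall>t. \<forall>\<xi>\<in>\<Xi>. R / 2 \<le> \<bar>t\<bar> \<and> (\<bar>t\<bar> \<le> R \<or> \<beta> = 2) \<longrightarrow>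
    (\<integral>u. (1 - \<alpha> * G' t \<xi> u) * weight1 \<kappa> \<kappa>0 \<alpha> (t - \<alpha> * G t \<xi> u) \<partial>Q) \<le> (1 - c1 * \<alpha>) * weight1 \<kappa> \<kappa>0 \<alpha> t"
    using contraction_middle by blast
  define \<kappa> where "\<kappa> = min k 1"
  have \<kappa>: "0 < \<kappa>" "\<kappa> \<le> k" "\<kappa> \<le> 1" using mid0 by (auto simp: \<kappa>_def)
  have "\<exists>k2>0. \<exists>c2>0. \<exists>a2>0. \<forall>\<kappa>0\<in>{0<..k2}. \<forall>\<alpha>\<in>{0<..a2}. \<forall>t. \<forall>\<xi>\<in>\<Xi>. \<beta> < 2 \<and> R \<le> \<bar>t\<bar> \<longrightarrow>
    (\<integral>u. (1 - \<alpha> * G' t \<xi> u) * weight1 \<kappa> \<kappa>0 \<alpha> (t - \<alpha> * G t \<xi> u) \<partial>Q) \<le> (1 - c2 * \<alpha>) * weight1 \<kappa> \<kappa>0 \<alpha> t"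
  proof (cases "\<beta> < 2")
    case True
    then show ?thesis using contraction_outer[OF True \<kappa>(1,3)] by simp
  next
    case False
    then show ?thesis by (intro exI[of _ 1] conjI) auto
  qed
  then obtain k2 c2 a2 where out0: "0 < k2" "0 < c2" "0 < a2" and
    out: "\<forall>\<kappa>0\<in>{0<..k2}. \<forall>\<alpha>\<in>{0<..a2}. \<forall>t. \<forall>\<xi>\<in>\<Xi>. \<beta> < 2 \<and> R \<le> \<bar>t\<bar> \<longrightarrow>
    (\<integral>u. (1 - \<alpha> * G' t \<xi> u) * weight1 \<kappa> \<kappa>0 \<alpha> (t - \<alpha> * G t \<xi> u) \<partial>Q) \<le> (1 - c2 * \<alpha>) * weight1 \<kappa> \<kappa>0 \<alpha> t"
    by blast
  obtain k3 where core0: "0 < k3" and core': "\<forall>\<kappa>0\<in>{0<..k3}. \<exists>c>0. \<exists>a>0. \<forall>\<kappa>\<in>{0<..1}. \<forall>\<alpha>\<in>{0<..a}. \<forall>t. \<forall>\<xi>\<in>\<Xi>. \<bar>t\<bar> \<le> R / 2 \<longrightarrow>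
    (\<integral>u. (1 - \<alpha> * G' t \<xi> u) * weight1 \<kappa> \<kappa>0 \<alpha> (t - \<alpha> * G t \<xi> u) \<partial>Q) \<le> weight1 \<kappa> \<kappa>0 \<alpha> t - c * \<alpha> powr (m - 1)"
    using contraction_core by blast
  define \<kappa>0 where "\<kappa>0 = min k1 (min k2 k3)"
  have \<kappa>0: "0 < \<kappa>0" "\<kappa>0 \<le> k1" "\<kappa>0 \<le> k2" "\<kappa>0 \<le> k3" using mid0 out0 core0 by (auto simp: \<kappa>0_def)
  obtain c3 a3 where core1: "0 < c3" "0 < a3" and core: "\<forall>\<kappa>\<in>{0<..1}. \<forall>\<alpha>\<in>{0<..a3}. \<forall>t. \<forall>\<xi>\<in>\<Xi>. \<bar>t\<bar> \<le> R / 2 \<longrightarrow>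
    (\<integral>u. (1 - \<alpha> * G' t \<xi> u) * weight1 \<kappa> \<kappa>0 \<alpha> (t - \<alpha> * G t \<xi> u) \<partial>Q) \<le> weight1 \<kappa> \<kappa>0 \<alpha> t - c3 * \<alpha> powr (m - 1)"
    using core'[rule_format, of \<kappa>0] \<kappa>0 by auto
  obtain C a4 where exc0: "0 < C" "0 < a4" and exc: "\<forall>\<kappa>\<in>{0<..1}. \<forall>\<alpha>\<in>{0<..a4}. \<forall>t. \<forall>\<xi>\<in>\<Xi>. \<exists>Z. Z \<in> borel_measurable Q \<and>
    (\<forall>u\<in>space Q. 0 \<le> Z u \<and> (\<forall>s. \<bar>s - t\<bar> \<le> \<alpha> * (\<bar>G t \<xi> u\<bar> + Lg) \<longrightarrow>
        tail_weight \<beta> R \<kappa> s \<le> tail_weight \<beta> R \<kappa> t * exp (Z u))) \<and>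
    integrable Q (\<lambda>u. exp (Z u)) \<and> (\<integral>u. exp (Z u) \<partial>Q) \<le> 1 + \<kappa> * C * \<alpha>"
    using weight_excess by blast
  define a where "a = min (min (min a1 a2) (min a3 a4)) (min 1 (1 / LG))"
  define c where "c = min (min c1 c2) (c3 / (1 + \<kappa>0))"
  have ac: "0 < a" "0 < c" using mid0 out0 core1 exc0 par \<kappa>0 by (auto simp: a_def c_def)
  have "integrable Q (\<lambda>u. (1 - \<alpha> * G' t \<xi> u) * weight1 \<kappa> \<kappa>0 \<alpha> (t - \<alpha> * G t \<xi> u)) \<and>
    (\<integral>u. (1 - \<alpha> * G' t \<xi> u) * weight1 \<kappa> \<kappa>0 \<alpha> (t - \<alpha> * G t \<xi> u) \<partial>Q)
      \<le> (1 - c * \<alpha> powr (m - 1)) * weight1 \<kappa> \<kappa>0 \<alpha> t" if \<alpha>: "0 < \<alpha>" "\<alpha> \<le> a" and \<xi>: "\<xi> \<in> \<Xi>" for \<alpha> t \<xi>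
  proof
    have \<alpha>': "\<alpha> \<le> a1" "\<alpha> \<le> a2" "\<alpha> \<le> a3" "\<alpha> \<le> a4" "\<alpha> \<le> 1" "\<alpha> * LG \<le> 1" using \<alpha> par by (auto simp: a_def field_simps)
    have w1: "1 \<le> weight1 \<kappa> \<kappa>0 \<alpha> t" by (rule weight1_bounds(1)[OF \<kappa>(1) \<kappa>0(1) \<alpha>(1) \<alpha>'(5)])
    obtain Z where Z: "\<And>u s. u \<in> space Q \<Longrightarrow> \<bar>s - t\<bar> \<le> \<alpha> * (\<bar>G t \<xi> u\<bar> + Lg) \<Longrightarrow> tail_weight \<beta> R \<kappa> s \<le> tail_weight \<beta> R \<kappa> t * exp (Z u)"
      "integrable Q (\<lambda>u. exp (Z u))"
      using exc[rule_format, of \<kappa> \<alpha> \<xi> t] \<kappa> \<alpha> \<alpha>' \<xi> by auto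
    have T1: "1 \<le> tail_weight \<beta> R \<kappa> s" for s using \<kappa> by (intro tail_weight_ge_1) auto
    have Tle: "tail_weight \<beta> R \<kappa> (t - \<alpha> * G t \<xi> u) \<le> tail_weight \<beta> R \<kappa> t * exp (Z u)" if "u \<in> space Q" for u
      using that \<alpha> par by (intro Z(1)) (auto simp: abs_mult intro!: mult_left_mono)
    have [measurable]: "G t \<xi> \<in> borel_measurable Q" using \<xi> by measurable
    have iTZ: "integrable Q (\<lambda>u. tail_weight \<beta> R \<kappa> t * exp (Z u))" using Z(2) by simp
    have iT: "integrable Q (\<lambda>u. tail_weight \<beta> R \<kappa> (t - \<alpha> * G t \<xi> u))"
    proof (rule Bochner_Integration.integrable_bound[OF iTZ])
      show "AE u in Q. norm (tail_weight \<beta> R \<kappa> (t - \<alpha> * G t \<xi> u)) \<le> norm (tail_weight \<beta> R \<kappa> t * exp (Z u))"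
        using Tle by (intro AE_I2) (auto intro: order_trans[OF _ abs_ge_self] simp: abs_of_nonneg[OF order_trans[OF zero_le_one T1]])
    qed measurable
    show "integrable Q (\<lambda>u. (1 - \<alpha> * G' t \<xi> u) * weight1 \<kappa> \<kappa>0 \<alpha> (t - \<alpha> * G t \<xi> u))"
      by (rule integrable_step_weight[OF \<alpha>'(6) \<alpha>(1) \<alpha>'(5) \<xi> \<kappa>(1) \<kappa>0(1) iT])
    have ap: "\<alpha> powr (m - 1) \<le> \<alpha>" "0 < \<alpha> powr (m - 1)" using powr_mono'[of 1 "m - 1" \<alpha>] m \<alpha> \<alpha>' by auto
    have lin: "(1 - c' * \<alpha>) * weight1 \<kappa> \<kappa>0 \<alpha> t \<le> (1 - c * \<alpha> powr (m - 1)) * weight1 \<kappa> \<kappa>0 \<alpha> t" if "c \<le> c'" for c'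
    proof -
      have "c * \<alpha> powr (m - 1) \<le> c' * \<alpha>" using that ap ac by (intro mult_mono) auto
      then show ?thesis using w1 by (intro mult_right_mono) auto
    qed
    consider "\<bar>t\<bar> \<le> R / 2" | "R / 2 \<le> \<bar>t\<bar> \<and> (\<bar>t\<bar> \<le> R \<or> \<beta> = 2)" | "\<beta> < 2 \<and> R \<le> \<bar>t\<bar>" using \<beta> by linarith
    then show "(\<integral>u. (1 - \<alpha> * G' t \<xi> u) * weight1 \<kappa> \<kappa>0 \<alpha> (t - \<alpha> * G t \<xi> u) \<partial>Q)
      \<le> (1 - c * \<alpha> powr (m - 1)) * weight1 \<kappa> \<kappa>0 \<alpha> t"
    proof cases
      case 1
      have "tail_weight \<beta> R \<kappa> t = 1" using 1 R by (intro tail_weight_inner) auto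
      then have "weight1 \<kappa> \<kappa>0 \<alpha> t \<le> 1 + \<kappa>0 * \<alpha>"
        using weight1_bounds(3)[OF \<kappa>(1) \<kappa>0(1) \<alpha>(1) \<alpha>'(5), of t] by simp
      also have "\<dots> \<le> 1 + \<kappa>0" using \<kappa>0 \<alpha>' by simp
      finally have "c * weight1 \<kappa> \<kappa>0 \<alpha> t \<le> c3 / (1 + \<kappa>0) * (1 + \<kappa>0)"
        using w1 ac core1 \<kappa>0 by (intro mult_mono) (auto simp: c_def)
      then have "c * weight1 \<kappa> \<kappa>0 \<alpha> t \<le> c3" using \<kappa>0 by simp
      then have "c * weight1 \<kappa> \<kappa>0 \<alpha> t * \<alpha> powr (m - 1) \<le> c3 * \<alpha> powr (m - 1)" by (intro mult_right_mono) auto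
      moreover have "(\<integral>u. (1 - \<alpha> * G' t \<xi> u) * weight1 \<kappa> \<kappa>0 \<alpha> (t - \<alpha> * G t \<xi> u) \<partial>Q) \<le> weight1 \<kappa> \<kappa>0 \<alpha> t - c3 * \<alpha> powr (m - 1)"
        using core[rule_format, of \<kappa> \<alpha> \<xi> t] \<kappa> \<alpha> \<alpha>' \<xi> 1 by auto
      moreover have "(1 - c * \<alpha> powr (m - 1)) * weight1 \<kappa> \<kappa>0 \<alpha> t = weight1 \<kappa> \<kappa>0 \<alpha> t - c * weight1 \<kappa> \<kappa>0 \<alpha> t * \<alpha> powr (m - 1)"
        by (simp add: algebra_simps)
      ultimately show ?thesis by linarith
    next
      case 2
      have "(\<integral>u. (1 - \<alpha> * G' t \<xi> u) * weight1 \<kappa> \<kappa>0 \<alpha> (t - \<alpha> * G t \<xi> u) \<partial>Q) \<le> (1 - c1 * \<alpha>) * weight1 \<kappa> \<kappa>0 \<alpha> t"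
        using mid[rule_format, of \<kappa> \<kappa>0 \<alpha> \<xi> t] \<kappa> \<kappa>0 \<alpha> \<alpha>' \<xi> 2 by auto
      moreover have "c \<le> c1" by (simp add: c_def min_le_iff_disj)
      ultimately show ?thesis using lin by (meson order_trans)
    next
      case 3
      have "(\<integral>u. (1 - \<alpha> * G' t \<xi> u) * weight1 \<kappa> \<kappa>0 \<alpha> (t - \<alpha> * G t \<xi> u) \<partial>Q) \<le> (1 - c2 * \<alpha>) * weight1 \<kappa> \<kappa>0 \<alpha> t"
        using out[rule_format, of \<kappa>0 \<alpha> \<xi> t] \<kappa>0 \<alpha> \<alpha>' \<xi> 3 by auto
      moreover have "c \<le> c2" by (simp add: c_def min_le_iff_disj)
      ultimately show ?thesis using lin by (meson order_trans)
    qed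
  qed
  then show ?thesis using \<kappa> \<kappa>0 ac
    by (intro exI[of _ \<kappa>] conjI exI[of _ \<kappa>0] exI[of _ c] exI[of _ a]) auto
qed

text \<open>Per unit of phase difference the next step has vertical length at most L\<Phi> /
  \<alpha> and horizontal length at most \<alpha> Lg, both times the weight, which \<open>W\<close>
  majorises near the iterate. Relative to the original 1 / \<alpha> the horizontal part is of order
  \<alpha>^2, so for small \<alpha> the factor stays below 1 by half of the gap between 1 and the
  mean of \<open>L\<Phi>\<close>.\<close>

lemma phase_contraction:
  assumes \<kappa>: "0 < \<kappa>" "\<kappa> \<le> 1" and \<kappa>0: "0 < \<kappa>0"
  shows "\<exists>c>0. \<exists>a>0. \<forall>\<alpha>\<in>{0<..a}. \<forall>t. \<forall>\<xi>\<in>\<Xi>. \<exists>W. W \<in> borel_measurable Q \<and>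
    (\<forall>u\<in>space Q. 0 \<le> W u \<and> (\<forall>s. \<bar>s - (t - \<alpha> * G t \<xi> u)\<bar> \<le> \<alpha> * Lg \<longrightarrow> weight1 \<kappa> \<kappa>0 \<alpha> s \<le> W u)) \<and>
    integrable Q (\<lambda>u. (\<alpha> * Lg + L\<Phi> u / \<alpha>) * W u) \<and>
    (\<integral>u. (\<alpha> * Lg + L\<Phi> u / \<alpha>) * W u \<partial>Q) \<le> (1 - c) * (weight1 \<kappa> \<kappa>0 \<alpha> t / \<alpha>)"
proof -
  obtain C a4 where exc0: "0 < C" "0 < a4" and exc: "\<forall>\<kappa>\<in>{0<..1}. \<forall>\<alpha>\<in>{0<..a4}. \<forall>t. \<forall>\<xi>\<in>\<Xi>. \<exists>Z. Z \<in> borel_measurable Q \<and>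
    (\<forall>u\<in>space Q. 0 \<le> Z u \<and> (\<forall>s. \<bar>s - t\<bar> \<le> \<alpha> * (\<bar>G t \<xi> u\<bar> + Lg) \<longrightarrow>
        tail_weight \<beta> R \<kappa> s \<le> tail_weight \<beta> R \<kappa> t * exp (Z u))) \<and>
    integrable Q (\<lambda>u. exp (Z u)) \<and> (\<integral>u. exp (Z u) \<partial>Q) \<le> 1 + \<kappa> * C * \<alpha>"
    using weight_excess by blast
  define l where "l = (\<integral>u. L\<Phi> u \<partial>Q)"
  \<comment> \<open>Collects the errors relative to 1 / \<alpha>: the horizontal part, the growth of
    the tail weight and the bump.\<close>
  define B where "B = Lg * (1 + C) + C + (Lg + 1) * \<kappa>0"
  define c where "c = (1 - l) / 2"
  define a where "a = min (min a4 1) (c / B)"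
  have B: "0 < B" using par exc0 \<kappa>0 by (simp add: B_def add_pos_pos)
  have c: "0 < c" using L\<Phi>_mean by (simp add: c_def l_def)
  have a: "0 < a" using exc0 B c by (simp add: a_def)
  note [measurable] = L\<Phi>_measurable
  have iL: "integrable Q L\<Phi>" by (rule integrable_const_bound[of _ 1]) (use L\<Phi>_bounds in \<open>auto intro!: AE_I2\<close>)
  have "\<exists>W. W \<in> borel_measurable Q \<and>
    (\<forall>u\<in>space Q. 0 \<le> W u \<and> (\<forall>s. \<bar>s - (t - \<alpha> * G t \<xi> u)\<bar> \<le> \<alpha> * Lg \<longrightarrow> weight1 \<kappa> \<kappa>0 \<alpha> s \<le> W u)) \<and>
    integrable Q (\<lambda>u. (\<alpha> * Lg + L\<Phi> u / \<alpha>) * W u) \<and>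
    (\<integral>u. (\<alpha> * Lg + L\<Phi> u / \<alpha>) * W u \<partial>Q) \<le> (1 - c) * (weight1 \<kappa> \<kappa>0 \<alpha> t / \<alpha>)"
    if \<alpha>: "0 < \<alpha>" "\<alpha> \<le> a" and \<xi>: "\<xi> \<in> \<Xi>" for \<alpha> t \<xi>
  proof -
    have \<alpha>': "\<alpha> \<le> a4" "\<alpha> \<le> 1" "B * \<alpha> \<le> c" using \<alpha> B by (auto simp: a_def field_simps)
    obtain Z where Z: "Z \<in> borel_measurable Q" "\<And>u. u \<in> space Q \<Longrightarrow> 0 \<le> Z u"
      "\<And>u s. u \<in> space Q \<Longrightarrow> \<bar>s - t\<bar> \<le> \<alpha> * (\<bar>G t \<xi> u\<bar> + Lg) \<Longrightarrow> tail_weight \<beta> R \<kappa> s \<le> tail_weight \<beta> R \<kappa> t * exp (Z u)"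
      "integrable Q (\<lambda>u. exp (Z u))" "(\<integral>u. exp (Z u) \<partial>Q) \<le> 1 + \<kappa> * C * \<alpha>"
      using exc[rule_format, of \<kappa> \<alpha> \<xi> t] \<kappa> \<alpha> \<alpha>' \<xi> by auto
    note [measurable] = Z(1)
    define T where "T = tail_weight \<beta> R \<kappa> t"
    have T: "1 \<le> T" unfolding T_def using \<kappa> by (intro tail_weight_ge_1) auto
    define W where "W u = T * exp (Z u) + \<kappa>0 * \<alpha>" for u
    have W0: "0 \<le> W u" for u using T \<kappa>0 \<alpha> by (simp add: W_def)
    have Wm[measurable]: "W \<in> borel_measurable Q" unfolding W_def by measurable
    have Wle: "weight1 \<kappa> \<kappa>0 \<alpha> s \<le> W u" if u: "u \<in> space Q" and s: "\<bar>s - (t - \<alpha> * G t \<xi> u)\<bar> \<le> \<alpha> * Lg" for u s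
    proof -
      have "\<bar>\<alpha> * G t \<xi> u\<bar> = \<alpha> * \<bar>G t \<xi> u\<bar>" using \<alpha> by (simp add: abs_mult)
      then have "\<bar>s - t\<bar> \<le> \<alpha> * (\<bar>G t \<xi> u\<bar> + Lg)" using s unfolding distrib_left by linarith
      then show ?thesis using Z(3)[OF u] weight1_bounds(3)[OF \<kappa>(1) \<kappa>0 \<alpha>(1) \<alpha>'(2), of s] unfolding W_def T_def by fastforce
    qed
    define E where "E u = T / \<alpha> * ((\<alpha>\<^sup>2 * Lg + 1) * exp (Z u) + L\<Phi> u - 1 + (\<alpha>\<^sup>2 * Lg + 1) * (\<kappa>0 * \<alpha>))" for u
    have le: "(\<alpha> * Lg + L\<Phi> u / \<alpha>) * W u \<le> E u" if u: "u \<in> space Q" for u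
    proof -
      have eZ: "1 \<le> exp (Z u)" using Z(2)[OF u] by simp
      \<comment> \<open>\<open>L\<Phi>\<close> and \<open>Z\<close> come from the same innovation;
        (1 - L\<Phi>) (exp Z - 1) \<ge> 0 replaces the mean of their product by separate
        means.\<close>
      have "(1 - L\<Phi> u) * 1 \<le> (1 - L\<Phi> u) * exp (Z u)" using eZ L\<Phi>_bounds[OF u] by (intro mult_left_mono) auto
      then have "L\<Phi> u * exp (Z u) \<le> exp (Z u) + L\<Phi> u - 1" by (simp add: algebra_simps)
      then have e1: "(\<alpha>\<^sup>2 * Lg + L\<Phi> u) * exp (Z u) \<le> (\<alpha>\<^sup>2 * Lg + 1) * exp (Z u) + L\<Phi> u - 1" by (simp add: algebra_simps)
      have "W u \<le> T * (exp (Z u) + \<kappa>0 * \<alpha>)"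
        using mult_right_mono[OF T, of "\<kappa>0 * \<alpha>"] \<kappa>0 \<alpha> unfolding W_def distrib_left by simp
      then have "(\<alpha>\<^sup>2 * Lg + L\<Phi> u) / \<alpha> * W u \<le> (\<alpha>\<^sup>2 * Lg + L\<Phi> u) / \<alpha> * (T * (exp (Z u) + \<kappa>0 * \<alpha>))"
        using par L\<Phi>_bounds[OF u] \<alpha> by (intro mult_left_mono) auto
      also have "\<dots> = T / \<alpha> * ((\<alpha>\<^sup>2 * Lg + L\<Phi> u) * exp (Z u) + (\<alpha>\<^sup>2 * Lg + L\<Phi> u) * (\<kappa>0 * \<alpha>))"
      proof -
        have "x / \<alpha> * (T * (e + k)) = T / \<alpha> * (x * e + x * k)" for x e k
          using \<alpha> by (simp add: field_simps)
        then show ?thesis .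
      qed
      also have "\<dots> \<le> E u" unfolding E_def
      proof (rule mult_left_mono)
        have "(\<alpha>\<^sup>2 * Lg + L\<Phi> u) * (\<kappa>0 * \<alpha>) \<le> (\<alpha>\<^sup>2 * Lg + 1) * (\<kappa>0 * \<alpha>)"
          using L\<Phi>_bounds[OF u] \<kappa>0 \<alpha> by (intro mult_right_mono) auto
        then show "(\<alpha>\<^sup>2 * Lg + L\<Phi> u) * exp (Z u) + (\<alpha>\<^sup>2 * Lg + L\<Phi> u) * (\<kappa>0 * \<alpha>)
          \<le> (\<alpha>\<^sup>2 * Lg + 1) * exp (Z u) + L\<Phi> u - 1 + (\<alpha>\<^sup>2 * Lg + 1) * (\<kappa>0 * \<alpha>)" using e1 by linarith
      qed (use T \<alpha> in auto)
      finally show ?thesis using \<alpha> by (simp add: add_divide_distrib power2_eq_square)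
    qed
    have iE: "integrable Q E" unfolding E_def using Z(4) iL by simp
    have iW: "integrable Q (\<lambda>u. (\<alpha> * Lg + L\<Phi> u / \<alpha>) * W u)"
    proof (rule Bochner_Integration.integrable_bound[OF iE])
      have "0 \<le> (\<alpha> * Lg + L\<Phi> u / \<alpha>) * W u" if "u \<in> space Q" for u
        using W0[of u] L\<Phi>_bounds[OF that] par \<alpha> by (intro mult_nonneg_nonneg add_nonneg_nonneg) auto
      then show "AE u in Q. norm ((\<alpha> * Lg + L\<Phi> u / \<alpha>) * W u) \<le> norm (E u)"
        using le by (intro AE_I2) (metis abs_ge_self abs_of_nonneg order_trans real_norm_def)
    qed measurable
    have "(\<integral>u. (\<alpha> * Lg + L\<Phi> u / \<alpha>) * W u \<partial>Q) \<le> (\<integral>u. E u \<partial>Q)"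
      using le iW iE by (intro integral_mono_AE) auto
    also have "\<dots> = T / \<alpha> * ((\<alpha>\<^sup>2 * Lg + 1) * (\<integral>u. exp (Z u) \<partial>Q) + l - 1 + (\<alpha>\<^sup>2 * Lg + 1) * (\<kappa>0 * \<alpha>))"
      unfolding E_def l_def using Z(4) iL by (simp add: prob_space)
    also have "\<dots> \<le> T / \<alpha> * (1 - c)"
    proof (rule mult_left_mono)
      have a2: "\<alpha>\<^sup>2 \<le> \<alpha>" "\<alpha>\<^sup>2 \<le> 1" using \<alpha> \<alpha>' by (auto simp: power2_eq_square mult_left_le_one_le intro: mult_le_one)
      have "\<kappa> * C * \<alpha> \<le> 1 * C * \<alpha>" using \<kappa> exc0 \<alpha> by (intro mult_right_mono) auto
      then have eZ: "(\<integral>u. exp (Z u) \<partial>Q) \<le> 1 + C * \<alpha>" using Z(5) by simp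
      have "(\<alpha>\<^sup>2 * Lg + 1) * (\<integral>u. exp (Z u) \<partial>Q) \<le> (\<alpha>\<^sup>2 * Lg + 1) * (1 + C * \<alpha>)"
        using eZ par by (intro mult_left_mono) auto
      also have "\<dots> = 1 + C * \<alpha> + \<alpha>\<^sup>2 * (Lg * (1 + C * \<alpha>))" by (simp add: algebra_simps)
      also have "\<alpha>\<^sup>2 * (Lg * (1 + C * \<alpha>)) \<le> \<alpha> * (Lg * (1 + C))"
        using a2 par exc0 \<alpha> \<alpha>' by (intro mult_mono mult_left_mono add_left_mono) auto
      finally have s1: "(\<alpha>\<^sup>2 * Lg + 1) * (\<integral>u. exp (Z u) \<partial>Q) \<le> 1 + C * \<alpha> + \<alpha> * (Lg * (1 + C))" by simp
      have "\<alpha>\<^sup>2 * Lg \<le> 1 * Lg" using a2 par by (intro mult_right_mono) auto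
      then have s2: "(\<alpha>\<^sup>2 * Lg + 1) * (\<kappa>0 * \<alpha>) \<le> (Lg + 1) * (\<kappa>0 * \<alpha>)" using \<kappa>0 \<alpha> by (intro mult_right_mono) auto
      have s0: "C * \<alpha> + \<alpha> * (Lg * (1 + C)) + (Lg + 1) * (\<kappa>0 * \<alpha>) = B * \<alpha>" unfolding B_def by (simp add: algebra_simps)
      \<comment> \<open>Since l = 1 - 2 c, errors of at most c in total leave 1 - c.\<close>
      have gen: "x + l - 1 + y \<le> 1 - c" if "p + q + r = b" "x \<le> 1 + p + q" "y \<le> r" "b \<le> c" for x y p q r b :: real
        using that unfolding c_def by (simp add: field_simps)
      show "(\<alpha>\<^sup>2 * Lg + 1) * (\<integral>u. exp (Z u) \<partial>Q) + l - 1 + (\<alpha>\<^sup>2 * Lg + 1) * (\<kappa>0 * \<alpha>) \<le> 1 - c"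
        by (rule gen[OF s0 s1 s2 \<alpha>'(3)])
    qed (use T \<alpha> in auto)
    also have "\<dots> = (1 - c) * (T / \<alpha>)" by simp
    also have "\<dots> \<le> (1 - c) * (weight1 \<kappa> \<kappa>0 \<alpha> t / \<alpha>)"
    proof (intro mult_left_mono divide_right_mono)
      have "0 \<le> l" unfolding l_def using L\<Phi>_bounds by (intro integral_nonneg_AE) auto
      then show "0 \<le> 1 - c" by (simp add: c_def)
      show "T \<le> weight1 \<kappa> \<kappa>0 \<alpha> t" unfolding T_def by (rule weight1_bounds(2)[OF \<kappa>(1) \<kappa>0 \<alpha>(1) \<alpha>'(2)])
    qed (use \<alpha> in auto)
    finally show ?thesis using Wm W0 Wle iW by blast
  qed
  then show ?thesis using a c by (intro exI[of _ c] exI[of _ a] conjI) auto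
qed

text \<open>\<open>W\<close> majorises the weight between 0 and the first iterate. The integrability
  comes from the first moment for \<beta> = 2 and from half of the exponential moment for \<beta> <
  2; it provides the finite first displacement behind the existence of the invariant law.\<close>

lemma start_moment:
  assumes \<kappa>: "0 < \<kappa>" "\<kappa> \<le> 1" and \<kappa>0: "0 < \<kappa>0"
  shows "\<exists>a>0. \<forall>\<alpha>\<in>{0<..a}. \<forall>\<xi>\<in>\<Xi>. \<exists>W. W \<in> borel_measurable Q \<and>
    (\<forall>u\<in>space Q. 0 \<le> W u \<and> (\<forall>s. \<bar>s\<bar> \<le> \<alpha> * \<bar>G 0 \<xi> u\<bar> \<longrightarrow> weight1 \<kappa> \<kappa>0 \<alpha> s \<le> W u)) \<and>
    integrable Q (\<lambda>u. W u * (\<alpha> * \<bar>G 0 \<xi> u\<bar>))"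
proof (cases "\<beta> = 2")
  case True
  have "\<exists>W. W \<in> borel_measurable Q \<and>
    (\<forall>u\<in>space Q. 0 \<le> W u \<and> (\<forall>s. \<bar>s\<bar> \<le> \<alpha> * \<bar>G 0 \<xi> u\<bar> \<longrightarrow> weight1 \<kappa> \<kappa>0 \<alpha> s \<le> W u)) \<and>
    integrable Q (\<lambda>u. W u * (\<alpha> * \<bar>G 0 \<xi> u\<bar>))" if \<alpha>: "0 < \<alpha>" "\<alpha> \<le> 1" and \<xi>: "\<xi> \<in> \<Xi>" for \<alpha> \<xi>
  proof (intro exI[of _ "\<lambda>_. 1 + \<kappa>0 * \<alpha>"] conjI ballI allI impI)
    show "weight1 \<kappa> \<kappa>0 \<alpha> s \<le> 1 + \<kappa>0 * \<alpha>" for s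
      using weight1_bounds(3)[OF \<kappa>(1) \<kappa>0 \<alpha>, of s] tail_weight_2[OF True] by simp
    show "integrable Q (\<lambda>u. (1 + \<kappa>0 * \<alpha>) * (\<alpha> * \<bar>G 0 \<xi> u\<bar>))"
      by (intro integrable_mult_right G_moment[OF True \<xi>])
  qed (use \<kappa>0 \<alpha> in auto)
  then show ?thesis by (intro exI[of _ 1]) auto
next
  case False
  then have b: "\<beta> < 2" using \<beta> by simp
  define a where "a = min 1 (rate / (2 * K))"
  have a: "0 < a" unfolding a_def using K_ge_1 par by auto
  have "\<exists>W. W \<in> borel_measurable Q \<and>
    (\<forall>u\<in>space Q. 0 \<le> W u \<and> (\<forall>s. \<bar>s\<bar> \<le> \<alpha> * \<bar>G 0 \<xi> u\<bar> \<longrightarrow> weight1 \<kappa> \<kappa>0 \<alpha> s \<le> W u)) \<and>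
    integrable Q (\<lambda>u. W u * (\<alpha> * \<bar>G 0 \<xi> u\<bar>))" if \<alpha>: "0 < \<alpha>" "\<alpha> \<le> a" and \<xi>: "\<xi> \<in> \<Xi>" for \<alpha> \<xi>
  proof -
    have \<alpha>1: "\<alpha> \<le> 1" using \<alpha> by (simp add: a_def)
    define Y where "Y u = \<bar>G 0 \<xi> u\<bar> / scale 0" for u
    define W where "W u = (1 + \<kappa>0 * \<alpha>) * exp (rate / 2 * Y u)" for u
    have [measurable]: "G 0 \<xi> \<in> borel_measurable Q" using \<xi> by measurable
    have Y0: "0 \<le> Y u" for u using scale_pos[of 0] by (simp add: Y_def)
    have Wm: "W \<in> borel_measurable Q" unfolding W_def Y_def by measurable
    have W0: "0 \<le> W u" for u using \<kappa>0 \<alpha> by (simp add: W_def)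
    have Ka: "\<kappa> * (K * \<alpha>) \<le> 1 * (rate / 2)"
    proof (rule mult_mono)
      have "K * \<alpha> \<le> K * (rate / (2 * K))" using \<alpha> K_ge_1 by (intro mult_left_mono) (auto simp: a_def)
      then show "K * \<alpha> \<le> rate / 2" using K_ge_1 by simp
    qed (use \<kappa> K_ge_1 \<alpha> in auto)
    have Wle: "weight1 \<kappa> \<kappa>0 \<alpha> s \<le> W u" if s: "\<bar>s\<bar> \<le> \<alpha> * \<bar>G 0 \<xi> u\<bar>" for s u
    proof -
      have "tail_weight \<beta> R \<kappa> s \<le> tail_weight \<beta> R \<kappa> 0 * exp (\<kappa> * K * \<bar>s - 0\<bar> / scale 0)"
        using \<kappa> by (intro tail_weight_ratio[OF b]) auto
      also have "tail_weight \<beta> R \<kappa> 0 = 1" using R by (intro tail_weight_inner) auto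
      also have "\<kappa> * K * \<bar>s - 0\<bar> / scale 0 \<le> \<kappa> * K * (\<alpha> * \<bar>G 0 \<xi> u\<bar>) / scale 0"
        using s \<kappa> K_ge_1 scale_pos[of 0] by (intro divide_right_mono mult_left_mono) auto
      also have "\<dots> = \<kappa> * (K * \<alpha>) * Y u" by (simp add: Y_def)
      also have "\<dots> \<le> rate / 2 * Y u" using mult_right_mono[OF Ka Y0[of u]] by simp
      finally have T: "tail_weight \<beta> R \<kappa> s \<le> exp (rate / 2 * Y u)" by simp
      have "\<kappa>0 * \<alpha> * 1 \<le> \<kappa>0 * \<alpha> * exp (rate / 2 * Y u)"
        using \<kappa>0 \<alpha> par Y0 by (intro mult_left_mono) auto
      then show ?thesis using T weight1_bounds(3)[OF \<kappa>(1) \<kappa>0 \<alpha>(1) \<alpha>1, of s] unfolding W_def distrib_right by simp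
    qed
    have "integrable Q (\<lambda>u. (1 + \<kappa>0 * \<alpha>) * (\<alpha> * scale 0) * (Y u ^ 1 * exp (rate / 2 * Y u)))"
      using moments(1)[OF b \<xi>, of 0 1] unfolding Y_def by (intro integrable_mult_right)
    moreover have "W u * (\<alpha> * \<bar>G 0 \<xi> u\<bar>) = (1 + \<kappa>0 * \<alpha>) * (\<alpha> * scale 0) * (Y u ^ 1 * exp (rate / 2 * Y u))" for u
      using scale_pos[of 0] unfolding W_def by (simp add: Y_def)
    ultimately have "integrable Q (\<lambda>u. W u * (\<alpha> * \<bar>G 0 \<xi> u\<bar>))" by (simp only:)
    then show ?thesis using Wm W0 Wle by blast
  qed
  then show ?thesis using a by (intro exI[of _ a] conjI) auto
qed

section \<open>From segments to the path metric of one coordinate\<close>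

definition step :: "real \<Rightarrow> real \<times> 'b \<Rightarrow> 'u \<Rightarrow> real \<times> 'b" where
  "step \<alpha> z u = (fst z - \<alpha> * G (fst z) (snd z) u, \<Phi> (snd z) u)"

lemma step_measurable: "snd z \<in> \<Xi> \<Longrightarrow> step \<alpha> z \<in> borel_measurable Q"
proof -
  assume z: "snd z \<in> \<Xi>"
  then have [measurable]: "G (fst z) (snd z) \<in> borel_measurable Q" "\<Phi> (snd z) \<in> borel_measurable Q"
    using \<Phi>_measurable by measurable
  show ?thesis unfolding step_def by (intro borel_measurable_Pair) measurable
qed

end

locale sgd_coordinate_contraction = sgd_coordinate + weighted_line V F \<alpha> for V F :: "real \<Rightarrow> real" and \<alpha> :: real +
  fixes \<rho> :: real
  assumes \<alpha>LG: "\<alpha> * LG \<le> 1" and \<rho>: "0 \<le> \<rho>"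
    and line: "\<And>t \<xi>. \<xi> \<in> \<Xi> \<Longrightarrow> integrable Q (\<lambda>u. (1 - \<alpha> * G' t \<xi> u) * V (t - \<alpha> * G t \<xi> u)) \<and>
      (\<integral>u. (1 - \<alpha> * G' t \<xi> u) * V (t - \<alpha> * G t \<xi> u) \<partial>Q) \<le> \<rho> * V t"
    and phase: "\<And>t \<xi>. \<xi> \<in> \<Xi> \<Longrightarrow> \<exists>W. W \<in> borel_measurable Q \<and>
      (\<forall>u\<in>space Q. 0 \<le> W u \<and> (\<forall>s. \<bar>s - (t - \<alpha> * G t \<xi> u)\<bar> \<le> \<alpha> * Lg \<longrightarrow> V s \<le> W u)) \<and>
      integrable Q (\<lambda>u. (\<alpha> * Lg + L\<Phi> u / \<alpha>) * W u) \<and>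
      (\<integral>u. (\<alpha> * Lg + L\<Phi> u / \<alpha>) * W u \<partial>Q) \<le> \<rho> * (V t / \<alpha>)"
begin

lemma V_measurable [measurable]: "V \<in> borel_measurable borel"
  by (rule borel_measurable_continuous_onI[OF contV])

lemma wdist_step_measurable:
  assumes "snd z \<in> \<Xi>" "snd z' \<in> \<Xi>"
  shows "(\<lambda>u. ennreal (wdist (step \<alpha> z u) (step \<alpha> z' u))) \<in> borel_measurable Q"
proof -
  have "(\<lambda>u. (step \<alpha> z u, step \<alpha> z' u)) \<in> borel_measurable Q"
    by (intro borel_measurable_Pair step_measurable assms)
  from measurable_compose[OF this wdist_measurable] show ?thesis by simp
qed

text \<open>Since 1 - \<alpha> G' \<ge> 0, the image of a horizontal segment is traversed
  monotonically and its weighted length is the integral of f. Exchanging the integrals reduces the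
  claim to the bound of \<open>line\<close> at each point of the segment.\<close>

lemma horizontal_contraction_aux:
  assumes \<xi>: "\<xi> \<in> \<Xi>" and st: "s \<le> t"
  shows "(\<integral>\<^sup>+u. ennreal \<bar>F (t - \<alpha> * G t \<xi> u) - F (s - \<alpha> * G s \<xi> u)\<bar> \<partial>Q) \<le> ennreal (\<rho> * \<bar>F t - F s\<bar>)"
proof -
  interpret P: pair_sigma_finite lborel Q ..
  have Gm[measurable]: "(\<lambda>q. G (fst q) \<xi> (snd q)) \<in> borel_measurable (lborel \<Otimes>\<^sub>M Q)"
    "(\<lambda>q. G' (fst q) \<xi> (snd q)) \<in> borel_measurable (lborel \<Otimes>\<^sub>M Q)"
    using G_measurable[OF \<xi>] G'_measurable[OF \<xi>] by (simp_all add: split_def measurable_cong_sets[OF sets_pair_measure_cong[OF sets_lborel refl] refl])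
  define f where "f \<tau> u = (1 - \<alpha> * G' \<tau> \<xi> u) * V (\<tau> - \<alpha> * G \<tau> \<xi> u)" for \<tau> u
  have fm: "(\<lambda>(\<tau>, u). ennreal (f \<tau> u) * indicator {s..t} \<tau>) \<in> borel_measurable (lborel \<Otimes>\<^sub>M Q)"
    unfolding f_def split_def by measurable
  have f0: "0 \<le> f \<tau> u" if "u \<in> space Q" for \<tau> u
    unfolding f_def using step_factor(1)[OF \<alpha>LG \<alpha> \<xi> that] V_pos[of "\<tau> - \<alpha> * G \<tau> \<xi> u"] by (intro mult_nonneg_nonneg) auto
  have "ennreal \<bar>F (t - \<alpha> * G t \<xi> u) - F (s - \<alpha> * G s \<xi> u)\<bar> = (\<integral>\<^sup>+\<tau>\<in>{s..t}. ennreal (f \<tau> u) \<partial>lborel)"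
    if u: "u \<in> space Q" for u
  proof -
    have d: "((\<lambda>\<tau>. F (\<tau> - \<alpha> * G \<tau> \<xi> u)) has_real_derivative f \<tau> u) (at \<tau>)" for \<tau>
    proof -
      have "((\<lambda>\<tau>. \<tau> - \<alpha> * G \<tau> \<xi> u) has_real_derivative (1 - \<alpha> * G' \<tau> \<xi> u)) (at \<tau>)"
        by (rule DERIV_diff[OF DERIV_ident DERIV_cmult[OF G_deriv[OF \<xi> u]]])
      from DERIV_chain2[OF derF this] show ?thesis by (simp add: f_def mult.commute)
    qed
    have fu: "(\<lambda>\<tau>. f \<tau> u) \<in> borel_measurable borel"
    proof -
      have "(\<lambda>\<tau>. (\<tau>, u)) \<in> borel \<rightarrow>\<^sub>M lborel \<Otimes>\<^sub>M Q" using u by measurable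
      from measurable_compose[OF this Gm(1)] measurable_compose[OF this Gm(2)]
      have [measurable]: "(\<lambda>\<tau>. G \<tau> \<xi> u) \<in> borel_measurable borel" "(\<lambda>\<tau>. G' \<tau> \<xi> u) \<in> borel_measurable borel" by simp_all
      show ?thesis unfolding f_def by measurable
    qed
    have I: "(\<integral>\<^sup>+\<tau>\<in>{s..t}. ennreal (f \<tau> u) \<partial>lborel) = ennreal (F (t - \<alpha> * G t \<xi> u) - F (s - \<alpha> * G s \<xi> u))"
      by (rule nn_integral_FTC_Icc[OF fu d f0[OF u] st])
    have "F (s - \<alpha> * G s \<xi> u) \<le> F (t - \<alpha> * G t \<xi> u)"
      using DERIV_nonneg_imp_nondecreasing[OF st, of "\<lambda>\<tau>. F (\<tau> - \<alpha> * G \<tau> \<xi> u)"] d f0[OF u] by blast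
    then show ?thesis unfolding I by simp
  qed
  then have "(\<integral>\<^sup>+u. ennreal \<bar>F (t - \<alpha> * G t \<xi> u) - F (s - \<alpha> * G s \<xi> u)\<bar> \<partial>Q)
      = (\<integral>\<^sup>+u. (\<integral>\<^sup>+\<tau>. ennreal (f \<tau> u) * indicator {s..t} \<tau> \<partial>lborel) \<partial>Q)"
    by (intro nn_integral_cong)
  also have "\<dots> = (\<integral>\<^sup>+\<tau>. (\<integral>\<^sup>+u. ennreal (f \<tau> u) * indicator {s..t} \<tau> \<partial>Q) \<partial>lborel)"
    by (rule P.Fubini'[OF fm])
  also have "\<dots> \<le> (\<integral>\<^sup>+\<tau>. ennreal \<rho> * (ennreal (V \<tau>) * indicator {s..t} \<tau>) \<partial>lborel)"
  proof (rule nn_integral_mono)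
    fix \<tau> :: real
    have "(\<integral>\<^sup>+u. ennreal (f \<tau> u) \<partial>Q) = ennreal (\<integral>u. f \<tau> u \<partial>Q)"
      using line[OF \<xi>, of \<tau>] f0 unfolding f_def by (intro nn_integral_eq_integral) auto
    also have "\<dots> \<le> ennreal (\<rho> * V \<tau>)" using line[OF \<xi>, of \<tau>] unfolding f_def by (intro ennreal_leI) auto
    also have "\<dots> = ennreal \<rho> * ennreal (V \<tau>)" using \<rho> V_pos[of \<tau>] by (intro ennreal_mult) auto
    finally show "(\<integral>\<^sup>+u. ennreal (f \<tau> u) * indicator {s..t} \<tau> \<partial>Q) \<le> ennreal \<rho> * (ennreal (V \<tau>) * indicator {s..t} \<tau>)"
      by (cases "\<tau> \<in> {s..t}") auto
  qed
  also have "\<dots> = ennreal \<rho> * (\<integral>\<^sup>+\<tau>\<in>{s..t}. ennreal (V \<tau>) \<partial>lborel)"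
    by (rule nn_integral_cmult) measurable
  also have "(\<integral>\<^sup>+\<tau>\<in>{s..t}. ennreal (V \<tau>) \<partial>lborel) = ennreal (F t - F s)"
    by (rule nn_integral_FTC_Icc[OF V_measurable derF less_imp_le[OF V_pos] st])
  also have "ennreal \<rho> * ennreal (F t - F s) = ennreal (\<rho> * \<bar>F t - F s\<bar>)"
    using F_mono[OF st] \<rho> by (simp add: ennreal_mult[symmetric])
  finally show ?thesis .
qed

lemma horizontal_contraction:
  assumes \<xi>: "\<xi> \<in> \<Xi>"
  shows "(\<integral>\<^sup>+u. ennreal (wdist (step \<alpha> (t, \<xi>) u) (step \<alpha> (s, \<xi>) u)) \<partial>Q) \<le> ennreal (\<rho> * \<bar>F t - F s\<bar>)"
proof -
  have "(\<integral>\<^sup>+u. ennreal (wdist (step \<alpha> (t, \<xi>) u) (step \<alpha> (s, \<xi>) u)) \<partial>Q)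
      \<le> (\<integral>\<^sup>+u. ennreal \<bar>F (t - \<alpha> * G t \<xi> u) - F (s - \<alpha> * G s \<xi> u)\<bar> \<partial>Q)"
  proof (intro nn_integral_mono ennreal_leI)
    fix u
    show "wdist (step \<alpha> (t, \<xi>) u) (step \<alpha> (s, \<xi>) u) \<le> \<bar>F (t - \<alpha> * G t \<xi> u) - F (s - \<alpha> * G s \<xi> u)\<bar>"
      using wdist_le[of "t - \<alpha> * G t \<xi> u" "\<Phi> \<xi> u" "s - \<alpha> * G s \<xi> u" "\<Phi> \<xi> u"] by (simp add: step_def)
  qed
  also have "\<dots> \<le> ennreal (\<rho> * \<bar>F t - F s\<bar>)"
    using horizontal_contraction_aux[OF \<xi>, of s t] horizontal_contraction_aux[OF \<xi>, of t s]
    by (cases "s \<le> t") (auto simp: abs_minus_commute)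
  finally show ?thesis .
qed

text \<open>For phases at distance at most 1 the two iterates are within \<alpha> Lg of each other,
  the range in which \<open>W\<close> majorises \<open>V\<close>.\<close>

lemma vertical_contraction_short:
  assumes \<xi>: "\<xi> \<in> \<Xi>" "\<eta> \<in> \<Xi>" and near: "norm (\<xi> - \<eta>) \<le> 1"
  shows "(\<integral>\<^sup>+u. ennreal (wdist (step \<alpha> (r, \<xi>) u) (step \<alpha> (r, \<eta>) u)) \<partial>Q)
    \<le> ennreal (\<rho> * (V r * (norm (\<xi> - \<eta>) / \<alpha>)))"
proof -
  obtain W where W: "W \<in> borel_measurable Q" "\<And>u. u \<in> space Q \<Longrightarrow> 0 \<le> W u"
      "\<And>u s. u \<in> space Q \<Longrightarrow> \<bar>s - (r - \<alpha> * G r \<xi> u)\<bar> \<le> \<alpha> * Lg \<Longrightarrow> V s \<le> W u"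
      "integrable Q (\<lambda>u. (\<alpha> * Lg + L\<Phi> u / \<alpha>) * W u)"
      "(\<integral>u. (\<alpha> * Lg + L\<Phi> u / \<alpha>) * W u \<partial>Q) \<le> \<rho> * (V r / \<alpha>)"
    using phase[OF \<xi>(1), of r] by auto
  define \<delta> where "\<delta> = norm (\<xi> - \<eta>)"
  have \<delta>: "0 \<le> \<delta>" "\<delta> \<le> 1" using near by (auto simp: \<delta>_def)
  have pt: "wdist (step \<alpha> (r, \<xi>) u) (step \<alpha> (r, \<eta>) u) \<le> \<delta> * ((\<alpha> * Lg + L\<Phi> u / \<alpha>) * W u)" if u: "u \<in> space Q" for u
  proof -
    define t1 where "t1 = r - \<alpha> * G r \<xi> u"
    define t2 where "t2 = r - \<alpha> * G r \<eta> u"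
    have "\<bar>\<alpha> * (G r \<xi> u - G r \<eta> u)\<bar> \<le> \<alpha> * (Lg * \<delta>)"
      using G_lipschitz[OF \<xi> u, of r] \<alpha> unfolding abs_mult \<delta>_def by (intro mult_mono) auto
    then have t12: "\<bar>t1 - t2\<bar> \<le> \<alpha> * Lg * \<delta>"
      unfolding t1_def t2_def by (simp add: algebra_simps abs_minus_commute)
    also have "\<dots> \<le> \<alpha> * Lg * 1" using \<delta> \<alpha> par by (intro mult_left_mono) auto
    finally have t12': "\<bar>t1 - t2\<bar> \<le> \<alpha> * Lg" by simp
    have "\<bar>F t1 - F t2\<bar> \<le> W u * \<bar>t1 - t2\<bar>"
    proof (rule F_abs_diff_le)
      fix s assume "min t2 t1 \<le> s" "s \<le> max t2 t1"
      then have "\<bar>s - (r - \<alpha> * G r \<xi> u)\<bar> \<le> \<alpha> * Lg" using t12' unfolding t1_def[symmetric] by auto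
      then show "V s \<le> W u" by (rule W(3)[OF u])
    qed
    also have "\<dots> \<le> W u * (\<alpha> * Lg * \<delta>)" using t12 W(2)[OF u] by (intro mult_left_mono) auto
    finally have h: "\<bar>F t1 - F t2\<bar> \<le> W u * (\<alpha> * Lg * \<delta>)" .
    have "V t1 \<le> W u" using \<alpha> par by (intro W(3)[OF u]) (auto simp: t1_def)
    then have v: "V t1 * (norm (\<Phi> \<xi> u - \<Phi> \<eta> u) / \<alpha>) \<le> W u * (L\<Phi> u * \<delta> / \<alpha>)"
      using \<Phi>_lipschitz[OF \<xi> u] \<alpha> W(2)[OF u] unfolding \<delta>_def by (intro mult_mono divide_right_mono) auto
    have "wdist (step \<alpha> (r, \<xi>) u) (step \<alpha> (r, \<eta>) u) \<le> \<bar>F t1 - F t2\<bar> + V t1 * (norm (\<Phi> \<xi> u - \<Phi> \<eta> u) / \<alpha>)"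
      unfolding step_def t1_def t2_def using wdist_le by simp
    also have "\<dots> \<le> W u * (\<alpha> * Lg * \<delta>) + W u * (L\<Phi> u * \<delta> / \<alpha>)" by (intro add_mono h v)
    also have "\<dots> = \<delta> * ((\<alpha> * Lg + L\<Phi> u / \<alpha>) * W u)" by (simp add: algebra_simps)
    finally show ?thesis .
  qed
  have "(\<integral>\<^sup>+u. ennreal (wdist (step \<alpha> (r, \<xi>) u) (step \<alpha> (r, \<eta>) u)) \<partial>Q)
      \<le> (\<integral>\<^sup>+u. ennreal (\<delta> * ((\<alpha> * Lg + L\<Phi> u / \<alpha>) * W u)) \<partial>Q)"
    by (intro nn_integral_mono ennreal_leI pt)
  also have "\<dots> = ennreal (\<integral>u. \<delta> * ((\<alpha> * Lg + L\<Phi> u / \<alpha>) * W u) \<partial>Q)"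
  proof (rule nn_integral_eq_integral)
    show "integrable Q (\<lambda>u. \<delta> * ((\<alpha> * Lg + L\<Phi> u / \<alpha>) * W u))" using W(4) by (rule integrable_mult_right)
    have "0 \<le> \<delta> * ((\<alpha> * Lg + L\<Phi> u / \<alpha>) * W u)" if "u \<in> space Q" for u
      using \<delta> W(2)[OF that] L\<Phi>_bounds[OF that] \<alpha> par by (intro mult_nonneg_nonneg add_nonneg_nonneg) auto
    then show "AE u in Q. 0 \<le> \<delta> * ((\<alpha> * Lg + L\<Phi> u / \<alpha>) * W u)" by auto
  qed
  also have "\<dots> \<le> ennreal (\<delta> * (\<rho> * (V r / \<alpha>)))"
    using mult_left_mono[OF W(5) \<delta>(1)] by (intro ennreal_leI) simp
  also have "\<delta> * (\<rho> * (V r / \<alpha>)) = \<rho> * (V r * (norm (\<xi> - \<eta>) / \<alpha>))" by (simp add: \<delta>_def)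
  finally show ?thesis .
qed

text \<open>Convexity of \<Xi> lets a long vertical segment be cut into n pieces of length at most
  1, to which the short estimate applies; the triangle inequality sums them.\<close>

lemma vertical_contraction:
  assumes \<xi>: "\<xi> \<in> \<Xi>" "\<eta> \<in> \<Xi>"
  shows "(\<integral>\<^sup>+u. ennreal (wdist (step \<alpha> (r, \<xi>) u) (step \<alpha> (r, \<eta>) u)) \<partial>Q)
    \<le> ennreal (\<rho> * (V r * (norm (\<xi> - \<eta>) / \<alpha>)))"
proof -
  \<comment> \<open>The summand 1 keeps n positive when the phases coincide.\<close>
  define n where "n = nat \<lceil>norm (\<xi> - \<eta>)\<rceil> + 1"
  have n: "norm (\<xi> - \<eta>) \<le> real n" "0 < n" unfolding n_def by linarith+
  define \<zeta> where "\<zeta> k = \<xi> + (real k / real n) *\<^sub>R (\<eta> - \<xi>)" for k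
  have \<zeta>X: "\<zeta> k \<in> \<Xi>" if "k \<le> n" for k
    using convexD_alt[OF \<Xi>_convex \<xi>, of "real k / real n"] that n by (simp add: \<zeta>_def algebra_simps)
  define q where "q = \<rho> * (V r * (norm (\<xi> - \<eta>) / n / \<alpha>))"
  have q: "0 \<le> q" unfolding q_def using \<rho> V_pos[of r] \<alpha> by simp
  have \<zeta>n: "norm (\<zeta> k - \<zeta> (Suc k)) = norm (\<xi> - \<eta>) / n" for k
  proof -
    have "\<zeta> k - \<zeta> (Suc k) = (1 / real n) *\<^sub>R (\<xi> - \<eta>)"
      unfolding \<zeta>_def by (simp add: algebra_simps add_divide_distrib)
    then show ?thesis by simp
  qed
  have "(\<integral>\<^sup>+u. ennreal (wdist (step \<alpha> (r, \<zeta> 0) u) (step \<alpha> (r, \<zeta> k) u)) \<partial>Q) \<le> ennreal (real k * q)" if "k \<le> n" for k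
    using that
  proof (induction k)
    case (Suc k)
    have "(\<integral>\<^sup>+u. ennreal (wdist (step \<alpha> (r, \<zeta> 0) u) (step \<alpha> (r, \<zeta> (Suc k)) u)) \<partial>Q)
        \<le> (\<integral>\<^sup>+u. ennreal (wdist (step \<alpha> (r, \<zeta> 0) u) (step \<alpha> (r, \<zeta> k) u)) + ennreal (wdist (step \<alpha> (r, \<zeta> k) u) (step \<alpha> (r, \<zeta> (Suc k)) u)) \<partial>Q)"
      by (intro nn_integral_mono) (simp add: ennreal_plus[symmetric] wdist_nonneg ennreal_leI wdist_triangle del: ennreal_plus)
    also have "\<dots> = (\<integral>\<^sup>+u. ennreal (wdist (step \<alpha> (r, \<zeta> 0) u) (step \<alpha> (r, \<zeta> k) u)) \<partial>Q)
        + (\<integral>\<^sup>+u. ennreal (wdist (step \<alpha> (r, \<zeta> k) u) (step \<alpha> (r, \<zeta> (Suc k)) u)) \<partial>Q)"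
      using Suc.prems by (intro nn_integral_add wdist_step_measurable) (auto intro!: \<zeta>X)
    also have "\<dots> \<le> ennreal (real k * q) + ennreal q"
    proof (rule add_mono)
      show "(\<integral>\<^sup>+u. ennreal (wdist (step \<alpha> (r, \<zeta> k) u) (step \<alpha> (r, \<zeta> (Suc k)) u)) \<partial>Q) \<le> ennreal q"
        using vertical_contraction_short[of "\<zeta> k" "\<zeta> (Suc k)" r] \<zeta>X[of k] \<zeta>X[of "Suc k"] Suc.prems n
        unfolding \<zeta>n q_def by (simp add: field_simps)
    qed (use Suc in auto)
    also have "\<dots> = ennreal (real (Suc k) * q)" using q by (simp add: ennreal_plus[symmetric] algebra_simps del: ennreal_plus)
    finally show ?case .
  qed simp
  from this[of n] have "(\<integral>\<^sup>+u. ennreal (wdist (step \<alpha> (r, \<zeta> 0) u) (step \<alpha> (r, \<zeta> n) u)) \<partial>Q) \<le> ennreal (real n * q)" by simp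
  moreover have "\<zeta> 0 = \<xi>" "\<zeta> n = \<eta>" using n by (auto simp: \<zeta>_def)
  moreover have "real n * q = \<rho> * (V r * (norm (\<xi> - \<eta>) / \<alpha>))" using n by (simp add: q_def)
  ultimately show ?thesis by simp
qed

theorem wdist_contraction:
  assumes \<xi>: "\<xi> \<in> \<Xi>" "\<eta> \<in> \<Xi>"
  shows "(\<integral>\<^sup>+u. ennreal (wdist (step \<alpha> (t, \<xi>) u) (step \<alpha> (s, \<eta>) u)) \<partial>Q)
    \<le> ennreal \<rho> * ennreal (wdist (t, \<xi>) (s, \<eta>))"
proof (rule ennreal_le_epsilon)
  fix e0 :: real assume e0: "0 < e0"
  define e where "e = e0 / (\<rho> + 1)"
  have e: "0 < e" "\<rho> * e \<le> e0" using e0 \<rho> by (auto simp: e_def field_simps)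
  \<comment> \<open>The two points are joined through (r, \<xi>) and (r, \<eta>) at a near-optimal
    height; the three lengths sum to \<open>cost\<close>.\<close>
  obtain r where r: "cost r (t, \<xi>) (s, \<eta>) < wdist (t, \<xi>) (s, \<eta>) + e" using wdist_approx[OF e(1)] .
  let ?d = "\<lambda>z z' u. ennreal (wdist (step \<alpha> z u) (step \<alpha> z' u))"
  have "(\<integral>\<^sup>+u. ?d (t, \<xi>) (s, \<eta>) u \<partial>Q) \<le> (\<integral>\<^sup>+u. ?d (t, \<xi>) (r, \<xi>) u + (?d (r, \<xi>) (r, \<eta>) u + ?d (r, \<eta>) (s, \<eta>) u) \<partial>Q)"
  proof (rule nn_integral_mono)
    fix u
    have "wdist (step \<alpha> (t, \<xi>) u) (step \<alpha> (s, \<eta>) u) \<le> wdist (step \<alpha> (t, \<xi>) u) (step \<alpha> (r, \<xi>) u) +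
      (wdist (step \<alpha> (r, \<xi>) u) (step \<alpha> (r, \<eta>) u) + wdist (step \<alpha> (r, \<eta>) u) (step \<alpha> (s, \<eta>) u))"
      by (meson add_left_mono order_trans wdist_triangle)
    then show "?d (t, \<xi>) (s, \<eta>) u \<le> ?d (t, \<xi>) (r, \<xi>) u + (?d (r, \<xi>) (r, \<eta>) u + ?d (r, \<eta>) (s, \<eta>) u)"
      by (simp add: ennreal_plus[symmetric] wdist_nonneg ennreal_leI del: ennreal_plus)
  qed
  also have "\<dots> = (\<integral>\<^sup>+u. ?d (t, \<xi>) (r, \<xi>) u \<partial>Q) + ((\<integral>\<^sup>+u. ?d (r, \<xi>) (r, \<eta>) u \<partial>Q) + (\<integral>\<^sup>+u. ?d (r, \<eta>) (s, \<eta>) u \<partial>Q))"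
  proof -
    have [measurable]: "?d (t, \<xi>) (r, \<xi>) \<in> borel_measurable Q" "?d (r, \<xi>) (r, \<eta>) \<in> borel_measurable Q"
      "?d (r, \<eta>) (s, \<eta>) \<in> borel_measurable Q" using \<xi> by (auto intro!: wdist_step_measurable)
    show ?thesis by (simp add: nn_integral_add)
  qed
  also have "\<dots> \<le> ennreal (\<rho> * \<bar>F t - F r\<bar>) + (ennreal (\<rho> * (V r * (norm (\<xi> - \<eta>) / \<alpha>))) + ennreal (\<rho> * \<bar>F r - F s\<bar>))"
    by (intro add_mono horizontal_contraction vertical_contraction \<xi>)
  also have "\<dots> = ennreal (\<rho> * cost r (t, \<xi>) (s, \<eta>))"
  proof -
    have c: "\<rho> * cost r (t, \<xi>) (s, \<eta>) = \<rho> * \<bar>F t - F r\<bar> + (\<rho> * (V r * (norm (\<xi> - \<eta>) / \<alpha>)) + \<rho> * \<bar>F r - F s\<bar>)"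
      by (simp add: cost_def algebra_simps abs_minus_commute)
    have n1: "0 \<le> \<rho> * \<bar>F t - F r\<bar>" "0 \<le> \<rho> * (V r * (norm (\<xi> - \<eta>) / \<alpha>))" "0 \<le> \<rho> * \<bar>F r - F s\<bar>"
      using \<rho> V_pos[of r] \<alpha> by auto
    show ?thesis unfolding c ennreal_plus[OF n1(1) add_nonneg_nonneg[OF n1(2,3)]] ennreal_plus[OF n1(2,3)] ..
  qed
  also have "\<dots> \<le> ennreal (\<rho> * wdist (t, \<xi>) (s, \<eta>) + e0)"
  proof (rule ennreal_leI)
    have "\<rho> * cost r (t, \<xi>) (s, \<eta>) \<le> \<rho> * (wdist (t, \<xi>) (s, \<eta>) + e)" using r \<rho> by (intro mult_left_mono) auto
    then show "\<rho> * cost r (t, \<xi>) (s, \<eta>) \<le> \<rho> * wdist (t, \<xi>) (s, \<eta>) + e0" using e(2) unfolding distrib_left by linarith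
  qed
  also have "\<dots> = ennreal \<rho> * ennreal (wdist (t, \<xi>) (s, \<eta>)) + ennreal e0"
    using \<rho> wdist_nonneg[of "(t, \<xi>)" "(s, \<eta>)"] e0 by (simp add: ennreal_mult)
  finally show "(\<integral>\<^sup>+u. ?d (t, \<xi>) (s, \<eta>) u \<partial>Q) \<le> ennreal \<rho> * ennreal (wdist (t, \<xi>) (s, \<eta>)) + ennreal e0" .
qed

lemma wdist_start_finite:
  assumes \<xi>: "\<xi> \<in> \<Xi>" and W: "W \<in> borel_measurable Q"
    "\<forall>u\<in>space Q. 0 \<le> W u \<and> (\<forall>s. \<bar>s\<bar> \<le> \<alpha> * \<bar>G 0 \<xi> u\<bar> \<longrightarrow> V s \<le> W u)"
    "integrable Q (\<lambda>u. W u * (\<alpha> * \<bar>G 0 \<xi> u\<bar>))"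
  shows "(\<integral>\<^sup>+u. ennreal (wdist (0, \<xi>) (step \<alpha> (0, \<xi>) u)) \<partial>Q) < \<infinity>"
proof -
  define E where "E u = W u * (\<alpha> * \<bar>G 0 \<xi> u\<bar>) + V 0 / \<alpha> * norm (\<Phi> \<xi> u - \<xi>)" for u
  have iE: "integrable Q E" unfolding E_def using W(3) \<Phi>_moment[OF \<xi>] by simp
  have le: "wdist (0, \<xi>) (step \<alpha> (0, \<xi>) u) \<le> E u" if u: "u \<in> space Q" for u
  proof -
    have "\<bar>F 0 - F (- (\<alpha> * G 0 \<xi> u))\<bar> \<le> W u * \<bar>0 - (- (\<alpha> * G 0 \<xi> u))\<bar>"
    proof (rule F_abs_diff_le)
      fix s assume "min (- (\<alpha> * G 0 \<xi> u)) 0 \<le> s" "s \<le> max (- (\<alpha> * G 0 \<xi> u)) 0"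
      then have "\<bar>s\<bar> \<le> \<bar>\<alpha> * G 0 \<xi> u\<bar>" by auto
      then show "V s \<le> W u" using W(2) u \<alpha> by (simp add: abs_mult)
    qed
    then show ?thesis
      using wdist_le[of 0 \<xi> "- (\<alpha> * G 0 \<xi> u)" "\<Phi> \<xi> u"] \<alpha>
      unfolding E_def step_def by (simp add: abs_mult norm_minus_commute)
  qed
  have "(\<integral>\<^sup>+u. ennreal (wdist (0, \<xi>) (step \<alpha> (0, \<xi>) u)) \<partial>Q) \<le> (\<integral>\<^sup>+u. ennreal (norm (E u)) \<partial>Q)"
    by (intro nn_integral_mono ennreal_leI) (use le in force)
  also have "\<dots> < \<infinity>" using iE by (simp add: integrable_iff_bounded)
  finally show ?thesis .
qed

end

section \<open>The separable recursion\<close>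

lemma C1_differentiable_on_UNIV_deriv:
  fixes f :: "real \<Rightarrow> real"
  assumes "f C1_differentiable_on UNIV"
  shows "(f has_real_derivative deriv f t) (at t)"
proof -
  obtain D where "(f has_vector_derivative D t) (at t)" using assms by (auto simp: C1_differentiable_on_def)
  then show ?thesis by (simp add: has_real_derivative_iff_has_vector_derivative[symmetric] DERIV_imp_deriv)
qed

lemma difference_quotients_tendsto:
  fixes f :: "real \<Rightarrow> real"
  assumes "(f has_real_derivative D) (at t)"
  shows "(\<lambda>n. (f (t + inverse (real (Suc n))) - f t) * real (Suc n)) \<longlonglongrightarrow> D"
proof -
  have "(\<lambda>h. (f (t + h) - f t) / h) \<midarrow>0\<rightarrow> D" using assms by (simp add: DERIV_def)
  moreover have "filterlim (\<lambda>n. inverse (real (Suc n))) (at 0) sequentially"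
    using LIMSEQ_inverse_real_of_nat by (intro filterlim_atI) auto
  ultimately have "(\<lambda>n. (f (t + inverse (real (Suc n))) - f t) / inverse (real (Suc n))) \<longlonglongrightarrow> D"
    by (rule filterlim_compose)
  then show ?thesis by (simp add: divide_inverse)
qed

text \<open>The right side is at most |t - s| |a - b|; dividing by |a - b| leaves the Lipschitz
  bound.\<close>

lemma cocoercive_lipschitz:
  fixes a b s t :: real
  assumes L: "1 \<le> L" and c: "inverse L * \<bar>a - b\<bar>\<^sup>2 \<le> (t - s) * (a - b)"
  shows "\<bar>a - b\<bar> \<le> L * \<bar>t - s\<bar>"
proof (cases "a = b")
  case False
  have "inverse L * \<bar>a - b\<bar>\<^sup>2 \<le> \<bar>t - s\<bar> * \<bar>a - b\<bar>" using c by (metis abs_ge_self abs_mult order_trans)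
  then have "inverse L * \<bar>a - b\<bar> * \<bar>a - b\<bar> \<le> \<bar>t - s\<bar> * \<bar>a - b\<bar>" by (simp add: power2_eq_square)
  then have "inverse L * \<bar>a - b\<bar> \<le> \<bar>t - s\<bar>" using False by (subst (asm) mult_le_cancel_right_pos) auto
  then show ?thesis using L by (simp add: field_simps)
qed (use L in auto)

section \<open>The law of an innovation\<close>

context sgd_noise
begin

definition innovation :: "'u measure" where
  "innovation = distr M S (U 1)"

lemma U_measurable [measurable]: "U 1 \<in> M \<rightarrow>\<^sub>M S"
  using U_indep unfolding indep_vars_def by auto

lemma prob_space_innovation: "prob_space innovation"
  unfolding innovation_def by (rule prob_space_distr) measurable

lemma sets_innovation [measurable_cong]: "sets innovation = sets S"
  and space_innovation: "space innovation = space S"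
  by (simp_all add: innovation_def)

lemma measurable_innovation: "measurable innovation N = measurable S N"
  by (rule measurable_cong_sets) (simp_all add: sets_innovation)

lemma Phi_slice: "\<xi> \<in> \<Xi> \<Longrightarrow> \<Phi> \<xi> \<in> S \<rightarrow>\<^sub>M restrict_space borel \<Xi>"
  using measurable_compose[OF measurable_Pair1' Phi_measurable, of \<xi>] by (simp add: space_restrict_space)

lemma Phi_slice_borel: "\<xi> \<in> \<Xi> \<Longrightarrow> \<Phi> \<xi> \<in> borel_measurable S"
  using measurable_compose[OF Phi_slice measurable_restrict_space1[OF measurable_ident_sets[OF refl]]] by simp

lemma Phi_in: "\<xi> \<in> \<Xi> \<Longrightarrow> u \<in> space S \<Longrightarrow> \<Phi> \<xi> u \<in> \<Xi>"
  using measurable_space[OF Phi_slice] by (simp add: space_restrict_space)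

lemma integral_innovation: "f \<in> borel_measurable S \<Longrightarrow> (\<integral>u. (f u :: real) \<partial>innovation) = (\<integral>\<omega>. f (U 1 \<omega>) \<partial>M)"
  unfolding innovation_def by (rule integral_distr[OF U_measurable]) auto

lemma integrable_innovation: "f \<in> borel_measurable S \<Longrightarrow> integrable innovation f \<longleftrightarrow> integrable M (\<lambda>\<omega>. (f (U 1 \<omega>) :: real))"
  unfolding innovation_def by (rule integrable_distr_eq[OF U_measurable]) auto

lemma nn_integral_innovation: "f \<in> borel_measurable S \<Longrightarrow> (\<integral>\<^sup>+u. f u \<partial>innovation) = (\<integral>\<^sup>+\<omega>. f (U 1 \<omega>) \<partial>M)"
  unfolding innovation_def by (rule nn_integral_distr[OF U_measurable]) auto

end

section \<open>Averaged consequences of the one-dimensional assumptions\<close>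

context one_dim_assumptions
begin

lemma g_Phi_measurable: "\<xi> \<in> \<Xi> \<Longrightarrow> (\<lambda>p. g (fst p) (\<Phi> \<xi> (snd p))) \<in> borel_measurable (borel \<Otimes>\<^sub>M S)"
proof -
  assume \<xi>: "\<xi> \<in> \<Xi>"
  have "(\<lambda>p. (fst p, \<Phi> \<xi> (snd p))) \<in> borel \<Otimes>\<^sub>M S \<rightarrow>\<^sub>M borel \<Otimes>\<^sub>M restrict_space borel \<Xi>"
    by (intro measurable_Pair measurable_compose[OF measurable_snd Phi_slice[OF \<xi>]]) measurable
  from measurable_compose[OF this g_measurable] show ?thesis by (simp add: split_def)
qed

lemma g_Phi_slice: "\<xi> \<in> \<Xi> \<Longrightarrow> (\<lambda>u. g t (\<Phi> \<xi> u)) \<in> borel_measurable S"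
  using measurable_compose[OF measurable_Pair1'[of t borel S] g_Phi_measurable[of \<xi>]] by simp

lemma H_deriv: "(H has_real_derivative deriv H t) (at t)"
  and H_deriv2: "(deriv H has_real_derivative deriv (deriv H) t) (at t)"
  by (rule C1_differentiable_on_UNIV_deriv[OF asm_a_C2(1)], rule C1_differentiable_on_UNIV_deriv[OF asm_a_C2(2)])

lemma deriv_H_measurable [measurable]: "deriv H \<in> borel_measurable borel"
  by (rule borel_measurable_continuous_onI)
    (use DERIV_isCont[OF H_deriv2] in \<open>auto simp: continuous_on_eq_continuous_within\<close>)

lemma deriv_H_0: "deriv H 0 = 0"
  by (rule DERIV_local_min[OF H_deriv, of 1]) (use asm_a_min in auto)

text \<open>For \<beta> < 2 the exponential moment dominates. For \<beta> = 2 integrability is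
  assumed at t = 0 and one phase; the Lipschitz bound in the phase and the one in t implied by
  cocoercivity carry it over.\<close>

lemma integrable_g_Phi:
  assumes \<beta>: "1 \<le> \<beta>" "\<beta> \<le> 2" and \<xi>: "\<xi> \<in> \<Xi>"
  shows "integrable innovation (\<lambda>u. g t (\<Phi> \<xi> u))"
proof (cases "\<beta> = 2")
  case False
  then have b: "\<beta> < 2" using \<beta> by simp
  obtain rate where rate: "0 < rate" "(SUP t. SUP \<xi>\<in>\<Xi>.
        \<integral>\<^sup>+\<omega>. ennreal (exp (rate * \<bar>g t (\<Phi> \<xi> (U 1 \<omega>))\<bar> / (1 + abs_pow t (\<beta> - 1)))) \<partial>M) < \<infinity>"
    using asm_h[OF b] by blast
  define q where "q = rate / (1 + abs_pow t (\<beta> - 1))"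
  have q: "0 < q" using rate by (auto simp: q_def abs_pow_def intro!: divide_pos_pos add_pos_nonneg)
  note [measurable] = g_Phi_slice[OF \<xi>]
  have "(\<integral>\<^sup>+\<omega>. ennreal (exp (rate * \<bar>g t (\<Phi> \<xi> (U 1 \<omega>))\<bar> / (1 + abs_pow t (\<beta> - 1)))) \<partial>M) < \<infinity>"
    by (rule le_less_trans[OF _ rate(2)], rule SUP_upper2[of t], simp, rule SUP_upper2[of \<xi>]) (use \<xi> in auto)
  then have "integrable innovation (\<lambda>u. exp (q * \<bar>g t (\<Phi> \<xi> u)\<bar>))"
    unfolding integrable_iff_bounded measurable_innovation by (subst nn_integral_innovation) (auto simp: q_def)
  then have "integrable innovation (\<lambda>u. exp (q * \<bar>g t (\<Phi> \<xi> u)\<bar>) / q)" by simp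
  then show ?thesis
  proof (rule Bochner_Integration.integrable_bound)
    have "q * \<bar>x\<bar> \<le> exp (q * \<bar>x\<bar>)" for x :: real using exp_ge_add_one_self[of "q * \<bar>x\<bar>"] by linarith
    then have "norm x \<le> norm (exp (q * \<bar>x\<bar>) / q)" for x :: real using q by (simp add: field_simps)
    then show "AE u in innovation. norm (g t (\<Phi> \<xi> u)) \<le> norm (exp (q * \<bar>g t (\<Phi> \<xi> u)\<bar>) / q)" by auto
  qed (simp add: measurable_innovation)
next
  case True
  interpret Q: prob_space innovation by (rule prob_space_innovation)
  obtain \<zeta> where \<zeta>: "\<zeta> \<in> \<Xi>" "integrable M (\<lambda>\<omega>. \<bar>g 0 (\<Phi> \<zeta> (U 1 \<omega>))\<bar>)" using asm_f True by blast
  obtain L where L: "0 < L" "\<And>t \<xi> \<eta> u. \<xi> \<in> \<Xi> \<Longrightarrow> \<eta> \<in> \<Xi> \<Longrightarrow> u \<in> space S \<Longrightarrow> \<bar>g t (\<Phi> \<xi> u) - g t (\<Phi> \<eta> u)\<bar> \<le> L * norm (\<xi> - \<eta>)"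
    using asm_e by blast
  obtain L' where L': "1 \<le> L'" "\<And>s t \<xi>. \<xi> \<in> \<Xi> \<Longrightarrow> (t - s) * ((deriv H t + g t \<xi>) - (deriv H s + g s \<xi>))
          \<ge> inverse L' * \<bar>(deriv H t + g t \<xi>) - (deriv H s + g s \<xi>)\<bar>\<^sup>2" using asm_j_cocoercive by blast
  note [measurable] = g_Phi_slice[OF \<xi>] g_Phi_slice[OF \<zeta>(1)]
  have "integrable innovation (\<lambda>u. \<bar>g 0 (\<Phi> \<zeta> u)\<bar>)" using \<zeta> by (simp add: integrable_innovation)
  then have "integrable innovation (\<lambda>u. \<bar>g 0 (\<Phi> \<zeta> u)\<bar> + (L * norm (\<xi> - \<zeta>) + \<bar>deriv H t - deriv H 0\<bar> + L' * \<bar>t\<bar>))" by simp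
  then show ?thesis
  proof (rule Bochner_Integration.integrable_bound)
    have "\<bar>g t (\<Phi> \<xi> u)\<bar> \<le> \<bar>g 0 (\<Phi> \<zeta> u)\<bar> + (L * norm (\<xi> - \<zeta>) + \<bar>deriv H t - deriv H 0\<bar> + L' * \<bar>t\<bar>)" if u: "u \<in> space S" for u
    proof -
      have "\<bar>(deriv H t + g t (\<Phi> \<xi> u)) - (deriv H 0 + g 0 (\<Phi> \<xi> u))\<bar> \<le> L' * \<bar>t - 0\<bar>"
        by (rule cocoercive_lipschitz[OF L'(1) L'(2)[OF Phi_in[OF \<xi> u]]])
      moreover have "\<bar>g 0 (\<Phi> \<xi> u) - g 0 (\<Phi> \<zeta> u)\<bar> \<le> L * norm (\<xi> - \<zeta>)" by (rule L(2)[OF \<xi> \<zeta>(1) u])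
      ultimately show ?thesis unfolding diff_0_right by linarith
    qed
    then show "AE u in innovation. norm (g t (\<Phi> \<xi> u)) \<le> norm (\<bar>g 0 (\<Phi> \<zeta> u)\<bar> + (L * norm (\<xi> - \<zeta>) + \<bar>deriv H t - deriv H 0\<bar> + L' * \<bar>t\<bar>))"
      by (intro AE_I2) (simp add: space_innovation, smt (verit))
  qed (simp add: measurable_innovation)
qed

lemma mean_field_eq: "\<xi> \<in> \<Xi> \<Longrightarrow> (\<integral>u. g t (\<Phi> \<xi> u) \<partial>innovation) = mean_field M U \<Phi> g t \<xi>"
  unfolding mean_field_def by (rule integral_innovation[OF g_Phi_slice])

lemma mean_drift:
  assumes "1 \<le> \<beta>" "\<beta> \<le> 2" "\<xi> \<in> \<Xi>"
  shows "(\<integral>u. deriv H t + g t (\<Phi> \<xi> u) \<partial>innovation) = deriv H t + mean_field M U \<Phi> g t \<xi>"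
proof -
  interpret Q: prob_space innovation by (rule prob_space_innovation)
  show ?thesis using integrable_g_Phi[OF assms] mean_field_eq[OF assms(3)] by (simp add: Q.prob_space)
qed

definition slope :: "real \<Rightarrow> real ^ 'k \<Rightarrow> 'u \<Rightarrow> real" where
  "slope t \<xi> u = deriv (\<lambda>t. deriv H t + g t (\<Phi> \<xi> u)) t"

lemma slope_deriv:
  assumes "\<xi> \<in> \<Xi>" "u \<in> space S"
  shows "((\<lambda>t. deriv H t + g t (\<Phi> \<xi> u)) has_real_derivative slope t \<xi> u) (at t)"
  unfolding slope_def by (rule C1_differentiable_on_UNIV_deriv[OF asm_j_C1[OF Phi_in[OF assms]]])

text \<open>Difference quotients of the drift along 1 / (n + 1). Cocoercivity bounds them between 0
  and a constant, so the derivative inherits measurability and bounds, and its mean is the limit of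
  their means.\<close>

definition quotient :: "nat \<Rightarrow> real \<Rightarrow> real ^ 'k \<Rightarrow> 'u \<Rightarrow> real" where
  "quotient n t \<xi> u = ((deriv H (t + inverse (real (Suc n))) + g (t + inverse (real (Suc n))) (\<Phi> \<xi> u))
    - (deriv H t + g t (\<Phi> \<xi> u))) * real (Suc n)"

lemma quotient_tendsto: "\<xi> \<in> \<Xi> \<Longrightarrow> u \<in> space S \<Longrightarrow> (\<lambda>n. quotient n t \<xi> u) \<longlonglongrightarrow> slope t \<xi> u"
  unfolding quotient_def by (rule difference_quotients_tendsto[OF slope_deriv])

lemma slope_measurable:
  assumes \<xi>: "\<xi> \<in> \<Xi>"
  shows "(\<lambda>p. slope (fst p) \<xi> (snd p)) \<in> borel_measurable (borel \<Otimes>\<^sub>M S)"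
proof (rule borel_measurable_LIMSEQ_real)
  show "(\<lambda>n. quotient n (fst p) \<xi> (snd p)) \<longlonglongrightarrow> slope (fst p) \<xi> (snd p)" if "p \<in> space (borel \<Otimes>\<^sub>M S)" for p
    by (rule quotient_tendsto[OF \<xi>]) (use that in \<open>auto simp: space_pair_measure\<close>)
  note [measurable] = g_Phi_measurable[OF \<xi>]
  have "(\<lambda>p. g (fst p + h) (\<Phi> \<xi> (snd p))) \<in> borel_measurable (borel \<Otimes>\<^sub>M S)" for h
  proof -
    have "(\<lambda>p. (fst p + h, snd p)) \<in> borel \<Otimes>\<^sub>M S \<rightarrow>\<^sub>M borel \<Otimes>\<^sub>M S" by measurable
    from measurable_compose[OF this g_Phi_measurable[OF \<xi>]] show ?thesis by simp
  qed
  note [measurable] = this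
  show "(\<lambda>p. quotient n (fst p) \<xi> (snd p)) \<in> borel_measurable (borel \<Otimes>\<^sub>M S)" for n
    unfolding quotient_def by measurable
qed

text \<open>The mean field can cancel at most the fraction \<theta> of an increment of
  \<open>deriv H\<close>. The averaged drift keeps at least 1 - \<theta> of it, and dominated
  convergence turns this into a bound on the mean derivative.\<close>

lemma mean_slope_ge:
  assumes \<beta>: "1 \<le> \<beta>" "\<beta> \<le> 2" and \<xi>: "\<xi> \<in> \<Xi>"
    and L: "\<And>n u. u \<in> space S \<Longrightarrow> \<bar>quotient n t \<xi> u\<bar> \<le> L"
    and \<theta>: "\<And>s t. (t - s) * (mean_field M U \<Phi> g t \<xi> - mean_field M U \<Phi> g s \<xi>) \<ge> - \<theta> * (t - s) * (deriv H t - deriv H s)"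
  shows "(1 - \<theta>) * deriv (deriv H) t \<le> (\<integral>u. slope t \<xi> u \<partial>innovation)"
proof -
  interpret Q: prob_space innovation by (rule prob_space_innovation)
  have m1: "slope t \<xi> \<in> borel_measurable S"
    using measurable_compose[OF measurable_Pair1'[of t borel S] slope_measurable[OF \<xi>]] by simp
  note [measurable] = g_Phi_slice[OF \<xi>]
  have m2: "quotient n t \<xi> \<in> borel_measurable S" for n unfolding quotient_def by measurable
  have "(\<lambda>n. \<integral>u. quotient n t \<xi> u \<partial>innovation) \<longlonglongrightarrow> (\<integral>u. slope t \<xi> u \<partial>innovation)"
    by (rule integral_dominated_convergence[where w = "\<lambda>_. L"])
      (use m1 m2 L quotient_tendsto[OF \<xi>] in \<open>auto simp: measurable_innovation space_innovation intro!: AE_I2\<close>)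
  moreover have "(\<lambda>n. (1 - \<theta>) * ((deriv H (t + inverse (real (Suc n))) - deriv H t) * real (Suc n))) \<longlonglongrightarrow> (1 - \<theta>) * deriv (deriv H) t"
    by (intro tendsto_mult_left difference_quotients_tendsto H_deriv2)
  moreover have "(1 - \<theta>) * ((deriv H (t + inverse (real (Suc n))) - deriv H t) * real (Suc n)) \<le> (\<integral>u. quotient n t \<xi> u \<partial>innovation)" for n
  proof -
    define h where "h = inverse (real (Suc n))"
    have h: "0 < h" "real (Suc n) = 1 / h" unfolding h_def by (simp_all add: divide_inverse del: of_nat_Suc)
    have i: "integrable innovation (\<lambda>u. deriv H s + g s (\<Phi> \<xi> u))" for s using integrable_g_Phi[OF \<beta> \<xi>] by simp
    have eq: "(\<integral>u. quotient n t \<xi> u \<partial>innovation)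
      = ((deriv H (t + h) + mean_field M U \<Phi> g (t + h) \<xi>) - (deriv H t + mean_field M U \<Phi> g t \<xi>)) / h"
      unfolding quotient_def h_def[symmetric] h(2)
      using Bochner_Integration.integral_diff[OF i i, of "t + h" t] mean_drift[OF \<beta> \<xi>] by simp
    have mono: "- \<theta> * h * (deriv H (t + h) - deriv H t) \<le> h * (mean_field M U \<Phi> g (t + h) \<xi> - mean_field M U \<Phi> g t \<xi>)"
      using \<theta>[of "t + h" t] by simp
    have "- \<theta> * (deriv H (t + h) - deriv H t) \<le> mean_field M U \<Phi> g (t + h) \<xi> - mean_field M U \<Phi> g t \<xi>"
    proof -
      have "y \<le> x" if "- \<theta> * h * z \<le> h * x" "y = - \<theta> * z" for x y z
      proof -
        have "h * y \<le> h * x" using that by (simp add: mult_ac)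
        then show ?thesis using h(1) by simp
      qed
      then show ?thesis using mono by blast
    qed
    then have "(1 - \<theta>) * (deriv H (t + h) - deriv H t) \<le> (deriv H (t + h) + mean_field M U \<Phi> g (t + h) \<xi>) - (deriv H t + mean_field M U \<Phi> g t \<xi>)"
      by (simp add: algebra_simps)
    from divide_right_mono[OF this less_imp_le[OF h(1)]] eq
    show ?thesis unfolding h_def[symmetric] h(2) by simp
  qed
  ultimately show ?thesis by (intro LIMSEQ_le) auto
qed

end

section \<open>One coordinate with all constants chosen\<close>

context sgd_coordinate
begin

lemma wdist_contraction_weight1:
  "\<exists>\<kappa>>0. \<exists>\<kappa>0>0. \<exists>c>0. \<exists>a>0. \<forall>\<alpha>\<in>{0<..a}. \<exists>F. weighted_line (weight1 \<kappa> \<kappa>0 \<alpha>) F \<alpha> \<and>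
    (\<forall>t s. \<forall>\<xi>\<in>\<Xi>. \<forall>\<eta>\<in>\<Xi>.
      (\<integral>\<^sup>+u. ennreal (weighted_line.wdist (weight1 \<kappa> \<kappa>0 \<alpha>) F \<alpha> (step \<alpha> (t, \<xi>) u) (step \<alpha> (s, \<eta>) u)) \<partial>Q)
        \<le> ennreal (1 - c * \<alpha> powr (m - 1)) * ennreal (weighted_line.wdist (weight1 \<kappa> \<kappa>0 \<alpha>) F \<alpha> (t, \<xi>) (s, \<eta>))) \<and>
    (\<forall>\<xi>\<in>\<Xi>. (\<integral>\<^sup>+u. ennreal (weighted_line.wdist (weight1 \<kappa> \<kappa>0 \<alpha>) F \<alpha> (0, \<xi>) (step \<alpha> (0, \<xi>) u)) \<partial>Q) < \<infinity>)"
proof -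
  obtain \<kappa> \<kappa>0 c1 a1 where 1: "0 < \<kappa>" "\<kappa> \<le> 1" "0 < \<kappa>0" "0 < c1" "0 < a1" and
    line: "\<forall>\<alpha>\<in>{0<..a1}. \<forall>t. \<forall>\<xi>\<in>\<Xi>.
      integrable Q (\<lambda>u. (1 - \<alpha> * G' t \<xi> u) * weight1 \<kappa> \<kappa>0 \<alpha> (t - \<alpha> * G t \<xi> u)) \<and>
      (\<integral>u. (1 - \<alpha> * G' t \<xi> u) * weight1 \<kappa> \<kappa>0 \<alpha> (t - \<alpha> * G t \<xi> u) \<partial>Q)
        \<le> (1 - c1 * \<alpha> powr (m - 1)) * weight1 \<kappa> \<kappa>0 \<alpha> t"
    using line_contraction by blast
  obtain c2 a2 where 2: "0 < c2" "0 < a2" and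
    phase: "\<forall>\<alpha>\<in>{0<..a2}. \<forall>t. \<forall>\<xi>\<in>\<Xi>. \<exists>W. W \<in> borel_measurable Q \<and>
      (\<forall>u\<in>space Q. 0 \<le> W u \<and> (\<forall>s. \<bar>s - (t - \<alpha> * G t \<xi> u)\<bar> \<le> \<alpha> * Lg \<longrightarrow> weight1 \<kappa> \<kappa>0 \<alpha> s \<le> W u)) \<and>
      integrable Q (\<lambda>u. (\<alpha> * Lg + L\<Phi> u / \<alpha>) * W u) \<and>
      (\<integral>u. (\<alpha> * Lg + L\<Phi> u / \<alpha>) * W u \<partial>Q) \<le> (1 - c2) * (weight1 \<kappa> \<kappa>0 \<alpha> t / \<alpha>)"
    using phase_contraction[OF 1(1-3)] by blast
  obtain a3 where 3: "0 < a3" and start: "\<forall>\<alpha>\<in>{0<..a3}. \<forall>\<xi>\<in>\<Xi>. \<exists>W. W \<in> borel_measurable Q \<and>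
      (\<forall>u\<in>space Q. 0 \<le> W u \<and> (\<forall>s. \<bar>s\<bar> \<le> \<alpha> * \<bar>G 0 \<xi> u\<bar> \<longrightarrow> weight1 \<kappa> \<kappa>0 \<alpha> s \<le> W u)) \<and>
      integrable Q (\<lambda>u. W u * (\<alpha> * \<bar>G 0 \<xi> u\<bar>))"
    using start_moment[OF 1(1-3)] by blast
  \<comment> \<open>The cap at 1 keeps the factor nonnegative. Vertical segments contract by the
    fixed factor 1 - c2, which is at most 1 - c \<alpha>^(m-1) because \<alpha> \<le> 1.\<close>
  define c where "c = min (min c1 c2) 1"
  define a where "a = min (min a1 a2) (min a3 (min 1 (1 / LG)))"
  have c: "0 < c" "c \<le> c1" "c \<le> c2" "c \<le> 1" using 1 2 by (auto simp: c_def)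
  have a: "0 < a" using 1 2 3 par by (simp add: a_def)
  have "\<exists>F. weighted_line (weight1 \<kappa> \<kappa>0 \<alpha>) F \<alpha> \<and>
    (\<forall>t s. \<forall>\<xi>\<in>\<Xi>. \<forall>\<eta>\<in>\<Xi>.
      (\<integral>\<^sup>+u. ennreal (weighted_line.wdist (weight1 \<kappa> \<kappa>0 \<alpha>) F \<alpha> (step \<alpha> (t, \<xi>) u) (step \<alpha> (s, \<eta>) u)) \<partial>Q)
        \<le> ennreal (1 - c * \<alpha> powr (m - 1)) * ennreal (weighted_line.wdist (weight1 \<kappa> \<kappa>0 \<alpha>) F \<alpha> (t, \<xi>) (s, \<eta>))) \<and>
    (\<forall>\<xi>\<in>\<Xi>. (\<integral>\<^sup>+u. ennreal (weighted_line.wdist (weight1 \<kappa> \<kappa>0 \<alpha>) F \<alpha> (0, \<xi>) (step \<alpha> (0, \<xi>) u)) \<partial>Q) < \<infinity>)"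
    if \<alpha>0: "0 < \<alpha>" and \<alpha>a: "\<alpha> \<le> a" for \<alpha>
  proof -
    have \<alpha>b: "\<alpha> \<le> a1" "\<alpha> \<le> a2" "\<alpha> \<le> a3" "\<alpha> \<le> 1" "\<alpha> * LG \<le> 1"
      using \<alpha>a par by (auto simp: a_def field_simps)
    define V where "V = weight1 \<kappa> \<kappa>0 \<alpha>"
    define \<rho> where "\<rho> = 1 - c * \<alpha> powr (m - 1)"
    have pw: "0 \<le> \<alpha> powr (m - 1)" "\<alpha> powr (m - 1) \<le> 1" using \<alpha>0 \<alpha>b m by (auto intro: powr_le1)
    have \<rho>: "0 \<le> \<rho>" using mult_mono[OF c(4) pw(2)] pw c by (simp add: \<rho>_def)
    have \<rho>1: "1 - c1 * \<alpha> powr (m - 1) \<le> \<rho>" using mult_right_mono[OF c(2) pw(1)] by (simp add: \<rho>_def)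
    have \<rho>2: "1 - c2 \<le> \<rho>" using mult_mono[OF c(3) pw(2)] pw 2 by (simp add: \<rho>_def)
    have V1: "1 \<le> V t" for t unfolding V_def by (rule weight1_bounds(1)[OF 1(1,3) \<alpha>0 \<alpha>b(4)])
    have V0: "0 \<le> V t" for t using V1[of t] by simp
    obtain F where F: "\<And>t. (F has_real_derivative V t) (at t)"
      using continuous_antiderivative[OF continuous_weight1, of \<kappa> \<kappa>0 \<alpha>] unfolding V_def by blast
    have wl: "weighted_line V F \<alpha>"
      by unfold_locales (use F V1 \<alpha>0 continuous_weight1 in \<open>auto simp: V_def\<close>)
    interpret weighted_line V F \<alpha> by (rule wl)
    interpret sgd_coordinate_contraction Q \<Xi> \<Phi> G G' L\<Phi> m \<beta> R LG Lg cb cd rate Ce \<epsilon> p V F \<alpha> \<rho>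
    proof unfold_locales
      fix t \<xi> assume \<xi>: "\<xi> \<in> \<Xi>"
      have l: "integrable Q (\<lambda>u. (1 - \<alpha> * G' t \<xi> u) * V (t - \<alpha> * G t \<xi> u))"
        "(\<integral>u. (1 - \<alpha> * G' t \<xi> u) * V (t - \<alpha> * G t \<xi> u) \<partial>Q) \<le> (1 - c1 * \<alpha> powr (m - 1)) * V t"
        unfolding V_def using line \<alpha>0 \<alpha>b \<xi> by auto
      show "integrable Q (\<lambda>u. (1 - \<alpha> * G' t \<xi> u) * V (t - \<alpha> * G t \<xi> u)) \<and>
          (\<integral>u. (1 - \<alpha> * G' t \<xi> u) * V (t - \<alpha> * G t \<xi> u) \<partial>Q) \<le> \<rho> * V t"
        using l order_trans[OF l(2) mult_right_mono[OF \<rho>1 V0]] by blast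
      obtain W where W: "W \<in> borel_measurable Q"
        "\<forall>u\<in>space Q. 0 \<le> W u \<and> (\<forall>s. \<bar>s - (t - \<alpha> * G t \<xi> u)\<bar> \<le> \<alpha> * Lg \<longrightarrow> V s \<le> W u)"
        "integrable Q (\<lambda>u. (\<alpha> * Lg + L\<Phi> u / \<alpha>) * W u)"
        "(\<integral>u. (\<alpha> * Lg + L\<Phi> u / \<alpha>) * W u \<partial>Q) \<le> (1 - c2) * (V t / \<alpha>)"
        using phase[rule_format, of \<alpha> \<xi> t] \<alpha>0 \<alpha>b \<xi> unfolding V_def by auto
      have "(\<integral>u. (\<alpha> * Lg + L\<Phi> u / \<alpha>) * W u \<partial>Q) \<le> \<rho> * (V t / \<alpha>)"
        by (rule order_trans[OF W(4) mult_right_mono[OF \<rho>2]]) (use V0 \<alpha>0 in auto)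
      then show "\<exists>W. W \<in> borel_measurable Q \<and>
          (\<forall>u\<in>space Q. 0 \<le> W u \<and> (\<forall>s. \<bar>s - (t - \<alpha> * G t \<xi> u)\<bar> \<le> \<alpha> * Lg \<longrightarrow> V s \<le> W u)) \<and>
          integrable Q (\<lambda>u. (\<alpha> * Lg + L\<Phi> u / \<alpha>) * W u) \<and>
          (\<integral>u. (\<alpha> * Lg + L\<Phi> u / \<alpha>) * W u \<partial>Q) \<le> \<rho> * (V t / \<alpha>)" using W by blast
    qed (use \<alpha>b \<rho> in auto)
    have "(\<integral>\<^sup>+u. ennreal (wdist (0, \<xi>) (step \<alpha> (0, \<xi>) u)) \<partial>Q) < \<infinity>" if \<xi>: "\<xi> \<in> \<Xi>" for \<xi>
    proof -
      obtain W where "W \<in> borel_measurable Q"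
        "\<forall>u\<in>space Q. 0 \<le> W u \<and> (\<forall>s. \<bar>s\<bar> \<le> \<alpha> * \<bar>G 0 \<xi> u\<bar> \<longrightarrow> V s \<le> W u)"
        "integrable Q (\<lambda>u. W u * (\<alpha> * \<bar>G 0 \<xi> u\<bar>))"
        using start[rule_format, of \<alpha> \<xi>] \<alpha>0 \<alpha>b \<xi> unfolding V_def by auto
      then show ?thesis by (rule wdist_start_finite[OF \<xi>])
    qed
    then show ?thesis using wl wdist_contraction unfolding V_def \<rho>_def by blast
  qed
  then show ?thesis using 1 c a
    by (intro exI[of _ \<kappa>] conjI exI[of _ \<kappa>0] exI[of _ c] exI[of _ a]) auto
qed

end

context one_dim_assumptions
begin

lemma deriv_H_growth:
  assumes \<beta>: "1 \<le> \<beta>" "\<beta> < 2" and m: "2 \<le> m"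
  shows "\<exists>C\<ge>0. \<forall>t. \<bar>deriv H t\<bar> \<le> C * (1 + abs_pow t (\<beta> - 1))"
proof -
  obtain C_out where out: "0 < C_out" "\<And>t. \<bar>t\<bar> \<ge> R \<Longrightarrow> \<bar>deriv H t\<bar> \<le> C_out * abs_pow t (\<beta> - 1)"
    using asm_c_subquadratic[OF \<beta>] by blast
  obtain C_in where inn: "0 < C_in" "\<And>t. \<bar>t\<bar> \<le> R \<Longrightarrow> t \<noteq> 0 \<Longrightarrow> \<bar>deriv H t\<bar> \<le> C_in * abs_pow t (m - 1)"
    using asm_b by blast
  define C where "C = C_out + C_in * R powr (m - 1)"
  have C: "0 \<le> C" "C_out \<le> C" "C_in * R powr (m - 1) \<le> C" using out inn by (auto simp: C_def)
  have p: "0 \<le> abs_pow t (\<beta> - 1)" for t by (simp add: abs_pow_def)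
  have "\<bar>deriv H t\<bar> \<le> C * (1 + abs_pow t (\<beta> - 1))" for t
  proof (cases "R \<le> \<bar>t\<bar>")
    case True
    have "C_out * abs_pow t (\<beta> - 1) \<le> C * (1 + abs_pow t (\<beta> - 1))" using C p[of t] by (intro mult_mono) auto
    then show ?thesis using out(2)[OF True] by linarith
  next
    case F: False
    have "\<bar>deriv H t\<bar> \<le> C * 1"
    \<comment> \<open>For m > 2 the bound near the origin excludes t = 0; there
      \<open>deriv H\<close> vanishes by minimality.\<close>
    proof (cases "t = 0")
      case True
      then show ?thesis using C by (simp add: deriv_H_0)
    next
      case False
      have "abs_pow t (m - 1) \<le> R powr (m - 1)" unfolding abs_pow_def using F m by (auto intro!: powr_mono2)
      then have "C_in * abs_pow t (m - 1) \<le> C_in * R powr (m - 1)" using inn by simp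
      then show ?thesis using inn(2)[of t] F False C by simp
    qed
    also have "\<dots> \<le> C * (1 + abs_pow t (\<beta> - 1))" using C p[of t] by (intro mult_left_mono) auto
    finally show ?thesis .
  qed
  then show ?thesis using C by blast
qed

text \<open>Since |deriv H| is at most C times the normalising scale, adding it to the noise
  multiplies the exponential moment by at most exp (rate C).\<close>

lemma exp_moment_drift:
  assumes \<beta>: "1 \<le> \<beta>" "\<beta> < 2" and m: "2 \<le> m"
  shows "\<exists>rate>0. \<exists>Ce\<ge>0. \<forall>t. \<forall>\<xi>\<in>\<Xi>.
    (\<integral>\<^sup>+u. ennreal (exp (rate * (\<bar>deriv H t + g t (\<Phi> \<xi> u)\<bar> / (1 + abs_pow t (\<beta> - 1))))) \<partial>innovation) \<le> ennreal Ce"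
proof -
  define B where "B rate = (SUP t. SUP \<xi>\<in>\<Xi>.
        \<integral>\<^sup>+\<omega>. ennreal (exp (rate * \<bar>g t (\<Phi> \<xi> (U 1 \<omega>))\<bar> / (1 + abs_pow t (\<beta> - 1)))) \<partial>M)" for rate
  obtain rate where rate: "0 < rate" "B rate < \<infinity>" using asm_h[OF \<beta>(2)] unfolding B_def by blast
  obtain C where C: "0 \<le> C" "\<And>t. \<bar>deriv H t\<bar> \<le> C * (1 + abs_pow t (\<beta> - 1))"
    using deriv_H_growth[OF assms] by blast
  have "(\<integral>\<^sup>+u. ennreal (exp (rate * (\<bar>deriv H t + g t (\<Phi> \<xi> u)\<bar> / (1 + abs_pow t (\<beta> - 1))))) \<partial>innovation)
      \<le> ennreal (exp (rate * C) * enn2real (B rate))" if \<xi>: "\<xi> \<in> \<Xi>" for t \<xi>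
  proof -
    define q where "q = 1 + abs_pow t (\<beta> - 1)"
    have q: "0 < q" by (simp add: q_def abs_pow_def add_pos_nonneg)
    note [measurable] = g_Phi_slice[OF \<xi>]
    have pt: "exp (rate * (\<bar>deriv H t + x\<bar> / q)) \<le> exp (rate * C) * exp (rate * \<bar>x\<bar> / q)" for x
    proof -
      have "\<bar>deriv H t + x\<bar> \<le> C * q + \<bar>x\<bar>" using C(2)[of t] unfolding q_def by linarith
      then have "\<bar>deriv H t + x\<bar> / q \<le> C + \<bar>x\<bar> / q" using q by (simp add: field_simps)
      from mult_left_mono[OF this, of rate] rate show ?thesis unfolding exp_add[symmetric] by (simp add: distrib_left)
    qed
    have "(\<integral>\<^sup>+u. ennreal (exp (rate * (\<bar>deriv H t + g t (\<Phi> \<xi> u)\<bar> / q))) \<partial>innovation)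
      \<le> (\<integral>\<^sup>+u. ennreal (exp (rate * C)) * ennreal (exp (rate * \<bar>g t (\<Phi> \<xi> u)\<bar> / q)) \<partial>innovation)"
      by (intro nn_integral_mono) (use pt in \<open>auto simp: ennreal_mult[symmetric] intro!: ennreal_leI\<close>)
    also have "\<dots> = ennreal (exp (rate * C)) * (\<integral>\<^sup>+u. ennreal (exp (rate * \<bar>g t (\<Phi> \<xi> u)\<bar> / q)) \<partial>innovation)"
      by (rule nn_integral_cmult) (simp add: measurable_innovation)
    also have "(\<integral>\<^sup>+u. ennreal (exp (rate * \<bar>g t (\<Phi> \<xi> u)\<bar> / q)) \<partial>innovation) = (\<integral>\<^sup>+\<omega>. ennreal (exp (rate * \<bar>g t (\<Phi> \<xi> (U 1 \<omega>))\<bar> / q)) \<partial>M)"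
      by (rule nn_integral_innovation) simp
    also have "\<dots> \<le> B rate"
      unfolding B_def q_def by (rule SUP_upper2[of t], simp, rule SUP_upper2[of \<xi>]) (use \<xi> in auto)
    also have "B rate = ennreal (enn2real (B rate))" using rate(2) by simp
    finally show ?thesis unfolding q_def by (simp add: ennreal_mult mult_left_mono)
  qed
  then show ?thesis using rate by (intro exI[of _ rate] conjI exI[of _ "exp (rate * C) * enn2real (B rate)"]) auto
qed

lemma quotient_bounds:
  assumes L: "1 \<le> L" "\<And>s t \<xi>. \<xi> \<in> \<Xi> \<Longrightarrow> (t - s) * ((deriv H t + g t \<xi>) - (deriv H s + g s \<xi>))
      \<ge> inverse L * \<bar>(deriv H t + g t \<xi>) - (deriv H s + g s \<xi>)\<bar>\<^sup>2" and \<xi>: "\<xi> \<in> \<Xi>" and u: "u \<in> space S"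
  shows "0 \<le> quotient n t \<xi> u" "quotient n t \<xi> u \<le> L"
proof -
  define h where "h = inverse (real (Suc n))"
  have h: "0 < h" "real (Suc n) = 1 / h" unfolding h_def by (simp_all add: divide_inverse del: of_nat_Suc)
  define d where "d = (deriv H (t + h) + g (t + h) (\<Phi> \<xi> u)) - (deriv H t + g t (\<Phi> \<xi> u))"
  have q: "quotient n t \<xi> u = d / h" unfolding quotient_def h_def[symmetric] h(2) d_def by simp
  have c: "inverse L * \<bar>d\<bar>\<^sup>2 \<le> (t + h - t) * d"
    unfolding d_def by (rule L(2)[OF Phi_in[OF \<xi> u]])
  have "0 \<le> inverse L * \<bar>d\<bar>\<^sup>2" using L(1) by simp
  then have "0 \<le> h * d" using c by simp
  then have d: "0 \<le> d" using h(1) by (simp add: zero_le_mult_iff)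
  then show "0 \<le> quotient n t \<xi> u" unfolding q using h by simp
  have "\<bar>d\<bar> \<le> L * \<bar>t + h - t\<bar>" unfolding d_def
    by (rule cocoercive_lipschitz[OF L(1) L(2)[OF Phi_in[OF \<xi> u]]])
  then show "quotient n t \<xi> u \<le> L" unfolding q using h(1) d by (simp add: field_simps)
qed

lemma sgd_coordinate_exists:
  assumes m: "2 \<le> m" and \<beta>: "1 \<le> \<beta>" "\<beta> \<le> 2"
  shows "\<exists>L\<Phi> LG Lg cb cd rate Ce \<epsilon> p.
    sgd_coordinate innovation \<Xi> \<Phi> (\<lambda>t \<xi> u. deriv H t + g t (\<Phi> \<xi> u)) slope L\<Phi> m \<beta> R LG Lg cb cd rate Ce \<epsilon> p"
proof -
  interpret Q: prob_space innovation by (rule prob_space_innovation)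
  note [simp] = space_innovation measurable_innovation
  obtain LG where LG: "1 \<le> LG" "\<And>s t \<xi>. \<xi> \<in> \<Xi> \<Longrightarrow> (t - s) * ((deriv H t + g t \<xi>) - (deriv H s + g s \<xi>))
      \<ge> inverse LG * \<bar>(deriv H t + g t \<xi>) - (deriv H s + g s \<xi>)\<bar>\<^sup>2"
    using asm_j_cocoercive by blast
  have qb: "0 \<le> quotient n t \<xi> u" "quotient n t \<xi> u \<le> LG" if "\<xi> \<in> \<Xi>" "u \<in> space S" for n t \<xi> u
    by (rule quotient_bounds[OF LG(1)], rule LG(2), assumption, rule that(1), rule that(2))+
  obtain Lg where Lg: "0 < Lg" "\<And>t \<xi> \<eta> u. \<xi> \<in> \<Xi> \<Longrightarrow> \<eta> \<in> \<Xi> \<Longrightarrow> u \<in> space S \<Longrightarrow>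
      \<bar>g t (\<Phi> \<xi> u) - g t (\<Phi> \<eta> u)\<bar> \<le> Lg * norm (\<xi> - \<eta>)"
    using asm_e by blast
  obtain L\<Phi> where L\<Phi>: "L\<Phi> \<in> borel_measurable S" "\<And>u. u \<in> space S \<Longrightarrow> L\<Phi> u \<in> {0..1}"
    "\<And>\<xi> \<eta> u. \<xi> \<in> \<Xi> \<Longrightarrow> \<eta> \<in> \<Xi> \<Longrightarrow> u \<in> space S \<Longrightarrow> norm (\<Phi> \<xi> u - \<Phi> \<eta> u) \<le> L\<Phi> u * norm (\<xi> - \<eta>)"
    "(\<integral>\<omega>. L\<Phi> (U 1 \<omega>) \<partial>M) < 1" using asm_d by blast
  obtain \<theta> where \<theta>: "0 \<le> \<theta>" "\<theta> < 1" "\<And>s t \<xi>. \<xi> \<in> \<Xi> \<Longrightarrow>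
      (t - s) * (mean_field M U \<Phi> g t \<xi> - mean_field M U \<Phi> g s \<xi>) \<ge> - \<theta> * (t - s) * (deriv H t - deriv H s)"
    using asm_j_monotone by force
  have slope: "(1 - \<theta>) * deriv (deriv H) t \<le> (\<integral>u. slope t \<xi> u \<partial>innovation)" if "\<xi> \<in> \<Xi>" for t \<xi>
    by (rule mean_slope_ge[OF \<beta> that, where L = LG]) (use qb[OF that] \<theta>(3)[OF that] in auto)
  have "\<exists>cb>0. (\<forall>t. \<bar>t\<bar> \<le> R \<and> (t \<noteq> 0 \<or> m = 2) \<longrightarrow> cb * abs_pow t (m - 2) \<le> (1 - \<theta>) * deriv (deriv H) t) \<and>
    (\<beta> = 2 \<longrightarrow> (\<forall>t. R \<le> \<bar>t\<bar> \<longrightarrow> cb \<le> (1 - \<theta>) * deriv (deriv H) t))"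
  proof -
    obtain c_in where cin: "0 < c_in" "\<And>t. \<bar>t\<bar> \<le> R \<and> (t \<noteq> 0 \<or> m = 2) \<Longrightarrow> c_in * abs_pow t (m - 2) \<le> deriv (deriv H) t"
      using asm_b by blast
    obtain c_out where cout: "0 < c_out" "\<And>t. \<beta> = 2 \<Longrightarrow> R \<le> \<bar>t\<bar> \<Longrightarrow> c_out \<le> deriv (deriv H) t"
      using asm_c_quadratic zero_less_one by metis
    \<comment> \<open>One constant serves the core and, for \<beta> = 2, the outside; 1 - \<theta>
      is what the mean field leaves of the curvature.\<close>
    define c where "c = (1 - \<theta>) * min c_in c_out"
    have c: "0 < c" "c \<le> (1 - \<theta>) * c_in" "c \<le> (1 - \<theta>) * c_out"
      using cin cout \<theta> by (auto simp: c_def intro: mult_left_mono)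
    have "c * abs_pow t (m - 2) \<le> (1 - \<theta>) * deriv (deriv H) t" if "\<bar>t\<bar> \<le> R \<and> (t \<noteq> 0 \<or> m = 2)" for t
    proof -
      have "c * abs_pow t (m - 2) \<le> (1 - \<theta>) * c_in * abs_pow t (m - 2)"
        using c by (intro mult_right_mono) (auto simp: abs_pow_def)
      also have "\<dots> \<le> (1 - \<theta>) * deriv (deriv H) t" unfolding mult.assoc using cin(2)[OF that] \<theta> by (intro mult_left_mono) auto
      finally show ?thesis .
    qed
    moreover have "c \<le> (1 - \<theta>) * deriv (deriv H) t" if "\<beta> = 2" "R \<le> \<bar>t\<bar>" for t
      using mult_left_mono[OF cout(2)[OF that], of "1 - \<theta>"] c(3) \<theta> by linarith
    ultimately show ?thesis using c(1) by blast
  qed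
  then obtain cb where cb: "0 < cb" "\<And>t. \<bar>t\<bar> \<le> R \<Longrightarrow> t \<noteq> 0 \<or> m = 2 \<Longrightarrow> cb * abs_pow t (m - 2) \<le> (1 - \<theta>) * deriv (deriv H) t"
    "\<And>t. \<beta> = 2 \<Longrightarrow> R \<le> \<bar>t\<bar> \<Longrightarrow> cb \<le> (1 - \<theta>) * deriv (deriv H) t" by blast
  \<comment> \<open>Placing the implication under the quantifier supplies a positive dummy constant
    for \<beta> = 2.\<close>
  have "\<exists>cd>0. \<beta> < 2 \<longrightarrow> (\<forall>t. \<forall>\<xi>\<in>\<Xi>. \<bar>t\<bar> \<ge> R \<longrightarrow> t * (deriv H t + mean_field M U \<Phi> g t \<xi>) \<ge> cd * abs_pow t \<beta>)"
    using asm_g zero_less_one by metis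
  then obtain cd where cd: "0 < cd" "\<And>t \<xi>. \<beta> < 2 \<Longrightarrow> \<xi> \<in> \<Xi> \<Longrightarrow> \<bar>t\<bar> \<ge> R \<Longrightarrow>
      t * (deriv H t + mean_field M U \<Phi> g t \<xi>) \<ge> cd * abs_pow t \<beta>" by blast
  have "\<exists>rate>0. \<exists>Ce\<ge>0. \<beta> < 2 \<longrightarrow> (\<forall>t. \<forall>\<xi>\<in>\<Xi>.
    (\<integral>\<^sup>+u. ennreal (exp (rate * (\<bar>deriv H t + g t (\<Phi> \<xi> u)\<bar> / (1 + abs_pow t (\<beta> - 1))))) \<partial>innovation) \<le> ennreal Ce)"
  proof (cases "\<beta> < 2")
    case True
    then show ?thesis using exp_moment_drift[OF \<beta>(1) True m] by blast
  next
    case False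
    then show ?thesis by (intro exI[of _ 1] conjI) auto
  qed
  then obtain rate Ce where em: "0 < rate" "0 \<le> Ce" "\<And>t \<xi>. \<beta> < 2 \<Longrightarrow> \<xi> \<in> \<Xi> \<Longrightarrow>
    (\<integral>\<^sup>+u. ennreal (exp (rate * (\<bar>deriv H t + g t (\<Phi> \<xi> u)\<bar> / (1 + abs_pow t (\<beta> - 1))))) \<partial>innovation) \<le> ennreal Ce"
    by blast
  have "\<exists>\<epsilon>>0. \<exists>p>0. 2 < m \<longrightarrow> (INF \<xi>\<in>\<Xi>. prob {\<omega> \<in> space M. \<bar>g 0 (\<Phi> \<xi> (U 1 \<omega>))\<bar> \<ge> \<epsilon>}) \<ge> p"
  proof (cases "2 < m")
    case True
    obtain \<epsilon> p where "0 < \<epsilon>" "0 < p" "(INF \<xi>\<in>\<Xi>. prob {\<omega> \<in> space M. \<bar>g 0 (\<Phi> \<xi> (U 1 \<omega>))\<bar> \<ge> \<epsilon>}) \<ge> p"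
      using asm_i[OF True] by blast
    then show ?thesis by blast
  next
    case False
    then show ?thesis by (intro exI[of _ 1] conjI) auto
  qed
  then obtain \<epsilon> p where ep: "0 < \<epsilon>" "0 < p" "2 < m \<Longrightarrow> (INF \<xi>\<in>\<Xi>. prob {\<omega> \<in> space M. \<bar>g 0 (\<Phi> \<xi> (U 1 \<omega>))\<bar> \<ge> \<epsilon>}) \<ge> p"
    by blast
  obtain \<zeta> where \<zeta>: "\<zeta> \<in> \<Xi>" "integrable M (\<lambda>\<omega>. norm (\<Phi> \<zeta> (U 1 \<omega>) - \<zeta>))" using asm_f by blast
  have "sgd_coordinate innovation \<Xi> \<Phi> (\<lambda>t \<xi> u. deriv H t + g t (\<Phi> \<xi> u)) slope L\<Phi> m \<beta> R LG Lg cb cd rate Ce \<epsilon> p"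
  proof (rule sgd_coordinate.intro[OF prob_space_innovation sgd_coordinate_axioms.intro])
    show "2 \<le> m" "1 \<le> \<beta>" "\<beta> \<le> 2" "0 < R" by (fact m, fact \<beta>(1), fact \<beta>(2), fact R_pos)
    show "0 < LG" "0 < Lg" "0 < cb" "0 < cd" "0 < rate" "0 \<le> Ce" "0 < \<epsilon>" "0 < p"
      using LG(1) Lg(1) cb(1) cd(1) em(1,2) ep(1,2) by simp_all
    show "L\<Phi> \<in> borel_measurable innovation" using L\<Phi>(1) by simp
    show "0 \<le> L\<Phi> u" "L\<Phi> u \<le> 1" if "u \<in> space innovation" for u using L\<Phi>(2)[of u] that by auto
    show "(\<integral>u. L\<Phi> u \<partial>innovation) < 1" using L\<Phi>(4) integral_innovation[OF L\<Phi>(1)] by simp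
    show "convex \<Xi>" by (rule Xi_convex)
  next
    fix \<xi> assume \<xi>: "\<xi> \<in> \<Xi>"
    note [measurable] = g_Phi_measurable[OF \<xi>] g_Phi_slice[OF \<xi>] Phi_slice_borel[OF \<xi>] Phi_slice_borel[OF \<zeta>(1)]
    have bs: "measurable (borel \<Otimes>\<^sub>M innovation) N = measurable (borel \<Otimes>\<^sub>M S) N" for N :: "real measure"
      by (intro measurable_cong_sets sets_pair_measure_cong sets_innovation refl)
    show "(\<lambda>(t, u). deriv H t + g t (\<Phi> \<xi> u)) \<in> borel_measurable (borel \<Otimes>\<^sub>M innovation)"
      unfolding bs split_def by measurable
    show "(\<lambda>(t, u). slope t \<xi> u) \<in> borel_measurable (borel \<Otimes>\<^sub>M innovation)"
      unfolding bs split_def by (rule slope_measurable[OF \<xi>])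
    show "cb * abs_pow t (m - 2) \<le> (\<integral>u. slope t \<xi> u \<partial>innovation)" if "\<bar>t\<bar> \<le> R" "t \<noteq> 0 \<or> m = 2" for t
      by (rule order_trans[OF cb(2)[OF that] slope[OF \<xi>]])
    show "cb \<le> (\<integral>u. slope t \<xi> u \<partial>innovation)" if "\<beta> = 2" "R \<le> \<bar>t\<bar>" for t
      by (rule order_trans[OF cb(3)[OF that] slope[OF \<xi>]])
    show "cd * \<bar>t\<bar> powr \<beta> \<le> t * (\<integral>u. deriv H t + g t (\<Phi> \<xi> u) \<partial>innovation)" if "\<beta> < 2" "R \<le> \<bar>t\<bar>" for t
      using cd(2)[OF that(1) \<xi> that(2)] mean_drift[OF \<beta> \<xi>, of t] \<beta> by (simp add: abs_pow_def)
    show "(\<integral>\<^sup>+u. ennreal (exp (rate * (\<bar>deriv H t + g t (\<Phi> \<xi> u)\<bar> / (1 + abs_pow t (\<beta> - 1))))) \<partial>innovation) \<le> ennreal Ce"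
      if "\<beta> < 2" for t by (rule em(3)[OF that \<xi>])
    \<comment> \<open>At t = 0 the drift reduces to the noise because \<open>deriv H\<close>
      vanishes there.\<close>
    show "p \<le> measure innovation {u \<in> space innovation. \<epsilon> \<le> \<bar>deriv H 0 + g 0 (\<Phi> \<xi> u)\<bar>}" if "2 < m"
    proof -
      have "p \<le> prob {\<omega> \<in> space M. \<bar>g 0 (\<Phi> \<xi> (U 1 \<omega>))\<bar> \<ge> \<epsilon>}"
        by (rule order_trans[OF ep(3)[OF that] cINF_lower]) (use \<xi> in \<open>auto intro!: bdd_belowI[of _ 0]\<close>)
      also have "\<dots> = measure innovation {u \<in> space S. \<epsilon> \<le> \<bar>g 0 (\<Phi> \<xi> u)\<bar>}"
        unfolding innovation_def
        by (subst measure_distr[OF U_measurable]) (auto intro!: arg_cong[of _ _ prob] simp: measurable_space[OF U_measurable[unfolded One_nat_def]])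
      finally show ?thesis by (simp add: deriv_H_0)
    qed
    show "\<Phi> \<xi> \<in> borel_measurable innovation" using Phi_slice_borel[OF \<xi>] by simp
    show "integrable innovation (\<lambda>u. norm (\<Phi> \<xi> u - \<xi>))"
    \<comment> \<open>The moment assumed at one phase \<zeta> carries over to every \<xi>, because
      \<Phi> does not increase distances.\<close>
    proof (rule Bochner_Integration.integrable_bound)
      have "integrable innovation (\<lambda>u. norm (\<Phi> \<zeta> u - \<zeta>))" using \<zeta>(2) by (subst integrable_innovation) simp_all
      then show "integrable innovation (\<lambda>u. norm (\<Phi> \<zeta> u - \<zeta>) + 2 * norm (\<xi> - \<zeta>))" by simp
      have "norm (\<Phi> \<xi> u - \<xi>) \<le> norm (\<Phi> \<zeta> u - \<zeta>) + 2 * norm (\<xi> - \<zeta>)" if u: "u \<in> space S" for u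
      proof -
        have "norm (\<Phi> \<xi> u - \<Phi> \<zeta> u) \<le> 1 * norm (\<xi> - \<zeta>)"
          using L\<Phi>(2)[OF u] by (intro order_trans[OF L\<Phi>(3)[OF \<xi> \<zeta>(1) u]] mult_right_mono) auto
        moreover have "\<Phi> \<xi> u - \<xi> = (\<Phi> \<xi> u - \<Phi> \<zeta> u) + (\<Phi> \<zeta> u - \<zeta>) + (\<zeta> - \<xi>)" by simp
        then have "norm (\<Phi> \<xi> u - \<xi>) \<le> norm (\<Phi> \<xi> u - \<Phi> \<zeta> u) + norm (\<Phi> \<zeta> u - \<zeta>) + norm (\<zeta> - \<xi>)"
          by (metis norm_triangle_mono norm_triangle_ineq order_refl)
        ultimately show ?thesis using norm_minus_commute[of \<zeta> \<xi>] by linarith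
      qed
      then show "AE u in innovation. norm (norm (\<Phi> \<xi> u - \<xi>)) \<le> norm (norm (\<Phi> \<zeta> u - \<zeta>) + 2 * norm (\<xi> - \<zeta>))"
        by (intro AE_I2) simp
    qed simp
    show "integrable innovation (\<lambda>u. \<bar>deriv H 0 + g 0 (\<Phi> \<xi> u)\<bar>)"
      using integrable_g_Phi[OF \<beta> \<xi>, of 0] by (simp add: deriv_H_0)
  next
    fix \<xi> u assume \<xi>: "\<xi> \<in> \<Xi>" and "u \<in> space innovation"
    then have u: "u \<in> space S" by simp
    show "((\<lambda>t. deriv H t + g t (\<Phi> \<xi> u)) has_real_derivative slope t \<xi> u) (at t)" for t by (rule slope_deriv[OF \<xi> u])
    show "0 \<le> slope t \<xi> u" for t
      by (rule LIMSEQ_le_const[OF quotient_tendsto[OF \<xi> u]]) (use qb(1)[OF \<xi> u] in auto)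
    show "slope t \<xi> u \<le> LG" for t
      by (rule LIMSEQ_le_const2[OF quotient_tendsto[OF \<xi> u]]) (use qb(2)[OF \<xi> u] in auto)
    show "\<Phi> \<xi> u \<in> \<Xi>" by (rule Phi_in[OF \<xi> u])
    fix \<eta> assume \<eta>: "\<eta> \<in> \<Xi>"
    show "\<bar>deriv H t + g t (\<Phi> \<xi> u) - (deriv H t + g t (\<Phi> \<eta> u))\<bar> \<le> Lg * norm (\<xi> - \<eta>)" for t
      using Lg(2)[OF \<xi> \<eta> u, of t] by simp
    show "norm (\<Phi> \<xi> u - \<Phi> \<eta> u) \<le> L\<Phi> u * norm (\<xi> - \<eta>)" by (rule L\<Phi>(3)[OF \<xi> \<eta> u])
  qed
  then show ?thesis by blast
qed

text \<open>The weight and its antiderivative depend on \<alpha> and are hidden behind existential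
  quantifiers, so that coordinates with different parameters can be combined.\<close>

lemma coordinate_contraction:
  assumes m: "2 \<le> m" and \<beta>: "1 \<le> \<beta>" "\<beta> \<le> 2"
  shows "\<exists>\<kappa>>0. \<exists>\<kappa>0>0. \<exists>c>0. \<exists>a>0. \<forall>\<alpha>\<in>{0<..a}. \<exists>V F. weighted_line V F \<alpha> \<and>
    (\<forall>t. \<forall>\<xi> :: real ^ 'k. weight m \<beta> R \<kappa> \<kappa>0 \<alpha> (t, \<xi>) = V t) \<and>
    (\<forall>t s. \<forall>\<xi>\<in>\<Xi>. \<forall>\<eta>\<in>\<Xi>.
      (\<integral>\<^sup>+u. ennreal (weighted_line.wdist V F \<alpha> (t - \<alpha> * (deriv H t + g t (\<Phi> \<xi> u)), \<Phi> \<xi> u)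
          (s - \<alpha> * (deriv H s + g s (\<Phi> \<eta> u)), \<Phi> \<eta> u)) \<partial>innovation)
        \<le> ennreal (1 - c * \<alpha> powr (m - 1)) * ennreal (weighted_line.wdist V F \<alpha> (t, \<xi>) (s, \<eta>))) \<and>
    (\<forall>\<xi>\<in>\<Xi>. (\<integral>\<^sup>+u. ennreal (weighted_line.wdist V F \<alpha> (0, \<xi>)
        (0 - \<alpha> * (deriv H 0 + g 0 (\<Phi> \<xi> u)), \<Phi> \<xi> u)) \<partial>innovation) < \<infinity>)"
proof -
  obtain L\<Phi> LG Lg cb cd rate Ce \<epsilon> p where
    "sgd_coordinate innovation \<Xi> \<Phi> (\<lambda>t \<xi> u. deriv H t + g t (\<Phi> \<xi> u)) slope L\<Phi> m \<beta> R LG Lg cb cd rate Ce \<epsilon> p"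
    using sgd_coordinate_exists[OF assms] by blast
  then interpret C: sgd_coordinate innovation \<Xi> \<Phi> "\<lambda>t \<xi> u. deriv H t + g t (\<Phi> \<xi> u)" slope L\<Phi> m \<beta> R LG Lg cb cd rate Ce \<epsilon> p .
  have w: "weight m \<beta> R \<kappa> \<kappa>0 \<alpha> (t, \<xi>) = C.weight1 \<kappa> \<kappa>0 \<alpha> t" for \<kappa> \<kappa>0 \<alpha> t and \<xi> :: "real ^ 'k"
    by (simp add: weight_def C.weight1_def)
  obtain \<kappa> \<kappa>0 c a where pos: "0 < \<kappa>" "0 < \<kappa>0" "0 < c" "0 < a" and
    con: "\<forall>\<alpha>\<in>{0<..a}. \<exists>F. weighted_line (C.weight1 \<kappa> \<kappa>0 \<alpha>) F \<alpha> \<and>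
    (\<forall>t s. \<forall>\<xi>\<in>\<Xi>. \<forall>\<eta>\<in>\<Xi>.
      (\<integral>\<^sup>+u. ennreal (weighted_line.wdist (C.weight1 \<kappa> \<kappa>0 \<alpha>) F \<alpha> (C.step \<alpha> (t, \<xi>) u) (C.step \<alpha> (s, \<eta>) u)) \<partial>innovation)
        \<le> ennreal (1 - c * \<alpha> powr (m - 1)) * ennreal (weighted_line.wdist (C.weight1 \<kappa> \<kappa>0 \<alpha>) F \<alpha> (t, \<xi>) (s, \<eta>))) \<and>
    (\<forall>\<xi>\<in>\<Xi>. (\<integral>\<^sup>+u. ennreal (weighted_line.wdist (C.weight1 \<kappa> \<kappa>0 \<alpha>) F \<alpha> (0, \<xi>) (C.step \<alpha> (0, \<xi>) u)) \<partial>innovation) < \<infinity>)"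
    using C.wdist_contraction_weight1 by blast
  have "\<exists>V F. weighted_line V F \<alpha> \<and>
      (\<forall>t. \<forall>\<xi> :: real ^ 'k. weight m \<beta> R \<kappa> \<kappa>0 \<alpha> (t, \<xi>) = V t) \<and>
      (\<forall>t s. \<forall>\<xi>\<in>\<Xi>. \<forall>\<eta>\<in>\<Xi>.
      (\<integral>\<^sup>+u. ennreal (weighted_line.wdist V F \<alpha> (t - \<alpha> * (deriv H t + g t (\<Phi> \<xi> u)), \<Phi> \<xi> u)
          (s - \<alpha> * (deriv H s + g s (\<Phi> \<eta> u)), \<Phi> \<eta> u)) \<partial>innovation)
        \<le> ennreal (1 - c * \<alpha> powr (m - 1)) * ennreal (weighted_line.wdist V F \<alpha> (t, \<xi>) (s, \<eta>))) \<and>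
      (\<forall>\<xi>\<in>\<Xi>. (\<integral>\<^sup>+u. ennreal (weighted_line.wdist V F \<alpha> (0, \<xi>)
        (0 - \<alpha> * (deriv H 0 + g 0 (\<Phi> \<xi> u)), \<Phi> \<xi> u)) \<partial>innovation) < \<infinity>)" if \<alpha>: "\<alpha> \<in> {0<..a}" for \<alpha>
  proof -
    obtain F where "weighted_line (C.weight1 \<kappa> \<kappa>0 \<alpha>) F \<alpha>"
      "\<forall>t s. \<forall>\<xi>\<in>\<Xi>. \<forall>\<eta>\<in>\<Xi>.
      (\<integral>\<^sup>+u. ennreal (weighted_line.wdist (C.weight1 \<kappa> \<kappa>0 \<alpha>) F \<alpha> (C.step \<alpha> (t, \<xi>) u) (C.step \<alpha> (s, \<eta>) u)) \<partial>innovation)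
        \<le> ennreal (1 - c * \<alpha> powr (m - 1)) * ennreal (weighted_line.wdist (C.weight1 \<kappa> \<kappa>0 \<alpha>) F \<alpha> (t, \<xi>) (s, \<eta>))"
      "\<forall>\<xi>\<in>\<Xi>. (\<integral>\<^sup>+u. ennreal (weighted_line.wdist (C.weight1 \<kappa> \<kappa>0 \<alpha>) F \<alpha> (0, \<xi>) (C.step \<alpha> (0, \<xi>) u)) \<partial>innovation) < \<infinity>"
      using con[rule_format, OF \<alpha>] by blast
    note F = this[unfolded C.step_def fst_conv snd_conv]
    show ?thesis
      by (rule exI[of _ "C.weight1 \<kappa> \<kappa>0 \<alpha>"], rule exI[of _ F], rule conjI[OF F(1)], rule conjI,
        intro allI, rule w, rule conjI[OF F(2,3)])
  qed
  then have all: "\<forall>\<alpha>\<in>{0<..a}. \<exists>V F. weighted_line V F \<alpha> \<and>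
      (\<forall>t. \<forall>\<xi> :: real ^ 'k. weight m \<beta> R \<kappa> \<kappa>0 \<alpha> (t, \<xi>) = V t) \<and>
      (\<forall>t s. \<forall>\<xi>\<in>\<Xi>. \<forall>\<eta>\<in>\<Xi>.
      (\<integral>\<^sup>+u. ennreal (weighted_line.wdist V F \<alpha> (t - \<alpha> * (deriv H t + g t (\<Phi> \<xi> u)), \<Phi> \<xi> u)
          (s - \<alpha> * (deriv H s + g s (\<Phi> \<eta> u)), \<Phi> \<eta> u)) \<partial>innovation)
        \<le> ennreal (1 - c * \<alpha> powr (m - 1)) * ennreal (weighted_line.wdist V F \<alpha> (t, \<xi>) (s, \<eta>))) \<and>
      (\<forall>\<xi>\<in>\<Xi>. (\<integral>\<^sup>+u. ennreal (weighted_line.wdist V F \<alpha> (0, \<xi>)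
        (0 - \<alpha> * (deriv H 0 + g 0 (\<Phi> \<xi> u)), \<Phi> \<xi> u)) \<partial>innovation) < \<infinity>)"
    by (intro ballI)
  show ?thesis
    by (rule exI[of _ \<kappa>], rule conjI[OF pos(1)], rule exI[of _ \<kappa>0], rule conjI[OF pos(2)],
      rule exI[of _ c], rule conjI[OF pos(3)], rule exI[of _ a], rule conjI[OF pos(4)], rule all)
qed

end

text \<open>Cocoercivity gives the bound in t, assumption (e) the one in the phase. The lemma serves
  the continuity of the random map, on which the fixed-point equation of the limit rests.\<close>

lemma (in one_dim_assumptions) drift_lipschitz:
  "\<exists>L. \<forall>u\<in>space S. L-lipschitz_on (UNIV \<times> \<Xi>) (\<lambda>p. deriv H (fst p) + g (fst p) (\<Phi> (snd p) u))"
proof -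
  obtain L1 where L1: "1 \<le> L1" "\<And>s t \<xi>. \<xi> \<in> \<Xi> \<Longrightarrow> (t - s) * ((deriv H t + g t \<xi>) - (deriv H s + g s \<xi>))
      \<ge> inverse L1 * \<bar>(deriv H t + g t \<xi>) - (deriv H s + g s \<xi>)\<bar>\<^sup>2"
    using asm_j_cocoercive by blast
  obtain L2 where L2: "0 < L2" "\<And>t \<xi> \<eta> u. \<xi> \<in> \<Xi> \<Longrightarrow> \<eta> \<in> \<Xi> \<Longrightarrow> u \<in> space S \<Longrightarrow>
      \<bar>g t (\<Phi> \<xi> u) - g t (\<Phi> \<eta> u)\<bar> \<le> L2 * norm (\<xi> - \<eta>)"
    using asm_e by blast
  have "(L1 + L2)-lipschitz_on (UNIV \<times> \<Xi>) (\<lambda>p. deriv H (fst p) + g (fst p) (\<Phi> (snd p) u))" if u: "u \<in> space S" for u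
  proof (rule lipschitz_onI)
    fix p q :: "real \<times> (real ^ 'k)" assume p: "p \<in> UNIV \<times> \<Xi>" and q: "q \<in> UNIV \<times> \<Xi>"
    define t s \<xi> \<eta> where "t = fst p" "s = fst q" "\<xi> = snd p" "\<eta> = snd q"
    have X: "\<xi> \<in> \<Xi>" "\<eta> \<in> \<Xi>" using p q by (auto simp: t_s_\<xi>_\<eta>_def)
    have "\<bar>(deriv H t + g t (\<Phi> \<xi> u)) - (deriv H s + g s (\<Phi> \<xi> u))\<bar> \<le> L1 * \<bar>t - s\<bar>"
      by (rule cocoercive_lipschitz[OF L1(1) L1(2)[OF Phi_in[OF X(1) u]]])
    also have "\<dots> \<le> L1 * dist p q"
      using dist_fst_le[of p q] L1(1) by (intro mult_left_mono) (auto simp: t_s_\<xi>_\<eta>_def dist_real_def)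
    finally have 1: "\<bar>(deriv H t + g t (\<Phi> \<xi> u)) - (deriv H s + g s (\<Phi> \<xi> u))\<bar> \<le> L1 * dist p q" .
    have "\<bar>g s (\<Phi> \<xi> u) - g s (\<Phi> \<eta> u)\<bar> \<le> L2 * norm (\<xi> - \<eta>)" by (rule L2(2)[OF X u])
    also have "\<dots> \<le> L2 * dist p q"
      using dist_snd_le[of p q] L2(1) by (intro mult_left_mono) (auto simp: t_s_\<xi>_\<eta>_def dist_norm)
    finally show "dist (deriv H (fst p) + g (fst p) (\<Phi> (snd p) u)) (deriv H (fst q) + g (fst q) (\<Phi> (snd q) u)) \<le> (L1 + L2) * dist p q"
      using 1 unfolding t_s_\<xi>_\<eta>_def[symmetric] dist_real_def distrib_right by linarith
  qed (use L1 L2 in simp)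
  then show ?thesis by blast
qed

text \<open>States carry the product of a Borel and a restricted Borel algebra, whereas the abstract
  contraction result uses the restriction of the Borel algebra of the whole product. The identity is
  measurable in both directions.\<close>

lemma sets_state_space: "sets (state_space \<Xi> :: ('d::finite, 'k::finite) state measure) = sets (restrict_space borel (UNIV \<times> \<Xi>))"
proof -
  let ?A = "state_space \<Xi> :: ('d, 'k) state measure" and ?B = "restrict_space borel (UNIV \<times> \<Xi>) :: ('d, 'k) state measure"
  have sp: "space ?A = UNIV \<times> \<Xi>" "space ?B = UNIV \<times> \<Xi>"
    by (simp_all add: state_space_def space_pair_measure space_restrict_space)
  have r: "(\<lambda>x. x) \<in> restrict_space borel \<Xi> \<rightarrow>\<^sub>M borel" by (rule measurable_restrict_space1) simp
  have "(\<lambda>z. (fst z, snd z)) \<in> borel_measurable ?A"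
    unfolding state_space_def by (intro borel_measurable_Pair measurable_fst measurable_compose[OF measurable_snd r])
  then have AB: "(\<lambda>z. z) \<in> ?A \<rightarrow>\<^sub>M ?B"
    by (intro measurable_restrict_space2) (auto simp: sp)
  have "(\<lambda>z. (fst z, snd z)) \<in> ?B \<rightarrow>\<^sub>M ?A"
    unfolding state_space_def
  proof (intro measurable_Pair measurable_restrict_space2)
    show "fst \<in> borel_measurable ?B" "snd \<in> borel_measurable ?B"
      by (intro measurable_restrict_space1 borel_measurable_continuous_onI continuous_intros)+
  qed (auto simp: space_restrict_space)
  then have BA: "(\<lambda>z. z) \<in> ?B \<rightarrow>\<^sub>M ?A" by simp
  have "X \<in> sets ?B" if "X \<in> sets ?A" for X
    using measurable_sets[OF BA that] sets.sets_into_space[OF that] by (simp add: sp Int_absorb2)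
  moreover have "X \<in> sets ?A" if "X \<in> sets ?B" for X
    using measurable_sets[OF AB that] sets.sets_into_space[OF that] by (simp add: sp Int_absorb2)
  ultimately show ?thesis by blast
qed

section \<open>All coordinates driven by the same innovations\<close>

locale separable_sgd =
  fixes M :: "'w measure" and S :: "'u measure" and U :: "nat \<Rightarrow> 'w \<Rightarrow> 'u"
    and \<Xi> :: "(real ^ 'k) set" and \<Phi> :: "real ^ 'k \<Rightarrow> 'u \<Rightarrow> real ^ 'k"
    and H :: "'d::finite \<Rightarrow> real \<Rightarrow> real" and g :: "'d \<Rightarrow> real \<Rightarrow> real ^ 'k \<Rightarrow> real"
    and m \<beta> R :: "'d \<Rightarrow> real"
  assumes m: "\<And>i. m i \<ge> 2" and \<beta>: "\<And>i. \<beta> i \<in> {1..2}"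
    and one_dim: "\<And>i. one_dim_assumptions M S U \<Xi> \<Phi> (H i) (g i) (m i) (\<beta> i) (R i)"
begin

sublocale sgd_noise M S U \<Xi> \<Phi>
  by (rule one_dim_assumptions.axioms(1)[OF one_dim])

abbreviation states :: "('d, 'k) state measure" where
  "states \<equiv> state_space \<Xi>"

lemma step_measurable: "case_prod (sgd_step H g \<Phi> \<alpha>) \<in> states \<Otimes>\<^sub>M S \<rightarrow>\<^sub>M states"
proof -
  have m1: "(\<lambda>p. fst (fst p) $ i) \<in> borel_measurable (states \<Otimes>\<^sub>M S)" for i
  proof -
    have "(\<lambda>p. fst (fst p)) \<in> borel_measurable (states \<Otimes>\<^sub>M S)" unfolding state_space_def by measurable
    moreover have "(\<lambda>x. x $ i) \<in> borel_measurable borel" by (intro borel_measurable_continuous_onI continuous_intros)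
    ultimately show ?thesis by (rule measurable_compose)
  qed
  have m2: "(\<lambda>p. \<Phi> (snd (fst p)) (snd p)) \<in> states \<Otimes>\<^sub>M S \<rightarrow>\<^sub>M restrict_space borel \<Xi>"
  proof -
    have "(\<lambda>p. (snd (fst p), snd p)) \<in> states \<Otimes>\<^sub>M S \<rightarrow>\<^sub>M restrict_space borel \<Xi> \<Otimes>\<^sub>M S"
      unfolding state_space_def by measurable
    from measurable_compose[OF this Phi_measurable] show ?thesis by simp
  qed
  have m3: "(\<lambda>p. fst (fst p) $ i - \<alpha> * (deriv (H i) (fst (fst p) $ i) + g i (fst (fst p) $ i) (\<Phi> (snd (fst p)) (snd p))))
      \<in> borel_measurable (states \<Otimes>\<^sub>M S)" for i
  proof -
    interpret one_dim_assumptions M S U \<Xi> \<Phi> "H i" "g i" "m i" "\<beta> i" "R i" by (rule one_dim)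
    have "(\<lambda>p. g i (fst (fst p) $ i) (\<Phi> (snd (fst p)) (snd p))) \<in> borel_measurable (states \<Otimes>\<^sub>M S)"
      using measurable_compose[OF measurable_Pair[OF m1 m2] g_measurable, of i] unfolding case_prod_conv .
    from borel_measurable_diff[OF m1 borel_measurable_times[OF borel_measurable_const
        borel_measurable_add[OF measurable_compose[OF m1 deriv_H_measurable] this]]]
    show ?thesis .
  qed
  have "(\<lambda>p. (\<chi> i. fst (fst p) $ i - \<alpha> * (deriv (H i) (fst (fst p) $ i) + g i (fst (fst p) $ i) (\<Phi> (snd (fst p)) (snd p)))))
      \<in> borel_measurable (states \<Otimes>\<^sub>M S)"
  proof (rule iffD2[OF borel_measurable_euclidean_space], rule ballI)
    fix b :: "real ^ 'd" assume "b \<in> Basis"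
    then obtain i where b: "b = axis i 1" by (auto simp: Basis_vec_def)
    show "(\<lambda>p. (\<chi> i. fst (fst p) $ i - \<alpha> * (deriv (H i) (fst (fst p) $ i) + g i (fst (fst p) $ i) (\<Phi> (snd (fst p)) (snd p)))) \<bullet> b)
        \<in> borel_measurable (states \<Otimes>\<^sub>M S)"
      using m3[of i] unfolding b inner_axis vec_lambda_beta inner_real_def mult_1_right .
  qed
  from measurable_Pair[OF this m2] show ?thesis
    unfolding sgd_step_def split_def state_space_def .
qed

lemma step_measurable_slice:
  assumes "z \<in> UNIV \<times> \<Xi>"
  shows "sgd_step H g \<Phi> \<alpha> z \<in> S \<rightarrow>\<^sub>M states"
proof -
  have "z \<in> space states" using assms by (simp add: state_space_def space_pair_measure space_restrict_space)
  from measurable_compose[OF measurable_Pair1'[OF this] step_measurable] show ?thesis unfolding case_prod_conv .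
qed

lemma step_continuous:
  assumes u: "u \<in> space S"
  shows "continuous_on (UNIV \<times> \<Xi>) (\<lambda>z. sgd_step H g \<Phi> \<alpha> z u)"
proof -
  have d: "continuous_on (UNIV \<times> \<Xi>) (\<lambda>z :: ('d, 'k) state. deriv (H i) (fst z $ i) + g i (fst z $ i) (\<Phi> (snd z) u))" for i
  proof -
    interpret one_dim_assumptions M S U \<Xi> \<Phi> "H i" "g i" "m i" "\<beta> i" "R i" by (rule one_dim)
    obtain L where "\<forall>u\<in>space S. L-lipschitz_on (UNIV \<times> \<Xi>) (\<lambda>p. deriv (H i) (fst p) + g i (fst p) (\<Phi> (snd p) u))"
      using drift_lipschitz by blast
    from lipschitz_on_continuous_on[OF bspec[OF this u]]
    have "continuous_on (UNIV \<times> \<Xi>) (\<lambda>p. deriv (H i) (fst p) + g i (fst p) (\<Phi> (snd p) u))" .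
    moreover have "continuous_on (UNIV \<times> \<Xi>) (\<lambda>z :: ('d, 'k) state. (fst z $ i, snd z))" by (intro continuous_intros)
    moreover have "(\<lambda>z :: ('d, 'k) state. (fst z $ i, snd z)) ` (UNIV \<times> \<Xi>) \<subseteq> UNIV \<times> \<Xi>" by auto
    ultimately have "continuous_on (UNIV \<times> \<Xi>) (\<lambda>z :: ('d, 'k) state. deriv (H i) (fst (fst z $ i, snd z)) + g i (fst (fst z $ i, snd z)) (\<Phi> (snd (fst z $ i, snd z)) u))"
      by (rule continuous_on_compose2)
    then show ?thesis by (simp only: fst_conv snd_conv)
  qed
  have f: "continuous_on (UNIV \<times> \<Xi>) (\<lambda>z :: ('d, 'k) state. \<Phi> (snd z) u)"
  proof -
    \<comment> \<open>The conditions on \<Phi> are common to all coordinates, so any index provides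
      them.\<close>
    interpret one_dim_assumptions M S U \<Xi> \<Phi> "H undefined" "g undefined" "m undefined" "\<beta> undefined" "R undefined" by (rule one_dim)
    obtain L where L: "\<forall>u\<in>space S. L u \<in> {0..1::real}"
      "\<forall>\<xi>\<in>\<Xi>. \<forall>\<eta>\<in>\<Xi>. \<forall>u\<in>space S. norm (\<Phi> \<xi> u - \<Phi> \<eta> u) \<le> L u * norm (\<xi> - \<eta>)" using asm_d by blast
    have "(L u)-lipschitz_on \<Xi> (\<lambda>\<xi>. \<Phi> \<xi> u)"
      using L u by (intro lipschitz_onI) (simp_all add: dist_norm)
    then show ?thesis
      by (rule continuous_on_compose2[OF lipschitz_on_continuous_on continuous_on_snd[OF continuous_on_id]]) auto
  qed
  show ?thesis unfolding sgd_step_def split_def by (intro continuous_intros d f)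
qed

lemma kernel_eq: "z \<in> UNIV \<times> \<Xi> \<Longrightarrow> sgd_kernel M U \<Xi> \<Phi> H g \<alpha> z = distr innovation states (sgd_step H g \<Phi> \<alpha> z)"
proof -
  assume z: "z \<in> UNIV \<times> \<Xi>"
  have "sgd_chain H g \<Phi> U \<alpha> z 1 = sgd_step H g \<Phi> \<alpha> z \<circ> U 1" by (simp add: fun_eq_iff)
  then show ?thesis
    unfolding sgd_kernel_def innovation_def by (simp only: distr_distr[OF step_measurable_slice[OF z] U_measurable])
qed

text \<open>The coordinates contract with a common factor, so by linearity of the integral their sum
  does. The phase enters each of the summands, of which there is at least one, and \<alpha> \<le> 1
  keeps norm / \<alpha> above the norm; hence the sum dominates the distance.\<close>

lemma mean_contraction_step:
  fixes V F :: "'d \<Rightarrow> real \<Rightarrow> real" and \<alpha> :: real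
  defines "D \<equiv> \<lambda>z z' :: ('d, 'k) state. \<Sum>i\<in>UNIV. weighted_line.wdist (V i) (F i) \<alpha> (fst z $ i, snd z) (fst z' $ i, snd z')"
  assumes \<alpha>: "\<alpha> \<le> 1" and \<rho>: "0 < \<rho>" "\<rho> < 1" and \<xi>0: "\<xi>0 \<in> \<Xi>"
    and wl: "\<And>i. weighted_line (V i) (F i) \<alpha>"
    and w: "\<And>i t (\<xi> :: real ^ 'k). weight (m i) (\<beta> i) (R i) (\<kappa> i) (\<kappa>0 i) \<alpha> (t, \<xi>) = V i t"
    and con: "\<And>i t s \<xi> \<eta>. \<xi> \<in> \<Xi> \<Longrightarrow> \<eta> \<in> \<Xi> \<Longrightarrow>
      (\<integral>\<^sup>+u. ennreal (weighted_line.wdist (V i) (F i) \<alpha> (t - \<alpha> * (deriv (H i) t + g i t (\<Phi> \<xi> u)), \<Phi> \<xi> u)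
          (s - \<alpha> * (deriv (H i) s + g i s (\<Phi> \<eta> u)), \<Phi> \<eta> u)) \<partial>innovation)
        \<le> ennreal \<rho> * ennreal (weighted_line.wdist (V i) (F i) \<alpha> (t, \<xi>) (s, \<eta>))"
    and start: "\<And>i. (\<integral>\<^sup>+u. ennreal (weighted_line.wdist (V i) (F i) \<alpha> (0, \<xi>0)
        (0 - \<alpha> * (deriv (H i) 0 + g i 0 (\<Phi> \<xi>0 u)), \<Phi> \<xi>0 u)) \<partial>innovation) < \<infinity>"
  shows "mean_contraction innovation (UNIV \<times> \<Xi>) states (sgd_step H g \<Phi> \<alpha>) D (sep_metric \<Xi> m \<beta> R \<kappa> \<kappa>0 \<alpha>) \<rho> 1 (0, \<xi>0)
    (sgd_kernel M U \<Xi> \<Phi> H g \<alpha>)"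
proof (rule mean_contraction.intro[OF prob_space_innovation mean_contraction_axioms.intro])
  let ?d = "\<lambda>i. weighted_line.wdist (V i) (F i) \<alpha> :: real \<times> (real ^ 'k) \<Rightarrow> real \<times> (real ^ 'k) \<Rightarrow> real"
  let ?S = "\<lambda>i t \<xi> u. (t - \<alpha> * (deriv (H i) t + g i t (\<Phi> \<xi> u)), \<Phi> \<xi> u)"
  have \<alpha>0: "0 < \<alpha>" using weighted_line.\<alpha>[OF wl] .
  note nonneg = weighted_line.wdist_nonneg[OF wl]
  have S_fst: "fst (sgd_step H g \<Phi> \<alpha> z u) $ i = fst z $ i - \<alpha> * (deriv (H i) (fst z $ i) + g i (fst z $ i) (\<Phi> (snd z) u))"
    and S_snd: "snd (sgd_step H g \<Phi> \<alpha> z u) = \<Phi> (snd z) u" for z u i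
    by (simp_all add: sgd_step_def split_def)
  have Sm: "?S i t \<xi> \<in> borel_measurable innovation" if "\<xi> \<in> \<Xi>" for i t \<xi>
    unfolding measurable_innovation
  proof (rule borel_measurable_Pair)
    interpret one_dim_assumptions M S U \<Xi> \<Phi> "H i" "g i" "m i" "\<beta> i" "R i" by (rule one_dim)
    show "(\<lambda>u. t - \<alpha> * (deriv (H i) t + g i t (\<Phi> \<xi> u))) \<in> borel_measurable S"
      using g_Phi_slice[OF that, of t] by measurable
  qed (rule Phi_slice_borel[OF that])
  have dm: "(\<lambda>u. ennreal (?d i (f u) (h u))) \<in> borel_measurable innovation"
    if "f \<in> borel_measurable innovation" "h \<in> borel_measurable innovation" for i f h
    using measurable_compose[OF borel_measurable_Pair[OF that] weighted_line.wdist_measurable[OF wl]] by simp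
  show "closed (UNIV \<times> \<Xi>)" by (intro closed_Times closed_UNIV Xi_closed)
  show "(0, \<xi>0) \<in> UNIV \<times> \<Xi>" using \<xi>0 by simp
  show "sets states = sets (restrict_space borel (UNIV \<times> \<Xi>))" by (rule sets_state_space)
  show "case_prod (sgd_step H g \<Phi> \<alpha>) \<in> states \<Otimes>\<^sub>M innovation \<rightarrow>\<^sub>M states"
    using step_measurable[of \<alpha>]
    by (simp add: measurable_cong_sets[OF sets_pair_measure_cong[OF refl sets_innovation] refl])
  show "continuous_on (UNIV \<times> \<Xi>) (\<lambda>z. sgd_step H g \<Phi> \<alpha> z u)" if "u \<in> space innovation" for u
    using step_continuous that by (simp add: space_innovation)
  show "0 \<le> D z z'" for z z' unfolding D_def by (intro sum_nonneg nonneg)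
  show "D z z' = D z' z" for z z' unfolding D_def by (intro sum.cong weighted_line.wdist_sym[OF wl] refl)
  show "D z z'' \<le> D z z' + D z' z''" for z z' z''
    unfolding D_def sum.distrib[symmetric] by (intro sum_mono weighted_line.wdist_triangle[OF wl])
  show "(\<lambda>p. D (fst p) (snd p)) \<in> borel_measurable borel"
    unfolding D_def
  proof (rule borel_measurable_sum)
    fix i
    have "(\<lambda>p :: ('d, 'k) state \<times> ('d, 'k) state. ((fst (fst p) $ i, snd (fst p)), (fst (snd p) $ i, snd (snd p)))) \<in> borel_measurable borel"
      by (intro borel_measurable_continuous_onI continuous_intros)
    from measurable_compose[OF this weighted_line.wdist_measurable[OF wl]]
    show "(\<lambda>p :: ('d, 'k) state \<times> ('d, 'k) state. ?d i (fst (fst p) $ i, snd (fst p)) (fst (snd p) $ i, snd (snd p))) \<in> borel_measurable borel" by simp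
  qed
  show "dist z z' \<le> 1 * D z z'" for z z'
  proof -
    have a: "\<bar>fst z $ i - fst z' $ i\<bar> + norm (snd z - snd z') \<le> ?d i (fst z $ i, snd z) (fst z' $ i, snd z')" for i
    proof -
      have "norm (snd z - snd z') \<le> norm (snd z - snd z') / \<alpha>" using \<alpha> \<alpha>0 by (simp add: field_simps mult_left_le_one_le)
      then show ?thesis using weighted_line.wdist_ge[OF wl, of "fst z $ i" "fst z' $ i" "snd z" "snd z'" i] by linarith
    qed
    have "dist z z' \<le> dist (fst z) (fst z') + dist (snd z) (snd z')"
      unfolding dist_prod_def by (rule sqrt_sum_squares_le_sum) auto
    also have "dist (fst z) (fst z') \<le> (\<Sum>i\<in>UNIV. \<bar>fst z $ i - fst z' $ i\<bar>)"
      using norm_le_l1_cart[of "fst z - fst z'"] by (simp add: dist_norm)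
    also have "dist (snd z) (snd z') \<le> (\<Sum>i\<in>(UNIV::'d set). norm (snd z - snd z'))"
    proof -
      have "1 \<le> real CARD('d)" using zero_less_card_finite[where 'a = 'd] by linarith
      from mult_right_mono[OF this norm_ge_zero] show ?thesis by (simp add: dist_norm)
    qed
    finally have "dist z z' \<le> (\<Sum>i\<in>UNIV. \<bar>fst z $ i - fst z' $ i\<bar> + norm (snd z - snd z'))"
      by (simp add: sum.distrib)
    also have "\<dots> \<le> D z z'" unfolding D_def by (intro sum_mono a)
    finally show ?thesis by simp
  qed
  show "(\<lambda>n. D z (f n)) \<longlonglongrightarrow> 0" if "f \<longlonglongrightarrow> z" for f z
    unfolding D_def
    by (intro tendsto_null_sum weighted_line.wdist_tendsto_0[OF wl] tendsto_vec_nth tendsto_fst[OF that] tendsto_snd[OF that])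
  show "0 < \<rho>" "\<rho> < 1" "(0::real) \<le> 1" using \<rho> by simp_all
  show "(\<integral>\<^sup>+u. ennreal (D (sgd_step H g \<Phi> \<alpha> z u) (sgd_step H g \<Phi> \<alpha> z' u)) \<partial>innovation) \<le> ennreal \<rho> * ennreal (D z z')"
    if "z \<in> UNIV \<times> \<Xi>" "z' \<in> UNIV \<times> \<Xi>" for z z'
  proof -
    have X: "snd z \<in> \<Xi>" "snd z' \<in> \<Xi>" using that by auto
    have "(\<integral>\<^sup>+u. ennreal (D (sgd_step H g \<Phi> \<alpha> z u) (sgd_step H g \<Phi> \<alpha> z' u)) \<partial>innovation)
      = (\<integral>\<^sup>+u. (\<Sum>i\<in>UNIV. ennreal (?d i (?S i (fst z $ i) (snd z) u) (?S i (fst z' $ i) (snd z') u))) \<partial>innovation)"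
      unfolding D_def S_fst S_snd by (intro nn_integral_cong sum_ennreal[symmetric] nonneg)
    also have "\<dots> = (\<Sum>i\<in>UNIV. \<integral>\<^sup>+u. ennreal (?d i (?S i (fst z $ i) (snd z) u) (?S i (fst z' $ i) (snd z') u)) \<partial>innovation)"
      by (intro nn_integral_sum dm Sm X)
    also have "\<dots> \<le> (\<Sum>i\<in>UNIV. ennreal \<rho> * ennreal (?d i (fst z $ i, snd z) (fst z' $ i, snd z')))"
      by (intro sum_mono con X)
    also have "\<dots> = ennreal \<rho> * ennreal (D z z')"
      unfolding D_def sum_distrib_left[symmetric] by (intro arg_cong[where f = "(*) (ennreal \<rho>)"] sum_ennreal nonneg)
    finally show ?thesis .
  qed
  show "(\<integral>\<^sup>+u. ennreal (D (0, \<xi>0) (sgd_step H g \<Phi> \<alpha> (0, \<xi>0) u)) \<partial>innovation) < \<infinity>"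
  proof -
    have "(\<integral>\<^sup>+u. ennreal (D (0, \<xi>0) (sgd_step H g \<Phi> \<alpha> (0, \<xi>0) u)) \<partial>innovation)
      = (\<integral>\<^sup>+u. (\<Sum>i\<in>UNIV. ennreal (?d i (0, \<xi>0) (?S i 0 \<xi>0 u))) \<partial>innovation)"
      unfolding D_def S_fst S_snd fst_conv snd_conv zero_index by (intro nn_integral_cong sum_ennreal[symmetric] nonneg)
    also have "\<dots> = (\<Sum>i\<in>UNIV. \<integral>\<^sup>+u. ennreal (?d i (0, \<xi>0) (?S i 0 \<xi>0 u)) \<partial>innovation)"
      by (intro nn_integral_sum dm Sm \<xi>0 measurable_const) simp
    also have "\<dots> < \<infinity>" using start by (simp add: less_top[symmetric])
    finally show ?thesis .
  qed
  show "sep_metric \<Xi> m \<beta> R \<kappa> \<kappa>0 \<alpha> z z' = ennreal (D z z')" if "z \<in> UNIV \<times> \<Xi>" "z' \<in> UNIV \<times> \<Xi>" for z z'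
  proof -
    have "sep_metric \<Xi> m \<beta> R \<kappa> \<kappa>0 \<alpha> z z' =
      (\<Sum>i\<in>UNIV. coord_metric \<Xi> (m i) (\<beta> i) (R i) (\<kappa> i) (\<kappa>0 i) \<alpha> (fst z $ i, snd z) (fst z' $ i, snd z'))"
      by (simp add: sep_metric_def split_def)
    also have "\<dots> = (\<Sum>i\<in>UNIV. ennreal (?d i (fst z $ i, snd z) (fst z' $ i, snd z')))"
      using that by (intro sum.cong coord_metric_eq_wdist[OF wl w Xi_convex]) auto
    also have "\<dots> = ennreal (D z z')" unfolding D_def by (intro sum_ennreal nonneg)
    finally show ?thesis .
  qed
  show "sgd_kernel M U \<Xi> \<Phi> H g \<alpha> z = distr innovation states (sgd_step H g \<Phi> \<alpha> z)" if "z \<in> UNIV \<times> \<Xi>" for z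
    by (rule kernel_eq[OF that])
qed

end

theorem corollary2p15:
  fixes M :: "'w measure" and S :: "'u measure" and U :: "nat \<Rightarrow> 'w \<Rightarrow> 'u"
    and \<Xi> :: "(real ^ 'k) set" and \<Phi> :: "real ^ 'k \<Rightarrow> 'u \<Rightarrow> real ^ 'k"
    and H :: "'d::finite \<Rightarrow> real \<Rightarrow> real" and g :: "'d \<Rightarrow> real \<Rightarrow> real ^ 'k \<Rightarrow> real"
    and m \<beta> R :: "'d \<Rightarrow> real"
  assumes "\<And>i. m i \<ge> 2" and "\<And>i. \<beta> i \<in> {1..2}"
    and "\<And>i. one_dim_assumptions M S U \<Xi> \<Phi> (H i) (g i) (m i) (\<beta> i) (R i)"
  defines "m_max \<equiv> Max (range m)"
    and "E \<equiv> state_space \<Xi> :: ('d, 'k) state measure"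
    and "P \<equiv> sgd_kernel M U \<Xi> \<Phi> H g"
  shows "\<exists>\<kappa> \<kappa>0 :: 'd \<Rightarrow> real. (\<forall>i. \<kappa> i > 0 \<and> \<kappa>0 i > 0) \<and>
    (\<exists>\<alpha>0\<in>{0<..<1}. \<exists>c0\<in>{0<..<1}. \<forall>\<alpha>\<in>{0<..\<alpha>0}.
       let dsep = sep_metric \<Xi> m \<beta> R \<kappa> \<kappa>0 \<alpha>; W = wasserstein1 E dsep in
       (\<exists>!\<pi>. \<pi> \<in> finite_first_moment_laws E dsep \<and> invariant_law (P \<alpha>) \<pi>) \<and>
       (\<forall>\<mu> \<nu>. law_on E \<mu> \<longrightarrow> law_on E \<nu> \<longrightarrow> W \<mu> \<nu> < \<infinity> \<longrightarrow>
          (\<forall>n. W (kernel_power (P \<alpha>) n \<mu>) (kernel_power (P \<alpha>) n \<nu>)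
                 \<le> ennreal ((1 - c0 * \<alpha> powr (m_max - 1)) ^ n) * W \<mu> \<nu>)))"
proof -
  interpret separable_sgd M S U \<Xi> \<Phi> H g m \<beta> R by (rule separable_sgd.intro[OF assms(1-3)])
  \<comment> \<open>\<open>good\<close> concerns one step size, \<open>ok\<close> all small step
    sizes with the other constants fixed: these have to be chosen before \<alpha>.\<close>
  define good where "good i \<kappa> \<kappa>0 \<alpha> \<rho> V F \<longleftrightarrow> weighted_line V F \<alpha> \<and>
    (\<forall>t. \<forall>\<xi> :: real ^ 'k. weight (m i) (\<beta> i) (R i) \<kappa> \<kappa>0 \<alpha> (t, \<xi>) = V t) \<and>
    (\<forall>t s. \<forall>\<xi>\<in>\<Xi>. \<forall>\<eta>\<in>\<Xi>.
      (\<integral>\<^sup>+u. ennreal (weighted_line.wdist V F \<alpha> (t - \<alpha> * (deriv (H i) t + g i t (\<Phi> \<xi> u)), \<Phi> \<xi> u)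
          (s - \<alpha> * (deriv (H i) s + g i s (\<Phi> \<eta> u)), \<Phi> \<eta> u)) \<partial>innovation)
        \<le> ennreal \<rho> * ennreal (weighted_line.wdist V F \<alpha> (t, \<xi>) (s, \<eta>))) \<and>
    (\<forall>\<xi>\<in>\<Xi>. (\<integral>\<^sup>+u. ennreal (weighted_line.wdist V F \<alpha> (0, \<xi>)
        (0 - \<alpha> * (deriv (H i) 0 + g i 0 (\<Phi> \<xi> u)), \<Phi> \<xi> u)) \<partial>innovation) < \<infinity>)"
    for i \<kappa> \<kappa>0 \<alpha> \<rho> V F
  define ok where "ok i \<kappa> \<kappa>0 c a \<longleftrightarrow> (\<forall>\<alpha>\<in>{0<..a}. \<exists>V F. good i \<kappa> \<kappa>0 \<alpha> (1 - c * \<alpha> powr (m i - 1)) V F)"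
    for i \<kappa> \<kappa>0 c a
  have "\<exists>\<kappa>>0. \<exists>\<kappa>0>0. \<exists>c>0. \<exists>a>0. ok i \<kappa> \<kappa>0 c a" for i
  proof -
    have "1 \<le> \<beta> i" "\<beta> i \<le> 2" using \<beta>[of i] by auto
    from one_dim_assumptions.coordinate_contraction[OF one_dim m this]
    show ?thesis unfolding ok_def good_def .
  qed
  \<comment> \<open>The four constants are packed into one tuple for a single choice over the
    coordinates.\<close>
  then have "\<forall>i. \<exists>q. 0 < fst q \<and> 0 < fst (snd q) \<and> 0 < fst (snd (snd q)) \<and> 0 < snd (snd (snd q)) \<and>
      ok i (fst q) (fst (snd q)) (fst (snd (snd q))) (snd (snd (snd q)))" by simp
  from choice[OF this] obtain q where q: "\<And>i. 0 < fst (q i) \<and> 0 < fst (snd (q i)) \<and> 0 < fst (snd (snd (q i))) \<and>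
      0 < snd (snd (snd (q i))) \<and> ok i (fst (q i)) (fst (snd (q i))) (fst (snd (snd (q i)))) (snd (snd (snd (q i))))"
    by blast
  define \<kappa> \<kappa>0 c a where "\<kappa> i = fst (q i)" and "\<kappa>0 i = fst (snd (q i))" and "c i = fst (snd (snd (q i)))"
    and "a i = snd (snd (snd (q i)))" for i
  note defs = this
  have pos: "0 < \<kappa> i" "0 < \<kappa>0 i" "0 < c i" "0 < a i" and ok: "ok i (\<kappa> i) (\<kappa>0 i) (c i) (a i)" for i
    using q[of i] by (simp_all add: defs)
  \<comment> \<open>There are finitely many coordinates, so the minima are positive; 1 / 2 keeps
    \<alpha>0 and c0 below 1.\<close>
  define \<alpha>0 where "\<alpha>0 = min (1 / 2) (Min (range a))"
  define c0 where "c0 = min (1 / 2) (Min (range c))"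
  have \<alpha>0: "0 < \<alpha>0" "\<alpha>0 < 1" "\<And>i. \<alpha>0 \<le> a i" using pos by (auto simp: \<alpha>0_def intro: min.coboundedI2)
  have c0: "0 < c0" "c0 \<le> 1 / 2" "\<And>i. c0 \<le> c i" using pos by (auto simp: c0_def intro: min.coboundedI2)
  have main: "(\<exists>!\<pi>. \<pi> \<in> finite_first_moment_laws E (sep_metric \<Xi> m \<beta> R \<kappa> \<kappa>0 \<alpha>) \<and> invariant_law (P \<alpha>) \<pi>) \<and>
       (\<forall>\<mu> \<nu>. law_on E \<mu> \<longrightarrow> law_on E \<nu> \<longrightarrow> wasserstein1 E (sep_metric \<Xi> m \<beta> R \<kappa> \<kappa>0 \<alpha>) \<mu> \<nu> < \<infinity> \<longrightarrow>
          (\<forall>n. wasserstein1 E (sep_metric \<Xi> m \<beta> R \<kappa> \<kappa>0 \<alpha>) (kernel_power (P \<alpha>) n \<mu>) (kernel_power (P \<alpha>) n \<nu>)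
                 \<le> ennreal ((1 - c0 * \<alpha> powr (m_max - 1)) ^ n) * wasserstein1 E (sep_metric \<Xi> m \<beta> R \<kappa> \<kappa>0 \<alpha>) \<mu> \<nu>))"
    if \<alpha>: "\<alpha> \<in> {0<..\<alpha>0}" for \<alpha>
  proof -
    have \<alpha>1: "0 < \<alpha>" "\<alpha> \<le> 1" using \<alpha> \<alpha>0 by auto
    define \<rho> where "\<rho> = 1 - c0 * \<alpha> powr (m_max - 1)"
    have mm: "m i \<le> m_max" for i unfolding m_max_def by simp
    \<comment> \<open>Some index, here \<open>undefined\<close>, witnesses that \<open>m_max\<close>
      is at least 2.\<close>
    have pw: "0 < \<alpha> powr (m_max - 1)" "\<alpha> powr (m_max - 1) \<le> 1"
      using \<alpha>1 m[of undefined] mm[of undefined] by (auto intro: powr_le1)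
    have \<rho>: "0 < \<rho>" "\<rho> < 1" using mult_mono[OF c0(2) pw(2)] pw c0 by (auto simp: \<rho>_def)
    have \<rho>i: "1 - c i * \<alpha> powr (m i - 1) \<le> \<rho>" for i
    proof -
      \<comment> \<open>As \<alpha> \<le> 1, the largest exponent gives the smallest power: the
        flattest coordinate determines the rate.\<close>
      have "\<alpha> powr (m_max - 1) \<le> \<alpha> powr (m i - 1)" using \<alpha>1 mm[of i] by (intro powr_mono') auto
      from mult_mono[OF c0(3)[of i] this] show ?thesis using pos(3)[of i] by (simp add: \<rho>_def)
    qed
    have "\<forall>i. \<exists>V F. good i (\<kappa> i) (\<kappa>0 i) \<alpha> (1 - c i * \<alpha> powr (m i - 1)) V F"
    proof
      fix i
      have "\<alpha> \<in> {0<..a i}" using \<alpha> \<alpha>0(3)[of i] by auto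
      then show "\<exists>V F. good i (\<kappa> i) (\<kappa>0 i) \<alpha> (1 - c i * \<alpha> powr (m i - 1)) V F" using ok[of i] unfolding ok_def by blast
    qed
    then obtain V F where VF: "\<And>i. good i (\<kappa> i) (\<kappa>0 i) \<alpha> (1 - c i * \<alpha> powr (m i - 1)) (V i) (F i)" by metis
    note VF1 = VF[unfolded good_def, THEN conjunct1]
    note VF2 = VF[unfolded good_def, THEN conjunct2, THEN conjunct1, rule_format]
    note VF3 = VF[unfolded good_def, THEN conjunct2, THEN conjunct2, THEN conjunct1, rule_format]
    note VF4 = VF[unfolded good_def, THEN conjunct2, THEN conjunct2, THEN conjunct2, rule_format]
    obtain \<xi>0 where \<xi>0: "\<xi>0 \<in> \<Xi>" using Xi_nonempty by blast
    interpret mc: mean_contraction innovation "UNIV \<times> \<Xi>" E "sgd_step H g \<Phi> \<alpha>"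
      "\<lambda>z z'. \<Sum>i\<in>UNIV. weighted_line.wdist (V i) (F i) \<alpha> (fst z $ i, snd z) (fst z' $ i, snd z')"
      "sep_metric \<Xi> m \<beta> R \<kappa> \<kappa>0 \<alpha>" \<rho> 1 "(0, \<xi>0)" "P \<alpha>"
      unfolding E_def P_def
    proof (rule mean_contraction_step[OF \<alpha>1(2) \<rho> \<xi>0])
      fix i
      show "weighted_line (V i) (F i) \<alpha>" by (rule VF1)
      show "weight (m i) (\<beta> i) (R i) (\<kappa> i) (\<kappa>0 i) \<alpha> (t, \<xi>) = V i t" for t and \<xi> :: "real ^ 'k" by (rule VF2)
      show "(\<integral>\<^sup>+u. ennreal (weighted_line.wdist (V i) (F i) \<alpha> (0, \<xi>0)
        (0 - \<alpha> * (deriv (H i) 0 + g i 0 (\<Phi> \<xi>0 u)), \<Phi> \<xi>0 u)) \<partial>innovation) < \<infinity>" by (rule VF4[OF \<xi>0])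
      fix t s \<xi> \<eta> assume "\<xi> \<in> \<Xi>" "\<eta> \<in> \<Xi>"
      then have "(\<integral>\<^sup>+u. ennreal (weighted_line.wdist (V i) (F i) \<alpha> (t - \<alpha> * (deriv (H i) t + g i t (\<Phi> \<xi> u)), \<Phi> \<xi> u)
          (s - \<alpha> * (deriv (H i) s + g i s (\<Phi> \<eta> u)), \<Phi> \<eta> u)) \<partial>innovation)
        \<le> ennreal (1 - c i * \<alpha> powr (m i - 1)) * ennreal (weighted_line.wdist (V i) (F i) \<alpha> (t, \<xi>) (s, \<eta>))"
        by (rule VF3)
      also have "\<dots> \<le> ennreal \<rho> * ennreal (weighted_line.wdist (V i) (F i) \<alpha> (t, \<xi>) (s, \<eta>))"
        by (intro mult_right_mono ennreal_leI \<rho>i) simp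
      finally show "(\<integral>\<^sup>+u. ennreal (weighted_line.wdist (V i) (F i) \<alpha> (t - \<alpha> * (deriv (H i) t + g i t (\<Phi> \<xi> u)), \<Phi> \<xi> u)
          (s - \<alpha> * (deriv (H i) s + g i s (\<Phi> \<eta> u)), \<Phi> \<eta> u)) \<partial>innovation)
        \<le> ennreal \<rho> * ennreal (weighted_line.wdist (V i) (F i) \<alpha> (t, \<xi>) (s, \<eta>))" .
    qed
    show ?thesis
    proof (intro conjI allI impI)
      obtain \<pi> where "\<pi> \<in> finite_first_moment_laws E (sep_metric \<Xi> m \<beta> R \<kappa> \<kappa>0 \<alpha>)" "invariant_law (P \<alpha>) \<pi>"
        using mc.invariant_law_exists by blast
      note \<pi> = this
      show "\<exists>!\<pi>. \<pi> \<in> finite_first_moment_laws E (sep_metric \<Xi> m \<beta> R \<kappa> \<kappa>0 \<alpha>) \<and> invariant_law (P \<alpha>) \<pi>"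
      proof (intro ex1I[of _ \<pi>] conjI \<pi>)
        fix \<nu> assume "\<nu> \<in> finite_first_moment_laws E (sep_metric \<Xi> m \<beta> R \<kappa> \<kappa>0 \<alpha>) \<and> invariant_law (P \<alpha>) \<nu>"
        then show "\<nu> = \<pi>" by (elim conjE) (rule mc.invariant_law_unique[OF _ \<pi>(1) _ \<pi>(2)])
      qed
    qed (rule mc.wasserstein1_kernel_power[unfolded \<rho>_def])
  qed
  have all: "\<forall>\<alpha>\<in>{0<..\<alpha>0}.
       let dsep = sep_metric \<Xi> m \<beta> R \<kappa> \<kappa>0 \<alpha>; W = wasserstein1 E dsep in
       (\<exists>!\<pi>. \<pi> \<in> finite_first_moment_laws E dsep \<and> invariant_law (P \<alpha>) \<pi>) \<and>
       (\<forall>\<mu> \<nu>. law_on E \<mu> \<longrightarrow> law_on E \<nu> \<longrightarrow> W \<mu> \<nu> < \<infinity> \<longrightarrow>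
          (\<forall>n. W (kernel_power (P \<alpha>) n \<mu>) (kernel_power (P \<alpha>) n \<nu>)
                 \<le> ennreal ((1 - c0 * \<alpha> powr (m_max - 1)) ^ n) * W \<mu> \<nu>))"
    unfolding Let_def by (intro ballI main)
  have \<alpha>c: "\<alpha>0 \<in> {0<..<1}" "c0 \<in> {0<..<1}" using \<alpha>0 c0 by auto
  have "\<exists>\<alpha>0\<in>{0<..<1}. \<exists>c0\<in>{0<..<1}. \<forall>\<alpha>\<in>{0<..\<alpha>0}.
       let dsep = sep_metric \<Xi> m \<beta> R \<kappa> \<kappa>0 \<alpha>; W = wasserstein1 E dsep in
       (\<exists>!\<pi>. \<pi> \<in> finite_first_moment_laws E dsep \<and> invariant_law (P \<alpha>) \<pi>) \<and>
       (\<forall>\<mu> \<nu>. law_on E \<mu> \<longrightarrow> law_on E \<nu> \<longrightarrow> W \<mu> \<nu> < \<infinity> \<longrightarrow>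
          (\<forall>n. W (kernel_power (P \<alpha>) n \<mu>) (kernel_power (P \<alpha>) n \<nu>)
                 \<le> ennreal ((1 - c0 * \<alpha> powr (m_max - 1)) ^ n) * W \<mu> \<nu>))"
    by (rule bexI[where x = \<alpha>0], rule bexI[where x = c0], rule all, rule \<alpha>c(2), rule \<alpha>c(1))
  moreover have "\<forall>i. 0 < \<kappa> i \<and> 0 < \<kappa>0 i" using pos by simp
  ultimately show ?thesis by (intro exI conjI)
qed

end
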